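(* Let $X, Y$ be strings with $|Y| = |X| + 2K$ for an integer $K \ge 1$. One can compute, for all shifts $s \in \{-K,\dots,K\}$ simultaneously, a multiplicative $2$-approximation of $\mathrm{ED}^{\le K}(X, Y[K+s .. |X|+K+s))$, in total time $O(|X| + K^2)$.
   Context: Strings are indexed from $0$; $Y[i..j)$ denotes $Y[i]\cdots Y[j-1]$. $\mathrm{ED}$ is the edit distance and $\mathrm{ED}^{\le K}(A,B) = \min(\mathrm{ED}(A,B), K)$ is the $K$-capped edit distance. A multiplicative $2$-approximation of a value $x$ is a value $\tilde x$ with $x/2 \le \tilde x \le 2x$. The model is the word RAM (characters from an integer alphabet). *)

theory Defs
  imports Complex_Main
begin

text \<open>Strings are lists; \<open>substr Y i j\<close> is $Y[i..j)$, indexed from 0.\<close>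

definition substr :: "'a list \<Rightarrow> nat \<Rightarrow> nat \<Rightarrow> 'a list" where
  "substr Y i j = drop i (take j Y)"

inductive edit :: "'a list \<Rightarrow> 'a list \<Rightarrow> bool" where
  insertion: "edit (u @ v) (u @ [a] @ v)"
| deletion: "edit (u @ [a] @ v) (u @ v)"
| substitution: "edit (u @ [a] @ v) (u @ [b] @ v)"

definition ED :: "'a list \<Rightarrow> 'a list \<Rightarrow> nat" where
  "ED A B = (LEAST n. (edit ^^ n) A B)"

definition capped_ED :: "nat \<Rightarrow> 'a list \<Rightarrow> 'a list \<Rightarrow> nat" where
  "capped_ED K A B = min (ED A B) K"

definition two_approx :: "real \<Rightarrow> real \<Rightarrow> bool" where
  "two_approx x y \<longleftrightarrow> x / 2 \<le> y \<and> y \<le> 2 * x"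

text \<open>
  The word RAM with word size \<open>w\<close>, presented through structured programs. A word is a natural
  number below \<open>2 ^ w\<close>. A program refers to finitely many registers (by constant names) and
  accesses one random access memory, whose addresses are words. Programs do not depend on \<open>w\<close>.
\<close>

datatype binop = Add | Sub | Mult | Div | Mod | And | Or | Xor | Shl | Shr | Eq | Less

text \<open>Addition, subtraction, multiplication and left shift are modulo \<open>2 ^ w\<close>; the other
  operations map words to words without reduction (\<open>x div 0 = 0\<close> and \<open>x mod 0 = x\<close>).\<close>

fun word_op :: "nat \<Rightarrow> binop \<Rightarrow> nat \<Rightarrow> nat \<Rightarrow> nat" where
  "word_op w Add x y = (x + y) mod 2 ^ w"
| "word_op w Sub x y = nat ((int x - int y) mod 2 ^ w)"
| "word_op w Mult x y = (x * y) mod 2 ^ w"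
| "word_op w Div x y = x div y"
| "word_op w Mod x y = x mod y"
| "word_op w And x y = semiring_bit_operations_class.and x y"
| "word_op w Or x y = semiring_bit_operations_class.or x y"
| "word_op w Xor x y = semiring_bit_operations_class.xor x y"
| "word_op w Shl x y = (x * 2 ^ y) mod 2 ^ w"
| "word_op w Shr x y = x div 2 ^ y"
| "word_op w Eq x y = of_bool (x = y) mod 2 ^ w"
| "word_op w Less x y = of_bool (x < y) mod 2 ^ w"

datatype expr = Const nat | Reg nat | Mem expr | Op binop expr expr

datatype cmd =
    Skip
  | Assign nat expr
  | Store expr expr
  | Seq cmd cmd
  | Cond expr cmd cmd
  | While expr cmd

record state =
  reg :: "nat \<Rightarrow> nat"
  mem :: "nat \<Rightarrow> nat"

fun eval :: "nat \<Rightarrow> state \<Rightarrow> expr \<Rightarrow> nat" where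
  "eval w \<sigma> (Const c) = c mod 2 ^ w"
| "eval w \<sigma> (Reg r) = reg \<sigma> r"
| "eval w \<sigma> (Mem e) = mem \<sigma> (eval w \<sigma> e)"
| "eval w \<sigma> (Op f e1 e2) = word_op w f (eval w \<sigma> e1) (eval w \<sigma> e2)"

text \<open>Unit cost for every constant, register access, memory access and word operation.\<close>

fun cost :: "expr \<Rightarrow> nat" where
  "cost (Const c) = 1"
| "cost (Reg r) = 1"
| "cost (Mem e) = 1 + cost e"
| "cost (Op f e1 e2) = 1 + cost e1 + cost e2"

text \<open>\<open>exec w P \<sigma> t \<sigma>'\<close>: started in \<open>\<sigma>\<close>, the program \<open>P\<close> halts in \<open>\<sigma>'\<close> after time \<open>t\<close>.
  As in C, a condition counts as true iff its value is nonzero.\<close>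

inductive exec :: "nat \<Rightarrow> cmd \<Rightarrow> state \<Rightarrow> nat \<Rightarrow> state \<Rightarrow> bool" for w :: nat where
  Skip: "exec w Skip \<sigma> 1 \<sigma>"
| Assign: "exec w (Assign r e) \<sigma> (1 + cost e) (\<sigma>\<lparr>reg := (reg \<sigma>)(r := eval w \<sigma> e)\<rparr>)"
| Store: "exec w (Store a e) \<sigma> (1 + cost a + cost e)
            (\<sigma>\<lparr>mem := (mem \<sigma>)(eval w \<sigma> a := eval w \<sigma> e)\<rparr>)"
| Seq: "exec w P \<sigma> t \<sigma>' \<Longrightarrow> exec w Q \<sigma>' t' \<sigma>'' \<Longrightarrow> exec w (Seq P Q) \<sigma> (t + t') \<sigma>''"
| CondTrue: "eval w \<sigma> e \<noteq> 0 \<Longrightarrow> exec w P \<sigma> t \<sigma>' \<Longrightarrow> exec w (Cond e P Q) \<sigma> (1 + cost e + t) \<sigma>'"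
| CondFalse: "eval w \<sigma> e = 0 \<Longrightarrow> exec w Q \<sigma> t \<sigma>' \<Longrightarrow> exec w (Cond e P Q) \<sigma> (1 + cost e + t) \<sigma>'"
| WhileTrue: "eval w \<sigma> e \<noteq> 0 \<Longrightarrow> exec w P \<sigma> t \<sigma>' \<Longrightarrow> exec w (While e P) \<sigma>' t' \<sigma>'' \<Longrightarrow>
            exec w (While e P) \<sigma> (1 + cost e + t + t') \<sigma>''"
| WhileFalse: "eval w \<sigma> e = 0 \<Longrightarrow> exec w (While e P) \<sigma> (1 + cost e) \<sigma>"

text \<open>The machine is deterministic, so a halting run determines the output and the time.\<close>

lemma exec_deterministic:
  "exec w P \<sigma> t \<sigma>' \<Longrightarrow> exec w P \<sigma> u \<tau> \<Longrightarrow> u = t \<and> \<tau> = \<sigma>'"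
proof (induction arbitrary: u \<tau> rule: exec.induct)
  case (Seq P \<sigma> t \<sigma>' Q t' \<sigma>'')
  from Seq.prems show ?case by cases (use Seq.IH in blast)
next
  case (CondTrue \<sigma> e P t \<sigma>' Q)
  from CondTrue.prems show ?case by cases (use CondTrue in blast)+
next
  case (CondFalse \<sigma> e Q t \<sigma>' P)
  from CondFalse.prems show ?case by cases (use CondFalse in blast)+
next
  case (WhileTrue \<sigma> e P t \<sigma>' t' \<sigma>'')
  from WhileTrue.prems show ?case by cases (use WhileTrue in blast)+
next
  case (WhileFalse \<sigma> e P)
  from WhileFalse.prems show ?case by cases (use WhileFalse in auto)
qed (erule exec.cases; simp)+

text \<open>
  The input: \<open>X\<close> and then \<open>Y\<close> are stored from address 0 on, one character per word; register 0
  holds the length of \<open>X\<close> and register 1 holds \<open>K\<close>; everything else is 0.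
\<close>

definition input :: "nat list \<Rightarrow> nat list \<Rightarrow> nat \<Rightarrow> state" where
  "input X Y K =
     \<lparr>reg = (\<lambda>_. 0)(0 := length X, 1 := K),
      mem = (\<lambda>i. if i < length (X @ Y) then (X @ Y) ! i else 0)\<rparr>"

end

theory Submission
  imports Defs "HOL-Library.Product_Lexorder" "HOL-Library.Multiset"
begin

text \<open>
  Let $n = |X|$ and $h = \min(K, n)$. Drop the requirement that an alignment starts on the diagonal
  of the shift $s$: let $e_s$ be the least cost of aligning $X$ with a window of arbitrary start that
  ends where $Y[K+s .. n+K+s)$ ends. Then $e_s \le \mathrm{ED} \le 2 e_s$, because an alignment of
  cost $e$ starts at most $e$ diagonals away from the one on which it ends. All $e_s$, capped at
  $h$, come from a single run of the Landau-Vishkin algorithm on $2(K + h) + 1$ diagonals in which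
  every diagonal starts for free: $h$ rounds of $O(K)$ longest common extension queries each. A query
  takes constant time, using the suffix array of $XY$ (skew algorithm, after sorting the polynomial
  alphabet by a bounded number of digits), the table of longest common prefixes of adjacent suffixes
  (Kasai), and range minima (a sparse table over blocks of logarithmic length, and for each position
  a bit mask of the suffix minima of its block).
\<close>

text \<open>One run per shift would take cubic time in K; freeing the start lets all shifts share
  one run, and the factor 2 is its price. Every diagonal counts the rounds in which it has not
  reached the end of X; a reached end stays reached, so the counter is the least cost capped at h,
  and it is output unchanged. Capping at h rather than K is harmless, since strings of equal length
  n have distance at most n, and it settles the borders: alignments of cost at most h leave the 2K +
  1 wanted diagonals by at most h on each side, where the left ones begin in the last h characters
  of X itself and the right ones end in h padding characters. The program is written in an
  intermediate language on unbounded naturals with separate arrays, whose sums, products and indices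
  must stay below a bound \<open>L\<close>. Under this bound compilation preserves results and
  running times exactly, so the algorithmic proofs meet neither modular arithmetic nor
  addresses.\<close>

datatype hexp = Cst nat | Var nat | Arr nat hexp | Bin binop hexp hexp

datatype hcmd =
    HSkip
  | Upd nat hexp
  | Put nat hexp hexp
  | HSeq hcmd hcmd (infixr ";;" 60)
  | HIf hexp hcmd hcmd
  | HWhile hexp hcmd

record hst =
  rg :: "nat \<Rightarrow> nat"
  ar :: "nat \<Rightarrow> nat \<Rightarrow> nat"

fun hop :: "binop \<Rightarrow> nat \<Rightarrow> nat \<Rightarrow> nat" where
  "hop Add x y = x + y"
| "hop Sub x y = x - y"
| "hop Mult x y = x * y"
| "hop Div x y = x div y"
| "hop Mod x y = x mod y"
| "hop And x y = semiring_bit_operations_class.and x y"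
| "hop Or x y = semiring_bit_operations_class.or x y"
| "hop Xor x y = semiring_bit_operations_class.xor x y"
| "hop Shl x y = x * 2 ^ y"
| "hop Shr x y = x div 2 ^ y"
| "hop Eq x y = of_bool (x = y)"
| "hop Less x y = of_bool (x < y)"

text \<open>Only operations whose result can leave the range of a word are guarded. Comparisons,
  quotients and remainders stay free, so that characters, which may exceed \<open>L\<close>, can be
  processed.\<close>

fun opok :: "nat \<Rightarrow> binop \<Rightarrow> nat \<Rightarrow> nat \<Rightarrow> bool" where
  "opok L Add x y \<longleftrightarrow> x + y < L"
| "opok L Sub x y \<longleftrightarrow> y \<le> x \<and> x < L"
| "opok L Mult x y \<longleftrightarrow> x * y < L"
| "opok L Shl x y \<longleftrightarrow> x * 2 ^ y < L"
| "opok L _ x y \<longleftrightarrow> True"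

fun hev :: "hst \<Rightarrow> hexp \<Rightarrow> nat" where
  "hev s (Cst c) = c"
| "hev s (Var r) = rg s r"
| "hev s (Arr a e) = ar s a (hev s e)"
| "hev s (Bin f d e) = hop f (hev s d) (hev s e)"

fun hok :: "nat \<Rightarrow> hst \<Rightarrow> hexp \<Rightarrow> bool" where
  "hok L s (Cst c) \<longleftrightarrow> c < L"
| "hok L s (Var r) \<longleftrightarrow> True"
| "hok L s (Arr a e) \<longleftrightarrow> a < 32 \<and> hok L s e \<and> hev s e < L"
| "hok L s (Bin f d e) \<longleftrightarrow> hok L s d \<and> hok L s e \<and> opok L f (hev s d) (hev s e)"

text \<open>The surcharge 5 of an array access is the price of its compiled form: a memory access,
  an addition, a multiplication, and the constants for stride and array number.\<close>

fun hcost :: "hexp \<Rightarrow> nat" where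
  "hcost (Cst c) = 1"
| "hcost (Var r) = 1"
| "hcost (Arr a e) = 5 + hcost e"
| "hcost (Bin f d e) = 1 + hcost d + hcost e"

abbreviation upd :: "hst \<Rightarrow> nat \<Rightarrow> nat \<Rightarrow> hst" where
  "upd s r v \<equiv> s\<lparr>rg := (rg s)(r := v)\<rparr>"

abbreviation put :: "hst \<Rightarrow> nat \<Rightarrow> nat \<Rightarrow> nat \<Rightarrow> hst" where
  "put s a i v \<equiv> s\<lparr>ar := (ar s)(a := (ar s a)(i := v))\<rparr>"

text \<open>Every evaluated expression must pass \<open>hok\<close>, so exhibiting a run also proves
  that nothing overflows.\<close>

inductive hexec :: "nat \<Rightarrow> hcmd \<Rightarrow> hst \<Rightarrow> nat \<Rightarrow> hst \<Rightarrow> bool" for L :: nat where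
  HSkip: "hexec L HSkip s 1 s"
| Upd: "hok L s e \<Longrightarrow> hexec L (Upd r e) s (1 + hcost e) (upd s r (hev s e))"
| Put: "hok L s (Arr a i) \<Longrightarrow> hok L s e \<Longrightarrow>
    hexec L (Put a i e) s (5 + hcost i + hcost e) (put s a (hev s i) (hev s e))"
| HSeq: "hexec L P s t s' \<Longrightarrow> hexec L Q s' t' s'' \<Longrightarrow> hexec L (P ;; Q) s (t + t') s''"
| HIfTrue: "hok L s e \<Longrightarrow> hev s e \<noteq> 0 \<Longrightarrow> hexec L P s t s' \<Longrightarrow>
    hexec L (HIf e P Q) s (1 + hcost e + t) s'"
| HIfFalse: "hok L s e \<Longrightarrow> hev s e = 0 \<Longrightarrow> hexec L Q s t s' \<Longrightarrow>
    hexec L (HIf e P Q) s (1 + hcost e + t) s'"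
| HWhileTrue: "hok L s e \<Longrightarrow> hev s e \<noteq> 0 \<Longrightarrow> hexec L P s t s' \<Longrightarrow> hexec L (HWhile e P) s' t' s'' \<Longrightarrow>
    hexec L (HWhile e P) s (1 + hcost e + t + t') s''"
| HWhileFalse: "hok L s e \<Longrightarrow> hev s e = 0 \<Longrightarrow> hexec L (HWhile e P) s (1 + hcost e) s"

subsection \<open>Compilation\<close>

fun ce :: "hexp \<Rightarrow> expr" where
  "ce (Cst c) = Const c"
| "ce (Var r) = Reg r"
| "ce (Arr a e) = Mem (Op Add (Op Mult (Const 32) (ce e)) (Const a))"
| "ce (Bin f d e) = Op f (ce d) (ce e)"

fun cc :: "hcmd \<Rightarrow> cmd" where
  "cc HSkip = Skip"
| "cc (Upd r e) = Assign r (ce e)"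
| "cc (Put a i e) = Store (Op Add (Op Mult (Const 32) (ce i)) (Const a)) (ce e)"
| "cc (P ;; Q) = Seq (cc P) (cc Q)"
| "cc (HIf e P Q) = Cond (ce e) (cc P) (cc Q)"
| "cc (HWhile e P) = While (ce e) (cc P)"

text \<open>
  The 32 arrays are interleaved: entry \<open>i\<close> of array \<open>a\<close> lives at address \<open>32 * i + a\<close>.
  Arrays: 0 the text $XY$ with padding; 1 a permutation to be sorted, 2 its keys, 3 and 4 work space
  of counting sort; 5 the string of the current recursion level of the skew algorithm, 6 the triple
  names of all levels, 7 and 8 offset and length of each level; 9 ranks, 10 suffix array, 11 ranks
  and 12 sorted list of the sampled positions; 13 longest common prefixes; 14 start of the run of
  popped stack entries, 15 bit masks, 16 least set bits, 17 logarithms, 18 sparse table; 19 row of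
  the furthest reaching points, 20 their round counters; 21 quotients of the characters.
  Registers: 0 $n$, 1 $K$, 2 $h$, 3 length of the padded text, 4 $n - h$; 5 and 6 length and key
  bound for counting sort (later 5 is the number of diagonals); 7 length, 8 offset and 9 index of the
  level; 25 block length $b$, 26 $2^b$, 27 number of blocks; 30 and 31 bounds and 32 result of a
  range minimum query; 40 round, 41 diagonal.
\<close>


definition abst :: "state \<Rightarrow> hst" where
  "abst \<sigma> = \<lparr>rg = reg \<sigma>, ar = (\<lambda>a i. if a < 32 then mem \<sigma> (32 * i + a) else 0)\<rparr>"

lemma rg_abst [simp]: "rg (abst \<sigma>) = reg \<sigma>"
  by (simp add: abst_def)

lemma ar_abst [simp]: "a < 32 \<Longrightarrow> ar (abst \<sigma>) a i = mem \<sigma> (32 * i + a)"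
  by (simp add: abst_def)

lemma cost_ce [simp]: "cost (ce e) = hcost e"
  by (induction e) auto

text \<open>An index below \<open>L\<close> and an array number below 32 give an address below
  \<open>32 * L\<close>, and guarded results are below \<open>L\<close>, so no reduction modulo
  \<open>2 ^ w\<close> takes effect. The assumption \<open>1 \<le> L\<close> makes room for the
  truth value 1.\<close>

lemma eval_ce:
  assumes "32 * L \<le> 2 ^ w" "1 \<le> L" "hok L (abst \<sigma>) e"
  shows "eval w \<sigma> (ce e) = hev (abst \<sigma>) e"
  using assms(3)
proof (induction e)
  case (Arr a e)
  then have "hev (abst \<sigma>) e < L" "a < 32" by auto
  then have "32 * hev (abst \<sigma>) e + a < 2 ^ w" using assms(1) by linarith
  then show ?case using Arr \<open>a < 32\<close> by (simp add: mod_simps)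
next
  case (Bin f d e)
  have L: "x < L \<Longrightarrow> x < 2 ^ w" for x :: nat using assms(1) by linarith
  have one: "of_bool b < (2::nat) ^ w" for b using assms(1,2) by (cases b) auto
  have sub: "nat ((int x - int y) mod 2 ^ w) = x - y" if "y \<le> x" "x < L" for x y
  proof -
    have "(int x - int y) mod 2 ^ w = int ((x - y) mod 2 ^ w)"
      using that(1) by (simp add: of_nat_diff zmod_int)
    moreover have "x - y < 2 ^ w" using L[OF that(2)] by linarith
    ultimately show ?thesis by simp
  qed
  have "word_op w f x y = hop f x y" if "opok L f x y" for x y
    using that by (cases f) (simp_all add: L one sub)
  then show ?case using Bin by simp
qed (use assms in auto)

text \<open>The same \<open>t\<close> appears on both sides because \<open>hcost\<close> is
  calibrated to \<open>cost\<close>; time bounds can therefore be proved entirely in the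
  intermediate language.\<close>

lemma exec_cc:
  assumes "32 * L \<le> 2 ^ w" "1 \<le> L"
  shows "hexec L P s t s' \<Longrightarrow> s = abst \<sigma> \<Longrightarrow> \<exists>\<sigma>'. exec w (cc P) \<sigma> t \<sigma>' \<and> abst \<sigma>' = s'"
proof (induction arbitrary: \<sigma> rule: hexec.induct)
  case (HSkip s)
  then show ?case using exec.Skip by fastforce
next
  case (Upd s e r)
  then have "eval w \<sigma> (ce e) = hev s e" using eval_ce assms by blast
  then show ?case using Upd exec.Assign[of w r "ce e" \<sigma>] by (fastforce simp: abst_def)
next
  case (Put s a i e)
  have e: "eval w \<sigma> (ce e) = hev s e" "eval w \<sigma> (ce i) = hev s i" using eval_ce assms Put by auto
  have a: "a < 32" "hev s i < L" using Put by auto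
  then have "32 * hev s i + a < 2 ^ w" using assms(1) by linarith
  then have f: "eval w \<sigma> (Op Add (Op Mult (Const 32) (ce i)) (Const a)) = 32 * hev s i + a"
    using e(2) by (simp add: mod_simps)
  \<comment> \<open>Uniqueness of quotient and remainder: different array entries have different
    addresses, so a store changes exactly one of them.\<close>
  have *: "32 * j + b = 32 * k + a \<longleftrightarrow> j = k \<and> b = a" if "b < 32" for j k b :: nat
  proof
    assume eq: "32 * j + b = 32 * k + a"
    have "b = (32 * j + b) mod 32" "j = (32 * j + b) div 32" using that by auto
    then show "j = k \<and> b = a" unfolding eq using a(1) by auto
  qed auto
  have "abst (\<sigma>\<lparr>mem := (mem \<sigma>)(32 * hev s i + a := hev s e)\<rparr>) = put s a (hev s i) (hev s e)"
    unfolding Put(3) by (auto simp: abst_def fun_eq_iff * a)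
  moreover have c: "1 + cost (Op Add (Op Mult (Const 32) (ce i)) (Const a)) + cost (ce e) = 5 + hcost i + hcost e"
    by simp
  have "exec w (cc (Put a i e)) \<sigma> (5 + hcost i + hcost e) (\<sigma>\<lparr>mem := (mem \<sigma>)(32 * hev s i + a := hev s e)\<rparr>)"
    using exec.Store[of w "Op Add (Op Mult (Const 32) (ce i)) (Const a)" "ce e" \<sigma>, unfolded f e c] by simp
  ultimately show ?case by blast
next
  case (HSeq P s t s' Q t' s'')
  then show ?case by simp (metis exec.Seq)
next
  case (HIfTrue s e P t s' Q)
  then obtain \<sigma>' where 1: "exec w (cc P) \<sigma> t \<sigma>'" "abst \<sigma>' = s'" by blast
  have "eval w \<sigma> (ce e) \<noteq> 0" using HIfTrue eval_ce[OF assms] by auto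
  from exec.CondTrue[OF this 1(1)] 1(2) show ?case by auto
next
  case (HIfFalse s e Q t s' P)
  then obtain \<sigma>' where 1: "exec w (cc Q) \<sigma> t \<sigma>'" "abst \<sigma>' = s'" by blast
  have "eval w \<sigma> (ce e) = 0" using HIfFalse eval_ce[OF assms] by auto
  from exec.CondFalse[OF this 1(1)] 1(2) show ?case by auto
next
  case (HWhileTrue s e P t s' t' s'')
  then obtain \<sigma>' where 1: "exec w (cc P) \<sigma> t \<sigma>'" "abst \<sigma>' = s'" by blast
  obtain \<sigma>'' where 2: "exec w (cc (HWhile e P)) \<sigma>' t' \<sigma>''" "abst \<sigma>'' = s''"
    using HWhileTrue(6)[of \<sigma>'] 1 by auto
  have "eval w \<sigma> (ce e) \<noteq> 0" using HWhileTrue eval_ce[OF assms] by auto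
  from exec.WhileTrue[OF this 1(1) 2(1)[simplified]] 2(2) show ?case by auto
next
  case (HWhileFalse s e P)
  then show ?case using eval_ce[OF assms] exec.WhileFalse[of w \<sigma> "ce e"] by fastforce
qed

subsection \<open>Total correctness with time\<close>

text \<open>The existence of a halting run suffices for total correctness, since the machine that
  finally executes the program is deterministic.\<close>

definition runs :: "nat \<Rightarrow> hcmd \<Rightarrow> hst \<Rightarrow> nat \<Rightarrow> (hst \<Rightarrow> bool) \<Rightarrow> bool" where
  "runs L P s t Q \<longleftrightarrow> (\<exists>t' s'. hexec L P s t' s' \<and> t' \<le> t \<and> Q s')"

fun modr :: "hcmd \<Rightarrow> nat set" where
  "modr HSkip = {}"
| "modr (Upd r e) = {r}"
| "modr (Put a i e) = {}"
| "modr (P ;; Q) = modr P \<union> modr Q"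
| "modr (HIf e P Q) = modr P \<union> modr Q"
| "modr (HWhile e P) = modr P"

fun moda :: "hcmd \<Rightarrow> nat set" where
  "moda HSkip = {}"
| "moda (Upd r e) = {}"
| "moda (Put a i e) = {a}"
| "moda (P ;; Q) = moda P \<union> moda Q"
| "moda (HIf e P Q) = moda P \<union> moda Q"
| "moda (HWhile e P) = moda P"

text \<open>A syntactic frame condition. The rules for consequence, sequencing and loops hand it to
  their premises, so invariants need only speak of what a loop changes.\<close>

definition frm :: "hcmd \<Rightarrow> hst \<Rightarrow> hst \<Rightarrow> bool" where
  "frm P s s' \<longleftrightarrow> (\<forall>r. r \<notin> modr P \<longrightarrow> rg s' r = rg s r) \<and> (\<forall>a. a \<notin> moda P \<longrightarrow> ar s' a = ar s a)"

lemma frm_trans: "frm P s s' \<Longrightarrow> frm P s' s'' \<Longrightarrow> frm P s s''"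
  by (simp add: frm_def)

lemma hexec_frm: "hexec L P s t s' \<Longrightarrow> frm P s s'"
  by (induction rule: hexec.induct) (auto simp: frm_def)

lemma runs_mono: "runs L P s t Q \<Longrightarrow> t \<le> t' \<Longrightarrow> (\<And>s'. frm P s s' \<Longrightarrow> Q s' \<Longrightarrow> Q' s') \<Longrightarrow> runs L P s t' Q'"
  unfolding runs_def using hexec_frm by (meson le_trans)

lemma runs_HSeq:
  assumes "runs L P s t1 Q1" "\<And>s'. frm P s s' \<Longrightarrow> Q1 s' \<Longrightarrow> runs L Q s' t2 R" "t1 + t2 \<le> t"
  shows "runs L (P ;; Q) s t R"
proof -
  obtain u s' where 1: "hexec L P s u s'" "u \<le> t1" "Q1 s'" using assms(1) by (auto simp: runs_def)
  obtain v s'' where 2: "hexec L Q s' v s''" "v \<le> t2" "R s''"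
    using assms(2)[OF hexec_frm[OF 1(1)] 1(3)] by (auto simp: runs_def)
  show ?thesis unfolding runs_def
    using hexec.HSeq[OF 1(1) 2(1)] 1 2 assms(3) by (intro exI[of _ "u + v"] exI[of _ s'']) auto
qed

lemma runs_HIf:
  assumes "hok L s e" "hev s e \<noteq> 0 \<Longrightarrow> runs L P s t1 R" "hev s e = 0 \<Longrightarrow> runs L Q s t1 R"
    "1 + hcost e + t1 \<le> t"
  shows "runs L (HIf e P Q) s t R"
proof (cases "hev s e = 0")
  case True
  then obtain u s' where "hexec L Q s u s'" "u \<le> t1" "R s'" using assms(3) by (auto simp: runs_def)
  then show ?thesis unfolding runs_def using hexec.HIfFalse[OF assms(1) True] assms(4)
    by (intro exI[of _ "1 + hcost e + u"] exI[of _ s']) auto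
next
  case False
  then obtain u s' where "hexec L P s u s'" "u \<le> t1" "R s'" using assms(2) by (auto simp: runs_def)
  then show ?thesis unfolding runs_def using hexec.HIfTrue[OF assms(1) False] assms(4)
    by (intro exI[of _ "1 + hcost e + u"] exI[of _ s']) auto
qed

text \<open>The potential \<open>\<Phi>\<close> is an upper bound on the remaining time.\<close>

lemma runs_HWhile:
  assumes "I g s" "frm P s0 s"
    and ok: "\<And>g s. I g s \<Longrightarrow> frm P s0 s \<Longrightarrow> hok L s e"
    and exit: "\<And>g s. I g s \<Longrightarrow> frm P s0 s \<Longrightarrow> hev s e = 0 \<Longrightarrow> 1 + hcost e \<le> \<Phi> g s \<and> Q s"
    and step: "\<And>g s. I g s \<Longrightarrow> frm P s0 s \<Longrightarrow> hev s e \<noteq> 0 \<Longrightarrow>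
      runs L P s (u g s) (\<lambda>s'. \<exists>g'. I g' s' \<and> 1 + hcost e + u g s + \<Phi> g' s' \<le> \<Phi> g s)"
    and t: "\<Phi> g s \<le> t"
  shows "runs L (HWhile e P) s t Q"
proof -
  have "\<exists>u s'. hexec L (HWhile e P) s u s' \<and> u \<le> \<Phi> g s \<and> Q s'"
    using assms(1,2)
  proof (induction "\<Phi> g s" arbitrary: g s rule: less_induct)
    case less
    show ?case
    proof (cases "hev s e = 0")
      case True
      then show ?thesis
        using hexec.HWhileFalse[of L s e P] ok[OF less(2,3)] exit[OF less(2,3)] by auto
    next
      case False
      then obtain v s' g' where 1: "hexec L P s v s'" "v \<le> u g s" "I g' s'"
        "1 + hcost e + u g s + \<Phi> g' s' \<le> \<Phi> g s"
        using step[OF less(2,3)] by (auto simp: runs_def)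
      have "frm P s0 s'" using hexec_frm[OF 1(1)] less(3) frm_trans by blast
      then obtain v' s'' where 2: "hexec L (HWhile e P) s' v' s''" "v' \<le> \<Phi> g' s'" "Q s''"
        using less(1)[of g' s'] 1 by auto
      from hexec.HWhileTrue[OF ok[OF less(2,3)] False 1(1) 2(1)] 1 2 show ?thesis
        by (intro exI[of _ "1 + hcost e + v + v'"] exI[of _ s'']) auto
    qed
  qed
  then show ?thesis using t by (auto simp: runs_def intro: le_trans)
qed

section \<open>Weakest preconditions and time bounds of loop-free code\<close>

text \<open>Charging both branches of a conditional is good enough for constant-time code. The value
  0 for loops is a default: \<open>wp\<close> is false on them.\<close>

fun tb :: "hcmd \<Rightarrow> nat" where
  "tb HSkip = 1"
| "tb (Upd r e) = 1 + hcost e"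
| "tb (Put a i e) = 5 + hcost i + hcost e"
| "tb (P ;; Q) = tb P + tb Q"
| "tb (HIf e P Q) = 1 + hcost e + (tb P + tb Q)"
| "tb (HWhile e P) = 0"

fun wp :: "nat \<Rightarrow> hcmd \<Rightarrow> (hst \<Rightarrow> bool) \<Rightarrow> hst \<Rightarrow> bool" where
  "wp L HSkip Q s \<longleftrightarrow> Q s"
| "wp L (Upd r e) Q s \<longleftrightarrow> hok L s e \<and> Q (upd s r (hev s e))"
| "wp L (Put a i e) Q s \<longleftrightarrow> hok L s (Arr a i) \<and> hok L s e \<and> Q (put s a (hev s i) (hev s e))"
| "wp L (P1 ;; P2) Q s \<longleftrightarrow> wp L P1 (wp L P2 Q) s"
| "wp L (HIf e P1 P2) Q s \<longleftrightarrow> hok L s e \<and> (hev s e \<noteq> 0 \<longrightarrow> wp L P1 Q s) \<and> (hev s e = 0 \<longrightarrow> wp L P2 Q s)"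
| "wp L (HWhile e P) Q s \<longleftrightarrow> False"

lemma wp_hexec: "wp L P Q s \<Longrightarrow> \<exists>t' s'. hexec L P s t' s' \<and> t' \<le> tb P \<and> Q s'"
proof (induction P arbitrary: Q s)
  case (HSeq P1 P2)
  then obtain u s' where 1: "hexec L P1 s u s'" "u \<le> tb P1" "wp L P2 Q s'"
    by fastforce
  then obtain v s'' where 2: "hexec L P2 s' v s''" "v \<le> tb P2" "Q s''"
    using HSeq.IH(2) by blast
  from hexec.HSeq[OF 1(1) 2(1)] 1 2 show ?case by (intro exI[of _ "u + v"] exI[of _ s'']) auto
next
  case (HIf e P1 P2)
  show ?case
  proof (cases "hev s e = 0")
    case True
    then obtain u s' where 1: "hexec L P2 s u s'" "u \<le> tb P2" "Q s'" using HIf by auto metis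
    from hexec.HIfFalse[OF _ True 1(1)] 1 HIf.prems show ?thesis
      by (intro exI[of _ "1 + hcost e + u"] exI[of _ s']) auto
  next
    case False
    then obtain u s' where 1: "hexec L P1 s u s'" "u \<le> tb P1" "Q s'" using HIf by auto metis
    from hexec.HIfTrue[OF _ False 1(1)] 1 HIf.prems show ?thesis
      by (intro exI[of _ "1 + hcost e + u"] exI[of _ s']) auto
  qed
next
  case HSkip
  then show ?case using hexec.HSkip by fastforce
next
  case (Upd r e)
  then show ?case using hexec.Upd[of L s e r] by auto
next
  case (Put a i e)
  then show ?case using hexec.Put[of L s a i e] by auto
qed auto

lemma runs_wp: "wp L P Q s \<Longrightarrow> tb P \<le> t \<Longrightarrow> runs L P s t Q"
  unfolding runs_def using wp_hexec by (meson le_trans)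

lemma runs_Upd_HSeq:
  assumes "hok L s e" "runs L Q (upd s r (hev s e)) t2 R" "1 + hcost e + t2 \<le> t"
  shows "runs L (Upd r e ;; Q) s t R"
proof (rule runs_HSeq)
  show "runs L (Upd r e) s (1 + hcost e) (\<lambda>s'. s' = upd s r (hev s e))"
    by (rule runs_wp) (use assms in auto)
qed (use assms in auto)

section \<open>Counting loops\<close>

definition For :: "nat \<Rightarrow> hexp \<Rightarrow> hcmd \<Rightarrow> hcmd" where
  "For r e P = Upd r (Cst 0) ;; HWhile (Bin Less (Var r) e) (P ;; Upd r (Bin Add (Var r) (Cst 1)))"

lemma modr_For [simp]: "modr (For r e P) = insert r (modr P)"
  and moda_For [simp]: "moda (For r e P) = moda P"
  by (auto simp: For_def)

text \<open>A round costs \<open>c\<close> for the body, \<open>3 + hcost e\<close> for the test and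
  4 for the increment; the additional round in the bound pays for the initial assignment and the
  last test. The invariant is established after the counter has been increased, hence the
  \<open>upd s'' r (Suc i)\<close>.\<close>

lemma runs_For:
  assumes r: "r \<notin> modr P"
    and e: "\<And>s'. frm (For r e P) s s' \<Longrightarrow> hok L s' e \<and> hev s' e = n"
    and init: "I 0 (upd s r 0)"
    and step: "\<And>i s'. i < n \<Longrightarrow> rg s' r = i \<Longrightarrow> I i s' \<Longrightarrow> frm (For r e P) s s' \<Longrightarrow>
      runs L P s' c (\<lambda>s''. I (Suc i) (upd s'' r (Suc i)))"
    and n: "n < L" "1 < L"
    and Q: "\<And>s'. I n s' \<Longrightarrow> rg s' r = n \<Longrightarrow> frm (For r e P) s s' \<Longrightarrow> Q s'"
    and t: "(n + 1) * (c + 7 + hcost e) \<le> t"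
  shows "runs L (For r e P) s t Q"
proof -
  let ?P = "P ;; Upd r (Bin Add (Var r) (Cst 1))"
  let ?J = "\<lambda>s'. rg s' r \<le> n \<and> I (rg s' r) s'"
  let ?F = "\<lambda>s'. (n - rg s' r) * (c + 7 + hcost e) + 3 + hcost e"
  have fr: "frm (For r e P) s s'" if "frm ?P (upd s r 0) s'" for s'
    using that by (auto simp: frm_def)
  have "runs L (HWhile (Bin Less (Var r) e) ?P) (upd s r 0) (?F (upd s r 0)) Q"
  proof (rule runs_HWhile[where I = "\<lambda>_::unit. ?J" and \<Phi> = "\<lambda>_. ?F" and u = "\<lambda>_ _. c + 4" and ?s0.0 = "upd s r 0"])
    fix s' assume J: "?J s'" and f: "frm ?P (upd s r 0) s'"
    note e' = e[OF fr[OF f]]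
    show "hok L s' (Bin Less (Var r) e)" using e' by simp
    {
      assume 0: "hev s' (Bin Less (Var r) e) = 0"
      then have "rg s' r = n" using J e' by auto
      then show "1 + hcost (Bin Less (Var r) e) \<le> ?F s' \<and> Q s'" using J Q fr[OF f] by auto
    }
    assume "hev s' (Bin Less (Var r) e) \<noteq> 0"
    then have True: "rg s' r < n" using e' by auto
    have F: "?F s' = (c + 7 + hcost e) + ((n - Suc (rg s' r)) * (c + 7 + hcost e) + 3 + hcost e)"
      using Suc_diff_Suc[OF True, symmetric] by simp
    have "runs L ?P s' (c + 4) (\<lambda>s''. ?J s'' \<and> rg s'' r = Suc (rg s' r))"
    proof (rule runs_HSeq)
      show "runs L P s' c (\<lambda>s''. I (Suc (rg s' r)) (upd s'' r (Suc (rg s' r))))"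
        by (rule step) (use True J fr[OF f] in auto)
      fix s'' assume "frm P s' s''" and I: "I (Suc (rg s' r)) (upd s'' r (Suc (rg s' r)))"
      then have "rg s'' r = rg s' r" using r by (simp add: frm_def)
      then show "runs L (Upd r (Bin Add (Var r) (Cst 1))) s'' 4 (\<lambda>s''. ?J s'' \<and> rg s'' r = Suc (rg s' r))"
        using I True n by (intro runs_wp) auto
    qed simp
    then show "runs L ?P s' (c + 4) (\<lambda>s''. \<exists>_::unit. ?J s'' \<and> 1 + hcost (Bin Less (Var r) e) + (c + 4) + ?F s'' \<le> ?F s')"
      by (rule runs_mono) (auto simp: F)
  qed (use init in \<open>auto simp: frm_def\<close>)
  then have "runs L (For r e P) s (2 + ?F (upd s r 0)) Q"
    unfolding For_def by (intro runs_Upd_HSeq[where ?t2.0 = "?F (upd s r 0)"]) (use n in auto)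
  then show ?thesis by (rule runs_mono) (use t in auto)
qed

subsection \<open>Counting sort\<close>

definition lst :: "hst \<Rightarrow> nat \<Rightarrow> nat \<Rightarrow> nat list" where
  "lst s a q = map (ar s a) [0..<q]"

lemma length_lst [simp]: "length (lst s a q) = q"
  by (simp add: lst_def)

lemma nth_lst [simp]: "i < q \<Longrightarrow> lst s a q ! i = ar s a i"
  by (simp add: lst_def)

lemma set_lst: "set (lst s a q) = ar s a ` {..<q}"
  by (auto simp: lst_def)

text \<open>Stability is expressed through an arbitrary relation \<open>Q\<close>: whatever holds
  pairwise along the input survives among equal keys. Successive passes then compose to
  lexicographic orders without further argument.\<close>

definition sorts_to :: "('a \<Rightarrow> 'b::linorder) \<Rightarrow> 'a list \<Rightarrow> 'a list \<Rightarrow> bool" where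
  "sorts_to key xs ys \<longleftrightarrow> mset ys = mset xs \<and>
     (\<forall>Q. sorted_wrt Q xs \<longrightarrow> sorted_wrt (\<lambda>x y. key x < key y \<or> key x = key y \<and> Q x y) ys)"

text \<open>The position of entry \<open>j\<close> in the stably sorted list.\<close>

definition bpos :: "(nat \<Rightarrow> nat) \<Rightarrow> nat \<Rightarrow> nat \<Rightarrow> nat" where
  "bpos key q j = card {k. k < q \<and> key k < key j} + card {k. k < j \<and> key k = key j}"

lemma bpos_less:
  assumes "j < q"
  shows "bpos key q j < q"
proof -
  have "bpos key q j = card ({k. k < q \<and> key k < key j} \<union> {k. k < j \<and> key k = key j})"
    unfolding bpos_def by (rule card_Un_disjoint[symmetric]) auto
  also have "\<dots> < card {..<q}"
    by (rule psubset_card_mono) (use assms in auto)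
  finally show ?thesis by simp
qed

lemma bpos_mono:
  assumes "i < q" "j < q" "key i < key j \<or> key i = key j \<and> i < j"
  shows "bpos key q i < bpos key q j"
proof -
  have *: "bpos key q j = card ({k. k < q \<and> key k < key j} \<union> {k. k < j \<and> key k = key j})" for j
    unfolding bpos_def by (rule card_Un_disjoint[symmetric]) auto
  show ?thesis unfolding *
  proof (rule psubset_card_mono)
    have "i \<in> {k. k < q \<and> key k < key j} \<union> {k. k < j \<and> key k = key j}"
      "i \<notin> {k. k < q \<and> key k < key i} \<union> {k. k < i \<and> key k = key i}" using assms by auto
    then show "{k. k < q \<and> key k < key i} \<union> {k. k < i \<and> key k = key i}
       \<subset> {k. k < q \<and> key k < key j} \<union> {k. k < j \<and> key k = key j}"
      using assms by fastforce
  qed auto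
qed

lemma bpos_less_iff:
  assumes "i < q" "j < q"
  shows "bpos key q i < bpos key q j \<longleftrightarrow> key i < key j \<or> key i = key j \<and> i < j"
  using bpos_mono[OF assms, of key] bpos_mono[OF assms(2,1), of key]
  by (metis linorder_neqE_nat nat_neq_iff order_less_asym)

lemma inj_bpos: "inj_on (bpos key q) {..<q}"
  by (rule inj_onI) (metis bpos_mono lessThan_iff linorder_neqE_nat nat_neq_iff)

text \<open>\<open>bpos\<close> maps \<open>{..<q}\<close> injectively into itself and is thus a
  permutation. Comparing target positions is comparing pairs of key and index, which gives both
  sortedness and stability.\<close>

lemma bpos_sorts_to:
  fixes xs ys :: "'a list"
  assumes "length xs = q" "length ys = q" "\<And>j. j < q \<Longrightarrow> ys ! bpos key q j = xs ! j"
    and key: "\<And>j. j < q \<Longrightarrow> key j = f (xs ! j)"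
  shows "sorts_to f xs ys"
proof -
  have im: "bpos key q ` {..<q} = {..<q}"
    by (rule card_subset_eq) (auto simp: bpos_less card_image inj_bpos)
  have xs: "xs = map ((!) ys) (map (bpos key q) [0..<q])"
    by (rule nth_equalityI) (use assms in auto)
  have "mset xs = image_mset ((!) ys) (image_mset (bpos key q) (mset_set {0..<q}))"
    by (subst xs) (simp only: mset_map mset_upt)
  also have "image_mset (bpos key q) (mset_set {0..<q}) = mset_set {0..<q}"
    using image_mset_mset_set[OF inj_bpos[of key q]] im by (simp add: lessThan_atLeast0)
  also have "image_mset ((!) ys) (mset_set {0..<q}) = mset ys"
    using map_nth[of ys] assms(2) by (simp only: mset_map[symmetric] mset_upt[symmetric])
  finally have "mset ys = mset xs" ..
  moreover have "sorted_wrt (\<lambda>x y. f x < f y \<or> f x = f y \<and> Q x y) ys" if Q: "sorted_wrt Q xs" for Q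
    unfolding sorted_wrt_iff_nth_less
  proof (intro allI impI)
    fix i j assume ij: "i < j" "j < length ys"
    have "i \<in> bpos key q ` {..<q}" "j \<in> bpos key q ` {..<q}" using ij assms(2) by (auto simp: im)
    then obtain a b where ab: "a < q" "b < q" "i = bpos key q a" "j = bpos key q b" by auto
    then have "key a < key b \<or> key a = key b \<and> a < b" using ij bpos_less_iff by blast
    then show "f (ys ! i) < f (ys ! j) \<or> f (ys ! i) = f (ys ! j) \<and> Q (ys ! i) (ys ! j)"
      using ab assms Q by (auto simp: sorted_wrt_iff_nth_less)
  qed
  ultimately show ?thesis by (auto simp: sorts_to_def)
qed

abbreviation plus1 :: "hexp \<Rightarrow> hexp" where
  "plus1 e \<equiv> Bin Add e (Cst 1)"

text \<open>Occurrences of key \<open>v\<close> are counted in cell \<open>v + 1\<close>, so that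
  the prefix sums turn cell \<open>v\<close> into the number of keys below \<open>v\<close>, which
  is the first slot for key \<open>v\<close>.\<close>

definition csort :: hcmd where
  "csort =
     For 20 (plus1 (Var 6)) (Put 3 (Var 20) (Cst 0)) ;;
     For 20 (Var 5) (Put 3 (plus1 (Arr 2 (Arr 1 (Var 20)))) (plus1 (Arr 3 (plus1 (Arr 2 (Arr 1 (Var 20))))))) ;;
     For 20 (Var 6) (Put 3 (plus1 (Var 20)) (Bin Add (Arr 3 (plus1 (Var 20))) (Arr 3 (Var 20)))) ;;
     For 20 (Var 5) (Upd 21 (Arr 1 (Var 20)) ;; Upd 22 (Arr 2 (Var 21)) ;;
       Put 4 (Arr 3 (Var 22)) (Var 21) ;; Put 3 (Var 22) (plus1 (Arr 3 (Var 22)))) ;;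
     For 20 (Var 5) (Put 1 (Var 20) (Arr 4 (Var 20)))"

lemma mod_csort [simp]: "modr csort = {20,21,22}" "moda csort = {1,3,4}"
  by (auto simp: csort_def)

lemma card_Collect_Suc: "card {k. k < Suc i \<and> P k} = card {k. k < i \<and> P k} + of_bool (P i)"
proof (cases "P i")
  case True
  then have "{k. k < Suc i \<and> P k} = insert i {k. k < i \<and> P k}" by (auto simp: less_Suc_eq)
  then show ?thesis using True by simp
next
  case False
  then have "{k. k < Suc i \<and> P k} = {k. k < i \<and> P k}" by (auto simp: less_Suc_eq)
  then show ?thesis using False by simp
qed

lemma card_less_Collect: "card {k. k < (q::nat) \<and> P k} \<le> q"
proof -
  have "card {k. k < q \<and> P k} \<le> card {..<q}" by (rule card_mono) auto
  then show ?thesis by simp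
qed

lemma runs_csort:
  assumes q: "rg s 5 = q" and B: "rg s 6 = B"
    and P: "\<And>k. k < q \<Longrightarrow> ar s 1 k < L" "\<And>k. k < q \<Longrightarrow> ar s 2 (ar s 1 k) < B"
    and L: "q + 1 < L" "B + 1 < L"
  shows "runs L csort s (120 * (q + B + 2)) (\<lambda>s'. sorts_to (ar s 2) (lst s 1 q) (lst s' 1 q))"
proof -
  define key where "key k = ar s 2 (ar s 1 k)" for k
  let ?A = "\<lambda>s'. ar s' 1 = ar s 1 \<and> ar s' 2 = ar s 2 \<and> rg s' 5 = q \<and> rg s' 6 = B"
  let ?c1 = "\<lambda>v. card {k. k < q \<and> key k + 1 = v}"
  let ?c2 = "\<lambda>v. card {k. k < q \<and> key k < v}"
  have keyB: "key k < B" if "k < q" for k using P that by (simp add: key_def)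
  have c2: "?c2 (Suc v) = ?c2 v + ?c1 (Suc v)" for v
  proof -
    have "{k. k < q \<and> key k < Suc v} = {k. k < q \<and> key k < v} \<union> {k. k < q \<and> key k + 1 = Suc v}"
      by auto
    then show ?thesis by (simp add: card_Un_disjoint disjoint_iff)
  qed
  show ?thesis
    unfolding csort_def
  proof (rule runs_HSeq)
    show "runs L (For 20 (plus1 (Var 6)) (Put 3 (Var 20) (Cst 0))) s (17 * (B + 2)) (\<lambda>s'. \<forall>v<B + 1. ar s' 3 v = 0)"
      by (rule runs_For[where n = "B + 1" and I = "\<lambda>i s'. \<forall>v<i. ar s' 3 v = 0" and c = 7])
        (use B L in \<open>auto simp: frm_def less_Suc_eq intro!: runs_wp\<close>)
    fix s1 assume f1: "frm (For 20 (plus1 (Var 6)) (Put 3 (Var 20) (Cst 0))) s s1" and Q1: "\<forall>v<B + 1. ar s1 3 v = 0"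
    then have A1: "?A s1" using q B by (simp add: frm_def)
    let ?P2 = "For 20 (Var 5) (Put 3 (plus1 (Arr 2 (Arr 1 (Var 20)))) (plus1 (Arr 3 (plus1 (Arr 2 (Arr 1 (Var 20)))))))"
    let ?P3 = "For 20 (Var 6) (Put 3 (plus1 (Var 20)) (Bin Add (Arr 3 (plus1 (Var 20))) (Arr 3 (Var 20))))"
    let ?P4 = "For 20 (Var 5) (Upd 21 (Arr 1 (Var 20)) ;; Upd 22 (Arr 2 (Var 21)) ;;
       Put 4 (Arr 3 (Var 22)) (Var 21) ;; Put 3 (Var 22) (plus1 (Arr 3 (Var 22))))"
    let ?P5 = "For 20 (Var 5) (Put 1 (Var 20) (Arr 4 (Var 20)))"
    show "runs L (?P2 ;; ?P3 ;; ?P4 ;; ?P5) s1 (46 * (q + 1) + (31 * (B + 1) + (48 * (q + 1) + 20 * (q + 1))))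
      (\<lambda>s'. sorts_to (ar s 2) (lst s 1 q) (lst s' 1 q))"
    proof (rule runs_HSeq)
      show "runs L ?P2 s1 (46 * (q + 1)) (\<lambda>s'. \<forall>v\<le>B. ar s' 3 v = ?c1 v)"
      proof (rule runs_For[where n = q and c = 38 and I = "\<lambda>i s'. \<forall>v\<le>B. ar s' 3 v = card {k. k < i \<and> key k + 1 = v}"])
        fix i s' assume i: "i < q" "rg s' 20 = i" and I: "\<forall>v\<le>B. ar s' 3 v = card {k. k < i \<and> key k + 1 = v}"
          and f: "frm ?P2 s1 s'"
        have "?A s'" using A1 f by (simp add: frm_def)
        moreover have "card {k. k < i \<and> key k = key i} + 1 < L"
          using card_less_Collect[of i "\<lambda>k. key k = key i"] i L by linarith
        ultimately show "runs L (Put 3 (plus1 (Arr 2 (Arr 1 (Var 20)))) (plus1 (Arr 3 (plus1 (Arr 2 (Arr 1 (Var 20))))))) s' 38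
          (\<lambda>s''. \<forall>v\<le>B. ar (upd s'' 20 (Suc i)) 3 v = card {k. k < Suc i \<and> key k + 1 = v})"
          using i I L P[OF i(1)] keyB[OF i(1)] unfolding card_Collect_Suc
          by (intro runs_wp) (auto simp: key_def)
      qed (use L A1 Q1 in \<open>auto simp: frm_def\<close>)
      fix s2 assume f2: "frm ?P2 s1 s2" and Q2: "\<forall>v\<le>B. ar s2 3 v = ?c1 v"
      then have A2: "?A s2" using A1 by (simp add: frm_def)
      show "runs L (?P3 ;; ?P4 ;; ?P5) s2 (31 * (B + 1) + (48 * (q + 1) + 20 * (q + 1)))
        (\<lambda>s'. sorts_to (ar s 2) (lst s 1 q) (lst s' 1 q))"
      proof (rule runs_HSeq)
        show "runs L ?P3 s2 (31 * (B + 1)) (\<lambda>s'. \<forall>v\<le>B. ar s' 3 v = ?c2 v)"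
        proof (rule runs_For[where n = B and c = 23 and I = "\<lambda>i s'. \<forall>v\<le>B. ar s' 3 v = (if v \<le> i then ?c2 v else ?c1 v)"])
          fix i s' assume i: "i < B" "rg s' 20 = i" and I: "\<forall>v\<le>B. ar s' 3 v = (if v \<le> i then ?c2 v else ?c1 v)"
            and f: "frm ?P3 s2 s'"
          have "?A s'" using A2 f by (simp add: frm_def)
          moreover have "?c1 (Suc i) + ?c2 i < L"
            using card_less_Collect[of q "\<lambda>k. key k < Suc i"] c2[of i] L by linarith
          ultimately show "runs L (Put 3 (plus1 (Var 20)) (Bin Add (Arr 3 (plus1 (Var 20))) (Arr 3 (Var 20)))) s' 23
            (\<lambda>s''. \<forall>v\<le>B. ar (upd s'' 20 (Suc i)) 3 v = (if v \<le> Suc i then ?c2 v else ?c1 v))"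
            using i I L c2[of i]
            by (intro runs_wp) (auto simp: le_Suc_eq)
        qed (use L A2 Q2 in \<open>auto simp: frm_def\<close>)
        fix s3 assume f3: "frm ?P3 s2 s3" and Q3: "\<forall>v\<le>B. ar s3 3 v = ?c2 v"
        then have A3: "?A s3" using A2 by (simp add: frm_def)
        show "runs L (?P4 ;; ?P5) s3 (48 * (q + 1) + 20 * (q + 1))
          (\<lambda>s'. sorts_to (ar s 2) (lst s 1 q) (lst s' 1 q))"
        proof (rule runs_HSeq)
          \<comment> \<open>Cell \<open>v\<close> is the next free slot of key \<open>v\<close>; for
            the key of the current entry it equals \<open>bpos\<close>.\<close>
          let ?I = "\<lambda>i s'. (\<forall>v\<le>B. ar s' 3 v = ?c2 v + card {k. k < i \<and> key k = v}) \<and>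
              (\<forall>j<i. ar s' 4 (bpos key q j) = ar s 1 j)"
          show "runs L ?P4 s3 (48 * (q + 1)) (\<lambda>s'. \<forall>j<q. ar s' 4 (bpos key q j) = ar s 1 j)"
          proof (rule runs_For[where n = q and c = 40 and I = ?I])
            fix i s' assume i: "i < q" "rg s' 20 = i" and I: "?I i s'" and f: "frm ?P4 s3 s'"
            have A: "?A s'" using A3 f by (simp add: frm_def)
            have b: "ar s' 3 (key i) = bpos key q i" using I keyB[OF i(1)] by (simp add: bpos_def)
            have ne: "bpos key q j = bpos key q i \<longleftrightarrow> j = i" if "j \<le> i" for j
              using inj_onD[OF inj_bpos, of key q j i] that i by auto
            show "runs L (Upd 21 (Arr 1 (Var 20)) ;; Upd 22 (Arr 2 (Var 21)) ;;
              Put 4 (Arr 3 (Var 22)) (Var 21) ;; Put 3 (Var 22) (plus1 (Arr 3 (Var 22)))) s' 40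
              (\<lambda>s''. ?I (Suc i) (upd s'' 20 (Suc i)))"
              using i I L A P[OF i(1)] keyB[OF i(1)] b bpos_less[OF i(1), of key] ne unfolding card_Collect_Suc
              by (intro runs_wp) (auto simp: key_def less_Suc_eq)
          qed (use L A3 Q3 in \<open>auto simp: frm_def\<close>)
          fix s4 assume f4: "frm ?P4 s3 s4" and Q4: "\<forall>j<q. ar s4 4 (bpos key q j) = ar s 1 j"
          then have A4: "?A s4" using A3 by (simp add: frm_def)
          show "runs L ?P5 s4 (20 * (q + 1)) (\<lambda>s'. sorts_to (ar s 2) (lst s 1 q) (lst s' 1 q))"
          proof (rule runs_For[where n = q and c = 12 and I = "\<lambda>i s'. \<forall>j<i. ar s' 1 j = ar s4 4 j"])
            fix s' :: hst assume "\<forall>j<q. ar s' 1 j = ar s4 4 j"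
            then show "sorts_to (ar s 2) (lst s 1 q) (lst s' 1 q)"
              using Q4 by (intro bpos_sorts_to[of _ q _ key]) (auto simp: bpos_less key_def)
          qed (use L A4 in \<open>auto simp: frm_def less_Suc_eq intro!: runs_wp\<close>)
        qed simp
      qed simp
    qed simp
  qed simp
qed

subsection \<open>The skew suffix sorting step\<close>

text \<open>Suffixes are compared as infinite sequences. Under \<open>wf_str\<close> the zeros from
  \<open>m\<close> on act as an end marker below every letter, so a proper prefix comes
  first.\<close>

definition suffix_less :: "(nat \<Rightarrow> nat) \<Rightarrow> nat \<Rightarrow> nat \<Rightarrow> bool" where
  "suffix_less T i j \<longleftrightarrow> (\<exists>k. (\<forall>l<k. T (i + l) = T (j + l)) \<and> T (i + k) < T (j + k))"

definition wf_str :: "(nat \<Rightarrow> nat) \<Rightarrow> nat \<Rightarrow> bool" where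
  "wf_str T m \<longleftrightarrow> (\<forall>i<m. 1 \<le> T i) \<and> (\<forall>i\<ge>m. T i = 0)"

lemma suffix_less_irrefl [simp]: "\<not> suffix_less T i i"
  by (auto simp: suffix_less_def)

lemma suffix_less_trans:
  assumes "suffix_less T i j" "suffix_less T j k"
  shows "suffix_less T i k"
proof -
  obtain a where a: "\<forall>l<a. T (i + l) = T (j + l)" "T (i + a) < T (j + a)" using assms(1) by (auto simp: suffix_less_def)
  obtain b where b: "\<forall>l<b. T (j + l) = T (k + l)" "T (j + b) < T (k + b)" using assms(2) by (auto simp: suffix_less_def)
  show ?thesis unfolding suffix_less_def
    by (rule exI[of _ "min a b"]) (use a b in \<open>cases a b rule: linorder_cases; auto\<close>)
qed

lemma suffix_less_asym: "suffix_less T i j \<Longrightarrow> \<not> suffix_less T j i"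
  using suffix_less_trans suffix_less_irrefl by blast

text \<open>At the offset where suffix \<open>i\<close> shows its last letter, suffix
  \<open>j\<close>, which starts later, already shows the end marker 0.\<close>

lemma wf_str_neq:
  assumes "wf_str T m" "i < m" "i < j"
  shows "\<exists>k. T (i + k) \<noteq> T (j + k)"
proof
  have "m \<le> j + (m - Suc i)" "i + (m - Suc i) < m" using assms by auto
  then have "T (j + (m - Suc i)) = 0" "1 \<le> T (i + (m - Suc i))" using assms(1) unfolding wf_str_def by blast+
  then show "T (i + (m - Suc i)) \<noteq> T (j + (m - Suc i))" by simp
qed

lemma suffix_less_total:
  assumes "wf_str T m" "i < m \<or> j < m" "i \<noteq> j"
  shows "suffix_less T i j \<or> suffix_less T j i"
proof -
  have ex: "\<exists>k. T (i + k) \<noteq> T (j + k)"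
  proof (cases "i < j")
    case True
    then show ?thesis using assms wf_str_neq[of T m i j] by auto
  next
    case False
    then obtain k where "T (j + k) \<noteq> T (i + k)" using assms wf_str_neq[of T m j i] by auto
    then show ?thesis by (intro exI[of _ k]) simp
  qed
  define k where "k = (LEAST k. T (i + k) \<noteq> T (j + k))"
  have "T (i + k) \<noteq> T (j + k)" unfolding k_def using ex by (rule LeastI_ex)
  moreover have "\<forall>l<k. T (i + l) = T (j + l)" unfolding k_def using not_less_Least by blast
  ultimately show ?thesis unfolding suffix_less_def by (metis linorder_neqE_nat)
qed

lemma suffix_less_shift:
  assumes "\<forall>l<d. T (i + l) = T (j + l)"
  shows "suffix_less T i j \<longleftrightarrow> suffix_less T (i + d) (j + d)"
proof
  assume "suffix_less T i j"
  then obtain k where k: "\<forall>l<k. T (i + l) = T (j + l)" "T (i + k) < T (j + k)" by (auto simp: suffix_less_def)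
  then have "d \<le> k" using assms by (metis less_irrefl not_le)
  then obtain e where "k = d + e" using le_Suc_ex by blast
  then show "suffix_less T (i + d) (j + d)" unfolding suffix_less_def using k by (intro exI[of _ e]) (auto simp: add.assoc)
next
  assume "suffix_less T (i + d) (j + d)"
  then obtain k where k: "\<forall>l<k. T (i + d + l) = T (j + d + l)" "T (i + d + k) < T (j + d + k)" by (auto simp: suffix_less_def)
  have "T (i + l) = T (j + l)" if "l < d + k" for l
  proof (cases "l < d")
    case False
    then obtain e where "l = d + e" using le_Suc_ex not_less by blast
    then show ?thesis using k that by (auto simp: add.assoc)
  qed (use assms in auto)
  then show "suffix_less T i j" unfolding suffix_less_def using k by (intro exI[of _ "d + k"]) (auto simp: add.assoc)
qed

definition trip :: "(nat \<Rightarrow> nat) \<Rightarrow> nat \<Rightarrow> nat \<times> nat \<times> nat" where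
  "trip T i = (T i, T (i + 1), T (i + 2))"

text \<open>Names start at 1 to leave 0 as the end marker of a renamed string; the upper bound
  \<open>m\<close> keeps the next counting sort linear.\<close>

definition names :: "(nat \<Rightarrow> 'k::linorder) \<Rightarrow> nat \<Rightarrow> (nat \<Rightarrow> nat) \<Rightarrow> bool" where
  "names key m nm \<longleftrightarrow> (\<forall>i<m. 1 \<le> nm i \<and> nm i \<le> m) \<and> (\<forall>i<m. \<forall>j<m. nm i < nm j \<longleftrightarrow> key i < key j)"

lemma names_eq: "names key m nm \<Longrightarrow> i < m \<Longrightarrow> j < m \<Longrightarrow> nm i = nm j \<longleftrightarrow> key i = key j"
  unfolding names_def by (metis less_irrefl linorder_neqE)

lemma trip_less_suffix_less: "trip T i < trip T j \<Longrightarrow> suffix_less T i j"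
proof -
  assume "trip T i < trip T j"
  then consider "T i < T j" | "T i = T j" "T (i + 1) < T (j + 1)"
    | "T i = T j" "T (i + 1) = T (j + 1)" "T (i + 2) < T (j + 2)"
    by (auto simp: trip_def less_prod_def le_less)
  then show ?thesis
  proof cases
    case 1
    then show ?thesis unfolding suffix_less_def by (intro exI[of _ 0]) auto
  next
    case 2
    then show ?thesis unfolding suffix_less_def by (intro exI[of _ 1]) auto
  next
    case 3
    then show ?thesis unfolding suffix_less_def by (intro exI[of _ 2]) (auto simp: numeral_2_eq_2 less_Suc_eq)
  qed
qed

lemma trip_eq: "trip T i = trip T j \<longleftrightarrow> (\<forall>l<3. T (i + l) = T (j + l))"
proof -
  have "(\<forall>l<3. T (i + l) = T (j + l)) \<longleftrightarrow> (\<forall>l\<in>{0,1,2}. T (i + l) = T (j + l))"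
    by (rule iffI) (auto simp: less_Suc_eq numeral_3_eq_3 numeral_2_eq_2)
  then show ?thesis by (auto simp: trip_def)
qed

lemma suffix_less_trip_cases: "suffix_less T i j \<longleftrightarrow> trip T i < trip T j \<or> trip T i = trip T j \<and> suffix_less T (i + 3) (j + 3)"
proof (cases "trip T i" "trip T j" rule: linorder_cases)
  case less
  then show ?thesis using trip_less_suffix_less[OF less] by simp
next
  case equal
  then have "\<forall>l<3. T (i + l) = T (j + l)" by (simp only: trip_eq)
  then have "suffix_less T i j \<longleftrightarrow> suffix_less T (i + 3) (j + 3)" by (rule suffix_less_shift)
  then show ?thesis using equal by simp
next
  case greater
  then show ?thesis using trip_less_suffix_less suffix_less_asym by (metis less_imp_not_less less_irrefl)
qed

text \<open>The first difference lies in some block of three letters; equal leading blocks are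
  stripped by induction on its position.\<close>

lemma suffix_less_trip_ex:
  assumes "suffix_less T i j"
  shows "\<exists>k. (\<forall>l<k. trip T (i + 3 * l) = trip T (j + 3 * l)) \<and> trip T (i + 3 * k) < trip T (j + 3 * k)"
proof -
  obtain k where k: "\<forall>l<k. T (i + l) = T (j + l)" "T (i + k) < T (j + k)" using assms by (auto simp: suffix_less_def)
  from k show ?thesis
  proof (induction k arbitrary: i j rule: less_induct)
    case (less k)
    show ?case
    proof (cases "trip T i = trip T j")
      case False
      have "suffix_less T i j" using less.prems by (auto simp: suffix_less_def)
      then have "trip T i < trip T j" using False suffix_less_trip_cases by blast
      then show ?thesis by (intro exI[of _ 0]) auto
    next
      case True
      then have eq: "\<forall>l<3. T (i + l) = T (j + l)" using trip_eq by blast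
      then have k3: "3 \<le> k" using less.prems(2) by (metis less_irrefl not_le)
      have "\<exists>k. (\<forall>l<k. trip T (i + 3 + 3 * l) = trip T (j + 3 + 3 * l)) \<and> trip T (i + 3 + 3 * k) < trip T (j + 3 + 3 * k)"
      proof (rule less.IH[of "k - 3"])
        show "\<forall>l<k - 3. T (i + 3 + l) = T (j + 3 + l)"
          using less.prems(1) by (metis add.assoc less_diff_conv add.commute)
      qed (use k3 less.prems in auto)
      then obtain k' where k': "\<forall>l<k'. trip T (i + 3 + 3 * l) = trip T (j + 3 + 3 * l)"
        "trip T (i + 3 + 3 * k') < trip T (j + 3 + 3 * k')" by blast
      have "trip T (i + 3 * l) = trip T (j + 3 * l)" if "l < Suc k'" for l
        using that True k'(1) by (cases l) (auto simp: algebra_simps)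
      then show ?thesis using k'(2) by (intro exI[of _ "Suc k'"]) (auto simp: algebra_simps)
    qed
  qed
qed

section \<open>The reduced string of the skew algorithm\<close>

abbreviation (input) n1 :: "nat \<Rightarrow> nat" where "n1 m \<equiv> (m + 1) div 3"
abbreviation (input) n2 :: "nat \<Rightarrow> nat" where "n2 m \<equiv> m div 3"

definition nextm :: "nat \<Rightarrow> nat" where
  "nextm m = n1 m + 1 + n2 m"

text \<open>The triple names at the \<open>n1 m\<close> positions that are 1 modulo 3, a separator,
  and those at the \<open>n2 m\<close> positions that are 2 modulo 3. Names are raised by one so
  that the separator 1 lies between the end marker 0 and all of them.\<close>

definition nextT :: "(nat \<Rightarrow> nat) \<Rightarrow> nat \<Rightarrow> nat \<Rightarrow> nat" where
  "nextT nm m j =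
    (if j < n1 m then nm (3 * j + 1) + 1
     else if j = n1 m then 1
     else if j < nextm m then nm (3 * (j - n1 m - 1) + 2) + 1 else 0)"

text \<open>The place of the sampled position \<open>i\<close> in the reduced string; the summand
  \<open>n1 m + 1\<close> skips the first half and the separator.\<close>

definition ix :: "nat \<Rightarrow> nat \<Rightarrow> nat" where
  "ix m i = (if i mod 3 = 1 then i div 3 else n1 m + 1 + i div 3)"

lemma wf_nextT: "wf_str (nextT nm m) (nextm m)"
  by (auto simp: wf_str_def nextT_def nextm_def)

lemma mod3_cases:
  assumes "(i::nat) mod 3 \<noteq> 0"
  obtains e where "i = 3 * e + 1" | e where "i = 3 * e + 2"
proof -
  have "i = 3 * (i div 3) + i mod 3" "i mod 3 < 3" by simp_all
  moreover from this(2) assms have "i mod 3 = 1 \<or> i mod 3 = 2" by linarith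
  ultimately show ?thesis using that by metis
qed

lemma ix_1 [simp]: "ix m (3 * e + 1) = e" "ix m (Suc (3 * e)) = e"
  and ix_2 [simp]: "ix m (3 * e + 2) = n1 m + 1 + e" "ix m (Suc (Suc (3 * e))) = n1 m + 1 + e"
  by (simp_all add: ix_def) presburger+

lemma less_n1: "e < n1 m \<longleftrightarrow> 3 * e + 1 < m"
  by (simp add: less_eq_div_iff_mult_less_eq flip: Suc_le_eq) presburger

lemma less_n2: "e < n2 m \<longleftrightarrow> 3 * e + 2 < m"
  by (simp add: less_eq_div_iff_mult_less_eq flip: Suc_le_eq) presburger

lemma nextT_ix:
  assumes "i mod 3 \<noteq> 0" "i + 3 * k < m"
  shows "nextT nm m (ix m i + k) = nm (i + 3 * k) + 1"
  using assms(1)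
proof (cases i rule: mod3_cases)
  case (1 e)
  then have "e + k < n1 m" unfolding less_n1 using assms(2) by simp
  moreover have "3 * (e + k) + 1 = i + 3 * k" using 1 by simp
  ultimately show ?thesis unfolding 1 ix_1 by (simp add: nextT_def)
next
  case (2 e)
  then have "e + k < n2 m" unfolding less_n2 using assms(2) by simp
  moreover have "3 * (e + k) + 2 = i + 3 * k" using 2 by simp
  ultimately show ?thesis unfolding 2 ix_2 by (simp add: nextT_def nextm_def)
qed

text \<open>The first step beyond the text leads from the first half to the separator and from the
  second half to the end marker, both at most 1.\<close>

lemma nextT_ix_end:
  assumes "i mod 3 \<noteq> 0" "i < m" "m \<le> i + 3 * k" "\<And>l. l < k \<Longrightarrow> i + 3 * l < m"
  shows "nextT nm m (ix m i + k) \<le> 1"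
proof -
  have k: "0 < k" "i + 3 * (k - 1) < m" using assms by (cases k; auto)+
  show ?thesis using assms(1)
  proof (cases i rule: mod3_cases)
    case (1 e)
    have "\<not> e + k < n1 m" "e + (k - 1) < n1 m" unfolding less_n1 using k assms(3) 1 by simp_all
    then have "e + k = n1 m" using k(1) by linarith
    then show ?thesis using 1 by (simp add: nextT_def)
  next
    case (2 e)
    have "\<not> e + k < n2 m" "e + (k - 1) < n2 m" unfolding less_n2 using k assms(3) 2 by simp_all
    then show ?thesis using 2 by (simp add: nextT_def nextm_def)
  qed
qed

text \<open>Up to the first difference both suffixes are inside the text and their names agree. At
  the difference either both names exist and compare like the triples, or the smaller suffix has
  ended; then it shows at most 1, while a raised name is at least 2.\<close>

lemma suffix_less_nextT_aux:
  assumes wf: "wf_str T m" and nm: "names (trip T) m nm"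
    and i: "i < m" "i mod 3 \<noteq> 0" and j: "j < m" "j mod 3 \<noteq> 0" and suffix_less: "suffix_less T i j"
  shows "suffix_less (nextT nm m) (ix m i) (ix m j)"
proof -
  obtain k where k: "\<forall>l<k. trip T (i + 3 * l) = trip T (j + 3 * l)"
    "trip T (i + 3 * k) < trip T (j + 3 * k)" using suffix_less_trip_ex[OF suffix_less] by blast
  have pos: "T x = 0 \<longleftrightarrow> m \<le> x" for x using wf unfolding wf_str_def by (metis not_one_le_zero not_le)
  \<comment> \<open>Past the end the triple consists of zeros and is minimal, so it cannot be the
    larger one.\<close>
  have jk: "j + 3 * k < m"
  proof (rule ccontr)
    assume "\<not> ?thesis"
    then have "trip T (j + 3 * k) = (0, 0, 0)" using pos by (auto simp: trip_def)
    then show False using k(2) by (auto simp: trip_def less_prod_def le_less)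
  qed
  have jl: "j + 3 * l < m" if "l < k" for l using that jk by linarith
  \<comment> \<open>Equal triples have equal first letters, and a nonzero letter means that suffix
    \<open>i\<close> has not ended either.\<close>
  have il: "i + 3 * l < m" if "l < k" for l
    using k(1) that jl[OF that] pos by (simp add: trip_def) (metis not_le)
  have eq: "nextT nm m (ix m i + l) = nextT nm m (ix m j + l)" if "l < k" for l
    using names_eq[OF nm il[OF that] jl[OF that]] k(1) that
    by (simp add: nextT_ix[OF i(2) il[OF that]] nextT_ix[OF j(2) jl[OF that]])
  have "nextT nm m (ix m i + k) < nextT nm m (ix m j + k)"
  proof (cases "i + 3 * k < m")
    case True
    then have "nm (i + 3 * k) < nm (j + 3 * k)" using nm k(2) jk by (simp add: names_def)
    then show ?thesis by (simp add: nextT_ix[OF i(2) True] nextT_ix[OF j(2) jk])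
  next
    case False
    then have "nextT nm m (ix m i + k) \<le> 1" using nextT_ix_end[OF i(2,1) _ il] by simp
    moreover have "1 \<le> nm (j + 3 * k)" using nm jk by (simp add: names_def)
    ultimately show ?thesis by (simp add: nextT_ix[OF j(2) jk])
  qed
  then show ?thesis using eq by (auto simp: suffix_less_def)
qed

lemma suffix_less_nextT:
  assumes "wf_str T m" "names (trip T) m nm" "i < m" "i mod 3 \<noteq> 0" "j < m" "j mod 3 \<noteq> 0"
  shows "suffix_less (nextT nm m) (ix m i) (ix m j) \<longleftrightarrow> suffix_less T i j"
proof
  assume s: "suffix_less (nextT nm m) (ix m i) (ix m j)"
  show "suffix_less T i j"
  proof (rule ccontr)
    assume "\<not> suffix_less T i j"
    then consider "i = j" | "suffix_less T j i" using suffix_less_total[OF assms(1), of i j] assms(3) by auto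
    then show False
      using s suffix_less_nextT_aux[OF assms(1,2,5,6,3,4)] suffix_less_asym by cases auto
  qed
qed (use assms suffix_less_nextT_aux in blast)

lemma suffix_less_zero:
  assumes "wf_str T m" "m \<le> b"
  shows "\<not> suffix_less T a b" "a < m \<Longrightarrow> suffix_less T b a"
proof -
  show "\<not> suffix_less T a b" using assms by (auto simp: suffix_less_def wf_str_def)
  then show "suffix_less T b a" if "a < m" using suffix_less_total[OF assms(1), of a b] that assms(2) by auto
qed

text \<open>Equal names mean three equal letters, so any shift by \<open>d \<le> 3\<close> is
  allowed. Offset 3 serves the base case, 1 the suffixes at multiples of three, and 1 or 2 the
  merge.\<close>

lemma suffix_less_names:
  assumes nm: "names (trip T) m nm" and "i < m" "j < m" "d \<le> 3"
  shows "suffix_less T i j \<longleftrightarrow> nm i < nm j \<or> nm i = nm j \<and> suffix_less T (i + d) (j + d)"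
proof (cases "nm i = nm j")
  case True
  then have "trip T i = trip T j" using names_eq assms by metis
  then have "\<forall>l<d. T (i + l) = T (j + l)" using assms(4) by (simp add: trip_eq)
  then show ?thesis using True suffix_less_shift by auto
next
  case False
  then have "trip T i \<noteq> trip T j" using names_eq assms by metis
  then show ?thesis using False nm assms(2,3) suffix_less_trip_cases[of T i j] by (auto simp: names_def)
qed

lemma nextm_bound: "3 * nextm m \<le> 2 * m + 4"
proof -
  have "3 * x \<le> m + 1 \<Longrightarrow> 3 * y \<le> m \<Longrightarrow> 3 * (x + 1 + y) \<le> 2 * m + 4" for x y
    by (simp add: distrib_left)
  then show ?thesis unfolding nextm_def by simp
qed

text \<open>Each level loses at least a sixth of its length, which makes the total length linear;
  the factor 6 is attained at \<open>m = 6\<close>. The recursion stops at length 3, where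
  \<open>nextm 3 = 3\<close> makes no progress.\<close>

lemma nextm_less: "3 < m \<Longrightarrow> nextm m < m \<and> m \<le> 6 * (m - nextm m)"
proof (cases "8 \<le> m")
  case True
  then show ?thesis using nextm_bound[of m] by linarith
next
  case False
  assume "3 < m"
  with False have "m \<in> {4,5,6,7}" by auto
  then show ?thesis by (auto simp: nextm_def)
qed

lemma ix_less: "i < m \<Longrightarrow> i mod 3 \<noteq> 0 \<Longrightarrow> ix m i < nextm m"
proof (erule mod3_cases, goal_cases)
  case (1 e)
  then have "e < n1 m" by (simp only: less_n1)
  then show ?case using 1 by (simp add: nextm_def)
next
  case (2 e)
  then have "e < n2 m" by (simp only: less_n2)
  then show ?case using 2 by (simp add: nextm_def)
qed

subsection \<open>Naming\<close>

abbreviation neqe :: "hexp \<Rightarrow> hexp \<Rightarrow> hexp" where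
  "neqe d e \<equiv> Bin Eq (Bin Eq d e) (Cst 0)"

text \<open>The parameter \<open>d\<close> tests whether the items in registers 21 and 22 have
  different keys; it will be a comparison of characters or of triples. Names are written from the
  offset in register 8 on, behind those of earlier levels.\<close>

definition naming :: "hexp \<Rightarrow> hcmd" where
  "naming d =
     Upd 23 (Cst 0) ;;
     For 20 (Var 5)
       (Upd 21 (Arr 1 (Var 20)) ;;
        HIf (Var 20)
          (Upd 22 (Arr 1 (Bin Sub (Var 20) (Cst 1))) ;; HIf d (Upd 23 (plus1 (Var 23))) HSkip)
          (Upd 23 (Cst 1)) ;;
        Put 6 (Bin Add (Var 8) (Var 21)) (Var 23))"

lemma mod_naming [simp]: "modr (naming d) = {20,21,22,23}" "moda (naming d) = {6}"
  by (auto simp: naming_def)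

definition nstep :: "(nat \<Rightarrow> 'k::linorder) \<Rightarrow> (nat \<Rightarrow> nat) \<Rightarrow> nat \<Rightarrow> nat \<Rightarrow> nat" where
  "nstep key pk k c = (if k = 0 then 1 else if key (pk k) = key (pk (k - 1)) then c else c + 1)"

definition ninv :: "(nat \<Rightarrow> 'k::linorder) \<Rightarrow> (nat \<Rightarrow> nat) \<Rightarrow> nat \<Rightarrow> nat \<Rightarrow> (nat \<Rightarrow> nat) \<Rightarrow> bool" where
  "ninv key pk k c nm \<longleftrightarrow> c \<le> k \<and> (0 < k \<longrightarrow> 1 \<le> c \<and> nm (pk (k - 1)) = c) \<and>
     (\<forall>a<k. 1 \<le> nm (pk a) \<and> nm (pk a) \<le> c) \<and>
     (\<forall>a<k. \<forall>b<k. nm (pk a) < nm (pk b) \<longleftrightarrow> key (pk a) < key (pk b))"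

text \<open>Keys arrive in ascending order, so the predecessor decides everything: an equal key
  inherits its comparisons with earlier entries, and a different key exceeds all of them.\<close>

lemma ninv_step:
  assumes inv: "ninv key pk k c nm" and k: "k < q" and inj: "inj_on pk {..<q}"
    and sorted: "\<And>a b. a < b \<Longrightarrow> b < q \<Longrightarrow> key (pk a) \<le> key (pk b)"
    and nm': "nm' (pk k) = nstep key pk k c" "\<And>a. a < k \<Longrightarrow> nm' (pk a) = nm (pk a)"
  shows "ninv key pk (Suc k) (nstep key pk k c) nm'"
proof (cases "k = 0")
  case True
  then show ?thesis using nm' by (simp add: ninv_def nstep_def)
next
  case False
  let ?c = "nstep key pk k c"
  have c: "1 \<le> c" "c \<le> k" "nm (pk (k - 1)) = c" using inv False by (auto simp: ninv_def)
  have le: "c \<le> ?c" "?c \<le> c + 1" using False by (auto simp: nstep_def)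
  have old: "1 \<le> nm (pk a)" "nm (pk a) \<le> c" if "a < k" for a using inv that by (auto simp: ninv_def)
  have new: "nm (pk a) < ?c \<longleftrightarrow> key (pk a) < key (pk k)" if a: "a < k" for a
  proof (cases "key (pk k) = key (pk (k - 1))")
    case True
    then have "nm (pk a) < ?c \<longleftrightarrow> nm (pk a) < nm (pk (k - 1))" using False c by (simp add: nstep_def)
    also have "\<dots> \<longleftrightarrow> key (pk a) < key (pk (k - 1))" using inv a diff_less[OF zero_less_one, of k] False unfolding ninv_def by blast
    finally show ?thesis using True by simp
  next
    case ne: False
    then have "key (pk (k - 1)) < key (pk k)" using sorted[of "k - 1" k] k False by (simp add: le_less)
    moreover have "key (pk a) \<le> key (pk (k - 1))"
      using sorted[of a "k - 1"] a k by (cases "a = k - 1") auto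
    moreover have "nm (pk a) < ?c" using old[OF a] ne False by (simp add: nstep_def)
    ultimately show ?thesis by auto
  qed
  have "\<not> key (pk k) < key (pk a)" if "a < k" for a using sorted[OF that k] by auto
  then have "nm' (pk a) < nm' (pk b) \<longleftrightarrow> key (pk a) < key (pk b)" if "a < Suc k" "b < Suc k" for a b
    using that inv new nm' old le by (fastforce simp: less_Suc_eq ninv_def)
  moreover have "1 \<le> nm' (pk a) \<and> nm' (pk a) \<le> ?c" if "a < Suc k" for a
    using that old[of a] nm' le c by (cases "a = k") auto
  moreover have "?c \<le> Suc k" "1 \<le> ?c" using le c by linarith+
  ultimately show ?thesis using nm'(1) unfolding ninv_def by simp
qed

lemma runs_naming:
  fixes key :: "nat \<Rightarrow> 'k::linorder"
  assumes q: "rg s 5 = q" "rg s 8 = off"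
    and P: "set (lst s 1 q) = {..<q}" and sorted: "sorted_wrt (\<lambda>x y. key x \<le> key y) (lst s 1 q)"
    and d: "\<And>s'. (\<And>r. r \<notin> {20,21,22,23} \<Longrightarrow> rg s' r = rg s r) \<Longrightarrow> (\<And>a. a \<noteq> 6 \<Longrightarrow> ar s' a = ar s a) \<Longrightarrow>
      rg s' 21 < q \<Longrightarrow> rg s' 22 < q \<Longrightarrow> hok L s' d \<and> (hev s' d \<noteq> 0 \<longleftrightarrow> key (rg s' 21) \<noteq> key (rg s' 22))"
    and L: "off + q + 2 < L"
  shows "runs L (naming d) s ((q + 2) * (80 + hcost d))
    (\<lambda>s'. names key q (\<lambda>i. ar s' 6 (off + i)) \<and> (\<forall>i<off. ar s' 6 i = ar s 6 i))"
proof -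
  define pk where "pk = ar s 1"
  have pk: "pk ` {..<q} = {..<q}" using P by (simp add: set_lst pk_def)
  then have inj: "inj_on pk {..<q}" by (intro eq_card_imp_inj_on) auto
  have pkq: "pk k < q" if "k < q" for k using pk that by blast
  have srt: "key (pk a) \<le> key (pk b)" if "a < b" "b < q" for a b
    using sorted that by (auto simp: sorted_wrt_iff_nth_less pk_def)
  let ?B = "Upd 21 (Arr 1 (Var 20)) ;;
        HIf (Var 20)
          (Upd 22 (Arr 1 (Bin Sub (Var 20) (Cst 1))) ;; HIf d (Upd 23 (plus1 (Var 23))) HSkip)
          (Upd 23 (Cst 1)) ;;
        Put 6 (Bin Add (Var 8) (Var 21)) (Var 23)"
  let ?I = "\<lambda>k s'. ninv key pk k (rg s' 23) (\<lambda>i. ar s' 6 (off + i)) \<and> (\<forall>i<off. ar s' 6 i = ar s 6 i)"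
  show ?thesis unfolding naming_def
  proof (rule runs_Upd_HSeq)
    let ?s = "upd s 23 (hev s (Cst 0))"
    show "runs L (For 20 (Var 5) ?B) ?s ((q + 1) * (70 + hcost d))
      (\<lambda>s'. names key q (\<lambda>i. ar s' 6 (off + i)) \<and> (\<forall>i<off. ar s' 6 i = ar s 6 i))"
    proof (rule runs_For[where n = q and c = "62 + hcost d" and I = ?I])
      fix k s' assume k: "k < q" "rg s' 20 = k" and I: "?I k s'" and f: "frm (For 20 (Var 5) ?B) ?s s'"
      have fr: "rg s' r = rg s r" if "r \<notin> {20,21,22,23}" for r using f that by (simp add: frm_def)
      have fa: "ar s' a = ar s a" if "a \<noteq> 6" for a using f that by (simp add: frm_def)
      have A: "ar s' 1 = pk" "rg s' 5 = q" "rg s' 8 = off" using fr fa q by (simp_all add: pk_def)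
      let ?c = "nstep key pk k (rg s' 23)"
      have c: "rg s' 23 \<le> k" using I by (simp add: ninv_def)
      have 1: "hok L (s'\<lparr>rg := (rg s')(21 := pk k, 22 := pk (k - 1))\<rparr>) d \<and>
         (hev (s'\<lparr>rg := (rg s')(21 := pk k, 22 := pk (k - 1))\<rparr>) d \<noteq> 0 \<longleftrightarrow> key (pk k) \<noteq> key (pk (k - 1)))"
        if "0 < k"
        using d[of "s'\<lparr>rg := (rg s')(21 := pk k, 22 := pk (k - 1))\<rparr>"] pkq[of k] pkq[of "k - 1"] k that fr fa by auto
      have "runs L ?B s' (62 + hcost d) (\<lambda>s''. rg s'' 23 = ?c \<and> ar s'' 6 = (ar s' 6)(off + pk k := ?c))"
        by (rule runs_wp) (use A k L c pkq[OF k(1)] pkq[of "k - 1"] 1 in \<open>auto simp: nstep_def\<close>)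
      then show "runs L ?B s' (62 + hcost d) (\<lambda>s''. ?I (Suc k) (upd s'' 20 (Suc k)))"
      proof (rule runs_mono)
        fix s'' :: hst assume s'': "rg s'' 23 = ?c \<and> ar s'' 6 = (ar s' 6)(off + pk k := ?c)"
        have "ninv key pk (Suc k) ?c (\<lambda>i. ar s'' 6 (off + i))"
        proof (rule ninv_step[where q = q])
          fix a assume "a < k"
          then have "pk a \<noteq> pk k" using inj_onD[OF inj, of a k] k by auto
          then show "ar s'' 6 (off + pk a) = ar s' 6 (off + pk a)" using s'' by simp
        qed (use I k inj srt s'' in auto)
        then show "?I (Suc k) (upd s'' 20 (Suc k))" using s'' I by simp
      qed simp
    next
      fix s' :: hst assume I: "?I q s'"
      have ex: "\<exists>a<q. i = pk a" if "i < q" for i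
      proof -
        have "i \<in> pk ` {..<q}" using that pk by simp
        then show ?thesis by auto
      qed
      have "1 \<le> ar s' 6 (off + i) \<and> ar s' 6 (off + i) \<le> q" if i: "i < q" for i
      proof -
        obtain a where "a < q" "i = pk a" using ex[OF i] by blast
        then have "1 \<le> ar s' 6 (off + i)" "ar s' 6 (off + i) \<le> rg s' 23" "rg s' 23 \<le> q"
          using I by (simp_all add: ninv_def)
        then show ?thesis by linarith
      qed
      moreover have "ar s' 6 (off + i) < ar s' 6 (off + j) \<longleftrightarrow> key i < key j" if "i < q" "j < q" for i j
        using ex[OF that(1)] ex[OF that(2)] I unfolding ninv_def by blast
      ultimately show "names key q (\<lambda>i. ar s' 6 (off + i)) \<and> (\<forall>i<off. ar s' 6 i = ar s 6 i)"
        using I unfolding names_def by blast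
    qed (use q L in \<open>auto simp: frm_def ninv_def\<close>)
  qed (use L in \<open>auto simp: algebra_simps\<close>)
qed

subsection \<open>Sorting the alphabet\<close>

definition digits :: hcmd where
  "digits =
     Upd 10 (Cst 0) ;;
     For 20 (Var 3)
       (Put 2 (Var 20) (Bin Mod (Arr 21 (Var 20)) (Var 6)) ;;
        Put 21 (Var 20) (Bin Div (Arr 21 (Var 20)) (Var 6)) ;;
        HIf (Arr 21 (Var 20)) (Upd 10 (Cst 1)) HSkip)"

text \<open>Radix sort in base \<open>M + 1\<close> from the least significant digit. It stops as
  soon as all quotients vanish, so the program need not know the exponent that bounds the alphabet;
  the exponent only affects the time.\<close>

definition rename_chars :: hcmd where
  "rename_chars =
     Upd 5 (Var 3) ;; Upd 6 (plus1 (Var 3)) ;; Upd 8 (Cst 0) ;; Upd 10 (Cst 1) ;;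
     For 20 (Var 3) (Put 1 (Var 20) (Var 20) ;; Put 21 (Var 20) (Arr 0 (Var 20))) ;;
     HWhile (Var 10) (digits ;; csort) ;;
     naming (neqe (Arr 0 (Var 21)) (Arr 0 (Var 22))) ;;
     For 20 (Var 3) (Put 5 (Var 20) (Arr 6 (Var 20))) ;;
     Put 5 (Var 3) (Cst 0) ;; Put 5 (plus1 (Var 3)) (Cst 0) ;; Put 5 (Bin Add (Var 3) (Cst 2)) (Cst 0)"

lemma mod_rename [simp]: "modr rename_chars = {5,6,8,10,20,21,22,23}" "moda rename_chars = {1,2,3,4,5,6,21}"
  by (auto simp: rename_chars_def digits_def)

lemma runs_digits:
  assumes "rg s 3 = M" "rg s 6 = M + 1" "M + 2 < L"
  shows "runs L digits s (80 * (M + 1)) (\<lambda>s'. (\<forall>i<M. ar s' 2 i = ar s 21 i mod (M + 1) \<and> ar s' 21 i = ar s 21 i div (M + 1)) \<and>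
    (if \<forall>i<M. ar s' 21 i = 0 then rg s' 10 = 0 else rg s' 10 = 1))"
  unfolding digits_def
proof (rule runs_Upd_HSeq)
  let ?B = "Put 2 (Var 20) (Bin Mod (Arr 21 (Var 20)) (Var 6)) ;;
        Put 21 (Var 20) (Bin Div (Arr 21 (Var 20)) (Var 6)) ;;
        HIf (Arr 21 (Var 20)) (Upd 10 (Cst 1)) HSkip"
  let ?I = "\<lambda>k s'. (\<forall>i<M. ar s' 21 i = (if i < k then ar s 21 i div (M + 1) else ar s 21 i)) \<and>
     (\<forall>i<k. ar s' 2 i = ar s 21 i mod (M + 1)) \<and> (if \<forall>i<k. ar s' 21 i = 0 then rg s' 10 = 0 else rg s' 10 = 1)"
  let ?s = "upd s 10 (hev s (Cst 0))"
  show "runs L (For 20 (Var 3) ?B) ?s (70 * (M + 1)) (\<lambda>s'. (\<forall>i<M. ar s' 2 i = ar s 21 i mod (M + 1) \<and> ar s' 21 i = ar s 21 i div (M + 1)) \<and>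
    (if \<forall>i<M. ar s' 21 i = 0 then rg s' 10 = 0 else rg s' 10 = 1))"
  proof (rule runs_For[where n = M and c = 58 and I = ?I])
    fix k s' assume k: "k < M" "rg s' 20 = k" and I: "?I k s'" and f: "frm (For 20 (Var 3) ?B) ?s s'"
    have A: "rg s' 3 = M" "rg s' 6 = M + 1" using f assms by (simp_all add: frm_def)
    have "runs L ?B s' 58 (\<lambda>s''. ar s'' 2 = (ar s' 2)(k := ar s 21 k mod (M + 1)) \<and> ar s'' 21 = (ar s' 21)(k := ar s 21 k div (M + 1)) \<and>
      rg s'' 10 = (if ar s 21 k div (M + 1) = 0 then rg s' 10 else 1))"
      by (rule runs_wp) (use A I k assms in auto)
    then show "runs L ?B s' 58 (\<lambda>s''. ?I (Suc k) (upd s'' 20 (Suc k)))"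
      by (rule runs_mono) (use I k in \<open>auto simp: less_Suc_eq split: if_splits\<close>)
  qed (use assms in \<open>auto simp: frm_def\<close>)
qed (use assms in auto)

lemma sorted_wrt_set_mono:
  "sorted_wrt P xs \<Longrightarrow> (\<And>x y. x \<in> set xs \<Longrightarrow> y \<in> set xs \<Longrightarrow> P x y \<Longrightarrow> Q x y) \<Longrightarrow> sorted_wrt Q xs"
  by (rule sorted_wrt_mono_rel)

text \<open>By stability the result is ordered by digit \<open>t\<close> and then by the lower
  digits, and this is the order of the remainders modulo \<open>b ^ Suc t\<close>, because such a
  remainder is \<open>b ^ t\<close> times the digit plus the lower part.\<close>

lemma sorts_to_mod:
  fixes Z :: "nat \<Rightarrow> nat"
  assumes st: "sorts_to f xs ys" and f: "\<And>x. x \<in> set xs \<Longrightarrow> f x = Z x div b ^ t mod b"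
    and srt: "sorted_wrt (\<lambda>x y. Z x mod b ^ t \<le> Z y mod b ^ t) xs" and b: "0 < b"
  shows "sorted_wrt (\<lambda>x y. Z x mod b ^ Suc t \<le> Z y mod b ^ Suc t) ys"
proof -
  have set: "set ys = set xs" using st by (metis sorts_to_def set_mset_mset)
  have "sorted_wrt (\<lambda>x y. f x < f y \<or> f x = f y \<and> Z x mod b ^ t \<le> Z y mod b ^ t) ys"
    using st srt by (auto simp: sorts_to_def)
  then show ?thesis
  proof (rule sorted_wrt_set_mono)
    fix x y assume xy: "x \<in> set ys" "y \<in> set ys" and *: "f x < f y \<or> f x = f y \<and> Z x mod b ^ t \<le> Z y mod b ^ t"
    have e: "Z x mod b ^ Suc t = b ^ t * f x + Z x mod b ^ t" if "x \<in> set ys" for x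
      using f that set mod_mult2_eq[of "Z x" "b ^ t" b] by (simp add: mult.commute)
    from * show "Z x mod b ^ Suc t \<le> Z y mod b ^ Suc t"
    proof
      assume "f x < f y"
      then have "b ^ t * f x + b ^ t \<le> b ^ t * f y" by (metis Suc_leI mult_Suc_right mult_le_mono2 add.commute)
      moreover have "Z x mod b ^ t < b ^ t" using b by simp
      ultimately show ?thesis unfolding e[OF xy(1)] e[OF xy(2)] by linarith
    next
      assume "f x = f y \<and> Z x mod b ^ t \<le> Z y mod b ^ t"
      then show ?thesis unfolding e[OF xy(1)] e[OF xy(2)] by simp
    qed
  qed
qed

lemma runs_rename_loop:
  assumes r: "rg s 3 = M" "rg s 5 = M" "rg s 6 = M + 1" "rg s 10 = 1" and L: "M + 3 < L"
    and Q: "\<And>i. i < M \<Longrightarrow> ar s 21 i = Z i" and P: "\<And>i. i < M \<Longrightarrow> ar s 1 i = i"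
    and D: "\<And>i. i < M \<Longrightarrow> Z i < (M + 1) ^ D"
  shows "runs L (HWhile (Var 10) (digits ;; csort)) s ((D + 1) * (450 * (M + 1)) + 2)
    (\<lambda>s'. set (lst s' 1 M) = {..<M} \<and> sorted_wrt (\<lambda>x y. Z x \<le> Z y) (lst s' 1 M))"
proof -
  let ?b = "M + 1"
  define c where "c = 450 * (M + 1)"
  \<comment> \<open>After \<open>t\<close> passes the order respects the \<open>t\<close> lowest
    digits and the quotients hold the rest. The alternative \<open>t = 0\<close> accounts for the
    first pass, which is made even if all characters are 0.\<close>
  let ?J = "\<lambda>t s'. (\<forall>i<M. ar s' 21 i = Z i div ?b ^ t) \<and> set (lst s' 1 M) = {..<M} \<and>
    sorted_wrt (\<lambda>x y. Z x mod ?b ^ t \<le> Z y mod ?b ^ t) (lst s' 1 M) \<and>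
    (if rg s' 10 = 0 then \<forall>i<M. Z i div ?b ^ t = 0 else t = 0 \<or> t < D)"
  show ?thesis
  proof (rule runs_HWhile[where I = ?J and \<Phi> = "\<lambda>t s'. if rg s' 10 = 0 then 2 else (D + 1 - t) * c + 2" and g = 0
        and u = "\<lambda>_ _. 80 * (M + 1) + 120 * (M + (M + 1) + 2)"])
    show "?J 0 s" using r Q P by (auto simp: lst_def intro: nth_equalityI)
    show "frm (digits ;; csort) s s" by (simp add: frm_def)
    show "(if rg s 10 = 0 then 2 else (D + 1 - 0) * c + 2) \<le> (D + 1) * (450 * (M + 1)) + 2"
      by (simp add: c_def)
    fix t s' assume J: "?J t s'" and f: "frm (digits ;; csort) s s'"
    have A: "rg s' 3 = M" "rg s' 5 = M" "rg s' 6 = M + 1" using f r by (simp_all add: frm_def digits_def)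
    have Pl: "ar s' 1 k < M" if "k < M" for k using J that by (auto simp: set_lst)
    have PL: "ar s' 1 k < L" if "k < M" for k using Pl[OF that] L by linarith
    show "hok L s' (Var 10)" by simp
    have step: "runs L (digits ;; csort) s' (80 * (M + 1) + 120 * (M + (M + 1) + 2)) (?J (Suc t))" if "rg s' 10 \<noteq> 0"
    proof (rule runs_HSeq[OF runs_digits])
      fix s1 assume f1: "frm digits s' s1" and
        1: "(\<forall>i<M. ar s1 2 i = ar s' 21 i mod (M + 1) \<and> ar s1 21 i = ar s' 21 i div (M + 1)) \<and>
          (if \<forall>i<M. ar s1 21 i = 0 then rg s1 10 = 0 else rg s1 10 = 1)"
      have A1: "rg s1 5 = M" "rg s1 6 = M + 1" "ar s1 1 = ar s' 1" using f1 A by (simp_all add: frm_def digits_def)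
      show "runs L csort s1 (120 * (M + (M + 1) + 2)) (?J (Suc t))"
      proof (rule runs_mono[OF runs_csort])
        fix s2 assume f2: "frm csort s1 s2" and 2: "sorts_to (ar s1 2) (lst s1 1 M) (lst s2 1 M)"
        have eq: "lst s1 1 M = lst s' 1 M" using A1 by (simp add: lst_def)
        have set: "set (lst s2 1 M) = {..<M}" using 2 J eq by (metis sorts_to_def set_mset_mset)
        have s2: "ar s2 21 = ar s1 21" "rg s2 10 = rg s1 10" using f2 by (simp_all add: frm_def)
        have Z: "ar s1 21 i = Z i div ?b ^ Suc t" if "i < M" for i
          using 1 J that unfolding power_Suc2 div_mult2_eq by simp
        have "sorted_wrt (\<lambda>x y. Z x mod ?b ^ Suc t \<le> Z y mod ?b ^ Suc t) (lst s2 1 M)"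
          by (rule sorts_to_mod[OF 2[unfolded eq]]) (use J 1 in auto)
        moreover have "Suc t < D" if "rg s2 10 \<noteq> 0"
        proof (rule ccontr)
          assume "\<not> Suc t < D"
          then have "?b ^ D \<le> ?b ^ Suc t" by (intro power_increasing) auto
          then have "Z i div ?b ^ Suc t = 0" if "i < M" for i using D[OF that] by (intro div_less) linarith
          then show False using 1 Z that s2 by auto
        qed
        moreover have "\<forall>i<M. Z i div ?b ^ Suc t = 0" if "rg s2 10 = 0"
          using 1 Z that s2 by (auto split: if_splits)
        ultimately show "?J (Suc t) s2" using set s2 Z by auto
      qed (use A1 Pl PL 1 L in auto)
    qed (use A L in auto)
    {
      assume 0: "hev s' (Var 10) = 0"
      have md: "Z i mod ?b ^ t = Z i" if "i < M" for i
      proof -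
        have z: "Z i div ?b ^ t = 0" using J 0 that by simp
        show ?thesis using div_mult_mod_eq[of "Z i" "?b ^ t"] unfolding z by (simp only: mult_0 add_0_left)
      qed
      from J have srt: "sorted_wrt (\<lambda>x y. Z x mod ?b ^ t \<le> Z y mod ?b ^ t) (lst s' 1 M)"
        and st: "set (lst s' 1 M) = {..<M}" by blast+
      have "sorted_wrt (\<lambda>x y. Z x \<le> Z y) (lst s' 1 M)"
        by (rule sorted_wrt_set_mono[OF srt]) (simp only: st lessThan_iff md)
      then show "1 + hcost (Var 10) \<le> (if rg s' 10 = 0 then 2 else (D + 1 - t) * c + 2) \<and>
        set (lst s' 1 M) = {..<M} \<and> sorted_wrt (\<lambda>x y. Z x \<le> Z y) (lst s' 1 M)" using J 0 by simp
    }
    assume "hev s' (Var 10) \<noteq> 0"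
    then have ne: "rg s' 10 \<noteq> 0" by simp
    let ?u = "80 * (M + 1) + 120 * (M + (M + 1) + 2)"
    have tD: "t \<le> D" using J ne by auto
    have "2 + ?u \<le> c" by (simp add: c_def)
    moreover have "(D + 1 - t) * c = c + (D + 1 - Suc t) * c" using tD by (simp add: Suc_diff_le)
    ultimately have le: "2 + ?u + (if b then 2 else (D + 1 - Suc t) * c + 2) \<le> (D + 1 - t) * c + 2" for b
      by simp
    show "runs L (digits ;; csort) s' ?u (\<lambda>s''. \<exists>t'. ?J t' s'' \<and>
        1 + hcost (Var 10) + ?u + (if rg s'' 10 = 0 then 2 else (D + 1 - t') * c + 2) \<le>
        (if rg s' 10 = 0 then 2 else (D + 1 - t) * c + 2))"
    proof (rule runs_mono[OF step[OF ne]])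
      fix s'' assume J': "?J (Suc t) s''"
      have "1 + hcost (Var 10) + ?u + (if rg s'' 10 = 0 then 2 else (D + 1 - Suc t) * c + 2) \<le>
        (if rg s' 10 = 0 then 2 else (D + 1 - t) * c + 2)"
        using le[of "rg s'' 10 = 0"] ne by simp
      with J' show "\<exists>t'. ?J t' s'' \<and>
        1 + hcost (Var 10) + ?u + (if rg s'' 10 = 0 then 2 else (D + 1 - t') * c + 2) \<le>
        (if rg s' 10 = 0 then 2 else (D + 1 - t) * c + 2)"
        by (intro exI[of _ "Suc t"] conjI[of "?J (Suc t) s''"])
    qed simp
  qed
qed

lemma runs_rename:
  assumes M: "rg s 3 = M" and L: "M + 10 < L" and D: "\<And>i. i < M \<Longrightarrow> ar s 0 i < (M + 1) ^ D"
  shows "runs L rename_chars s ((D + 2) * (700 * (M + 1)))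
    (\<lambda>s'. names (ar s 0) M (ar s' 5) \<and> ar s' 5 M = 0 \<and> ar s' 5 (M + 1) = 0 \<and> ar s' 5 (M + 2) = 0)"
proof -
  let ?s = "s\<lparr>rg := (rg s)(5 := M, 6 := M + 1, 8 := 0, 10 := 1)\<rparr>"
  let ?P1 = "For 20 (Var 3) (Put 1 (Var 20) (Var 20) ;; Put 21 (Var 20) (Arr 0 (Var 20)))"
  let ?P2 = "HWhile (Var 10) (digits ;; csort)"
  let ?P3 = "naming (neqe (Arr 0 (Var 21)) (Arr 0 (Var 22)))"
  let ?P4 = "For 20 (Var 3) (Put 5 (Var 20) (Arr 6 (Var 20)))"
  let ?P5 = "Put 5 (Var 3) (Cst 0) ;; Put 5 (plus1 (Var 3)) (Cst 0) ;; Put 5 (Bin Add (Var 3) (Cst 2)) (Cst 0)"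
  let ?Q = "\<lambda>s'. names (ar s 0) M (ar s' 5) \<and> ar s' 5 M = 0 \<and> ar s' 5 (M + 1) = 0 \<and> ar s' 5 (M + 2) = 0"
  have "runs L (?P1 ;; ?P2 ;; ?P3 ;; ?P4 ;; ?P5) ?s (40 * (M + 1) + ((D + 1) * (450 * (M + 1)) + 2 + ((M + 2) * 95 + (21 * (M + 1) + 30)))) ?Q"
  proof (rule runs_HSeq)
    show "runs L ?P1 ?s (40 * (M + 1)) (\<lambda>s'. \<forall>i<M. ar s' 1 i = i \<and> ar s' 21 i = ar s 0 i)"
      by (rule runs_For[where n = M and c = 30 and I = "\<lambda>k s'. \<forall>i<k. ar s' 1 i = i \<and> ar s' 21 i = ar s 0 i"])
        (use M L in \<open>auto simp: frm_def less_Suc_eq intro!: runs_wp\<close>)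
    fix s1 assume f1: "frm ?P1 ?s s1" and 1: "\<forall>i<M. ar s1 1 i = i \<and> ar s1 21 i = ar s 0 i"
    have A1: "rg s1 3 = M" "rg s1 5 = M" "rg s1 6 = M + 1" "rg s1 8 = 0" "rg s1 10 = 1" "ar s1 0 = ar s 0"
      using f1 M by (simp_all add: frm_def)
    show "runs L (?P2 ;; ?P3 ;; ?P4 ;; ?P5) s1 ((D + 1) * (450 * (M + 1)) + 2 + ((M + 2) * 95 + (21 * (M + 1) + 30))) ?Q"
    proof (rule runs_HSeq[OF runs_rename_loop[where M = M and D = D and Z = "ar s 0"]])
      fix s2 assume f2: "frm ?P2 s1 s2"
        and 2: "set (lst s2 1 M) = {..<M} \<and> sorted_wrt (\<lambda>x y. ar s 0 x \<le> ar s 0 y) (lst s2 1 M)"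
      have A2: "rg s2 3 = M" "rg s2 5 = M" "rg s2 8 = 0" "ar s2 0 = ar s 0"
        using f2 A1 by (simp_all add: frm_def digits_def)
      show "runs L (?P3 ;; ?P4 ;; ?P5) s2 ((M + 2) * 95 + (21 * (M + 1) + 30)) ?Q"
      proof (rule runs_HSeq)
        show "runs L ?P3 s2 ((M + 2) * 95) (\<lambda>s'. names (ar s 0) M (ar s' 6))"
        proof (rule runs_mono[OF runs_naming[where q = M and off = 0 and key = "ar s 0"]])
          fix s' :: hst assume "\<And>r. r \<notin> {20, 21, 22, 23} \<Longrightarrow> rg s' r = rg s2 r"
            and a: "\<And>a. a \<noteq> 6 \<Longrightarrow> ar s' a = ar s2 a" and "rg s' 21 < M" "rg s' 22 < M"
          moreover have "ar s' 0 = ar s 0" using a[of 0] A2 by simp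
          ultimately show "hok L s' (neqe (Arr 0 (Var 21)) (Arr 0 (Var 22))) \<and>
            (hev s' (neqe (Arr 0 (Var 21)) (Arr 0 (Var 22))) \<noteq> 0 \<longleftrightarrow> ar s 0 (rg s' 21) \<noteq> ar s 0 (rg s' 22))"
            using L by auto
        qed (use A2 2 L in auto)
        fix s3 assume f3: "frm ?P3 s2 s3" and 3: "names (ar s 0) M (ar s3 6)"
        have A3: "rg s3 3 = M" using f3 A2 by (simp add: frm_def)
        show "runs L (?P4 ;; ?P5) s3 (21 * (M + 1) + 30) ?Q"
        proof (rule runs_HSeq)
          show "runs L ?P4 s3 (21 * (M + 1)) (\<lambda>s'. \<forall>i<M. ar s' 5 i = ar s3 6 i)"
            by (rule runs_For[where n = M and c = 12 and I = "\<lambda>k s'. \<forall>i<k. ar s' 5 i = ar s3 6 i"])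
              (use A3 L in \<open>auto simp: frm_def less_Suc_eq intro!: runs_wp\<close>)
          fix s4 assume f4: "frm ?P4 s3 s4" and 4: "\<forall>i<M. ar s4 5 i = ar s3 6 i"
          have A4: "rg s4 3 = M" using f4 A3 by (simp add: frm_def)
          show "runs L ?P5 s4 30 ?Q"
            by (rule runs_wp) (use A4 L 3 4 in \<open>auto simp: names_def\<close>)
        qed simp
      qed simp
    qed (use A1 1 L D in auto)
  qed simp
  then show ?thesis
    unfolding rename_chars_def using M L
    by (intro runs_Upd_HSeq[OF _ _ order_refl, THEN runs_mono]) (auto simp: algebra_simps)
qed

subsection \<open>Descending through the levels\<close>

lemma runs_wp_HSeq:
  assumes "wp L P (\<lambda>s'. runs L Q s' t2 R) s" "tb P + t2 \<le> t"
  shows "runs L (P ;; Q) s t R"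
  by (rule runs_HSeq[OF runs_wp[OF assms(1) order_refl] _ assms(2)]) simp

definition radix_pass :: "nat \<Rightarrow> hcmd" where
  "radix_pass d = For 20 (Var 7) (Put 2 (Var 20) (Arr 5 (Bin Add (Var 20) (Cst d)))) ;; csort"

lemma mod_radix_pass [simp]: "modr (radix_pass d) = {20,21,22}" "moda (radix_pass d) = {1,2,3,4}"
  by (auto simp: radix_pass_def)

lemma set_sorts_to: "sorts_to f xs ys \<Longrightarrow> set ys = set xs"
  by (metis sorts_to_def set_mset_mset)

text \<open>\<open>Q\<close> is the order left by the previous passes. Chaining the offsets 2, 1 and
  0 yields the lexicographic order of triples.\<close>

lemma runs_radix_pass:
  assumes r: "rg s 7 = m" "rg s 5 = m" "rg s 6 = B" and T: "\<And>i. i < m \<Longrightarrow> ar s 5 (i + d) = T (i + d) \<and> T (i + d) < B"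
    and P: "set (lst s 1 m) = {..<m}" "sorted_wrt Q (lst s 1 m)" and L: "m + d + 2 < L" "B + 1 < L"
  shows "runs L (radix_pass d) s (180 * (m + B + 2)) (\<lambda>s'. set (lst s' 1 m) = {..<m} \<and>
    sorted_wrt (\<lambda>x y. T (x + d) < T (y + d) \<or> T (x + d) = T (y + d) \<and> Q x y) (lst s' 1 m))"
  unfolding radix_pass_def
proof (rule runs_HSeq)
  let ?P = "For 20 (Var 7) (Put 2 (Var 20) (Arr 5 (Bin Add (Var 20) (Cst d))))"
  show "runs L ?P s (25 * (m + 1)) (\<lambda>s'. \<forall>i<m. ar s' 2 i = T (i + d))"
    by (rule runs_For[where n = m and c = 15 and I = "\<lambda>k s'. \<forall>i<k. ar s' 2 i = T (i + d)"])
      (use r T L in \<open>auto simp: frm_def less_Suc_eq intro!: runs_wp\<close>)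
  fix s1 assume f: "frm ?P s s1" and 1: "\<forall>i<m. ar s1 2 i = T (i + d)"
  have A: "rg s1 5 = m" "rg s1 6 = B" "ar s1 1 = ar s 1" using f r by (simp_all add: frm_def)
  have eq: "lst s1 1 m = lst s 1 m" using A by (simp add: lst_def)
  have Pm: "ar s 1 k < m" if "k < m" for k using P that by (auto simp: set_lst)
  then have PL: "ar s 1 k < L" if "k < m" for k using that L by (meson add_lessD1 less_trans)
  show "runs L csort s1 (120 * (m + B + 2)) (\<lambda>s'. set (lst s' 1 m) = {..<m} \<and>
    sorted_wrt (\<lambda>x y. T (x + d) < T (y + d) \<or> T (x + d) = T (y + d) \<and> Q x y) (lst s' 1 m))"
  proof (rule runs_mono[OF runs_csort[where q = m and B = B]])
    fix s' assume 2: "sorts_to (ar s1 2) (lst s1 1 m) (lst s' 1 m)"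
    have st: "set (lst s' 1 m) = {..<m}" using set_sorts_to[OF 2] eq P by simp
    have "sorted_wrt (\<lambda>x y. ar s1 2 x < ar s1 2 y \<or> ar s1 2 x = ar s1 2 y \<and> Q x y) (lst s' 1 m)"
      using 2 eq P(2) by (simp add: sorts_to_def)
    then have "sorted_wrt (\<lambda>x y. T (x + d) < T (y + d) \<or> T (x + d) = T (y + d) \<and> Q x y) (lst s' 1 m)"
      by (rule sorted_wrt_set_mono) (use 1 st in auto)
    with st show "set (lst s' 1 m) = {..<m} \<and>
      sorted_wrt (\<lambda>x y. T (x + d) < T (y + d) \<or> T (x + d) = T (y + d) \<and> Q x y) (lst s' 1 m)" by blast
  qed (use A Pm PL L 1 T in auto)
qed simp

definition triples_differ :: hexp where
  "triples_differ = Bin Eq (Bin Mult (Bin Mult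
       (Bin Eq (Arr 5 (Var 21)) (Arr 5 (Var 22)))
       (Bin Eq (Arr 5 (Bin Add (Var 21) (Cst 1))) (Arr 5 (Bin Add (Var 22) (Cst 1)))))
       (Bin Eq (Arr 5 (Bin Add (Var 21) (Cst 2))) (Arr 5 (Bin Add (Var 22) (Cst 2))))) (Cst 0)"

definition name_triples :: hcmd where
  "name_triples =
     Upd 5 (Var 7) ;;
     For 20 (Var 7) (Put 1 (Var 20) (Var 20)) ;;
     radix_pass 2 ;; radix_pass 1 ;; radix_pass 0 ;; naming triples_differ"

lemma mod_name_triples [simp]: "modr name_triples = {5,20,21,22,23}" "moda name_triples = {1,2,3,4,6}"
  by (auto simp: name_triples_def)

lemma runs_name_triples:
  assumes r: "rg s 7 = m" "rg s 8 = off" "rg s 6 = B" and T: "\<And>i. i < m + 2 \<Longrightarrow> ar s 5 i = T i \<and> T i < B"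
    and L: "off + m + 10 < L" "B + 1 < L"
  shows "runs L name_triples s (800 * (m + B + 2))
    (\<lambda>s'. names (trip T) m (\<lambda>i. ar s' 6 (off + i)) \<and> (\<forall>i<off. ar s' 6 i = ar s 6 i))"
  unfolding name_triples_def
proof (rule runs_Upd_HSeq)
  let ?t = "180 * (m + B + 2)"
  let ?s = "upd s 5 (hev s (Var 7))"
  let ?P1 = "For 20 (Var 7) (Put 1 (Var 20) (Var 20))"
  let ?Q0 = "\<lambda>x y. True"
  let ?Q1 = "\<lambda>x y. T (x + 2) < T (y + 2) \<or> T (x + 2) = T (y + 2) \<and> ?Q0 x y"
  let ?Q2 = "\<lambda>x y. T (x + 1) < T (y + 1) \<or> T (x + 1) = T (y + 1) \<and> ?Q1 x y"
  let ?Q3 = "\<lambda>x y. T (x + 0) < T (y + 0) \<or> T (x + 0) = T (y + 0) \<and> ?Q2 x y"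
  let ?R = "\<lambda>s'. names (trip T) m (\<lambda>i. ar s' 6 (off + i)) \<and> (\<forall>i<off. ar s' 6 i = ar s 6 i)"
  show "runs L (?P1 ;; radix_pass 2 ;; radix_pass 1 ;; radix_pass 0 ;; naming triples_differ) ?s
     (15 * (m + 1) + (?t + (?t + (?t + (m + 2) * 140)))) ?R"
  proof (rule runs_HSeq)
    show "runs L ?P1 ?s (15 * (m + 1)) (\<lambda>s'. \<forall>i<m. ar s' 1 i = i)"
      by (rule runs_For[where n = m and c = 7 and I = "\<lambda>k s'. \<forall>i<k. ar s' 1 i = i"])
        (use r L in \<open>auto simp: frm_def less_Suc_eq intro!: runs_wp\<close>)
    fix s1 assume f1: "frm ?P1 ?s s1" and 1: "\<forall>i<m. ar s1 1 i = i"
    let ?A = "\<lambda>s'. rg s' 7 = m \<and> rg s' 5 = m \<and> rg s' 6 = B \<and> rg s' 8 = off \<and> ar s' 5 = ar s 5 \<and> ar s' 6 = ar s 6"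
    have A1: "?A s1" using f1 r by (simp add: frm_def)
    have l1: "lst s1 1 m = [0..<m]" using 1 by (auto intro: nth_equalityI)
    show "runs L (radix_pass 2 ;; radix_pass 1 ;; radix_pass 0 ;; naming triples_differ) s1 (?t + (?t + (?t + (m + 2) * 140))) ?R"
    proof (rule runs_HSeq[OF runs_radix_pass[where T = T and Q = ?Q0]])
      show "set (lst s1 1 m) = {..<m}" unfolding l1 by auto
      show "sorted_wrt (\<lambda>x y. True) (lst s1 1 m)" by (simp add: sorted_wrt_iff_nth_less)
      fix s2 assume f2: "frm (radix_pass 2) s1 s2" and 2: "set (lst s2 1 m) = {..<m} \<and> sorted_wrt ?Q1 (lst s2 1 m)"
      have A2: "?A s2" using f2 A1 by (simp add: frm_def)
      show "runs L (radix_pass 1 ;; radix_pass 0 ;; naming triples_differ) s2 (?t + (?t + (m + 2) * 140)) ?R"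
      proof (rule runs_HSeq[OF runs_radix_pass[where T = T and Q = ?Q1]])
        fix s3 assume f3: "frm (radix_pass 1) s2 s3" and 3: "set (lst s3 1 m) = {..<m} \<and> sorted_wrt ?Q2 (lst s3 1 m)"
        have A3: "?A s3" using f3 A2 by (simp add: frm_def)
        show "runs L (radix_pass 0 ;; naming triples_differ) s3 (?t + (m + 2) * 140) ?R"
        proof (rule runs_HSeq[OF runs_radix_pass[where T = T and Q = ?Q2]])
          fix s4 assume f4: "frm (radix_pass 0) s3 s4" and 4: "set (lst s4 1 m) = {..<m} \<and> sorted_wrt ?Q3 (lst s4 1 m)"
          have A4: "?A s4" using f4 A3 by (simp add: frm_def)
          show "runs L (naming triples_differ) s4 ((m + 2) * 140) ?R"
          proof (rule runs_mono[OF runs_naming[where q = m and off = off and key = "trip T"]])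
            show "sorted_wrt (\<lambda>x y. trip T x \<le> trip T y) (lst s4 1 m)"
              by (rule sorted_wrt_set_mono[of ?Q3])
                (use 4 in \<open>auto simp: trip_def less_eq_prod_def le_less\<close>)
            fix s' :: hst assume a: "\<And>a. a \<noteq> 6 \<Longrightarrow> ar s' a = ar s4 a" and m: "rg s' 21 < m" "rg s' 22 < m"
            have "ar s' 5 = ar s 5" using a[of 5] A4 by simp
            then show "hok L s' triples_differ \<and> (hev s' triples_differ \<noteq> 0 \<longleftrightarrow> trip T (rg s' 21) \<noteq> trip T (rg s' 22))"
              using m T L by (auto simp: triples_differ_def trip_def)
          qed (use A4 4 L in \<open>auto simp: triples_differ_def\<close>)
        qed (use A3 3 L T in auto)
      qed (use A2 2 L T in auto)
    qed (use A1 L T in auto)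
  qed simp
qed (use L in auto)

text \<open>The reduced string overwrites the current one. On the way back up only the triple names
  of a level are needed, and these stay in array 6. The new key bound is \<open>m + 2\<close>
  because a raised name is at most \<open>m + 1\<close>.\<close>

definition next_level :: hcmd where
  "next_level =
     (Upd 11 (Bin Div (plus1 (Var 7)) (Cst 3)) ;; Upd 12 (Bin Div (Var 7) (Cst 3))) ;;
     For 20 (Var 11) (Put 5 (Var 20)
       (plus1 (Arr 6 (Bin Add (Var 8) (plus1 (Bin Mult (Cst 3) (Var 20))))))) ;;
     Put 5 (Var 11) (Cst 1) ;;
     For 20 (Var 12) (Put 5 (Bin Add (plus1 (Var 11)) (Var 20))
       (plus1 (Arr 6 (Bin Add (Var 8) (Bin Add (Bin Mult (Cst 3) (Var 20)) (Cst 2)))))) ;;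
     Upd 6 (Bin Add (Var 7) (Cst 2)) ;; Upd 8 (Bin Add (Var 8) (Var 7)) ;;
     Upd 7 (Bin Add (plus1 (Var 11)) (Var 12)) ;;
     Put 5 (Var 7) (Cst 0) ;; Put 5 (plus1 (Var 7)) (Cst 0) ;; Put 5 (Bin Add (Var 7) (Cst 2)) (Cst 0) ;;
     Upd 9 (plus1 (Var 9))"

lemma mod_next_level [simp]: "modr next_level = {6,7,8,9,11,12,20}" "moda next_level = {5}"
  by (auto simp: next_level_def)

lemma runs_next_level:
  assumes r: "rg s 7 = m" "rg s 8 = off" and N: "\<And>i. i < m \<Longrightarrow> ar s 6 (off + i) \<le> m"
    and L: "off + 2 * m + 10 < L" "rg s 9 + 1 < L" and m: "3 < m"
  shows "runs L next_level s (150 * (m + 1))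
    (\<lambda>s'. (\<forall>i<nextm m + 3. ar s' 5 i = nextT (\<lambda>i. ar s 6 (off + i)) m i) \<and>
       rg s' 6 = m + 2 \<and> rg s' 8 = off + m \<and> rg s' 7 = nextm m \<and> rg s' 9 = rg s 9 + 1)"
proof -
  let ?nm = "\<lambda>i. ar s 6 (off + i)"
  have n1: "n1 m \<le> m" using m by simp
  have n2: "n2 m \<le> m" by simp
  let ?s = "s\<lparr>rg := (rg s)(11 := n1 m, 12 := n2 m)\<rparr>"
  let ?P1 = "For 20 (Var 11) (Put 5 (Var 20)
       (plus1 (Arr 6 (Bin Add (Var 8) (plus1 (Bin Mult (Cst 3) (Var 20)))))))"
  let ?P2 = "Put 5 (Var 11) (Cst 1)"
  let ?P3 = "For 20 (Var 12) (Put 5 (Bin Add (plus1 (Var 11)) (Var 20))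
       (plus1 (Arr 6 (Bin Add (Var 8) (Bin Add (Bin Mult (Cst 3) (Var 20)) (Cst 2))))))"
  let ?P4 = "Upd 6 (Bin Add (Var 7) (Cst 2)) ;; Upd 8 (Bin Add (Var 8) (Var 7)) ;;
     Upd 7 (Bin Add (plus1 (Var 11)) (Var 12)) ;;
     Put 5 (Var 7) (Cst 0) ;; Put 5 (plus1 (Var 7)) (Cst 0) ;; Put 5 (Bin Add (Var 7) (Cst 2)) (Cst 0) ;;
     Upd 9 (plus1 (Var 9))"
  let ?Q = "\<lambda>s'. (\<forall>i<nextm m + 3. ar s' 5 i = nextT (\<lambda>i. ar s 6 (off + i)) m i) \<and>
       rg s' 6 = m + 2 \<and> rg s' 8 = off + m \<and> rg s' 7 = nextm m \<and> rg s' 9 = rg s 9 + 1"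
  let ?A = "\<lambda>s'. rg s' 7 = m \<and> rg s' 8 = off \<and> rg s' 9 = rg s 9 \<and> rg s' 11 = n1 m \<and> rg s' 12 = n2 m \<and> ar s' 6 = ar s 6"
  have "runs L (?P1 ;; ?P2 ;; ?P3 ;; ?P4) ?s (35 * (m + 1) + (10 + (40 * (m + 1) + 60))) ?Q"
  proof (rule runs_HSeq)
    show "runs L ?P1 ?s (35 * (m + 1)) (\<lambda>s'. \<forall>i<n1 m. ar s' 5 i = ?nm (3 * i + 1) + 1)"
    proof (rule runs_For[where n = "n1 m" and c = 22 and I = "\<lambda>k s'. \<forall>i<k. ar s' 5 i = ?nm (3 * i + 1) + 1"])
      fix i s' assume i: "i < n1 m" "rg s' 20 = i" and I: "\<forall>j<i. ar s' 5 j = ?nm (3 * j + 1) + 1" and f: "frm ?P1 ?s s'"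
      have A: "?A s'" using f r by (simp add: frm_def)
      have lt: "3 * i + 1 < m" using i less_n1 by blast
      show "runs L (Put 5 (Var 20) (plus1 (Arr 6 (Bin Add (Var 8) (plus1 (Bin Mult (Cst 3) (Var 20))))))) s' 22
        (\<lambda>s''. \<forall>j<Suc i. ar (upd s'' 20 (Suc i)) 5 j = ?nm (3 * j + 1) + 1)"
        by (rule runs_wp) (use A lt i I L N[OF lt] in \<open>auto simp: less_Suc_eq\<close>)
    next
      have "(n1 m + 1) * (22 + 7 + hcost (Var 11)) \<le> (m + 1) * (22 + 7 + hcost (Var 11))" using n1 by (intro mult_le_mono1) simp
      then show "(n1 m + 1) * (22 + 7 + hcost (Var 11)) \<le> 35 * (m + 1)" by simp
    qed (use r L n1 in \<open>auto simp: frm_def\<close>)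
    fix s1 assume f1: "frm ?P1 ?s s1" and 1: "\<forall>i<n1 m. ar s1 5 i = ?nm (3 * i + 1) + 1"
    have A1: "?A s1" using f1 r by (simp add: frm_def)
    show "runs L (?P2 ;; ?P3 ;; ?P4) s1 (10 + (40 * (m + 1) + 60)) ?Q"
    proof (rule runs_HSeq)
      show "runs L ?P2 s1 10 (\<lambda>s'. (\<forall>i<n1 m. ar s' 5 i = ?nm (3 * i + 1) + 1) \<and> ar s' 5 (n1 m) = 1)"
        by (rule runs_wp) (use A1 1 L n1 in auto)
      fix s2 assume f2: "frm ?P2 s1 s2" and 2: "(\<forall>i<n1 m. ar s2 5 i = ?nm (3 * i + 1) + 1) \<and> ar s2 5 (n1 m) = 1"
      have A2: "?A s2" using f2 A1 by (simp add: frm_def)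
      let ?I = "\<lambda>k s'. (\<forall>i<n1 m. ar s' 5 i = ?nm (3 * i + 1) + 1) \<and> ar s' 5 (n1 m) = 1 \<and>
          (\<forall>i<k. ar s' 5 (n1 m + 1 + i) = ?nm (3 * i + 2) + 1)"
      show "runs L (?P3 ;; ?P4) s2 (40 * (m + 1) + 60) ?Q"
      proof (rule runs_HSeq)
        show "runs L ?P3 s2 (40 * (m + 1)) (?I (n2 m))"
        proof (rule runs_For[where n = "n2 m" and c = 28 and I = ?I])
          fix i s' assume i: "i < n2 m" "rg s' 20 = i" and I: "?I i s'" and f: "frm ?P3 s2 s'"
          have A: "?A s'" using f A2 by (simp add: frm_def)
          have lt: "3 * i + 2 < m" using i less_n2 by blast
          show "runs L (Put 5 (Bin Add (plus1 (Var 11)) (Var 20))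
              (plus1 (Arr 6 (Bin Add (Var 8) (Bin Add (Bin Mult (Cst 3) (Var 20)) (Cst 2)))))) s' 28
            (\<lambda>s''. ?I (Suc i) (upd s'' 20 (Suc i)))"
            by (rule runs_wp) (use A lt i I L N[OF lt] n1 in \<open>auto simp: less_Suc_eq\<close>)
        next
          have "(n2 m + 1) * (28 + 7 + hcost (Var 12)) \<le> (m + 1) * (28 + 7 + hcost (Var 12))" using n2 by (intro mult_le_mono1) simp
          then show "(n2 m + 1) * (28 + 7 + hcost (Var 12)) \<le> 40 * (m + 1)" by simp
        qed (use 2 A2 r L n2 in \<open>auto simp: frm_def\<close>)
        fix s3 assume f3: "frm ?P3 s2 s3" and 3: "?I (n2 m) s3"
        have A3: "?A s3" using f3 A2 by (simp add: frm_def)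
        have T: "ar s3 5 i = nextT ?nm m i" if "i < nextm m" for i
        proof (cases i "n1 m" rule: linorder_cases)
          case greater
          then obtain j where j: "i = n1 m + 1 + j" by (metis Suc_eq_plus1 less_iff_Suc_add add_Suc add_Suc_shift)
          then have "j < n2 m" using that by (simp add: nextm_def)
          then show ?thesis using 3 that unfolding j by (simp add: nextT_def nextm_def)
        qed (use 3 in \<open>auto simp: nextT_def\<close>)
        have n: "nextm m = n1 m + 1 + n2 m" "nextm m \<le> m" using nextm_less[OF m] by (auto simp: nextm_def)
        have T0: "nextT ?nm m i = 0" if "nextm m \<le> i" for i using wf_nextT that by (auto simp: wf_str_def)
        have "wp L ?P4 (\<lambda>s'. ar s' 5 = (ar s3 5)(nextm m := 0, nextm m + 1 := 0, nextm m + 2 := 0) \<and>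
          rg s' 6 = m + 2 \<and> rg s' 8 = off + m \<and> rg s' 7 = nextm m \<and> rg s' 9 = rg s 9 + 1) s3"
          using A3 L n by auto
        then have "runs L ?P4 s3 60 (\<lambda>s'. ar s' 5 = (ar s3 5)(nextm m := 0, nextm m + 1 := 0, nextm m + 2 := 0) \<and>
          rg s' 6 = m + 2 \<and> rg s' 8 = off + m \<and> rg s' 7 = nextm m \<and> rg s' 9 = rg s 9 + 1)"
          by (rule runs_wp) simp
        then show "runs L ?P4 s3 60 ?Q"
        proof (rule runs_mono)
          fix s' assume *: "ar s' 5 = (ar s3 5)(nextm m := 0, nextm m + 1 := 0, nextm m + 2 := 0) \<and>
            rg s' 6 = m + 2 \<and> rg s' 8 = off + m \<and> rg s' 7 = nextm m \<and> rg s' 9 = rg s 9 + 1"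
          have "ar s' 5 i = nextT ?nm m i" if "i < nextm m + 3" for i
          proof (cases "i < nextm m")
            case True
            then show ?thesis using * T by simp
          next
            case False
            then have "i = nextm m \<or> i = nextm m + 1 \<or> i = nextm m + 2" using that by linarith
            then show ?thesis using * T0[of i] False by auto
          qed
          with * show "?Q s'" by simp
        qed simp
      qed simp
    qed simp
  qed simp
  then have "runs L (?P1 ;; ?P2 ;; ?P3 ;; ?P4) ?s (150 * (m + 1) - 12) ?Q" by (rule runs_mono) (use m in auto)
  then show ?thesis
    unfolding next_level_def using r L m
    by (intro runs_wp_HSeq[where ?t2.0 = "150 * (m + 1) - 12"]) auto
qed

section \<open>The levels of the recursion\<close>

fun lvl_length :: "nat \<Rightarrow> nat \<Rightarrow> nat" where
  "lvl_length M 0 = M"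
| "lvl_length M (Suc l) = nextm (lvl_length M l)"

definition lvl_offset :: "nat \<Rightarrow> nat \<Rightarrow> nat" where
  "lvl_offset M l = (\<Sum>i<l. lvl_length M i)"

lemma lvl_offset_Suc [simp]: "lvl_offset M 0 = 0" "lvl_offset M (Suc l) = lvl_offset M l + lvl_length M l"
  by (simp_all add: lvl_offset_def)

text \<open>Six times the current length is a potential that pays for the length of each level by
  \<open>nextm_less\<close>. The second bound holds because every level is shorter than the one
  before.\<close>

lemma lvl_offset_bound:
  assumes "\<And>i. i < l \<Longrightarrow> 3 < lvl_length M i"
  shows "lvl_offset M l + 6 * lvl_length M l \<le> 6 * M" "lvl_length M l + l \<le> M"
  using assms
proof (induction l)
  case (Suc l)
  {
    case 1
    then show ?case using Suc.IH(1) nextm_less[of "lvl_length M l"] by fastforce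
  next
    case 2
    then show ?case using Suc.IH(2) nextm_less[of "lvl_length M l"] by fastforce
  }
qed auto

text \<open>The strings \<open>Ts l\<close> exist only in the proof, since array 5 is overwritten at
  each level; the definition ties them to the names \<open>N\<close> that are kept.\<close>

definition levels :: "nat \<Rightarrow> (nat \<Rightarrow> nat) \<Rightarrow> (nat \<Rightarrow> nat \<Rightarrow> nat) \<Rightarrow> (nat \<Rightarrow> nat) \<Rightarrow> nat \<Rightarrow> bool" where
  "levels M T0 Ts N n \<longleftrightarrow> Ts 0 = T0 \<and> (\<forall>l<n. wf_str (Ts l) (lvl_length M l) \<and>
     names (trip (Ts l)) (lvl_length M l) (\<lambda>i. N (lvl_offset M l + i)) \<and>
     (3 < lvl_length M l \<longrightarrow> Ts (Suc l) = nextT (\<lambda>i. N (lvl_offset M l + i)) (lvl_length M l)))"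

definition down_body :: hcmd where
  "down_body = name_triples ;; Put 7 (Var 9) (Var 8) ;; Put 8 (Var 9) (Var 7) ;;
     HIf (Bin Less (Cst 3) (Var 7)) next_level (Upd 10 (Cst 0))"

definition down :: hcmd where
  "down = (Upd 7 (Var 3) ;; Upd 8 (Cst 0) ;; Upd 9 (Cst 0) ;; Upd 6 (plus1 (Var 3)) ;; Upd 10 (Cst 1)) ;;
     HWhile (Var 10) down_body"

lemma mod_down [simp]: "modr down = {5,6,7,8,9,10,11,12,20,21,22,23}" "moda down = {1,2,3,4,5,6,7,8}"
  by (auto simp: down_def down_body_def)

text \<open>Deeper levels write their names behind the earlier ones; the string derived from a level
  depends only on the names inside its own stretch and is therefore unaffected.\<close>

lemma nextT_cong: "(\<And>i. i < m \<Longrightarrow> f i = g i) \<Longrightarrow> nextT f m = nextT g m"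
proof
  fix j assume eq: "\<And>i. i < m \<Longrightarrow> f i = g i"
  have "j < n1 m \<Longrightarrow> f (3 * j + 1) = g (3 * j + 1)" using eq less_n1 by blast
  moreover have "j - n1 m - 1 < n2 m \<Longrightarrow> f (3 * (j - n1 m - 1) + 2) = g (3 * (j - n1 m - 1) + 2)"
    using eq less_n2 by blast
  moreover have "\<not> j < n1 m \<Longrightarrow> j \<noteq> n1 m \<Longrightarrow> j < nextm m \<Longrightarrow> j - n1 m - 1 < n2 m"
    by (simp add: nextm_def)
  ultimately show "nextT f m j = nextT g m j" unfolding nextT_def by (cases "j < n1 m"; cases "j = n1 m"; cases "j < nextm m") simp_all
qed

lemma nextT_le:
  assumes "\<And>i. i < m \<Longrightarrow> f i \<le> m"
  shows "nextT f m j \<le> m + 1"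
proof -
  have "j < n1 m \<Longrightarrow> f (3 * j + 1) \<le> m" using assms less_n1 by blast
  moreover have "j - n1 m - 1 < n2 m \<Longrightarrow> f (3 * (j - n1 m - 1) + 2) \<le> m"
    using assms less_n2 by blast
  moreover have "\<not> j < n1 m \<Longrightarrow> j \<noteq> n1 m \<Longrightarrow> j < nextm m \<Longrightarrow> j - n1 m - 1 < n2 m"
    by (simp add: nextm_def)
  ultimately show ?thesis unfolding nextT_def by simp
qed

lemma runs_down:
  assumes r: "rg s 3 = M" and wf: "wf_str T0 M" and T: "\<And>i. i < M + 3 \<Longrightarrow> ar s 5 i = T0 i" "\<And>i. T0 i \<le> M"
    and L: "7 * M + 20 < L"
  shows "runs L down s (31000 * (M + 2))
    (\<lambda>s'. \<exists>Ts Lv. levels M T0 Ts (ar s' 6) (Suc Lv) \<and> (\<forall>l<Lv. 3 < lvl_length M l) \<and> lvl_length M Lv \<le> 3 \<and>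
       (\<forall>l\<le>Lv. ar s' 7 l = lvl_offset M l \<and> ar s' 8 l = lvl_length M l) \<and>
       rg s' 9 = Lv \<and> rg s' 8 = lvl_offset M Lv \<and> rg s' 7 = lvl_length M Lv)"
proof -
  let ?E = "\<lambda>s'. \<exists>Ts Lv. levels M T0 Ts (ar s' 6) (Suc Lv) \<and> (\<forall>l<Lv. 3 < lvl_length M l) \<and> lvl_length M Lv \<le> 3 \<and>
       (\<forall>l\<le>Lv. ar s' 7 l = lvl_offset M l \<and> ar s' 8 l = lvl_length M l) \<and>
       rg s' 9 = Lv \<and> rg s' 8 = lvl_offset M Lv \<and> rg s' 7 = lvl_length M Lv"
  let ?s = "s\<lparr>rg := (rg s)(7 := M, 8 := 0, 9 := 0, 6 := M + 1, 10 := 1)\<rparr>"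
  let ?u = "\<lambda>s'. 1000 * (rg s' 7 + rg s' 6 + 3)"
  \<comment> \<open>A level of length \<open>m\<close> with key bound \<open>B\<close> costs at most
    \<open>1000 * (m + B + 3)\<close>, and the next key bound is \<open>m + 2\<close>. The weight 30
    pays for this, as \<open>30 * (m - nextm m) \<ge> 5 * m\<close> by
    \<open>nextm_less\<close>.\<close>
  define \<Phi> where "\<Phi> s' = (if rg s' 10 = 0 then 2 else 1000 * (30 * rg s' 7 + rg s' 6 + 4) + 2)" for s' :: hst
  define J0 where "J0 Ts lev s' \<longleftrightarrow> levels M T0 Ts (ar s' 6) lev \<and> (\<forall>l<lev. 3 < lvl_length M l) \<and>
    (\<forall>l<lev. ar s' 7 l = lvl_offset M l \<and> ar s' 8 l = lvl_length M l) \<and> rg s' 9 = lev \<and> rg s' 8 = lvl_offset M lev \<and> rg s' 7 = lvl_length M lev \<and>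
    wf_str (Ts lev) (lvl_length M lev) \<and> (\<forall>i<lvl_length M lev + 3. ar s' 5 i = Ts lev i \<and> Ts lev i < rg s' 6) \<and> rg s' 6 \<le> M + 2" for Ts lev and s' :: hst
  define J where "J Ts s' \<longleftrightarrow> (if rg s' 10 = 0 then ?E s' else J0 Ts (rg s' 9) s')" for Ts and s' :: hst
  have step: "runs L down_body s' (?u s') (\<lambda>s''. \<exists>Ts'. J Ts' s'' \<and> 2 + ?u s' + \<Phi> s'' \<le> \<Phi> s')"
    if J0: "J0 Ts lev s'" and fl: "rg s' 10 \<noteq> 0" for Ts lev and s' :: hst
  proof -
    define m off B where "m = lvl_length M lev" and "off = lvl_offset M lev" and "B = rg s' 6"
    have A: "rg s' 7 = m" "rg s' 8 = off" "rg s' 6 = B" "rg s' 9 = lev" "B \<le> M + 2"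
      and lev: "\<And>l. l < lev \<Longrightarrow> 3 < lvl_length M l" and wfm: "wf_str (Ts lev) m"
      and lv: "levels M T0 Ts (ar s' 6) lev" and LO: "\<And>l. l < lev \<Longrightarrow> ar s' 7 l = lvl_offset M l \<and> ar s' 8 l = lvl_length M l"
      and T5: "\<And>i. i < m + 3 \<Longrightarrow> ar s' 5 i = Ts lev i \<and> Ts lev i < B"
      using J0 by (auto simp: J0_def m_def off_def B_def)
    have bnd: "off + 6 * m \<le> 6 * M" "m + lev \<le> M" using lvl_offset_bound[OF lev] by (auto simp: m_def off_def)
    have u: "?u s' = 1000 * (m + B + 3)" "\<Phi> s' = 1000 * (30 * m + B + 4) + 2" using A fl by (simp_all add: \<Phi>_def)
    show ?thesis unfolding down_body_def
    proof (rule runs_HSeq[OF runs_name_triples[where T = "Ts lev" and m = m and B = B and off = off]])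
      fix s1 assume f1: "frm name_triples s' s1"
        and 1: "names (trip (Ts lev)) m (\<lambda>i. ar s1 6 (off + i)) \<and> (\<forall>i<off. ar s1 6 i = ar s' 6 i)"
      have A1: "rg s1 7 = m" "rg s1 8 = off" "rg s1 9 = lev" "rg s1 10 = rg s' 10" "ar s1 7 = ar s' 7" "ar s1 8 = ar s' 8"
        using f1 A by (simp_all add: frm_def)
      have N1: "ar s1 6 (off + i) \<le> m" if "i < m" for i using 1 that by (simp add: names_def)
      let ?nm = "\<lambda>i. ar s1 6 (off + i)"
      define Ts' where "Ts' = Ts(Suc lev := nextT ?nm m)"
      have mono: "lvl_offset M l + lvl_length M l \<le> off" if "l < lev" for l
      proof -
        have "lvl_offset M (Suc l) \<le> lvl_offset M lev" unfolding lvl_offset_def by (rule sum_mono2) (use that in auto)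
        then show ?thesis by (simp add: off_def)
      qed
      have lv': "levels M T0 Ts' (ar s1 6) (Suc lev)"
        unfolding levels_def
      proof (intro conjI allI impI)
        show "Ts' 0 = T0" using lv by (simp add: levels_def Ts'_def)
        fix l assume l: "l < Suc lev"
        have old: "(\<lambda>i. ar s1 6 (lvl_offset M l + i)) i = (\<lambda>i. ar s' 6 (lvl_offset M l + i)) i" if "i < lvl_length M l" "l < lev" for i
          using 1 mono[OF that(2)] that(1) by simp
        show "wf_str (Ts' l) (lvl_length M l)" using lv l wfm by (auto simp: levels_def Ts'_def less_Suc_eq m_def)
        show "names (trip (Ts' l)) (lvl_length M l) (\<lambda>i. ar s1 6 (lvl_offset M l + i))"
        proof (cases "l < lev")
          case True
          then have "names (trip (Ts l)) (lvl_length M l) (\<lambda>i. ar s' 6 (lvl_offset M l + i))" using lv by (simp add: levels_def)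
          then show ?thesis using True old[OF _ True] by (simp add: names_def Ts'_def)
        next
          case False
          then show ?thesis using l 1 by (auto simp: less_Suc_eq m_def off_def Ts'_def)
        qed
        assume l3: "3 < lvl_length M l"
        show "Ts' (Suc l) = nextT (\<lambda>i. ar s1 6 (lvl_offset M l + i)) (lvl_length M l)"
        proof (cases "l < lev")
          case True
          then have "Ts' (Suc l) = nextT (\<lambda>i. ar s' 6 (lvl_offset M l + i)) (lvl_length M l)" using lv l3 by (simp add: levels_def Ts'_def)
          also have "\<dots> = nextT (\<lambda>i. ar s1 6 (lvl_offset M l + i)) (lvl_length M l)"
            by (rule nextT_cong) (use old True in simp)
          finally show ?thesis .
        next
          case False
          then have "l = lev" using l by simp
          then show ?thesis by (simp add: Ts'_def m_def off_def)
        qed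
      qed
      let ?A2 = "\<lambda>s2. ar s2 6 = ar s1 6 \<and> (\<forall>l<Suc lev. ar s2 7 l = lvl_offset M l \<and> ar s2 8 l = lvl_length M l)"
      show "runs L (Put 7 (Var 9) (Var 8) ;; Put 8 (Var 9) (Var 7) ;;
        HIf (Bin Less (Cst 3) (Var 7)) next_level (Upd 10 (Cst 0))) s1 (7 + (7 + (4 + (150 * (m + 1)))))
        (\<lambda>s''. \<exists>Ts'. J Ts' s'' \<and> 2 + ?u s' + \<Phi> s'' \<le> \<Phi> s')"
      proof (rule runs_HSeq[OF runs_wp[where Q = "\<lambda>s2. ar s2 7 = (ar s' 7)(lev := off)"]])
        fix s2 assume f2: "frm (Put 7 (Var 9) (Var 8)) s1 s2" and 2: "ar s2 7 = (ar s' 7)(lev := off)"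
        have A2: "rg s2 = rg s1" "ar s2 8 = ar s1 8" "ar s2 6 = ar s1 6" using f2 by (auto simp: frm_def)
        show "runs L (Put 8 (Var 9) (Var 7) ;; HIf (Bin Less (Cst 3) (Var 7)) next_level (Upd 10 (Cst 0))) s2 (7 + (4 + (150 * (m + 1))))
          (\<lambda>s''. \<exists>Ts'. J Ts' s'' \<and> 2 + ?u s' + \<Phi> s'' \<le> \<Phi> s')"
        proof (rule runs_HSeq[OF runs_wp[where Q = "\<lambda>s3. ar s3 8 = (ar s' 8)(lev := m)"]])
          fix s3 assume f3: "frm (Put 8 (Var 9) (Var 7)) s2 s3" and 3: "ar s3 8 = (ar s' 8)(lev := m)"
          have A3: "rg s3 = rg s1" "ar s3 7 = (ar s' 7)(lev := off)" "ar s3 6 = ar s1 6"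
            using f3 A2 2 by (auto simp: frm_def)
          have LO': "ar s3 7 l = lvl_offset M l \<and> ar s3 8 l = lvl_length M l" if "l < Suc lev" for l
            using that LO A3 3 by (auto simp: less_Suc_eq m_def off_def)
          show "runs L (HIf (Bin Less (Cst 3) (Var 7)) next_level (Upd 10 (Cst 0))) s3 (4 + (150 * (m + 1)))
            (\<lambda>s''. \<exists>Ts'. J Ts' s'' \<and> 2 + ?u s' + \<Phi> s'' \<le> \<Phi> s')"
          proof (rule runs_HIf)
            show "hok L s3 (Bin Less (Cst 3) (Var 7))" using L by simp
            assume "hev s3 (Bin Less (Cst 3) (Var 7)) \<noteq> 0"
            then have m3: "3 < m" using A3 A1 by (auto split: if_splits)
            show "runs L next_level s3 (150 * (m + 1)) (\<lambda>s''. \<exists>Ts'. J Ts' s'' \<and> 2 + ?u s' + \<Phi> s'' \<le> \<Phi> s')"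
            proof (rule runs_mono[OF runs_next_level[where m = m and off = off]])
              fix s4 assume f4: "frm next_level s3 s4"
                and 4: "(\<forall>i<nextm m + 3. ar s4 5 i = nextT (\<lambda>i. ar s3 6 (off + i)) m i) \<and>
                  rg s4 6 = m + 2 \<and> rg s4 8 = off + m \<and> rg s4 7 = nextm m \<and> rg s4 9 = rg s3 9 + 1"
              have A4: "rg s4 10 = rg s' 10" "ar s4 6 = ar s1 6" "ar s4 7 = ar s3 7" "ar s4 8 = ar s3 8"
                using f4 A3 A1 by (simp_all add: frm_def)
              have "nextT ?nm m i < m + 2" for i
              proof -
                have "nextT ?nm m i \<le> m + 1"
                  by (rule nextT_le) (use N1 in auto)
                then show ?thesis by simp
              qed
              then have "J0 Ts' (Suc lev) s4"
                unfolding J0_def using lv' A4 LO' lev m3 4 A3 A1 bnd wf_nextT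
                by (auto simp: less_Suc_eq m_def off_def Ts'_def)
              then have "J Ts' s4" using fl A4 4 A3 A1 by (simp add: J_def)
              moreover have "30 * nextm m + 2 * m + 6 \<le> 30 * m" using nextm_less[OF m3] m3 by linarith
              then have "2 + ?u s' + \<Phi> s4 \<le> \<Phi> s'"
                unfolding u using fl A4 4 by (simp add: \<Phi>_def)
              ultimately show "\<exists>Ts'. J Ts' s4 \<and> 2 + ?u s' + \<Phi> s4 \<le> \<Phi> s'" by blast
            qed (use A3 A1 L bnd m3 N1 in auto)
          next
            assume "hev s3 (Bin Less (Cst 3) (Var 7)) = 0"
            then have m3: "m \<le> 3" using A3 A1 by (auto split: if_splits)
            show "runs L (Upd 10 (Cst 0)) s3 (150 * (m + 1)) (\<lambda>s''. \<exists>Ts'. J Ts' s'' \<and> 2 + ?u s' + \<Phi> s'' \<le> \<Phi> s')"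
            proof (rule runs_mono[OF runs_wp[where Q = "\<lambda>s4. rg s4 10 = 0"]])
              fix s4 assume f4: "frm (Upd 10 (Cst 0)) s3 s4" and 4: "rg s4 10 = 0"
              have A4: "ar s4 = ar s3" "rg s4 7 = m" "rg s4 8 = off" "rg s4 9 = lev" using f4 A3 A1 by (auto simp: frm_def)
              have "?E s4"
                by (rule exI[of _ Ts'], rule exI[of _ lev])
                  (use A4 A3 LO' lv' lev m3 in \<open>auto simp: m_def off_def less_Suc_eq_le\<close>)
              then have "J Ts' s4" using 4 by (simp add: J_def)
              moreover have "2 + ?u s' + \<Phi> s4 \<le> \<Phi> s'"
                unfolding u using 4 by (simp add: \<Phi>_def)
              ultimately show "\<exists>Ts'. J Ts' s4 \<and> 2 + ?u s' + \<Phi> s4 \<le> \<Phi> s'" by blast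
            qed (use L in auto)
          qed (use L in auto)
        qed (use A2 A1 L bnd in auto)
      qed (use A1 L bnd in auto)
    qed (use A T5 bnd L in auto)
  qed
  have "runs L (HWhile (Var 10) down_body) ?s (31000 * (M + 2) - 20) ?E"
  proof (rule runs_HWhile[where I = J and \<Phi> = "\<lambda>_. \<Phi>" and u = "\<lambda>_. ?u" and g = "\<lambda>_. T0"])
    have "T0 i < M + 1" for i using T(2)[of i] by simp
    then show "J (\<lambda>_. T0) ?s"
      using wf T r by (simp add: J_def J0_def levels_def)
    show "frm down_body ?s ?s" by (simp add: frm_def)
    show "\<Phi> ?s \<le> 31000 * (M + 2) - 20" by (simp add: \<Phi>_def)
    fix Ts s' assume J: "J Ts s'"
    show "hok L s' (Var 10)" by simp
    show "1 + hcost (Var 10) \<le> \<Phi> s' \<and> ?E s'" if "hev s' (Var 10) = 0"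
      using J that by (simp add: J_def \<Phi>_def)
    show "runs L down_body s' (?u s') (\<lambda>s''. \<exists>Ts'. J Ts' s'' \<and> 1 + hcost (Var 10) + ?u s' + \<Phi> s'' \<le> \<Phi> s')"
      if "hev s' (Var 10) \<noteq> 0"
      using step[of Ts "rg s' 9" s'] J that by (simp add: J_def)
  qed
  then show ?thesis
    unfolding down_def using r L
    by (intro runs_wp_HSeq[where ?t2.0 = "31000 * (M + 2) - 20"]) auto
qed

subsection \<open>Ascending through the levels\<close>

text \<open>Ranks start at 1, one more than the place in the suffix array; this leaves 0 for the
  empty suffixes met by the merge.\<close>

definition ranked :: "(nat \<Rightarrow> nat) \<Rightarrow> nat \<Rightarrow> hst \<Rightarrow> bool" where
  "ranked T m s \<longleftrightarrow> set (lst s 10 m) = {..<m} \<and> sorted_wrt (suffix_less T) (lst s 10 m) \<and>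
     (\<forall>k<m. ar s 9 (ar s 10 k) = k + 1)"

lemma ranked_less:
  assumes R: "ranked T m s" and ij: "i < m" "j < m"
  shows "ar s 9 i < ar s 9 j \<longleftrightarrow> suffix_less T i j" "1 \<le> ar s 9 i" "ar s 9 i \<le> m"
proof -
  have S: "suffix_less T (ar s 10 a) (ar s 10 b)" if "a < b" "b < m" for a b
    using R that by (auto simp: ranked_def sorted_wrt_iff_nth_less)
  have "\<exists>a<m. i = ar s 10 a" if "i < m" for i
  proof -
    have "i \<in> ar s 10 ` {..<m}" using R that by (simp add: ranked_def set_lst)
    then show ?thesis by auto
  qed
  then obtain a b where ab: "a < m" "i = ar s 10 a" "b < m" "j = ar s 10 b" using ij by metis
  then have "ar s 9 i = a + 1" "ar s 9 j = b + 1" using R by (auto simp: ranked_def)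
  moreover have "a < b \<longleftrightarrow> suffix_less T i j"
    using S[of a b] S[of b a] ab suffix_less_asym by (metis linorder_neqE_nat suffix_less_irrefl)
  ultimately show "ar s 9 i < ar s 9 j \<longleftrightarrow> suffix_less T i j" "1 \<le> ar s 9 i" "ar s 9 i \<le> m" using ab by auto
qed

definition base_ranks :: hcmd where
  "base_ranks = For 20 (Var 7) (Upd 21 (Arr 6 (Bin Add (Var 8) (Var 20))) ;; Put 9 (Var 20) (Var 21) ;;
     Put 10 (Bin Sub (Var 21) (Cst 1)) (Var 20))"

lemma mod_base_ranks [simp]: "modr base_ranks = {20,21}" "moda base_ranks = {9,10}"
  by (auto simp: base_ranks_def)

text \<open>With at most three letters a triple determines the whole suffix. The names are then
  \<open>m\<close> different values in \<open>{1..m}\<close>, which makes them the ranks.\<close>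

lemma runs_base_ranks:
  assumes r: "rg s 7 = m" "rg s 8 = off" and m: "m \<le> 3" and wf: "wf_str T m"
    and nm: "names (trip T) m (\<lambda>i. ar s 6 (off + i))" and L: "off + m + 10 < L"
  shows "runs L base_ranks s 200 (ranked T m)"
proof -
  define nm where "nm = (\<lambda>i. ar s 6 (off + i))"
  have nms: "names (trip T) m nm" using assms by (simp add: nm_def)
  have suffix_less: "suffix_less T i j \<longleftrightarrow> nm i < nm j" if "i < m" "j < m" for i j
    using suffix_less_names[OF nms that, of 3] suffix_less_zero(1)[OF wf, of "j + 3" "i + 3"] m by auto
  have nb: "1 \<le> nm i" "nm i \<le> m" if "i < m" for i using nms that by (auto simp: names_def)
  have inj: "nm i = nm j \<longleftrightarrow> i = j" if "i < m" "j < m" for i j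
    using suffix_less[OF that] suffix_less[OF that(2,1)] suffix_less_total[OF wf, of i j] that by auto
  have im: "nm ` {..<m} = {1..m}"
    by (rule card_subset_eq) (use nb inj in \<open>auto simp: card_image inj_on_def\<close>)
  let ?B = "Upd 21 (Arr 6 (Bin Add (Var 8) (Var 20))) ;; Put 9 (Var 20) (Var 21) ;;
     Put 10 (Bin Sub (Var 21) (Cst 1)) (Var 20)"
  show ?thesis unfolding base_ranks_def
  proof (rule runs_For[where n = m and c = 30 and I = "\<lambda>k s'. \<forall>i<k. ar s' 9 i = nm i \<and> ar s' 10 (nm i - 1) = i"])
    fix i s' assume i: "i < m" "rg s' 20 = i" and I: "\<forall>j<i. ar s' 9 j = nm j \<and> ar s' 10 (nm j - 1) = j"
      and f: "frm (For 20 (Var 7) ?B) s s'"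
    have A: "rg s' 7 = m" "rg s' 8 = off" "ar s' 6 = ar s 6" using f r by (simp_all add: frm_def)
    have ne: "nm j - 1 = nm i - 1 \<longleftrightarrow> j = i" if "j < m" for j
      using inj[OF that i(1)] nb[OF that] nb[OF i(1)] by auto
    have v: "ar s 6 (off + i) = nm i" by (simp add: nm_def)
    have "runs L ?B s' 30 (\<lambda>s''. ar s'' 9 = (ar s' 9)(i := nm i) \<and> ar s'' 10 = (ar s' 10)(nm i - 1 := i))"
      by (rule runs_wp) (use A i L nb[OF i(1)] v in auto)
    then show "runs L ?B s' 30 (\<lambda>s''. \<forall>j<Suc i. ar (upd s'' 20 (Suc i)) 9 j = nm j \<and> ar (upd s'' 20 (Suc i)) 10 (nm j - 1) = j)"
    proof (rule runs_mono)
      fix s'' :: hst assume *: "ar s'' 9 = (ar s' 9)(i := nm i) \<and> ar s'' 10 = (ar s' 10)(nm i - 1 := i)"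
      show "\<forall>j<Suc i. ar (upd s'' 20 (Suc i)) 9 j = nm j \<and> ar (upd s'' 20 (Suc i)) 10 (nm j - 1) = j"
      proof (intro allI impI)
        fix j assume "j < Suc i"
        then have "j = i \<or> j < i \<and> j < m" using i by auto
        then show "ar (upd s'' 20 (Suc i)) 9 j = nm j \<and> ar (upd s'' 20 (Suc i)) 10 (nm j - 1) = j"
          using * I ne by auto
      qed
    qed simp
  next
    fix s' :: hst assume I: "\<forall>i<m. ar s' 9 i = nm i \<and> ar s' 10 (nm i - 1) = i"
    have ex: "\<exists>i<m. nm i = k + 1" if "k < m" for k
    proof -
      have "k + 1 \<in> nm ` {..<m}" unfolding im using that by auto
      then show ?thesis by auto
    qed
    have SA: "ar s' 10 k < m \<and> nm (ar s' 10 k) = k + 1" if "k < m" for k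
      using ex[OF that] I by fastforce
    have "sorted_wrt (suffix_less T) (lst s' 10 m)"
      unfolding sorted_wrt_iff_nth_less using SA suffix_less by simp
    moreover have "set (lst s' 10 m) = {..<m}"
    proof
      show "set (lst s' 10 m) \<subseteq> {..<m}" using SA by (auto simp: set_lst)
      show "{..<m} \<subseteq> set (lst s' 10 m)"
      proof
        fix i assume i: "i \<in> {..<m}"
        then have "i = ar s' 10 (nm i - 1)" "nm i - 1 < m" using I nb[of i] by auto
        then show "i \<in> set (lst s' 10 m)" unfolding set_lst by blast
      qed
    qed
    ultimately show "ranked T m s'" using SA I by (simp add: ranked_def)
  qed (use r L m in \<open>auto simp: frm_def\<close>)
qed

lemma mod3_neq [simp]: "Suc (3 * i) \<noteq> 3 * j" "3 * j \<noteq> Suc (3 * i)" for i j :: nat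
  by presburger+

lemma mod3_Suc [simp]: "Suc (3 * i) mod 3 = 1" "Suc (Suc (3 * i)) mod 3 = 2" for i :: nat
  by presburger+

definition sample_ranks :: hcmd where
  "sample_ranks = For 20 (Var 11) (Put 11 (plus1 (Bin Mult (Cst 3) (Var 20))) (Arr 9 (Var 20))) ;;
     For 20 (Var 12) (Put 11 (Bin Add (Bin Mult (Cst 3) (Var 20)) (Cst 2)) (Arr 9 (Bin Add (plus1 (Var 11)) (Var 20)))) ;;
     Put 11 (Var 7) (Cst 0) ;; Put 11 (plus1 (Var 7)) (Cst 0) ;; Put 11 (Bin Add (Var 7) (Cst 2)) (Cst 0)"

lemma mod_sample_ranks [simp]: "modr sample_ranks = {20}" "moda sample_ranks = {11}"
  by (auto simp: sample_ranks_def)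

lemma runs_sample_ranks:
  assumes r: "rg s 7 = m" "rg s 11 = n1 m" "rg s 12 = n2 m" and m: "3 < m" and L: "2 * m + 10 < L"
  shows "runs L sample_ranks s (80 * (m + 1)) (\<lambda>s'. (\<forall>i<m. i mod 3 \<noteq> 0 \<longrightarrow> ar s' 11 i = ar s 9 (ix m i)) \<and>
     (\<forall>i<3. ar s' 11 (m + i) = 0))"
  unfolding sample_ranks_def
proof (rule runs_HSeq)
  let ?P1 = "For 20 (Var 11) (Put 11 (plus1 (Bin Mult (Cst 3) (Var 20))) (Arr 9 (Var 20)))"
  let ?P2 = "For 20 (Var 12) (Put 11 (Bin Add (Bin Mult (Cst 3) (Var 20)) (Cst 2)) (Arr 9 (Bin Add (plus1 (Var 11)) (Var 20))))"
  let ?P3 = "Put 11 (Var 7) (Cst 0) ;; Put 11 (plus1 (Var 7)) (Cst 0) ;; Put 11 (Bin Add (Var 7) (Cst 2)) (Cst 0)"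
  let ?A = "\<lambda>s'. rg s' 7 = m \<and> rg s' 11 = n1 m \<and> rg s' 12 = n2 m \<and> ar s' 9 = ar s 9"
  have n: "n1 m \<le> m" "n2 m \<le> m" "n1 m + n2 m \<le> m" using nextm_bound[of m] by (auto simp: nextm_def)
  show "runs L ?P1 s (30 * (m + 1)) (\<lambda>s'. \<forall>j<n1 m. ar s' 11 (3 * j + 1) = ar s 9 j)"
  proof (rule runs_For[where n = "n1 m" and c = 22 and I = "\<lambda>i s'. \<forall>j<i. ar s' 11 (3 * j + 1) = ar s 9 j"])
    fix i s' assume i: "i < n1 m" "rg s' 20 = i" and I: "\<forall>j<i. ar s' 11 (3 * j + 1) = ar s 9 j" and f: "frm ?P1 s s'"
    have "?A s'" using f r by (simp add: frm_def)
    moreover have "3 * i + 1 < m" using i(1) unfolding less_n1 .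
    ultimately show "runs L (Put 11 (plus1 (Bin Mult (Cst 3) (Var 20))) (Arr 9 (Var 20))) s' 22
      (\<lambda>s''. \<forall>j<Suc i. ar (upd s'' 20 (Suc i)) 11 (3 * j + 1) = ar s 9 j)"
      by (intro runs_wp) (use i I L in \<open>auto simp: less_Suc_eq\<close>)
  qed (use r L n in \<open>auto simp: frm_def\<close>)
  fix s1 assume f1: "frm ?P1 s s1" and 1: "\<forall>j<n1 m. ar s1 11 (3 * j + 1) = ar s 9 j"
  have A1: "?A s1" using f1 r by (simp add: frm_def)
  let ?I = "\<lambda>i s'. (\<forall>j<n1 m. ar s' 11 (3 * j + 1) = ar s 9 j) \<and> (\<forall>j<i. ar s' 11 (3 * j + 2) = ar s 9 (n1 m + 1 + j))"
  show "runs L (?P2 ;; ?P3) s1 (35 * (m + 1) + 30) (\<lambda>s'. (\<forall>i<m. i mod 3 \<noteq> 0 \<longrightarrow> ar s' 11 i = ar s 9 (ix m i)) \<and>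
     (\<forall>i<3. ar s' 11 (m + i) = 0))"
  proof (rule runs_HSeq)
    show "runs L ?P2 s1 (35 * (m + 1)) (?I (n2 m))"
    proof (rule runs_For[where n = "n2 m" and c = 25 and I = ?I])
      fix i s' assume i: "i < n2 m" "rg s' 20 = i" and I: "?I i s'" and f: "frm ?P2 s1 s'"
      have "?A s'" using f A1 by (simp add: frm_def)
      moreover have "3 * i + 2 < m" using i(1) unfolding less_n2 .
      ultimately show "runs L (Put 11 (Bin Add (Bin Mult (Cst 3) (Var 20)) (Cst 2)) (Arr 9 (Bin Add (plus1 (Var 11)) (Var 20)))) s' 25
        (\<lambda>s''. ?I (Suc i) (upd s'' 20 (Suc i)))"
        by (intro runs_wp) (use i I L n in \<open>auto simp: less_Suc_eq\<close>)
    qed (use A1 1 L n in \<open>auto simp: frm_def\<close>)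
    fix s2 assume f2: "frm ?P2 s1 s2" and 2: "?I (n2 m) s2"
    have A2: "?A s2" using f2 A1 by (simp add: frm_def)
    have 3: "ar s2 11 i = ar s 9 (ix m i)" if "i < m" "i mod 3 \<noteq> 0" for i
      using that(2)
    proof (cases i rule: mod3_cases)
      case (1 e)
      then have "e < n1 m" unfolding less_n1 using that by simp
      then show ?thesis using 2 1 by simp
    next
      case e: (2 e)
      then have "e < n2 m" unfolding less_n2 using that by simp
      then show ?thesis using 2 e by simp
    qed
    have "runs L ?P3 s2 30 (\<lambda>s'. ar s' 11 = (ar s2 11)(m := 0, m + 1 := 0, m + 2 := 0))"
      by (rule runs_wp) (use A2 L in auto)
    then show "runs L ?P3 s2 30 (\<lambda>s'. (\<forall>i<m. i mod 3 \<noteq> 0 \<longrightarrow> ar s' 11 i = ar s 9 (ix m i)) \<and> (\<forall>i<3. ar s' 11 (m + i) = 0))"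
    proof (rule runs_mono)
      fix s' :: hst assume *: "ar s' 11 = (ar s2 11)(m := 0, m + 1 := 0, m + 2 := 0)"
      have "ar s' 11 (m + i) = 0" if "i < 3" for i
      proof -
        have "i = 0 \<or> i = 1 \<or> i = 2" using that by auto
        then show ?thesis using * by auto
      qed
      then show "(\<forall>i<m. i mod 3 \<noteq> 0 \<longrightarrow> ar s' 11 i = ar s 9 (ix m i)) \<and> (\<forall>i<3. ar s' 11 (m + i) = 0)"
        using * 3 by auto
    qed simp
  qed simp
qed (use m in simp)

text \<open>The merge looks up to two places beyond its positions and may pass the end of the text.
  Rank 0 there puts the empty suffixes below all others; inside, the claim is
  \<open>suffix_less_nextT\<close>.\<close>

lemma RS_less:
  assumes wf: "wf_str T m" and nm: "names (trip T) m nm" and R: "ranked (nextT nm m) (nextm m) s"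
    and RS: "\<And>i. i < m \<Longrightarrow> i mod 3 \<noteq> 0 \<Longrightarrow> RS i = ar s 9 (ix m i)" "\<And>i. i < 3 \<Longrightarrow> RS (m + i) = 0"
    and ab: "a < m + 3" "b < m + 3" "a mod 3 \<noteq> 0" "b mod 3 \<noteq> 0"
  shows "RS a < RS b \<longleftrightarrow> suffix_less T a b"
proof -
  have z: "RS i = 0" if "m \<le> i" "i < m + 3" for i using RS(2)[of "i - m"] that by auto
  show ?thesis
  proof (cases "b < m")
    case False
    then show ?thesis using z[of b] ab suffix_less_zero(1)[OF wf, of b a] by auto
  next
    case b: True
    have rb: "ix m b < nextm m" using ix_less b ab by blast
    show ?thesis
    proof (cases "a < m")
      case False
      then show ?thesis using z[of a] ab RS(1)[OF b ab(4)] suffix_less_zero(2)[OF wf, of a b] b ranked_less(2)[OF R rb rb] by auto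
    next
      case True
      have ra: "ix m a < nextm m" using ix_less True ab by blast
      show ?thesis unfolding RS(1)[OF b ab(4)] RS(1)[OF True ab(3)] ranked_less(1)[OF R ra rb]
        by (rule suffix_less_nextT) (use wf nm True b ab in auto)
    qed
  qed
qed

text \<open>The inverse of \<open>ix\<close>, to be used at every place of the reduced string except
  the separator \<open>n1 m\<close>.\<close>

definition dx :: "nat \<Rightarrow> nat \<Rightarrow> nat" where
  "dx m q = (if q < n1 m then 3 * q + 1 else 3 * (q - (n1 m + 1)) + 2)"

lemma dx:
  assumes "q < nextm m" "q \<noteq> n1 m"
  shows "dx m q < m" "dx m q mod 3 \<noteq> 0" "ix m (dx m q) = q"
proof -
  have "dx m q < m \<and> dx m q mod 3 \<noteq> 0 \<and> ix m (dx m q) = q"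
  proof (cases "q < n1 m")
    case True
    then have "3 * q + 1 < m" unfolding less_n1 .
    then show ?thesis using True by (simp add: dx_def)
  next
    case False
    define e where "e = q - (n1 m + 1)"
    have q: "q = n1 m + 1 + e" using False assms by (simp add: e_def)
    then have "e < n2 m" using assms by (simp add: nextm_def)
    then have "3 * e + 2 < m" unfolding less_n2 .
    moreover have "dx m q = 3 * e + 2" using False by (simp add: dx_def e_def)
    ultimately show ?thesis using q by simp
  qed
  then show "dx m q < m" "dx m q mod 3 \<noteq> 0" "ix m (dx m q) = q" by auto
qed

lemma dx_ix:
  assumes "i < m" "i mod 3 \<noteq> 0"
  shows "dx m (ix m i) = i" "ix m i \<noteq> n1 m"
proof -
  have "dx m (ix m i) = i \<and> ix m i \<noteq> n1 m" using assms(2)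
  proof (cases i rule: mod3_cases)
    case (1 e)
    then have "e < n1 m" unfolding less_n1 using assms by simp
    then show ?thesis using 1 by (simp add: dx_def)
  next
    case (2 e)
    then show ?thesis by (simp add: dx_def)
  qed
  then show "dx m (ix m i) = i" "ix m i \<noteq> n1 m" by auto
qed

lemma lst_Suc [simp]: "lst s a (Suc q) = lst s a q @ [ar s a q]"
  by (simp add: lst_def)

lemma lst_cong: "(\<And>i. i < q \<Longrightarrow> ar s a i = ar s' a' i) \<Longrightarrow> lst s a q = lst s' a' q"
  by (simp add: lst_def)

text \<open>The suffix array of the reduced string, without its entry for the separator and
  translated back by \<open>dx\<close>, is the order of the sampled suffixes.\<close>

definition sample_order :: hcmd where
  "sample_order = Upd 14 (Cst 0) ;;
     For 20 (Var 13) (Upd 21 (Arr 10 (Var 20)) ;;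
       HIf (Bin Less (Var 21) (Var 11)) (Put 12 (Var 14) (plus1 (Bin Mult (Cst 3) (Var 21))) ;; Upd 14 (plus1 (Var 14)))
         (HIf (Bin Less (Var 11) (Var 21))
           (Put 12 (Var 14) (Bin Add (Bin Mult (Cst 3) (Bin Sub (Var 21) (plus1 (Var 11)))) (Cst 2)) ;; Upd 14 (plus1 (Var 14)))
           HSkip))"

lemma mod_sample_order [simp]: "modr sample_order = {14,20,21}" "moda sample_order = {12}"
  by (auto simp: sample_order_def)

lemma runs_sample_order:
  assumes r: "rg s 11 = n1 m" "rg s 13 = nextm m" and SA: "\<And>k. k < nextm m \<Longrightarrow> ar s 10 k < nextm m" and L: "3 * m + 20 < L"
  shows "runs L sample_order s (90 * (m + 3)) (\<lambda>s'. lst s' 12 (rg s' 14) = map (dx m) (filter (\<lambda>q. q \<noteq> n1 m) (lst s 10 (nextm m))))"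
  unfolding sample_order_def
proof (rule runs_Upd_HSeq)
  let ?B = "Upd 21 (Arr 10 (Var 20)) ;;
       HIf (Bin Less (Var 21) (Var 11)) (Put 12 (Var 14) (plus1 (Bin Mult (Cst 3) (Var 21))) ;; Upd 14 (plus1 (Var 14)))
         (HIf (Bin Less (Var 11) (Var 21))
           (Put 12 (Var 14) (Bin Add (Bin Mult (Cst 3) (Bin Sub (Var 21) (plus1 (Var 11)))) (Cst 2)) ;; Upd 14 (plus1 (Var 14)))
           HSkip)"
  let ?s = "upd s 14 (hev s (Cst 0))"
  let ?l = "\<lambda>i. map (dx m) (filter (\<lambda>q. q \<noteq> n1 m) (lst s 10 i))"
  have nm: "nextm m \<le> m + 2" using nextm_bound[of m] by simp
  show "runs L (For 20 (Var 13) ?B) ?s (90 * (m + 3) - 10) (\<lambda>s'. lst s' 12 (rg s' 14) = ?l (nextm m))"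
  proof (rule runs_For[where n = "nextm m" and c = 75 and I = "\<lambda>i s'. lst s' 12 (rg s' 14) = ?l i \<and> rg s' 14 \<le> i"])
    fix i s' assume i: "i < nextm m" "rg s' 20 = i" and I: "lst s' 12 (rg s' 14) = ?l i \<and> rg s' 14 \<le> i"
      and f: "frm (For 20 (Var 13) ?B) ?s s'"
    have A: "rg s' 11 = n1 m" "rg s' 13 = nextm m" "ar s' 10 = ar s 10" using f r by (simp_all add: frm_def)
    let ?q = "ar s 10 i"
    have q: "?q < nextm m" using SA i by simp
    have *: "runs L ?B s' 75 (\<lambda>s''. if ?q = n1 m then ar s'' 12 = ar s' 12 \<and> rg s'' 14 = rg s' 14
        else ar s'' 12 = (ar s' 12)(rg s' 14 := dx m ?q) \<and> rg s'' 14 = Suc (rg s' 14))"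
    proof (rule runs_wp)
      have "?q \<noteq> n1 m \<Longrightarrow> dx m ?q < m" using dx(1)[OF q] by simp
      then show "wp L ?B (\<lambda>s''. if ?q = n1 m then ar s'' 12 = ar s' 12 \<and> rg s'' 14 = rg s' 14
        else ar s'' 12 = (ar s' 12)(rg s' 14 := dx m ?q) \<and> rg s'' 14 = Suc (rg s' 14)) s'"
        using A i L nm I q by (auto simp: dx_def)
    qed simp
    show "runs L ?B s' 75 (\<lambda>s''. lst (upd s'' 20 (Suc i)) 12 (rg (upd s'' 20 (Suc i)) 14) = ?l (Suc i) \<and> rg (upd s'' 20 (Suc i)) 14 \<le> Suc i)"
    proof (rule runs_mono[OF *])
      fix s'' :: hst assume e: "if ?q = n1 m then ar s'' 12 = ar s' 12 \<and> rg s'' 14 = rg s' 14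
        else ar s'' 12 = (ar s' 12)(rg s' 14 := dx m ?q) \<and> rg s'' 14 = Suc (rg s' 14)"
      have "lst (upd s'' 20 (Suc i)) 12 (rg s' 14) = lst s' 12 (rg s' 14)"
        by (rule lst_cong) (use e in \<open>auto split: if_splits\<close>)
      then show "lst (upd s'' 20 (Suc i)) 12 (rg (upd s'' 20 (Suc i)) 14) = ?l (Suc i) \<and> rg (upd s'' 20 (Suc i)) 14 \<le> Suc i"
        using e I by (auto split: if_splits)
    qed simp
  next
    have "(nextm m + 1) * 83 \<le> (m + 3) * 83" using nm by (intro mult_le_mono1) simp
    then show "(nextm m + 1) * (75 + 7 + hcost (Var 13)) \<le> 90 * (m + 3) - 10" by simp
  qed (use r L nm in \<open>auto simp: frm_def lst_def\<close>)
qed (use L in auto)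

lemma samples:
  assumes wf: "wf_str T m" and nm: "names (trip T) m nm" and R: "ranked (nextT nm m) (nextm m) s"
    and xs: "xs = map (dx m) (filter (\<lambda>q. q \<noteq> n1 m) (lst s 10 (nextm m)))"
  shows "sorted_wrt (suffix_less T) xs" "set xs = {i. i < m \<and> i mod 3 \<noteq> 0}"
proof -
  have SA: "set (lst s 10 (nextm m)) = {..<nextm m}" "sorted_wrt (suffix_less (nextT nm m)) (lst s 10 (nextm m))"
    using R by (auto simp: ranked_def)
  have "sorted_wrt (suffix_less (nextT nm m)) (filter (\<lambda>q. q \<noteq> n1 m) (lst s 10 (nextm m)))"
    using SA(2) by (rule sorted_wrt_filter)
  then show "sorted_wrt (suffix_less T) xs" unfolding xs sorted_wrt_map
  proof (rule sorted_wrt_set_mono)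
    fix x y assume "x \<in> set (filter (\<lambda>q. q \<noteq> n1 m) (lst s 10 (nextm m)))" "y \<in> set (filter (\<lambda>q. q \<noteq> n1 m) (lst s 10 (nextm m)))"
      and s: "suffix_less (nextT nm m) x y"
    then have x: "x < nextm m" "x \<noteq> n1 m" and y: "y < nextm m" "y \<noteq> n1 m" using SA by auto
    show "suffix_less T (dx m x) (dx m y)"
      using s suffix_less_nextT[OF wf nm dx(1,2)[OF x] dx(1,2)[OF y]] by (simp add: dx(3)[OF x] dx(3)[OF y])
  qed
  show "set xs = {i. i < m \<and> i mod 3 \<noteq> 0}"
  proof (intro set_eqI iffI)
    fix i assume "i \<in> set xs"
    then show "i \<in> {i. i < m \<and> i mod 3 \<noteq> 0}" using SA(1) dx by (auto simp: xs)
  next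
    fix i assume "i \<in> {i. i < m \<and> i mod 3 \<noteq> 0}"
    then have i: "i < m" "i mod 3 \<noteq> 0" by auto
    have "ix m i \<in> set (filter (\<lambda>q. q \<noteq> n1 m) (lst s 10 (nextm m)))"
      using SA(1) ix_less[OF i] dx_ix(2)[OF i] by simp
    then have "dx m (ix m i) \<in> set xs" unfolding xs by (simp only: set_map image_eqI)
    then show "i \<in> set xs" using dx_ix(1)[OF i] by simp
  qed
qed

section \<open>Suffixes at multiples of three\<close>

text \<open>Subtracting one from the samples that are 1 modulo 3 lists the multiples of three in the
  order of their remainders after one letter. If \<open>m mod 3 = 1\<close>, the last position
  \<open>m - 1\<close> is followed by the empty suffix, which is no sample; as the empty suffix is
  the least, this position goes first.\<close>

definition collect_zeros :: hcmd where
  "collect_zeros = Upd 5 (Cst 0) ;;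
     HIf (Bin Eq (Bin Mod (Var 7) (Cst 3)) (Cst 1)) (Put 1 (Cst 0) (Bin Sub (Var 7) (Cst 1)) ;; Upd 5 (Cst 1)) HSkip ;;
     For 20 (Var 14) (Upd 21 (Arr 12 (Var 20)) ;;
       HIf (Bin Eq (Bin Mod (Var 21) (Cst 3)) (Cst 1)) (Put 1 (Var 5) (Bin Sub (Var 21) (Cst 1)) ;; Upd 5 (plus1 (Var 5))) HSkip)"

lemma mod_collect_zeros [simp]: "modr collect_zeros = {5,20,21}" "moda collect_zeros = {1}"
  by (auto simp: collect_zeros_def)

lemma runs_collect_zeros:
  assumes r: "rg s 7 = m" "rg s 14 = cs" and SS: "\<And>k. k < cs \<Longrightarrow> ar s 12 k < m" and cs: "cs \<le> m" and L: "m + 20 < L"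
  shows "runs L collect_zeros s (60 * (m + 2)) (\<lambda>s'. lst s' 1 (rg s' 5) = (if m mod 3 = 1 then [m - 1] else []) @
     map (\<lambda>i. i - 1) (filter (\<lambda>i. i mod 3 = 1) (lst s 12 cs)))"
  unfolding collect_zeros_def
proof (rule runs_Upd_HSeq)
  let ?P = "HIf (Bin Eq (Bin Mod (Var 7) (Cst 3)) (Cst 1)) (Put 1 (Cst 0) (Bin Sub (Var 7) (Cst 1)) ;; Upd 5 (Cst 1)) HSkip"
  let ?B = "Upd 21 (Arr 12 (Var 20)) ;;
       HIf (Bin Eq (Bin Mod (Var 21) (Cst 3)) (Cst 1)) (Put 1 (Var 5) (Bin Sub (Var 21) (Cst 1)) ;; Upd 5 (plus1 (Var 5))) HSkip"
  let ?s = "upd s 5 (hev s (Cst 0))"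
  let ?l = "\<lambda>i. (if m mod 3 = 1 then [m - 1] else []) @ map (\<lambda>i. i - 1) (filter (\<lambda>i. i mod 3 = 1) (lst s 12 i))"
  show "runs L (?P ;; For 20 (Var 14) ?B) ?s (25 + 50 * (m + 1)) (\<lambda>s'. lst s' 1 (rg s' 5) = ?l cs)"
  proof (rule runs_HSeq)
    show "runs L ?P ?s 25 (\<lambda>s'. lst s' 1 (rg s' 5) = ?l 0 \<and> rg s' 5 \<le> 1)"
      by (rule runs_wp) (use r L in \<open>auto simp: lst_def\<close>)
    fix s1 assume f1: "frm ?P ?s s1" and 1: "lst s1 1 (rg s1 5) = ?l 0 \<and> rg s1 5 \<le> 1"
    have A1: "rg s1 14 = cs" "ar s1 12 = ar s 12" using f1 r by (simp_all add: frm_def)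
    show "runs L (For 20 (Var 14) ?B) s1 (50 * (m + 1)) (\<lambda>s'. lst s' 1 (rg s' 5) = ?l cs)"
    proof (rule runs_For[where n = cs and c = 42 and I = "\<lambda>i s'. lst s' 1 (rg s' 5) = ?l i \<and> rg s' 5 \<le> i + 1"])
      fix i s' assume i: "i < cs" "rg s' 20 = i" and I: "lst s' 1 (rg s' 5) = ?l i \<and> rg s' 5 \<le> i + 1"
        and f: "frm (For 20 (Var 14) ?B) s1 s'"
      have A: "rg s' 14 = cs" "ar s' 12 = ar s 12" using f A1 by (simp_all add: frm_def)
      let ?q = "ar s 12 i"
      have *: "runs L ?B s' 42 (\<lambda>s''. if ?q mod 3 = 1 then ar s'' 1 = (ar s' 1)(rg s' 5 := ?q - 1) \<and> rg s'' 5 = Suc (rg s' 5)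
          else ar s'' 1 = ar s' 1 \<and> rg s'' 5 = rg s' 5)"
      proof (rule runs_wp)
        have "?q mod 3 = 1 \<Longrightarrow> 1 \<le> ?q" by (cases ?q) auto
        moreover have "?q < m" using SS i by simp
        ultimately show "wp L ?B (\<lambda>s''. if ?q mod 3 = 1 then ar s'' 1 = (ar s' 1)(rg s' 5 := ?q - 1) \<and> rg s'' 5 = Suc (rg s' 5)
          else ar s'' 1 = ar s' 1 \<and> rg s'' 5 = rg s' 5) s'"
          using A i L I cs by auto
      qed simp
      show "runs L ?B s' 42 (\<lambda>s''. lst (upd s'' 20 (Suc i)) 1 (rg (upd s'' 20 (Suc i)) 5) = ?l (Suc i) \<and> rg (upd s'' 20 (Suc i)) 5 \<le> Suc i + 1)"
      proof (rule runs_mono[OF *])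
        fix s'' :: hst assume e: "if ?q mod 3 = 1 then ar s'' 1 = (ar s' 1)(rg s' 5 := ?q - 1) \<and> rg s'' 5 = Suc (rg s' 5)
          else ar s'' 1 = ar s' 1 \<and> rg s'' 5 = rg s' 5"
        have "lst (upd s'' 20 (Suc i)) 1 (rg s' 5) = lst s' 1 (rg s' 5)"
          by (rule lst_cong) (use e in \<open>auto split: if_splits\<close>)
        then show "lst (upd s'' 20 (Suc i)) 1 (rg (upd s'' 20 (Suc i)) 5) = ?l (Suc i) \<and> rg (upd s'' 20 (Suc i)) 5 \<le> Suc i + 1"
          using e I by (auto split: if_splits)
      qed simp
    next
      have "(cs + 1) * 50 \<le> (m + 1) * 50" using cs by (intro mult_le_mono1) simp
      then show "(cs + 1) * (42 + 7 + hcost (Var 14)) \<le> 50 * (m + 1)" by simp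
    qed (use A1 1 L cs in \<open>auto simp: frm_def lst_def\<close>)
  qed simp
qed (use L in auto)

lemma zeros:
  assumes wf: "wf_str T m" and xs: "sorted_wrt (suffix_less T) xs" "set xs = {i. i < m \<and> i mod 3 \<noteq> 0}"
    and zs: "zs = (if m mod 3 = 1 then [m - 1] else []) @ map (\<lambda>i. i - 1) (filter (\<lambda>i. i mod 3 = 1) xs)"
  shows "sorted_wrt (\<lambda>x y. suffix_less T (x + 1) (y + 1)) zs" "set zs = {i. i < m \<and> i mod 3 = 0}"
proof -
  have pos: "Suc (i - 1) = i" if "i mod 3 = 1" for i :: nat using that by (cases i) auto
  have "sorted_wrt (suffix_less T) (filter (\<lambda>i. i mod 3 = 1) xs)" using xs(1) by (rule sorted_wrt_filter)
  then have "sorted_wrt (\<lambda>x y. suffix_less T (x + 1) (y + 1)) (map (\<lambda>i. i - 1) (filter (\<lambda>i. i mod 3 = 1) xs))"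
    unfolding sorted_wrt_map by (rule sorted_wrt_set_mono) (auto simp: pos)
  moreover have "suffix_less T m y" if "y \<in> set xs" for y
    using that suffix_less_zero(2)[OF wf order_refl, of y] xs(2) by auto
  moreover have "Suc (m - Suc 0) = m" if "m mod 3 = 1" using pos that by simp
  ultimately show "sorted_wrt (\<lambda>x y. suffix_less T (x + 1) (y + 1)) zs"
    unfolding zs by (auto simp: pos)
  show "set zs = {i. i < m \<and> i mod 3 = 0}"
  proof (intro set_eqI iffI)
    fix i assume "i \<in> set zs"
    then consider "m mod 3 = 1" "i = m - 1" | j where "j < m" "j mod 3 = 1" "i = j - 1"
      unfolding zs using xs(2) by (auto split: if_splits)
    then show "i \<in> {i. i < m \<and> i mod 3 = 0}"
    proof cases
      case 1
      then have m: "m = 3 * (m div 3) + 1" by presburger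
      then have "i = 3 * (m div 3)" using 1 by simp
      then show ?thesis using m by auto
    next
      case 2
      then have m: "j = 3 * (j div 3) + 1" by presburger
      then have "i = 3 * (j div 3)" using 2 by simp
      then show ?thesis using 2 m by auto
    qed
  next
    fix i assume "i \<in> {i. i < m \<and> i mod 3 = 0}"
    then have i: "i < m" "i mod 3 = 0" by auto
    then have "(i + 1) mod 3 = 1" by presburger
    show "i \<in> set zs"
    proof (cases "i + 1 < m")
      case True
      then have "i + 1 \<in> set (filter (\<lambda>i. i mod 3 = 1) xs)" using xs(2) \<open>(i + 1) mod 3 = 1\<close> by auto
      then have "i + 1 - 1 \<in> set (map (\<lambda>i. i - 1) (filter (\<lambda>i. i mod 3 = 1) xs))"
        unfolding set_map by (rule imageI)
      then show ?thesis by (simp add: zs)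
    next
      case False
      then have "m = i + 1" using i by simp
      then show ?thesis using \<open>(i + 1) mod 3 = 1\<close> by (simp add: zs)
    qed
  qed
qed

text \<open>The positions arrive ordered by the suffix one place later. A stable sort by triple name
  completes this to the suffix order, as equal names imply equal first letters.\<close>

definition sort_zeros :: hcmd where
  "sort_zeros = For 20 (Var 7) (Put 2 (Var 20) (Arr 6 (Bin Add (Var 8) (Var 20)))) ;; Upd 6 (plus1 (Var 7)) ;; csort"

lemma mod_sort_zeros [simp]: "modr sort_zeros = {6,20,21,22}" "moda sort_zeros = {1,2,3,4}"
  by (auto simp: sort_zeros_def)

lemma runs_sort_zeros:
  assumes r: "rg s 7 = m" "rg s 8 = off" "rg s 5 = cz" and N: "\<And>i. i < m \<Longrightarrow> ar s 6 (off + i) = nm i" and nm: "names (trip T) m nm"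
    and P: "set (lst s 1 cz) = {i. i < m \<and> i mod 3 = 0}" "sorted_wrt (\<lambda>x y. suffix_less T (x + 1) (y + 1)) (lst s 1 cz)"
    and cz: "cz \<le> m" and L: "off + m + 20 < L"
  shows "runs L sort_zeros s (300 * (m + 3)) (\<lambda>s'. set (lst s' 1 cz) = {i. i < m \<and> i mod 3 = 0} \<and> sorted_wrt (suffix_less T) (lst s' 1 cz))"
  unfolding sort_zeros_def
proof (rule runs_HSeq)
  let ?P = "For 20 (Var 7) (Put 2 (Var 20) (Arr 6 (Bin Add (Var 8) (Var 20))))"
  let ?R = "\<lambda>s'. set (lst s' 1 cz) = {i. i < m \<and> i mod 3 = 0} \<and> sorted_wrt (suffix_less T) (lst s' 1 cz)"
  show "runs L ?P s (25 * (m + 1)) (\<lambda>s'. \<forall>i<m. ar s' 2 i = nm i)"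
    by (rule runs_For[where n = m and c = 15 and I = "\<lambda>k s'. \<forall>i<k. ar s' 2 i = nm i"])
      (use r L N in \<open>auto simp: frm_def less_Suc_eq intro!: runs_wp\<close>)
  fix s1 assume f1: "frm ?P s s1" and 1: "\<forall>i<m. ar s1 2 i = nm i"
  have A1: "rg s1 5 = cz" "rg s1 7 = m" "ar s1 1 = ar s 1" using f1 r by (simp_all add: frm_def)
  let ?s = "upd s1 6 (hev s1 (plus1 (Var 7)))"
  have Pm: "ar s 1 k < m" if "k < cz" for k using P(1) that unfolding set_lst by blast
  have PL: "ar s 1 k < L" if "k < cz" for k using Pm[OF that] L by simp
  have nb: "nm i < m + 1" if "i < m" for i using nm that by (auto simp: names_def less_Suc_eq_le)
  have l: "lst ?s 1 cz = lst s 1 cz" using A1 by (simp add: lst_def)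
  show "runs L (Upd 6 (plus1 (Var 7)) ;; csort) s1 (10 + 120 * (cz + (m + 1) + 2)) ?R"
  proof (rule runs_Upd_HSeq)
    show "runs L csort ?s (120 * (cz + (m + 1) + 2)) ?R"
    proof (rule runs_mono[OF runs_csort[where q = cz and B = "m + 1"]])
      fix s' assume 2: "sorts_to (ar ?s 2) (lst ?s 1 cz) (lst s' 1 cz)"
      have st: "set (lst s' 1 cz) = {i. i < m \<and> i mod 3 = 0}" using set_sorts_to[OF 2] P l by simp
      have "sorted_wrt (\<lambda>x y. ar ?s 2 x < ar ?s 2 y \<or> ar ?s 2 x = ar ?s 2 y \<and> suffix_less T (x + 1) (y + 1)) (lst s' 1 cz)"
        using 2 P(2) unfolding sorts_to_def l by blast
      then have "sorted_wrt (suffix_less T) (lst s' 1 cz)"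
      proof (rule sorted_wrt_set_mono)
        fix x y assume "x \<in> set (lst s' 1 cz)" "y \<in> set (lst s' 1 cz)"
          and *: "ar ?s 2 x < ar ?s 2 y \<or> ar ?s 2 x = ar ?s 2 y \<and> suffix_less T (x + 1) (y + 1)"
        then have "x < m" "y < m" using st by auto
        then show "suffix_less T x y" using * 1 suffix_less_names[OF nm, of x y 1] by auto
      qed
      with st show "?R s'" by blast
    qed (use A1 PL L 1 Pm nb cz in auto)
  qed (use A1 L in auto)
qed (use cz in simp)

section \<open>Merging the two classes of suffixes\<close>

definition merge_inv :: "(nat \<Rightarrow> nat) \<Rightarrow> nat list \<Rightarrow> nat list \<Rightarrow> nat list \<Rightarrow> nat \<Rightarrow> nat \<Rightarrow> bool" where
  "merge_inv T ss zs out a b \<longleftrightarrow> sorted_wrt (suffix_less T) out \<and> a \<le> length ss \<and> b \<le> length zs \<and>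
     set out = set (take a ss) \<union> set (take b zs) \<and>
     (\<forall>x\<in>set out. \<forall>y\<in>set (drop a ss) \<union> set (drop b zs). suffix_less T x y) \<and> length out = a + b"

lemma merge_inv_sym: "merge_inv T ss zs out a b \<Longrightarrow> merge_inv T zs ss out b a"
  by (auto simp: merge_inv_def)

lemma merge_inv_step:
  assumes inv: "merge_inv T ss zs out a b" and a: "a < length ss" and srt: "sorted_wrt (suffix_less T) ss" "sorted_wrt (suffix_less T) zs"
    and le: "b < length zs \<Longrightarrow> suffix_less T (ss ! a) (zs ! b)"
  shows "merge_inv T ss zs (out @ [ss ! a]) (Suc a) b"
proof -
  have d: "drop a ss = ss ! a # drop (Suc a) ss" using a by (simp add: Cons_nth_drop_Suc)
  have "sorted_wrt (suffix_less T) (drop a ss)" using srt(1) by (rule sorted_wrt_drop)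
  then have 1: "suffix_less T (ss ! a) y" if "y \<in> set (drop (Suc a) ss)" for y using d that by auto
  have 2: "suffix_less T (ss ! a) y" if y: "y \<in> set (drop b zs)" for y
  proof -
    have b: "b < length zs" using y by (cases "b < length zs") auto
    then have dz: "drop b zs = zs ! b # drop (Suc b) zs" by (simp add: Cons_nth_drop_Suc)
    have "sorted_wrt (suffix_less T) (drop b zs)" using srt(2) by (rule sorted_wrt_drop)
    then have "y = zs ! b \<or> suffix_less T (zs ! b) y" using dz y by auto
    then show ?thesis using le[OF b] suffix_less_trans by blast
  qed
  show ?thesis using inv a 1 2 d unfolding merge_inv_def
    by (auto simp: sorted_wrt_append take_Suc_conv_app_nth)
qed

text \<open>A sample \<open>x\<close> and a multiple of three \<open>z\<close> are compared by name
  and then by rank at offset \<open>x mod 3\<close>, held in register 23: with this offset neither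
  of the two places is a multiple of three, so both ranks are in array 11. Register 17 receives the
  decision.\<close>

definition merge_step :: hcmd where
  "merge_step = Upd 17 (Bin Less (Var 15) (Var 14)) ;;
     HIf (Bin Mult (Var 17) (Bin Less (Var 16) (Var 5)))
       (Upd 21 (Arr 12 (Var 15)) ;; Upd 22 (Arr 1 (Var 16)) ;; Upd 23 (Bin Mod (Var 21) (Cst 3)) ;;
        Upd 17 (Bin Add (Bin Less (Arr 6 (Bin Add (Var 8) (Var 21))) (Arr 6 (Bin Add (Var 8) (Var 22))))
           (Bin Mult (Bin Eq (Arr 6 (Bin Add (Var 8) (Var 21))) (Arr 6 (Bin Add (Var 8) (Var 22))))
              (Bin Less (Arr 11 (Bin Add (Var 21) (Var 23))) (Arr 11 (Bin Add (Var 22) (Var 23))))))) HSkip ;;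
     HIf (Var 17) (Put 10 (Var 20) (Arr 12 (Var 15)) ;; Upd 15 (plus1 (Var 15)))
       (Put 10 (Var 20) (Arr 1 (Var 16)) ;; Upd 16 (plus1 (Var 16)))"

definition merge_sorted :: hcmd where
  "merge_sorted = (Upd 15 (Cst 0) ;; Upd 16 (Cst 0)) ;; For 20 (Var 7) merge_step"

lemma mod_merge_sorted [simp]: "modr merge_step = {15,16,17,21,22,23}" "moda merge_step = {10}"
   "modr merge_sorted = {15,16,17,20,21,22,23}" "moda merge_sorted = {10}"
  by (auto simp: merge_sorted_def merge_step_def)

lemma runs_merge_step:
  assumes r: "rg s 8 = off" "rg s 14 = cs" "rg s 5 = cz" "rg s 15 = a" "rg s 16 = b" "rg s 20 = k"
    and N: "\<And>i. i < m \<Longrightarrow> ar s 6 (off + i) = nm i" and nm: "names (trip T) m nm"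
    and RS: "\<And>i j. i < m + 3 \<Longrightarrow> j < m + 3 \<Longrightarrow> i mod 3 \<noteq> 0 \<Longrightarrow> j mod 3 \<noteq> 0 \<Longrightarrow> ar s 11 i < ar s 11 j \<longleftrightarrow> suffix_less T i j"
    and ss: "a < cs \<Longrightarrow> ar s 12 a < m \<and> ar s 12 a mod 3 \<noteq> 0" and zs: "b < cz \<Longrightarrow> ar s 1 b < m \<and> ar s 1 b mod 3 = 0"
    and L: "off + m + 20 < L" "a < m" "b < m" "k < m"
  shows "runs L merge_step s 200 (\<lambda>s'. if a < cs \<and> (b < cz \<longrightarrow> suffix_less T (ar s 12 a) (ar s 1 b))
     then ar s' 10 = (ar s 10)(k := ar s 12 a) \<and> rg s' 15 = Suc a \<and> rg s' 16 = b
     else ar s' 10 = (ar s 10)(k := ar s 1 b) \<and> rg s' 15 = a \<and> rg s' 16 = Suc b)"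
proof -
  define d where "d = ar s 12 a mod 3"
  define x where "x = ar s 12 a"
  define z where "z = ar s 1 b"
  have cmp: "suffix_less T x z \<longleftrightarrow> nm x < nm z \<or> nm x = nm z \<and> ar s 11 (x + d) < ar s 11 (z + d)" if "a < cs" "b < cz"
  proof -
    have x: "x < m" "x mod 3 \<noteq> 0" and z: "z < m" "z mod 3 = 0" using ss zs that by (auto simp: x_def z_def)
    have d3: "d < 3" "d = x mod 3" by (auto simp: d_def x_def)
    then have "d = 1 \<or> d = 2" using x by linarith
    moreover have "(x + d) mod 3 = (d + d) mod 3" "(z + d) mod 3 = d mod 3"
      using d3 z by (auto simp: mod_simps)
    ultimately have "(x + d) mod 3 \<noteq> 0" "(z + d) mod 3 \<noteq> 0" by auto
    then have "ar s 11 (x + d) < ar s 11 (z + d) \<longleftrightarrow> suffix_less T (x + d) (z + d)" using RS x z d3 by simp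
    then show ?thesis using suffix_less_names[OF nm x(1) z(1), of d] d3 by simp
  qed
  have dm: "ar s 12 a mod 3 < 3" by simp
  show ?thesis unfolding merge_step_def
  proof (rule runs_wp, goal_cases)
    case 1
    show ?case
    proof (cases "a < cs \<and> b < cz")
      case True
      then have "ar s 12 a + ar s 12 a mod 3 < L" "ar s 1 b + ar s 12 a mod 3 < L"
        using dm ss zs L by linarith+
      then show ?thesis using True r L ss zs cmp N by (simp add: x_def z_def d_def)
    next
      case False
      then show ?thesis using r L by auto
    qed
  qed simp
qed

lemma runs_merge_sorted:
  assumes r: "rg s 7 = m" "rg s 8 = off" "rg s 14 = cs" "rg s 5 = cz"
    and N: "\<And>i. i < m \<Longrightarrow> ar s 6 (off + i) = nm i" and nm: "names (trip T) m nm" and wf: "wf_str T m"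
    and RS: "\<And>i j. i < m + 3 \<Longrightarrow> j < m + 3 \<Longrightarrow> i mod 3 \<noteq> 0 \<Longrightarrow> j mod 3 \<noteq> 0 \<Longrightarrow> ar s 11 i < ar s 11 j \<longleftrightarrow> suffix_less T i j"
    and ss: "set (lst s 12 cs) = {i. i < m \<and> i mod 3 \<noteq> 0}" "sorted_wrt (suffix_less T) (lst s 12 cs)"
    and zs: "set (lst s 1 cz) = {i. i < m \<and> i mod 3 = 0}" "sorted_wrt (suffix_less T) (lst s 1 cz)"
    and cnt: "cs + cz = m" and L: "off + m + 20 < L"
  shows "runs L merge_sorted s (220 * (m + 1)) (\<lambda>s'. set (lst s' 10 m) = {..<m} \<and> sorted_wrt (suffix_less T) (lst s' 10 m))"
proof -
  let ?ss = "lst s 12 cs" and ?zs = "lst s 1 cz"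
  let ?I = "\<lambda>k s'. merge_inv T ?ss ?zs (lst s' 10 k) (rg s' 15) (rg s' 16)"
  let ?R = "\<lambda>s'. set (lst s' 10 m) = {..<m} \<and> sorted_wrt (suffix_less T) (lst s' 10 m)"
  let ?s = "s\<lparr>rg := (rg s)(15 := 0, 16 := 0)\<rparr>"
  have S: "ar s 12 a < m \<and> ar s 12 a mod 3 \<noteq> 0" if "a < cs" for a using ss(1) that unfolding set_lst by blast
  have Z: "ar s 1 b < m \<and> ar s 1 b mod 3 = 0" if "b < cz" for b using zs(1) that unfolding set_lst by blast
  have z0: "lst s' a 0 = []" for s' a by (simp add: lst_def)
  have "runs L (For 20 (Var 7) merge_step) ?s (208 * (m + 1)) ?R"
  proof (rule runs_For[where n = m and c = 200 and I = ?I])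
    fix k s' assume k: "k < m" "rg s' 20 = k" and I: "?I k s'" and f: "frm (For 20 (Var 7) merge_step) ?s s'"
    have A: "rg s' 7 = m" "rg s' 8 = off" "rg s' 14 = cs" "rg s' 5 = cz" "ar s' 6 = ar s 6" "ar s' 11 = ar s 11"
      "ar s' 12 = ar s 12" "ar s' 1 = ar s 1" using f r by (simp_all add: frm_def)
    define a b where "a = rg s' 15" and "b = rg s' 16"
    have I': "merge_inv T ?ss ?zs (lst s' 10 k) a b" using I by (simp add: a_def b_def)
    have ab: "a \<le> cs" "b \<le> cz" "a + b = k" using I' by (auto simp: merge_inv_def)
    show "runs L merge_step s' 200 (\<lambda>s''. ?I (Suc k) (upd s'' 20 (Suc k)))"
    proof (rule runs_mono[OF runs_merge_step[where s = s' and off = off and cs = cs and cz = cz and a = a and b = b and k = k and m = m and nm = nm and T = T]])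
      fix s'' :: hst assume e: "if a < cs \<and> (b < cz \<longrightarrow> suffix_less T (ar s' 12 a) (ar s' 1 b))
        then ar s'' 10 = (ar s' 10)(k := ar s' 12 a) \<and> rg s'' 15 = Suc a \<and> rg s'' 16 = b
        else ar s'' 10 = (ar s' 10)(k := ar s' 1 b) \<and> rg s'' 15 = a \<and> rg s'' 16 = Suc b"
      have l: "lst (upd s'' 20 (Suc k)) 10 k = lst s' 10 k"
        by (rule lst_cong) (use e in \<open>auto split: if_splits\<close>)
      show "?I (Suc k) (upd s'' 20 (Suc k))"
      proof (cases "a < cs \<and> (b < cz \<longrightarrow> suffix_less T (ar s 12 a) (ar s 1 b))")
        case True
        then have "merge_inv T ?ss ?zs (lst s' 10 k @ [?ss ! a]) (Suc a) b"
          by (intro merge_inv_step[OF I' _ ss(2) zs(2)]) auto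
        then show ?thesis using True e l A by simp
      next
        case False
        then have b: "b < cz" using ab cnt k by linarith
        have le: "suffix_less T (ar s 1 b) (ar s 12 a)" if "a < cs"
        proof -
          have "ar s 1 b \<noteq> ar s 12 a" using S[OF that] Z[OF b] by metis
          then show ?thesis using suffix_less_total[OF wf, of "ar s 1 b" "ar s 12 a"] Z[OF b] False that b by blast
        qed
        have "merge_inv T ?zs ?ss (lst s' 10 k @ [?zs ! b]) (Suc b) a"
          by (rule merge_inv_step[OF merge_inv_sym[OF I'] _ zs(2) ss(2)]) (use b le in auto)
        then have "merge_inv T ?ss ?zs (lst s' 10 k @ [?zs ! b]) a (Suc b)" by (rule merge_inv_sym)
        then show ?thesis using False e l A b by simp
      qed
    qed (use A k ab N nm RS S Z L in \<open>auto simp: a_def b_def\<close>)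
  next
    fix s' :: hst assume I: "?I m s'"
    then have "rg s' 15 \<le> cs" "rg s' 16 \<le> cz" "m = rg s' 15 + rg s' 16" unfolding merge_inv_def by simp_all
    then have ab: "rg s' 15 = cs" "rg s' 16 = cz" using cnt by linarith+
    from I have srt: "sorted_wrt (suffix_less T) (lst s' 10 m)"
      and "set (lst s' 10 m) = set (take (rg s' 15) ?ss) \<union> set (take (rg s' 16) ?zs)" unfolding merge_inv_def by blast+
    moreover have "take cs ?ss = ?ss" "take cz ?zs = ?zs" by simp_all
    ultimately have "set (lst s' 10 m) = {i. i < m \<and> i mod 3 \<noteq> 0} \<union> {i. i < m \<and> i mod 3 = 0}"
      by (simp only: ab ss zs)
    also have "\<dots> = {..<m}" by auto
    finally show "?R s'" using srt by blast
  qed (use r L z0 in \<open>auto simp: frm_def merge_inv_def\<close>)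
  then show ?thesis
    unfolding merge_sorted_def using L
    by (intro runs_wp_HSeq[where ?t2.0 = "208 * (m + 1)"]) auto
qed

definition invert_order :: hcmd where
  "invert_order = For 20 (Var 7) (Put 9 (Arr 10 (Var 20)) (plus1 (Var 20)))"

lemma mod_invert_order [simp]: "modr invert_order = {20}" "moda invert_order = {9}"
  by (auto simp: invert_order_def)

lemma distinct_lst: "set (lst s a m) = {..<m} \<Longrightarrow> distinct (lst s a m)"
  by (rule card_distinct) simp

lemma runs_invert_order:
  assumes r: "rg s 7 = m" and SA: "set (lst s 10 m) = {..<m}" "sorted_wrt (suffix_less T) (lst s 10 m)" and L: "m + 20 < L"
  shows "runs L invert_order s (30 * (m + 1)) (ranked T m)"
  unfolding invert_order_def
proof (rule runs_For[where n = m and c = 20 and I = "\<lambda>i s'. \<forall>k<i. ar s' 9 (ar s 10 k) = k + 1"])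
  let ?B = "Put 9 (Arr 10 (Var 20)) (plus1 (Var 20))"
  have S: "ar s 10 a < m" if "a < m" for a using SA(1) that unfolding set_lst by blast
  fix i s' assume i: "i < m" "rg s' 20 = i" and I: "\<forall>k<i. ar s' 9 (ar s 10 k) = k + 1" and f: "frm (For 20 (Var 7) ?B) s s'"
  have A: "ar s' 10 = ar s 10" using f by (simp add: frm_def)
  have ne: "ar s 10 k = ar s 10 i \<longleftrightarrow> k = i" if "k < Suc i" for k
    using distinct_conv_nth[of "lst s 10 m"] distinct_lst[OF SA(1)] that i by (cases "k = i") auto
  show "runs L ?B s' 20 (\<lambda>s''. \<forall>k<Suc i. ar (upd s'' 20 (Suc i)) 9 (ar s 10 k) = k + 1)"
    by (rule runs_wp) (use i I A L S[OF i(1)] ne in \<open>auto simp: less_Suc_eq\<close>)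
next
  let ?B = "Put 9 (Arr 10 (Var 20)) (plus1 (Var 20))"
  fix s' assume "\<forall>k<m. ar s' 9 (ar s 10 k) = k + 1" and f: "frm (For 20 (Var 7) ?B) s s'"
  moreover have "ar s' 10 = ar s 10" "lst s' 10 m = lst s 10 m" using f by (simp_all add: frm_def lst_def)
  ultimately show "ranked T m s'" using SA by (simp add: ranked_def)
qed (use r L in \<open>auto simp: frm_def\<close>)

definition up_body :: hcmd where
  "up_body = (Upd 9 (Bin Sub (Var 9) (Cst 1)) ;; Upd 13 (Var 7) ;; Upd 8 (Arr 7 (Var 9)) ;; Upd 7 (Arr 8 (Var 9)) ;;
     Upd 11 (Bin Div (plus1 (Var 7)) (Cst 3)) ;; Upd 12 (Bin Div (Var 7) (Cst 3))) ;;
     sample_ranks ;; sample_order ;; collect_zeros ;; sort_zeros ;; merge_sorted ;; invert_order"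

lemma mod_up_body [simp]: "modr up_body = {5,6,7,8,9,11,12,13,14,15,16,17,20,21,22,23}"
  "moda up_body = {1,2,3,4,9,10,11,12}"
  by (auto simp: up_body_def)

lemma runs_up_rest:
  assumes r: "rg s 7 = m" "rg s 8 = off" "rg s 11 = n1 m" "rg s 12 = n2 m" "rg s 13 = nextm m"
    and m: "3 < m" and wf: "wf_str T m" and nm: "names (trip T) m nm" and N: "\<And>i. i < m \<Longrightarrow> ar s 6 (off + i) = nm i"
    and R: "ranked (nextT nm m) (nextm m) s" and L: "off + 3 * m + 30 < L"
  shows "runs L (sample_ranks ;; sample_order ;; collect_zeros ;; sort_zeros ;; merge_sorted ;; invert_order) s (1000 * (m + 1)) (ranked T m)"
proof -
  let ?A = "\<lambda>s'. rg s' 7 = m \<and> rg s' 8 = off \<and> ar s' 6 = ar s 6"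
  define xs where "xs = map (dx m) (filter (\<lambda>q. q \<noteq> n1 m) (lst s 10 (nextm m)))"
  define zs where "zs = (if m mod 3 = 1 then [m - 1] else []) @ map (\<lambda>i. i - 1) (filter (\<lambda>i. i mod 3 = 1) xs)"
  note xs = samples[OF wf nm R xs_def]
  note zs = zeros[OF wf xs zs_def]
  \<comment> \<open>A list sorted by an irreflexive relation has no repetitions; this turns the
    sizes of the two residue classes into list lengths.\<close>
  have dist: "distinct l" if "sorted_wrt (\<lambda>x y. suffix_less T (x + d) (y + d)) l" for l d
    using that by (induction l) auto
  have cnt: "length xs + length zs = m"
  proof -
    have "card (set xs \<union> set zs) = card (set xs) + card (set zs)" by (rule card_Un_disjoint) (auto simp: xs zs)
    also have "set xs \<union> set zs = {..<m}" using xs zs by auto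
    finally show ?thesis using distinct_card[of xs] distinct_card[of zs] dist[of 0 xs] dist[of 1 zs] xs zs by simp
  qed
  define RS where "RS i = (if i < m then ar s 9 (ix m i) else 0)" for i
  have SA: "ar s 10 k < nextm m" if "k < nextm m" for k
    using R that unfolding ranked_def set_lst by blast
  have "runs L (sample_ranks ;; sample_order ;; collect_zeros ;; sort_zeros ;; merge_sorted ;; invert_order) s (80 * (m + 1) + (90 * (m + 3) + (60 * (m + 2) + (300 * (m + 3) + (220 * (m + 1) + 30 * (m + 1)))))) (ranked T m)"
  proof (rule runs_HSeq[OF runs_sample_ranks[OF r(1,3,4) m]])
    fix s1 assume f1: "frm sample_ranks s s1" and 1: "(\<forall>i<m. i mod 3 \<noteq> 0 \<longrightarrow> ar s1 11 i = ar s 9 (ix m i)) \<and> (\<forall>i<3. ar s1 11 (m + i) = 0)"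
    have A1: "?A s1" "rg s1 11 = n1 m" "rg s1 13 = nextm m" "ar s1 10 = ar s 10" using f1 r by (simp_all add: frm_def)
    have RS: "ar s1 11 i < ar s1 11 j \<longleftrightarrow> suffix_less T i j" if "i < m + 3" "j < m + 3" "i mod 3 \<noteq> 0" "j mod 3 \<noteq> 0" for i j
      by (rule RS_less[OF wf nm R]) (use 1 that in auto)
    have l1: "lst s1 10 (nextm m) = lst s 10 (nextm m)" using A1 by (simp add: lst_def)
    show "runs L (sample_order ;; collect_zeros ;; sort_zeros ;; merge_sorted ;; invert_order) s1 (90 * (m + 3) + (60 * (m + 2) + (300 * (m + 3) + (220 * (m + 1) + 30 * (m + 1))))) (ranked T m)"
    proof (rule runs_HSeq[OF runs_sample_order[OF A1(2,3)]])
      fix s2 assume f2: "frm sample_order s1 s2" and "lst s2 12 (rg s2 14) = map (dx m) (filter (\<lambda>q. q \<noteq> n1 m) (lst s1 10 (nextm m)))"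
      then have 2: "lst s2 12 (rg s2 14) = xs" by (simp add: xs_def l1)
      then have c14: "rg s2 14 = length xs" by (metis length_lst)
      have A2: "?A s2" "ar s2 11 = ar s1 11" using f2 A1 by (simp_all add: frm_def)
      have SS: "ar s2 12 k < m" if "k < length xs" for k
      proof -
        have "ar s2 12 k \<in> set (lst s2 12 (rg s2 14))" using that by (simp add: set_lst c14)
        then have "ar s2 12 k \<in> set xs" unfolding 2 .
        then show ?thesis using xs by auto
      qed
      show "runs L (collect_zeros ;; sort_zeros ;; merge_sorted ;; invert_order) s2 (60 * (m + 2) + (300 * (m + 3) + (220 * (m + 1) + 30 * (m + 1)))) (ranked T m)"
      proof (rule runs_HSeq[OF runs_collect_zeros[OF _ c14]])
        fix s3 assume f3: "frm collect_zeros s2 s3" and "lst s3 1 (rg s3 5) = (if m mod 3 = 1 then [m - 1] else []) @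
          map (\<lambda>i. i - 1) (filter (\<lambda>i. i mod 3 = 1) (lst s2 12 (length xs)))"
        then have 3: "lst s3 1 (rg s3 5) = zs" using 2 c14 by (simp add: zs_def)
        then have c5: "rg s3 5 = length zs" by (metis length_lst)
        have A3: "?A s3" "ar s3 11 = ar s1 11" "ar s3 12 = ar s2 12" "rg s3 14 = length xs" using f3 A2 c14 by (simp_all add: frm_def)
        show "runs L (sort_zeros ;; merge_sorted ;; invert_order) s3 (300 * (m + 3) + (220 * (m + 1) + 30 * (m + 1))) (ranked T m)"
        proof (rule runs_HSeq[OF runs_sort_zeros[where nm = nm and T = T and m = m and off = off and cz = "length zs"]])
          fix s4 assume f4: "frm sort_zeros s3 s4" and 4: "set (lst s4 1 (length zs)) = {i. i < m \<and> i mod 3 = 0} \<and> sorted_wrt (suffix_less T) (lst s4 1 (length zs))"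
          have A4: "?A s4" "ar s4 11 = ar s1 11" "ar s4 12 = ar s2 12" "rg s4 14 = length xs" "rg s4 5 = length zs"
            using f4 A3 c5 by (simp_all add: frm_def)
          have l4: "lst s4 12 (length xs) = xs" using A4 2 c14 by (simp add: lst_def)
          show "runs L (merge_sorted ;; invert_order) s4 (220 * (m + 1) + 30 * (m + 1)) (ranked T m)"
          proof (rule runs_HSeq[OF runs_merge_sorted[where nm = nm and T = T and m = m and off = off and cz = "length zs" and cs = "length xs"]])
            fix s5 assume f5: "frm merge_sorted s4 s5" and 5: "set (lst s5 10 m) = {..<m} \<and> sorted_wrt (suffix_less T) (lst s5 10 m)"
            have "rg s5 7 = m" using f5 A4 by (simp add: frm_def)
            then show "runs L invert_order s5 (30 * (m + 1)) (ranked T m)"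
              using 5 L by (intro runs_invert_order) auto
          qed (use A4 RS N nm wf l4 xs 4 cnt L in auto)
        qed (use A3 c5 3 zs N nm cnt L in auto)
      qed (use A2 SS cnt L in auto)
    qed (use A1 SA L in auto)
  qed (use L in auto)
  then show ?thesis by (rule runs_mono) (use m in auto)
qed

lemma runs_up_body:
  assumes r: "rg s 7 = nextm m" "ar s 7 (rg s 9 - 1) = off" "ar s 8 (rg s 9 - 1) = m" "0 < rg s 9" "rg s 9 < L"
    and m: "3 < m" and wf: "wf_str T m" and nm: "names (trip T) m nm" and N: "\<And>i. i < m \<Longrightarrow> ar s 6 (off + i) = nm i"
    and R: "ranked (nextT nm m) (nextm m) s" and L: "off + 3 * m + 30 < L"
  shows "runs L up_body s (1100 * (m + 1)) (\<lambda>s'. ranked T m s' \<and> rg s' 7 = m \<and> rg s' 9 = rg s 9 - 1)"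
proof -
  let ?s = "s\<lparr>rg := (rg s)(9 := rg s 9 - 1, 13 := nextm m, 8 := off, 7 := m, 11 := n1 m, 12 := n2 m)\<rparr>"
  let ?P = "sample_ranks ;; sample_order ;; collect_zeros ;; sort_zeros ;; merge_sorted ;; invert_order"
  have R': "ranked (nextT nm m) (nextm m) ?s" using R by (simp add: ranked_def lst_def)
  have "runs L ?P ?s (1000 * (m + 1)) (ranked T m)"
    by (rule runs_up_rest[where off = off and nm = nm]) (use m wf nm N R' L in auto)
  then have "runs L ?P ?s (1100 * (m + 1) - 48) (\<lambda>s'. ranked T m s' \<and> rg s' 7 = m \<and> rg s' 9 = rg s 9 - 1)"
    by (rule runs_mono) (use m in \<open>auto simp: frm_def\<close>)
  then show ?thesis
    unfolding up_body_def using r L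
    by (intro runs_wp_HSeq[where ?t2.0 = "1100 * (m + 1) - 48"]) auto
qed

definition up :: hcmd where
  "up = base_ranks ;; HWhile (Var 9) up_body"

lemma mod_up [simp]: "modr up = {5,6,7,8,9,11,12,13,14,15,16,17,20,21,22,23}"
  "moda up = {1,2,3,4,9,10,11,12}"
  by (auto simp: up_def)

lemma runs_up:
  assumes lv: "levels M T0 Ts (ar s 6) (Suc Lv)" "\<And>l. l < Lv \<Longrightarrow> 3 < lvl_length M l" "lvl_length M Lv \<le> 3"
    and LO: "\<And>l. l \<le> Lv \<Longrightarrow> ar s 7 l = lvl_offset M l \<and> ar s 8 l = lvl_length M l"
    and r: "rg s 9 = Lv" "rg s 8 = lvl_offset M Lv" "rg s 7 = lvl_length M Lv" and L: "9 * M + 40 < L"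
  shows "runs L up s (10000 * (M + 1)) (ranked T0 M)"
  unfolding up_def
proof (rule runs_HSeq)
  have bnd: "lvl_offset M l + 6 * lvl_length M l \<le> 6 * M" "lvl_length M l + l \<le> M" if "l \<le> Lv" for l
    using lvl_offset_bound[of l M] lv(2) that by auto
  have lvl: "wf_str (Ts l) (lvl_length M l)" "names (trip (Ts l)) (lvl_length M l) (\<lambda>i. ar s 6 (lvl_offset M l + i))" if "l \<le> Lv" for l
    using lv(1) that by (auto simp: levels_def)
  have nxt: "Ts (Suc l) = nextT (\<lambda>i. ar s 6 (lvl_offset M l + i)) (lvl_length M l)" if "l < Lv" for l
    using lv(1) lv(2)[OF that] that by (auto simp: levels_def)
  show "runs L base_ranks s 200 (ranked (Ts Lv) (lvl_length M Lv))"
    by (rule runs_base_ranks[OF r(3,2) lv(3) lvl[OF order_refl]]) (use bnd[of Lv] L in auto)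
  fix s1 assume f1: "frm base_ranks s s1" and 1: "ranked (Ts Lv) (lvl_length M Lv) s1"
  have A1: "ar s1 6 = ar s 6" "ar s1 7 = ar s 7" "ar s1 8 = ar s 8" "rg s1 9 = Lv" "rg s1 7 = lvl_length M Lv"
    using f1 r by (simp_all add: frm_def)
  let ?J = "\<lambda>l s'. l \<le> Lv \<and> ranked (Ts l) (lvl_length M l) s' \<and> rg s' 9 = l \<and> rg s' 7 = lvl_length M l"
  \<comment> \<open>The time still to be spent once level \<open>l\<close> is ranked. The levels
    above the deepest one have length at least 4, so \<open>1100 * (len + 1) + 2\<close> is at most
    \<open>1400 * len\<close>.\<close>
  define S where "S l = (\<Sum>i<l. 1100 * (lvl_length M i + 1) + 2)" for l
  have S: "S l \<le> 1400 * lvl_offset M l" if "l \<le> Lv" for l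
    using that
  proof (induction l)
    case (Suc l)
    then show ?case using lv(2)[of l] by (simp add: S_def)
  qed (simp add: S_def)
  show "runs L (HWhile (Var 9) up_body) s1 (8400 * M + 2) (ranked T0 M)"
  proof (rule runs_HWhile[where I = ?J and \<Phi> = "\<lambda>l s'. S l + 2" and u = "\<lambda>l s'. 1100 * (lvl_length M (l - 1) + 1)" and g = Lv and ?s0.0 = s1])
    show "?J Lv s1" using 1 A1 by simp
    show "frm up_body s1 s1" by (simp add: frm_def)
    show "S Lv + 2 \<le> 8400 * M + 2" using S[of Lv] bnd(1)[of Lv] by simp
    fix l s' assume J: "?J l s'" and f: "frm up_body s1 s'"
    have A: "ar s' 6 = ar s 6" "ar s' 7 = ar s 7" "ar s' 8 = ar s 8" using f A1 by (simp_all add: frm_def)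
    show "hok L s' (Var 9)" by simp
    {
      assume "hev s' (Var 9) = 0"
      then show "1 + hcost (Var 9) \<le> S l + 2 \<and> ranked T0 M s'" using J lv(1) by (auto simp: levels_def)
    }
    assume "hev s' (Var 9) \<noteq> 0"
    then obtain l' where l: "l = Suc l'" "l' < Lv" using J by (cases l) auto
    show "runs L up_body s' (1100 * (lvl_length M (l - 1) + 1)) (\<lambda>s''. \<exists>g'. ?J g' s'' \<and> 1 + hcost (Var 9) + 1100 * (lvl_length M (l - 1) + 1) + (S g' + 2) \<le> S l + 2)"
    proof (rule runs_mono[OF runs_up_body[where m = "lvl_length M l'" and off = "lvl_offset M l'" and nm = "\<lambda>i. ar s 6 (lvl_offset M l' + i)" and T = "Ts l'"]])
      fix s'' assume *: "ranked (Ts l') (lvl_length M l') s'' \<and> rg s'' 7 = lvl_length M l' \<and> rg s'' 9 = rg s' 9 - 1"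
      show "\<exists>g'. ?J g' s'' \<and> 1 + hcost (Var 9) + 1100 * (lvl_length M (l - 1) + 1) + (S g' + 2) \<le> S l + 2"
        by (rule exI[of _ l']) (use * J l in \<open>simp add: S_def\<close>)
    qed (use J l A lv(2)[of l'] lvl[of l'] nxt[of l'] LO[of l'] bnd[of l'] L in auto)
  qed
qed (use L in auto)

subsection \<open>Longest common prefixes\<close>

text \<open>Meaningful for different suffixes only: for \<open>i = j\<close> there is no mismatch
  and the value is unspecified.\<close>

definition lcp :: "(nat \<Rightarrow> nat) \<Rightarrow> nat \<Rightarrow> nat \<Rightarrow> nat" where
  "lcp T i j = (LEAST k. T (i + k) \<noteq> T (j + k))"

lemma lcp_less: "k < lcp T i j \<Longrightarrow> T (i + k) = T (j + k)"
  unfolding lcp_def using not_less_Least by blast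

lemma lcp_eqI: "(\<And>l. l < k \<Longrightarrow> T (i + l) = T (j + l)) \<Longrightarrow> T (i + k) \<noteq> T (j + k) \<Longrightarrow> lcp T i j = k"
  unfolding lcp_def by (rule Least_equality) (auto simp: not_less[symmetric])

lemma lcp_sym: "lcp T i j = lcp T j i"
  by (simp add: lcp_def eq_commute)

lemma suffix_less_lcp: "suffix_less T i j \<Longrightarrow> T (i + lcp T i j) < T (j + lcp T i j)"
proof -
  assume "suffix_less T i j"
  then obtain k where k: "\<forall>l<k. T (i + l) = T (j + l)" "T (i + k) < T (j + k)" by (auto simp: suffix_less_def)
  then have "lcp T i j = k" by (intro lcp_eqI) auto
  then show ?thesis using k by simp
qed

lemma lcp_neq:
  assumes "wf_str T m" "i < m" "j < m" "i \<noteq> j"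
  shows "T (i + lcp T i j) \<noteq> T (j + lcp T i j)"
proof -
  consider "suffix_less T i j" | "suffix_less T j i" using suffix_less_total[OF assms(1), of i j] assms by auto
  then show ?thesis
  proof cases
    case 1
    then show ?thesis using suffix_less_lcp[OF 1] by simp
  next
    case 2
    then show ?thesis using suffix_less_lcp[OF 2] unfolding lcp_sym[of T j i] by simp
  qed
qed

lemma lcp_bound:
  assumes "wf_str T m" "i < m" "j < m" "i \<noteq> j"
  shows "i + lcp T i j \<le> m"
proof (rule ccontr)
  assume n: "\<not> ?thesis"
  then have k: "m - i < lcp T i j" using assms(2) by linarith
  have pos: "T x = 0 \<longleftrightarrow> m \<le> x" for x
    using \<open>wf_str T m\<close> unfolding wf_str_def by (metis not_one_le_zero not_le)
  have "T (i + (m - i)) = T (j + (m - i))" using lcp_less[OF k] .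
  moreover have "T (i + (m - i)) = 0" using pos[of "i + (m - i)"] assms(2) by linarith
  ultimately have "T (j + (m - i)) = 0" by simp
  then have "m \<le> j + (m - i)" using pos by simp
  then have ij: "i < j" using assms(4,2) by linarith
  have "m - j < lcp T i j" using k ij by linarith
  then have "T (i + (m - j)) = T (j + (m - j))" by (rule lcp_less)
  moreover have "T (j + (m - j)) = 0" using pos[of "j + (m - j)"] assms(3) by linarith
  ultimately have "T (i + (m - j)) = 0" by simp
  then have "m \<le> i + (m - j)" using pos by simp
  then show False using ij assms(3) by linarith
qed

text \<open>At the smaller of the two lengths one comparison is strict and the other is an equality
  or strict in the same direction, so the difference cannot cancel.\<close>

lemma lcp_trans:
  assumes "suffix_less T i j" "suffix_less T j k"
  shows "lcp T i k = min (lcp T i j) (lcp T j k)"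
proof (rule lcp_eqI)
  fix l assume "l < min (lcp T i j) (lcp T j k)"
  then show "T (i + l) = T (k + l)" using lcp_less[of l T i j] lcp_less[of l T j k] by simp
next
  let ?a = "lcp T i j" and ?b = "lcp T j k"
  show "T (i + min ?a ?b) \<noteq> T (k + min ?a ?b)"
  proof (cases ?a ?b rule: linorder_cases)
    case less
    then show ?thesis using suffix_less_lcp[OF assms(1)] lcp_less[of ?a T j k] by simp
  next
    case equal
    then show ?thesis using suffix_less_lcp[OF assms(1)] suffix_less_lcp[OF assms(2)] by simp
  next
    case greater
    then show ?thesis using suffix_less_lcp[OF assms(2)] lcp_less[of ?b T i j] by simp
  qed
qed

lemma lcp_Suc:
  assumes "suffix_less T i j" "0 < lcp T i j"
  shows "lcp T (Suc i) (Suc j) = lcp T i j - 1" "suffix_less T (Suc i) (Suc j)"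
proof -
  obtain k where k: "lcp T i j = Suc k" using assms(2) by (cases "lcp T i j") auto
  have 1: "T (Suc i + l) = T (Suc j + l)" if "l < k" for l using lcp_less[of "Suc l" T i j] that k by simp
  have 2: "T (Suc i + k) < T (Suc j + k)" using suffix_less_lcp[OF assms(1)] k by simp
  show "lcp T (Suc i) (Suc j) = lcp T i j - 1" using k 1 2 by (intro lcp_eqI) auto
  show "suffix_less T (Suc i) (Suc j)" unfolding suffix_less_def using 1 2 by blast
qed

lemma ranked_facts:
  assumes "ranked T m s"
  shows "\<And>k. k < m \<Longrightarrow> ar s 10 k < m" "\<And>k. k < m \<Longrightarrow> ar s 9 (ar s 10 k) = k + 1"
    "\<And>a b. a < b \<Longrightarrow> b < m \<Longrightarrow> suffix_less T (ar s 10 a) (ar s 10 b)"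
    "\<And>i. i < m \<Longrightarrow> 1 \<le> ar s 9 i \<and> ar s 9 i \<le> m \<and> ar s 10 (ar s 9 i - 1) = i"
proof -
  show 1: "ar s 10 k < m" if "k < m" for k using assms that unfolding ranked_def set_lst by blast
  show 2: "ar s 9 (ar s 10 k) = k + 1" if "k < m" for k using assms that by (simp add: ranked_def)
  show "suffix_less T (ar s 10 a) (ar s 10 b)" if "a < b" "b < m" for a b
    using assms that by (auto simp: ranked_def sorted_wrt_iff_nth_less)
  show "1 \<le> ar s 9 i \<and> ar s 9 i \<le> m \<and> ar s 10 (ar s 9 i - 1) = i" if "i < m" for i
  proof -
    have "i \<in> ar s 10 ` {..<m}" using assms that by (simp add: ranked_def set_lst)
    then obtain k where "k < m" "i = ar s 10 k" by auto
    then show ?thesis using 2[of k] by simp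
  qed
qed

section \<open>Kasai's algorithm\<close>

text \<open>The usual nested loops are flattened: a round either extends the current match by one
  character or records it and moves to the next text position with the match shortened by
  one.\<close>

definition kasai_body :: hcmd where
  "kasai_body =
     Upd 22 (Arr 9 (Var 20)) ;;
     HIf (Bin Less (Cst 1) (Var 22))
       (Upd 23 (Arr 10 (Bin Sub (Var 22) (Cst 2))) ;;
        HIf (Bin Mult (Bin Less (Bin Add (Var 20) (Var 21)) (Var 3)) (Bin Less (Bin Add (Var 23) (Var 21)) (Var 3)))
          (Upd 24 (Bin Eq (Arr 0 (Bin Add (Var 20) (Var 21))) (Arr 0 (Bin Add (Var 23) (Var 21))))) (Upd 24 (Cst 0)) ;;
        HIf (Var 24) (Upd 21 (plus1 (Var 21)))
          (Put 13 (Bin Sub (Var 22) (Cst 1)) (Var 21) ;; Upd 20 (plus1 (Var 20)) ;;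
           HIf (Var 21) (Upd 21 (Bin Sub (Var 21) (Cst 1))) HSkip))
       (Upd 20 (plus1 (Var 20)))"

definition kasai :: hcmd where
  "kasai = (Upd 20 (Cst 0) ;; Upd 21 (Cst 0)) ;; HWhile (Bin Less (Var 20) (Var 3)) kasai_body"

lemma mod_kasai [simp]: "modr kasai = {20,21,22,23,24}" "moda kasai = {13}"
  "modr kasai_body = {20,21,22,23,24}" "moda kasai_body = {13}"
  by (auto simp: kasai_def kasai_body_def)

lemma runs_kasai:
  assumes r: "rg s 3 = M" and wf: "wf_str T M" and R: "ranked T M s"
    and Z: "\<And>i j. i < M \<Longrightarrow> j < M \<Longrightarrow> ar s 0 i = ar s 0 j \<longleftrightarrow> T i = T j" and L: "2 * M + 20 < L"
  shows "runs L kasai s (600 * (M + 1))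
    (\<lambda>s'. \<forall>k. 0 < k \<and> k < M \<longrightarrow> ar s' 13 k = lcp T (ar s 10 (k - 1)) (ar s 10 k))"
proof -
  note RF = ranked_facts[OF R]
  let ?R = "ar s 9" and ?S = "ar s 10"
  let ?s = "s\<lparr>rg := (rg s)(20 := 0, 21 := 0)\<rparr>"
  define J where "J s' \<longleftrightarrow> rg s' 20 \<le> M \<and> rg s' 20 + rg s' 21 \<le> M \<and>
    (\<forall>i<rg s' 20. 1 < ?R i \<longrightarrow> ar s' 13 (?R i - 1) = lcp T (?S (?R i - 2)) i) \<and>
    (rg s' 20 < M \<longrightarrow> (if 1 < ?R (rg s' 20) then rg s' 21 \<le> lcp T (?S (?R (rg s' 20) - 2)) (rg s' 20) else rg s' 21 = 0))" for s' :: hst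
  let ?Q = "\<lambda>s'. \<forall>k. 0 < k \<and> k < M \<longrightarrow> ar s' 13 k = lcp T (?S (k - 1)) (?S k)"
  \<comment> \<open>Moving to the next position gains two units and returns at most one for the
    shortened match; extending the match gains one.\<close>
  define \<Phi> where "\<Phi> s' = 160 * (2 * (M - rg s' 20) + (M - rg s' 21)) + 4" for s' :: hst
  have pred: "?S (?R i - 2) < M" "suffix_less T (?S (?R i - 2)) i" "?S (?R i - 2) \<noteq> i" if "i < M" "1 < ?R i" for i
  proof -
    have i: "?S (?R i - 1) = i" "?R i \<le> M" using RF(4)[OF that(1)] by auto
    show "?S (?R i - 2) < M" by (rule RF(1)) (use i that in linarith)
    have "suffix_less T (?S (?R i - 2)) (?S (?R i - 1))" by (rule RF(3)) (use i that in linarith)+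
    then show "suffix_less T (?S (?R i - 2)) i" using i by simp
    then show "?S (?R i - 2) \<noteq> i" by auto
  qed
  \<comment> \<open>If the match is at least 2, the predecessor moved on by one letter still
    precedes \<open>Suc i\<close> and shares \<open>h - 1\<close> letters with it. The immediate
    predecessor of \<open>Suc i\<close> lies at or after that suffix, so by \<open>lcp_trans\<close>
    it shares at least as many.\<close>
  have nxt: "if 1 < ?R (Suc i) then h - 1 \<le> lcp T (?S (?R (Suc i) - 2)) (Suc i) else h - 1 = 0"
    if i: "Suc i < M" "1 < ?R i" and h: "h = lcp T (?S (?R i - 2)) i" for i h
  proof (cases "h - 1 = 0")
    case False
    let ?j = "?S (?R i - 2)"
    have i': "i < M" using i by simp
    note p = pred[OF i' i(2)]
    have h2: "2 \<le> lcp T ?j i" using False h by simp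
    have j: "Suc ?j < M" using lcp_bound[OF wf p(1) i' p(3)] h2 by linarith
    have l: "lcp T (Suc ?j) (Suc i) = h - 1" "suffix_less T (Suc ?j) (Suc i)"
      using lcp_Suc[OF p(2)] h2 h by auto
    have rl: "?R (Suc ?j) < ?R (Suc i)" using ranked_less(1)[OF R j i(1)] l(2) by simp
    have r1: "1 \<le> ?R (Suc ?j)" "?S (?R (Suc ?j) - 1) = Suc ?j" using RF(4)[OF j] by auto
    have r2: "?R (Suc i) \<le> M" using RF(4)[OF i(1)] by auto
    have "h - 1 \<le> lcp T (?S (?R (Suc i) - 2)) (Suc i)"
    proof (cases "?R (Suc ?j) - 1 = ?R (Suc i) - 2")
      case True
      then show ?thesis using r1 l by simp
    next
      case False
      then have "?R (Suc ?j) - 1 < ?R (Suc i) - 2" using rl r1 by linarith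
      then have "suffix_less T (?S (?R (Suc ?j) - 1)) (?S (?R (Suc i) - 2))" by (rule RF(3)) (use r2 rl r1 in linarith)
      then have "suffix_less T (Suc ?j) (?S (?R (Suc i) - 2))" using r1 by simp
      moreover have "suffix_less T (?S (?R (Suc i) - 2)) (Suc i)" using pred(2)[OF i(1)] rl r1 by linarith
      ultimately have "lcp T (Suc ?j) (Suc i) = min (lcp T (Suc ?j) (?S (?R (Suc i) - 2))) (lcp T (?S (?R (Suc i) - 2)) (Suc i))"
        by (rule lcp_trans)
      then show ?thesis using l(1) by linarith
    qed
    then show ?thesis using rl r1 by auto
  qed auto
  have "runs L (HWhile (Bin Less (Var 20) (Var 3)) kasai_body) ?s (500 * (M + 1)) ?Q"
  proof (rule runs_HWhile[where I = "\<lambda>_::unit. J" and \<Phi> = "\<lambda>_. \<Phi>" and u = "\<lambda>_ _. 150"])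
    show "J ?s" by (simp add: J_def)
    show "frm kasai_body ?s ?s" by (simp add: frm_def)
    show "\<Phi> ?s \<le> 500 * (M + 1)" by (simp add: \<Phi>_def)
    fix s' assume J: "J s'" and f: "frm kasai_body ?s s'"
    have A: "rg s' 3 = M" "ar s' 9 = ?R" "ar s' 10 = ?S" "ar s' 0 = ar s 0" using f r by (simp_all add: frm_def)
    show "hok L s' (Bin Less (Var 20) (Var 3))" by simp
    {
      assume "hev s' (Bin Less (Var 20) (Var 3)) = 0"
      then have "rg s' 20 = M" using J A by (auto simp: J_def split: if_splits)
      moreover have "ar s' 13 k = lcp T (?S (k - 1)) (?S k)" if "0 < k" "k < M" "rg s' 20 = M" for k
      proof -
        have "?R (?S k) = k + 1" "?S k < M" using RF(1,2) that by auto
        then show ?thesis using J that by (auto simp: J_def dest!: spec[of _ "?S k"])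
      qed
      ultimately show "1 + hcost (Bin Less (Var 20) (Var 3)) \<le> \<Phi> s' \<and> ?Q s'" by (simp add: \<Phi>_def)
    }
    assume "hev s' (Bin Less (Var 20) (Var 3)) \<noteq> 0"
    define i h where "i = rg s' 20" and "h = rg s' 21"
    have i: "i < M" using \<open>hev s' _ \<noteq> 0\<close> A by (auto simp: i_def split: if_splits)
    have ih: "i + h \<le> M" using J by (simp add: J_def i_def h_def)
    have Ri: "1 \<le> ?R i" "?R i \<le> M" using RF(4)[OF i] by auto
    let ?j = "?S (?R i - 2)"
    define hit where "hit \<longleftrightarrow> 1 < ?R i \<and> h < lcp T ?j i"
    have hit: "(i + h < M \<and> ?j + h < M \<and> ar s 0 (i + h) = ar s 0 (?j + h)) \<longleftrightarrow> h < lcp T ?j i" if "1 < ?R i"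
    proof -
      note p = pred[OF i that]
      have "h \<le> lcp T ?j i" using J i that by (simp add: J_def i_def h_def)
      show ?thesis
      proof
        assume *: "i + h < M \<and> ?j + h < M \<and> ar s 0 (i + h) = ar s 0 (?j + h)"
        then have "T (?j + h) = T (i + h)" using Z by metis
        then show "h < lcp T ?j i" using \<open>h \<le> lcp T ?j i\<close> lcp_neq[OF wf p(1) i p(3)] by (cases "h = lcp T ?j i") auto
      next
        assume *: "h < lcp T ?j i"
        then have "i + h < M" "?j + h < M"
          using lcp_bound[OF wf p(1) i p(3)] lcp_bound[OF wf i p(1)] p(3) lcp_sym[of T i ?j] by auto
        then show "i + h < M \<and> ?j + h < M \<and> ar s 0 (i + h) = ar s 0 (?j + h)"
          using Z lcp_less[OF *] by metis
      qed
    qed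
    have jM: "?j < M" if "1 < ?R i" using pred(1)[OF i that] .
    have "runs L kasai_body s' 150 (\<lambda>s''. if hit then rg s'' 20 = i \<and> rg s'' 21 = h + 1 \<and> ar s'' 13 = ar s' 13
       else rg s'' 20 = i + 1 \<and> (if 1 < ?R i then rg s'' 21 = h - 1 \<and> ar s'' 13 = (ar s' 13)(?R i - 1 := h) else rg s'' 21 = h \<and> ar s'' 13 = ar s' 13))"
    proof (cases "1 < ?R i")
      case True
      show ?thesis unfolding kasai_body_def
        by (rule runs_wp) (use True A i ih Ri L jM[OF True] hit[OF True] in \<open>auto simp: hit_def i_def[symmetric] h_def[symmetric]\<close>)
    next
      case False
      show ?thesis unfolding kasai_body_def
        by (rule runs_wp) (use False A i ih Ri L in \<open>auto simp: hit_def i_def[symmetric] h_def[symmetric]\<close>)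
    qed
    then show "runs L kasai_body s' 150 (\<lambda>s''. \<exists>_::unit. J s'' \<and> 1 + hcost (Bin Less (Var 20) (Var 3)) + 150 + \<Phi> s'' \<le> \<Phi> s')"
    proof (rule runs_mono)
      fix s'' :: hst assume e: "if hit then rg s'' 20 = i \<and> rg s'' 21 = h + 1 \<and> ar s'' 13 = ar s' 13
       else rg s'' 20 = i + 1 \<and> (if 1 < ?R i then rg s'' 21 = h - 1 \<and> ar s'' 13 = (ar s' 13)(?R i - 1 := h) else rg s'' 21 = h \<and> ar s'' 13 = ar s' 13)"
      have J1: "ar s' 13 (?R i' - 1) = lcp T (?S (?R i' - 2)) i'" if "i' < i" "1 < ?R i'" for i'
        using J that by (simp add: J_def i_def)
      have inj: "?R i' - 1 \<noteq> ?R i - 1" if "i' < i" for i'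
        using RF(4)[of i'] RF(4)[OF i] that i by (metis less_irrefl less_trans)
      have hl: "if 1 < ?R i then h \<le> lcp T ?j i else h = 0" using J i by (simp add: J_def i_def h_def)
      consider (hit) "hit" | (miss) "\<not> hit" "1 < ?R i" "h = lcp T ?j i" | (first) "\<not> hit" "?R i = 1" "h = 0"
        using hl Ri by (cases "1 < ?R i") (auto simp: hit_def le_less)
      then have "J s'' \<and> 155 + \<Phi> s'' \<le> \<Phi> s'"
      proof cases
        case hit
        then have "1 < ?R i" "i + h < M" using \<open>1 < ?R i \<Longrightarrow> _ = (h < lcp T ?j i)\<close> by (auto simp: hit_def)
        then show ?thesis using hit e i J1 by (auto simp: J_def \<Phi>_def hit_def i_def[symmetric] h_def[symmetric])
      next
        case miss
        have "\<forall>i'<Suc i. 1 < ?R i' \<longrightarrow> ar s'' 13 (?R i' - 1) = lcp T (?S (?R i' - 2)) i'"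
          using miss e J1 inj by (auto simp: less_Suc_eq)
        moreover have "if 1 < ?R (Suc i) then h - 1 \<le> lcp T (?S (?R (Suc i) - 2)) (Suc i) else h - 1 = 0" if "Suc i < M"
          using nxt[OF that miss(2,3)] .
        moreover have "2 * (M - Suc i) + (M - (h - 1)) + 1 \<le> 2 * (M - i) + (M - h)" using i ih by linarith
        then have "155 + \<Phi> s'' \<le> \<Phi> s'" using miss e by (simp add: \<Phi>_def i_def[symmetric] h_def[symmetric])
        ultimately show ?thesis using miss e i ih by (auto simp: J_def i_def[symmetric] h_def[symmetric])
      next
        case first
        then have "\<forall>i'<Suc i. 1 < ?R i' \<longrightarrow> ar s'' 13 (?R i' - 1) = lcp T (?S (?R i' - 2)) i'"
          using e J1 by (auto simp: less_Suc_eq)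
        then show ?thesis using first e i ih by (auto simp: J_def \<Phi>_def i_def[symmetric] h_def[symmetric])
      qed
      then show "\<exists>_::unit. J s'' \<and> 1 + hcost (Bin Less (Var 20) (Var 3)) + 150 + \<Phi> s'' \<le> \<Phi> s'" by simp
    qed simp
  qed
  then show ?thesis
    unfolding kasai_def using L by (intro runs_wp_HSeq[where ?t2.0 = "500 * (M + 1)"]) auto
qed

section \<open>Range minima\<close>

definition rmin :: "(nat \<Rightarrow> nat) \<Rightarrow> nat \<Rightarrow> nat \<Rightarrow> nat" where
  "rmin A l r = Min (A ` {l..r})"

lemma rmin_split: "l \<le> k \<Longrightarrow> k < r \<Longrightarrow> rmin A l r = min (rmin A l k) (rmin A (Suc k) r)"
proof -
  assume "l \<le> k" "k < r"
  moreover from this have "{l..r} = {l..k} \<union> {Suc k..r}" by auto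
  ultimately show ?thesis unfolding rmin_def by (simp add: image_Un Min_Un)
qed

lemma rmin_overlap: "l \<le> b \<Longrightarrow> a \<le> r \<Longrightarrow> l \<le> a \<Longrightarrow> b \<le> r \<Longrightarrow> a \<le> Suc b \<Longrightarrow> rmin A l r = min (rmin A l b) (rmin A a r)"
proof -
  assume h: "l \<le> b" "a \<le> r" "l \<le> a" "b \<le> r" "a \<le> Suc b"
  then have "{l..r} = {l..b} \<union> {a..r}" by auto
  then show ?thesis unfolding rmin_def using h by (simp add: image_Un Min_Un)
qed

lemma rmin_self [simp]: "rmin A l l = A l"
  by (simp add: rmin_def)

lemma rmin_eqI: "l \<le> q \<Longrightarrow> q \<le> r \<Longrightarrow> (\<And>i. l \<le> i \<Longrightarrow> i \<le> r \<Longrightarrow> A q \<le> A i) \<Longrightarrow> rmin A l r = A q"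
  unfolding rmin_def by (rule Min_eqI) auto

text \<open>Along the suffix array common prefixes combine by minimum, by \<open>lcp_trans\<close>;
  induction on the right end reduces everything to adjacent entries.\<close>

lemma lcp_rmin:
  assumes S: "\<And>a b. a < b \<Longrightarrow> b < M \<Longrightarrow> suffix_less T (S a) (S b)"
    and A: "\<And>k. 0 < k \<Longrightarrow> k < M \<Longrightarrow> A k = lcp T (S (k - 1)) (S k)"
  shows "a < b \<Longrightarrow> b < M \<Longrightarrow> lcp T (S a) (S b) = rmin A (Suc a) b"
proof (induction b)
  case (Suc b)
  show ?case
  proof (cases "a = b")
    case True
    then show ?thesis using A[of "Suc b"] Suc by simp
  next
    case False
    then have "lcp T (S a) (S (Suc b)) = min (lcp T (S a) (S b)) (lcp T (S b) (S (Suc b)))"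
      using Suc.prems S by (intro lcp_trans) auto
    then show ?thesis using False Suc A[of "Suc b"] rmin_split[of "Suc a" b "Suc b" A] by simp
  qed
qed simp

subsection \<open>Range minimum queries\<close>

definition block_start :: "nat \<Rightarrow> nat \<Rightarrow> nat" where
  "block_start b r = r - r mod b"

text \<open>The positions of the block of \<open>r\<close> that are on the stack of strict suffix minima at \<open>r\<close>.\<close>

definition stk :: "(nat \<Rightarrow> nat) \<Rightarrow> nat \<Rightarrow> nat \<Rightarrow> nat set" where
  "stk A b r = {q. block_start b r \<le> q \<and> q \<le> r \<and> (\<forall>q'. q < q' \<and> q' \<le> r \<longrightarrow> A q < A q')}"

text \<open>What is left of the stack while \<open>r\<close> is processed, where \<open>p\<close> is
  one past the top entry; \<open>p\<close> at the start of the block means that the stack is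
  empty.\<close>

definition stk' :: "(nat \<Rightarrow> nat) \<Rightarrow> nat \<Rightarrow> nat \<Rightarrow> nat \<Rightarrow> nat set" where
  "stk' A b r p = (if block_start b r < p then stk A b (p - 1) else {})"

lemma block_start_le: "block_start b r \<le> r"
  by (simp add: block_start_def)

lemma block_start_mult: "block_start b r = r div b * b"
  by (simp add: block_start_def minus_mod_eq_div_mult)

lemma block_start_same: "0 < b \<Longrightarrow> block_start b r \<le> l \<Longrightarrow> l \<le> r \<Longrightarrow> l div b = r div b"
  unfolding block_start_mult by (metis div_le_mono div_mult_self_is_m dual_order.antisym)

lemma block_start_same': "0 < b \<Longrightarrow> block_start b r \<le> l \<Longrightarrow> l \<le> r \<Longrightarrow> block_start b l = block_start b r"
  using block_start_same unfolding block_start_mult by metis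

lemma block_start_add_mod: "block_start b l + l mod b = l"
  by (simp add: block_start_def)

lemma less_block_start_add: "0 < b \<Longrightarrow> r < block_start b r + b"
  using block_start_add_mod[of b r] mod_less_divisor[of b r] by linarith

lemma block_start_Suc: "block_start b (Suc r) = block_start b r \<or> block_start b (Suc r) = Suc r"
proof (cases "Suc r mod b = 0")
  case True
  then show ?thesis by (simp add: block_start_def)
next
  case False
  then have "Suc r mod b = Suc (r mod b)" by (metis mod_Suc)
  then show ?thesis by (simp add: block_start_def)
qed

lemma finite_stk [simp]: "finite (stk A b r)" "finite (stk' A b r p)"
  by (auto simp: stk_def stk'_def intro: finite_subset[of _ "{..r}"])

text \<open>The record made when \<open>p\<close> was pushed tells where the stack continues below
  it. Since \<open>A r \<le> A p\<close>, the popped entry is none of those that \<open>r\<close>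
  keeps.\<close>

lemma stk_pop:
  assumes r: "stk A b p = insert p (stk' A b p ps)" and p: "block_start b r < p1" "p = p1 - 1" "p1 \<le> r" and b: "0 < b"
    and ge: "A r \<le> A p" and ps: "block_start b p \<le> ps" "ps \<le> p"
  shows "{q \<in> stk' A b r p1. A q < A r} = {q \<in> stk' A b r ps. A q < A r}" "card (stk' A b r ps) < card (stk' A b r p1)"
    "block_start b r \<le> ps"
proof -
  have s: "block_start b p = block_start b r" by (rule block_start_same'[OF b]) (use p in auto)
  have "stk' A b r p1 = stk A b p" using p by (simp add: stk'_def)
  also have "\<dots> = insert p (stk' A b r ps)" using r by (simp only: stk'_def s)
  finally have e: "stk' A b r p1 = insert p (stk' A b r ps)" .
  have n: "p \<notin> stk' A b r ps" using ps p by (auto simp: stk'_def stk_def)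
  show "{q \<in> stk' A b r p1. A q < A r} = {q \<in> stk' A b r ps. A q < A r}" unfolding e using ge by auto
  show "card (stk' A b r ps) < card (stk' A b r p1)" unfolding e using n by simp
  show "block_start b r \<le> ps" using ps s by simp
qed

text \<open>Values increase from the bottom of the stack to its top, so a top below
  \<open>A r\<close> means that the entire remaining stack is kept.\<close>

lemma stk_push:
  assumes inv: "{q. block_start b r \<le> q \<and> q < r \<and> (\<forall>q'. q < q' \<and> q' \<le> r \<longrightarrow> A q < A q')} = {q \<in> stk' A b r p1. A q < A r}"
    and top: "block_start b r < p1 \<Longrightarrow> A (p1 - 1) < A r" and p: "p1 \<le> r"
  shows "stk A b r = insert r (stk' A b r p1)" "r \<notin> stk' A b r p1"
proof -
  have "A q < A r" if "q \<in> stk' A b r p1" for q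
  proof -
    have h: "block_start b r < p1" "q \<in> stk A b (p1 - 1)" using that by (auto simp: stk'_def split: if_splits)
    then have "q = p1 - 1 \<or> A q < A (p1 - 1)" by (cases "q = p1 - 1") (auto simp: stk_def)
    then show ?thesis using top[OF h(1)] by auto
  qed
  then have "{q \<in> stk' A b r p1. A q < A r} = stk' A b r p1" by auto
  moreover have "stk A b r = insert r {q. block_start b r \<le> q \<and> q < r \<and> (\<forall>q'. q < q' \<and> q' \<le> r \<longrightarrow> A q < A q')}"
    using block_start_le[of b r] by (auto simp: stk_def)
  ultimately show "stk A b r = insert r (stk' A b r p1)" using inv by simp
  show "r \<notin> stk' A b r p1" using p by (auto simp: stk'_def stk_def)
qed

lemma stk_next:
  assumes b: "0 < b"
  shows "{q. block_start b (Suc r) \<le> q \<and> q < Suc r \<and> (\<forall>q'. q < q' \<and> q' \<le> Suc r \<longrightarrow> A q < A q')}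
     = {q \<in> stk' A b (Suc r) (Suc r). A q < A (Suc r)}" "block_start b (Suc r) \<le> Suc r"
    "stk' A b (Suc r) (Suc r) \<subseteq> stk A b r"
proof -
  show "block_start b (Suc r) \<le> Suc r" by (rule block_start_le)
  consider "block_start b (Suc r) = Suc r" | "block_start b (Suc r) = block_start b r" "block_start b r < Suc r" using block_start_Suc[of b r] block_start_le[of b r] by linarith
  then show "{q. block_start b (Suc r) \<le> q \<and> q < Suc r \<and> (\<forall>q'. q < q' \<and> q' \<le> Suc r \<longrightarrow> A q < A q')}
     = {q \<in> stk' A b (Suc r) (Suc r). A q < A (Suc r)}"
    by cases (auto simp: stk'_def stk_def le_Suc_eq)
  show "stk' A b (Suc r) (Suc r) \<subseteq> stk A b r"
    by (auto simp: stk'_def)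
qed

lemma last_argmin:
  fixes A :: "nat \<Rightarrow> nat"
  assumes "l \<le> r"
  obtains p where "l \<le> p" "p \<le> r" "\<And>x. l \<le> x \<Longrightarrow> x \<le> r \<Longrightarrow> A p \<le> A x" "\<And>x. p < x \<Longrightarrow> x \<le> r \<Longrightarrow> A p < A x"
proof -
  let ?P = "{p \<in> {l..r}. A p = rmin A l r}"
  have "rmin A l r \<in> A ` {l..r}" unfolding rmin_def by (rule Min_in) (use assms in auto)
  then have ne: "?P \<noteq> {}" by auto
  have mn: "rmin A l r \<le> A x" if "l \<le> x" "x \<le> r" for x unfolding rmin_def by (rule Min_le) (use that in auto)
  have m: "Max ?P \<in> ?P" by (rule Max_in) (use ne in auto)
  have "A (Max ?P) < A x" if "Max ?P < x" "x \<le> r" for x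
  proof -
    have "x \<notin> ?P"
    proof
      assume "x \<in> ?P"
      then have "x \<le> Max ?P" by (intro Max_ge) auto
      then show False using that by simp
    qed
    then show ?thesis using m mn[of x] that by auto
  qed
  then show ?thesis using m mn that[of "Max ?P"] by auto
qed

text \<open>The last minimum of the range is on the stack, because everything after it is larger. A
  stack entry before it would have to be smaller than the minimum, so the least entry from
  \<open>l\<close> on is this minimum.\<close>

lemma stk_least:
  assumes q: "q \<in> stk A b r" "l \<le> q" and least: "\<And>x. x \<in> stk A b r \<Longrightarrow> l \<le> x \<Longrightarrow> q \<le> x" and l: "block_start b r \<le> l" "l \<le> r"
  shows "A q = rmin A l r"
proof -
  obtain p where p: "l \<le> p" "p \<le> r" "\<And>x. l \<le> x \<Longrightarrow> x \<le> r \<Longrightarrow> A p \<le> A x" "\<And>x. p < x \<Longrightarrow> x \<le> r \<Longrightarrow> A p < A x"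
    using last_argmin[OF l(2), of A] by blast
  have "p \<in> stk A b r" using p l by (auto simp: stk_def)
  then have "q \<le> p" using least p by blast
  moreover have "\<not> q < p" using q p(2) p(3)[of q] by (auto simp: stk_def)
  ultimately have "q = p" by simp
  then show ?thesis using p by (intro rmin_eqI[symmetric]) auto
qed

text \<open>A table of the number of trailing zeros. At 0 only the bound \<open>f v \<le> v\<close>
  is demanded, which keeps the table entries small.\<close>

definition ctz_ok :: "nat \<Rightarrow> (nat \<Rightarrow> nat) \<Rightarrow> bool" where
  "ctz_ok n f \<longleftrightarrow> (\<forall>v<n. f v \<le> v \<and> (v \<noteq> 0 \<longrightarrow> bit v (f v) \<and> (\<forall>i<f v. \<not> bit v i)))"

definition log_ok :: "nat \<Rightarrow> (nat \<Rightarrow> nat) \<Rightarrow> bool" where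
  "log_ok n f \<longleftrightarrow> (\<forall>v<n. f v \<le> v \<and> (v \<noteq> 0 \<longrightarrow> 2 ^ f v \<le> v \<and> v < 2 * 2 ^ f v))"

definition masks_ok :: "nat \<Rightarrow> (nat \<Rightarrow> nat) \<Rightarrow> nat \<Rightarrow> (nat \<Rightarrow> nat) \<Rightarrow> bool" where
  "masks_ok M A b mk \<longleftrightarrow> (\<forall>r<M. \<forall>i. bit (mk r) i \<longleftrightarrow> block_start b r + i \<in> stk A b r)"

lemma bit_less_exp: "(\<And>i. bit v i \<Longrightarrow> i < b) \<Longrightarrow> v < 2 ^ b" for v :: nat
  by (metis bit_take_bit_iff bit_eqI take_bit_nat_less_exp)

text \<open>The right shift by \<open>l mod b\<close> drops the stack entries left of
  \<open>l\<close>. The lowest remaining bit is the least entry from \<open>l\<close> on, which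
  holds the minimum by \<open>stk_least\<close>.\<close>

lemma inblock:
  assumes mk: "masks_ok M A b mk" and cz: "ctz_ok (2 ^ b) cz" and b: "0 < b"
    and r: "r < M" "block_start b r \<le> l" "l \<le> r"
  defines "v \<equiv> mk r div 2 ^ (l mod b)"
  shows "v < 2 ^ b" "l + cz v \<le> r" "A (l + cz v) = rmin A l r"
proof -
  have bl: "block_start b r + l mod b = l" using block_start_add_mod[of b l] block_start_same'[OF b r(2,3)] by simp
  have bit: "bit v i \<longleftrightarrow> l + i \<in> stk A b r" for i
  proof -
    have "bit v i \<longleftrightarrow> bit (mk r) (l mod b + i)" unfolding v_def by (simp add: bit_iff_odd power_add div_mult2_eq)
    also have "\<dots> \<longleftrightarrow> block_start b r + (l mod b + i) \<in> stk A b r" using mk r by (simp add: masks_ok_def)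
    also have "block_start b r + (l mod b + i) = l + i" using bl by simp
    finally show ?thesis .
  qed
  show v: "v < 2 ^ b"
  proof (rule bit_less_exp)
    fix i assume "bit v i"
    then have "l + i \<le> r" by (simp add: bit stk_def)
    then show "i < b" using less_block_start_add[OF b, of r] r by linarith
  qed
  have "bit v (r - l)" using r block_start_le[of b r] by (auto simp: bit stk_def)
  then have "v \<noteq> 0" by (cases "v = 0") simp_all
  then have c: "bit v (cz v)" "\<And>i. i < cz v \<Longrightarrow> \<not> bit v i" using cz v by (auto simp: ctz_ok_def)
  then show "l + cz v \<le> r" by (simp add: bit stk_def)
  show "A (l + cz v) = rmin A l r"
  proof (rule stk_least)
    show "l + cz v \<in> stk A b r" using c bit by simp
    fix x assume "x \<in> stk A b r" "l \<le> x"
    then have "bit v (x - l)" by (simp add: bit)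
    then show "l + cz v \<le> x" using c(2)[of "x - l"] \<open>l \<le> x\<close> by linarith
  qed (use r in auto)
qed

section \<open>Building the tables for range minima\<close>

text \<open>The block length \<open>b\<close> is the number of binary digits of \<open>M\<close>.
  From \<open>2 ^ b \<le> 2 * M\<close> the tables indexed by masks are linear; from
  \<open>M < 2 ^ b\<close> the logarithm of the number of blocks is below \<open>b\<close>, so the
  sparse table over about \<open>M div b\<close> blocks is linear too.\<close>

definition block_size :: hcmd where
  "block_size = (Upd 25 (Cst 0) ;; Upd 26 (Cst 1)) ;;
     HWhile (Bin Less (Var 26) (plus1 (Var 3))) (Upd 26 (Bin Mult (Cst 2) (Var 26)) ;; Upd 25 (plus1 (Var 25)))"

lemma mod_block_size [simp]: "modr block_size = {25,26}" "moda block_size = {}"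
  by (auto simp: block_size_def)

lemma runs_block_size:
  assumes r: "rg s 3 = M" and M: "1 \<le> M" and L: "2 * M + 20 < L"
  shows "runs L block_size s (30 * (M + 1)) (\<lambda>s'. rg s' 26 = 2 ^ rg s' 25 \<and> M < 2 ^ rg s' 25 \<and> 2 ^ rg s' 25 \<le> 2 * M \<and>
     1 \<le> rg s' 25 \<and> rg s' 25 \<le> M)"
proof -
  let ?B = "Upd 26 (Bin Mult (Cst 2) (Var 26)) ;; Upd 25 (plus1 (Var 25))"
  let ?s = "s\<lparr>rg := (rg s)(25 := 0, 26 := 1)\<rparr>"
  let ?Q = "\<lambda>s'. rg s' 26 = 2 ^ rg s' 25 \<and> M < 2 ^ rg s' 25 \<and> 2 ^ rg s' 25 \<le> 2 * M \<and> 1 \<le> rg s' 25 \<and> rg s' 25 \<le> M"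
  let ?J = "\<lambda>s'. rg s' 26 = 2 ^ rg s' 25 \<and> 2 ^ rg s' 25 \<le> 2 * M"
  let ?F = "\<lambda>s'. 20 * (M + 1 - rg s' 26) + 6"
  have "runs L (HWhile (Bin Less (Var 26) (plus1 (Var 3))) ?B) ?s (20 * M + 6) ?Q"
  proof (rule runs_HWhile[where I = "\<lambda>_::unit. ?J" and \<Phi> = "\<lambda>_. ?F" and u = "\<lambda>_ _. 10"])
    show "?J ?s" using M by simp
    show "frm ?B ?s ?s" by (simp add: frm_def)
    show "?F ?s \<le> 20 * M + 6" by simp
    fix s' assume J: "?J s'" and f: "frm ?B ?s s'"
    have A: "rg s' 3 = M" using f r by (simp add: frm_def)
    have lt: "rg s' 25 < 2 ^ rg s' 25" by (rule less_exp)
    show "hok L s' (Bin Less (Var 26) (plus1 (Var 3)))" using A L by simp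
    {
      assume "hev s' (Bin Less (Var 26) (plus1 (Var 3))) = 0"
      then have gt: "M < 2 ^ rg s' 25" using J A by (auto split: if_splits)
      then obtain k where k: "rg s' 25 = Suc k" using M by (cases "rg s' 25") auto
      have "2 ^ k \<le> M" using J k by simp
      then have "k < M" using less_exp[of k] by linarith
      then show "1 + hcost (Bin Less (Var 26) (plus1 (Var 3))) \<le> ?F s' \<and> ?Q s'" using J gt k by simp
    }
    assume "hev s' (Bin Less (Var 26) (plus1 (Var 3))) \<noteq> 0"
    then have le: "2 ^ rg s' 25 \<le> M" using J A by (auto split: if_splits)
    have "20 * (M + 1 - 2 * x) + 20 \<le> 20 * (M + 1 - x)" if "1 \<le> x" "x \<le> M" for x
      using that by linarith
    from this[of "2 ^ rg s' 25"] le have dec: "20 * (M + 1 - 2 * 2 ^ rg s' 25) + 20 \<le> 20 * (M + 1 - 2 ^ rg s' 25)" by simp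
    have "rg s' 25 + 1 < L" using lt le L by linarith
    show "runs L ?B s' 10 (\<lambda>s''. \<exists>_::unit. ?J s'' \<and> 1 + hcost (Bin Less (Var 26) (plus1 (Var 3))) + 10 + ?F s'' \<le> ?F s')"
      by (rule runs_wp) (use J le A L dec \<open>rg s' 25 + 1 < L\<close> in auto)
  qed
  then show ?thesis unfolding block_size_def using L
    by (intro runs_wp_HSeq[where ?t2.0 = "20 * M + 6"]) auto
qed

definition bit_tables :: hcmd where
  "bit_tables = For 20 (Var 26)
     (HIf (Bin Mod (Var 20) (Cst 2)) (Put 16 (Var 20) (Cst 0))
        (HIf (Var 20) (Put 16 (Var 20) (plus1 (Arr 16 (Bin Div (Var 20) (Cst 2))))) (Put 16 (Var 20) (Cst 0))) ;;
      HIf (Bin Less (Cst 1) (Var 20)) (Put 17 (Var 20) (plus1 (Arr 17 (Bin Div (Var 20) (Cst 2))))) (Put 17 (Var 20) (Cst 0)))"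

lemma mod_bit_tables [simp]: "modr bit_tables = {20}" "moda bit_tables = {16,17}"
  by (auto simp: bit_tables_def)

lemma ctz_ok_Suc:
  assumes "ctz_ok n f" "f' n = (if n mod 2 = 1 \<or> n = 0 then 0 else f (n div 2) + 1)" "\<And>v. v < n \<Longrightarrow> f' v = f v"
  shows "ctz_ok (Suc n) f'"
proof -
  have "f' n \<le> n \<and> (n \<noteq> 0 \<longrightarrow> bit n (f' n) \<and> (\<forall>i<f' n. \<not> bit n i))"
  proof (cases "n mod 2 = 1 \<or> n = 0")
    case True
    then show ?thesis using assms(2) by (auto simp: bit_0 odd_iff_mod_2_eq_one)
  next
    case False
    then have h: "n div 2 < n" "n div 2 \<noteq> 0" "even n" by auto
    then have "f (n div 2) \<le> n div 2 \<and> bit (n div 2) (f (n div 2)) \<and> (\<forall>i<f (n div 2). \<not> bit (n div 2) i)"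
      using assms(1) by (auto simp: ctz_ok_def)
    moreover have "\<not> bit n i" if "i < Suc (f (n div 2))" "\<forall>i<f (n div 2). \<not> bit (n div 2) i" for i
      using that h by (cases i) (auto simp: bit_0 bit_Suc)
    ultimately show ?thesis using assms(2) False h by (auto simp: bit_Suc)
  qed
  then show ?thesis using assms by (auto simp: ctz_ok_def less_Suc_eq)
qed

lemma log_ok_Suc:
  assumes "log_ok n f" "f' n = (if 1 < n then f (n div 2) + 1 else 0)" "\<And>v. v < n \<Longrightarrow> f' v = f v"
  shows "log_ok (Suc n) f'"
proof -
  have "f' n \<le> n \<and> (n \<noteq> 0 \<longrightarrow> 2 ^ f' n \<le> n \<and> n < 2 * 2 ^ f' n)"
  proof (cases "1 < n")
    case True
    then have h: "n div 2 < n" "n div 2 \<noteq> 0" by auto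
    then have "f (n div 2) \<le> n div 2 \<and> 2 ^ f (n div 2) \<le> n div 2 \<and> n div 2 < 2 * 2 ^ f (n div 2)"
      using assms(1) by (auto simp: log_ok_def)
    then show ?thesis using assms(2) True h by auto
  qed (use assms(2) in auto)
  then show ?thesis using assms by (auto simp: log_ok_def less_Suc_eq)
qed

lemma runs_bit_tables:
  assumes r: "rg s 26 = n" and L: "n + 20 < L"
  shows "runs L bit_tables s (110 * (n + 1)) (\<lambda>s'. ctz_ok n (ar s' 16) \<and> log_ok n (ar s' 17))"
  unfolding bit_tables_def
proof (rule runs_For[where n = n and c = 100 and I = "\<lambda>i s'. ctz_ok i (ar s' 16) \<and> log_ok i (ar s' 17)"])
  let ?B = "HIf (Bin Mod (Var 20) (Cst 2)) (Put 16 (Var 20) (Cst 0))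
        (HIf (Var 20) (Put 16 (Var 20) (plus1 (Arr 16 (Bin Div (Var 20) (Cst 2))))) (Put 16 (Var 20) (Cst 0))) ;;
      HIf (Bin Less (Cst 1) (Var 20)) (Put 17 (Var 20) (plus1 (Arr 17 (Bin Div (Var 20) (Cst 2))))) (Put 17 (Var 20) (Cst 0))"
  fix i and s' :: hst assume i: "i < n" "rg s' 20 = i" and I: "ctz_ok i (ar s' 16) \<and> log_ok i (ar s' 17)"
  have d: "ar s' 16 (i div 2) \<le> i div 2 \<and> ar s' 17 (i div 2) \<le> i div 2" if "i \<noteq> 0"
    using I that by (auto simp: ctz_ok_def log_ok_def)
  have "i div 2 \<le> i" by simp
  with d have d': "ar s' 16 (i div 2) \<le> i" "ar s' 17 (i div 2) \<le> i" if "i \<noteq> 0" using that by force+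
  have "runs L ?B s' 100 (\<lambda>s''. ar s'' 16 = (ar s' 16)(i := if i mod 2 = 1 \<or> i = 0 then 0 else ar s' 16 (i div 2) + 1) \<and>
     ar s'' 17 = (ar s' 17)(i := if 1 < i then ar s' 17 (i div 2) + 1 else 0))"
    by (rule runs_wp) (use i L d' in auto)
  then show "runs L ?B s' 100 (\<lambda>s''. ctz_ok (Suc i) (ar (upd s'' 20 (Suc i)) 16) \<and> log_ok (Suc i) (ar (upd s'' 20 (Suc i)) 17))"
  proof (rule runs_mono)
    fix s'' :: hst assume e: "ar s'' 16 = (ar s' 16)(i := if i mod 2 = 1 \<or> i = 0 then 0 else ar s' 16 (i div 2) + 1) \<and>
     ar s'' 17 = (ar s' 17)(i := if 1 < i then ar s' 17 (i div 2) + 1 else 0)"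
    have "ctz_ok (Suc i) (ar s'' 16)" by (rule ctz_ok_Suc[of i "ar s' 16"]) (use I e in simp_all)
    moreover have "log_ok (Suc i) (ar s'' 17)" by (rule log_ok_Suc[of i "ar s' 17"]) (use I e in simp_all)
    ultimately show "ctz_ok (Suc i) (ar (upd s'' 20 (Suc i)) 16) \<and> log_ok (Suc i) (ar (upd s'' 20 (Suc i)) 17)" by simp
  qed simp
qed (use r L in \<open>auto simp: frm_def ctz_ok_def log_ok_def\<close>)

text \<open>Again one round is a single pop or push. Register 21 is one past the top of the stack,
  and array 14 stores for each entry one past the entry below it. The mask of a new top is the mask
  of the entry below plus its own bit.\<close>

definition mask_body :: hcmd where
  "mask_body =
     Upd 22 (Bin Sub (Var 20) (Bin Mod (Var 20) (Var 25))) ;;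
     Upd 24 (Bin Less (Var 22) (Var 21)) ;;
     HIf (Var 24) (Upd 24 (Bin Eq (Bin Less (Arr 13 (Bin Sub (Var 21) (Cst 1))) (Arr 13 (Var 20))) (Cst 0))) HSkip ;;
     HIf (Var 24) (Upd 21 (Arr 14 (Bin Sub (Var 21) (Cst 1))))
       (Put 14 (Var 20) (Var 21) ;;
        HIf (Bin Less (Var 22) (Var 21)) (Upd 23 (Arr 15 (Bin Sub (Var 21) (Cst 1)))) (Upd 23 (Cst 0)) ;;
        Put 15 (Var 20) (Bin Or (Var 23) (Bin Shl (Cst 1) (Bin Sub (Var 20) (Var 22)))) ;;
        Upd 20 (plus1 (Var 20)) ;; Upd 21 (Var 20))"

definition block_masks :: hcmd where
  "block_masks = (Upd 20 (Cst 0) ;; Upd 21 (Cst 0)) ;; HWhile (Bin Less (Var 20) (Var 3)) mask_body"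

lemma mod_block_masks [simp]: "modr block_masks = {20,21,22,23,24}" "moda block_masks = {14,15}"
  "modr mask_body = {20,21,22,23,24}" "moda mask_body = {14,15}"
  by (auto simp: block_masks_def mask_body_def)

lemma runs_block_masks:
  assumes r: "rg s 3 = M" "rg s 25 = b" and b: "0 < b" "2 ^ b \<le> 2 * M" and L: "2 * M + 20 < L"
  shows "runs L block_masks s (600 * (M + 1)) (\<lambda>s'. masks_ok M (ar s 13) b (ar s' 15))"
proof -
  let ?A = "ar s 13"
  let ?s = "s\<lparr>rg := (rg s)(20 := 0, 21 := 0)\<rparr>"
  define J where "J s' \<longleftrightarrow> rg s' 20 \<le> M \<and> rg s' 21 \<le> rg s' 20 \<and> block_start b (rg s' 20) \<le> rg s' 21 \<and>
     {q. block_start b (rg s' 20) \<le> q \<and> q < rg s' 20 \<and> (\<forall>q'. q < q' \<and> q' \<le> rg s' 20 \<longrightarrow> ?A q < ?A q')} =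
        {q \<in> stk' ?A b (rg s' 20) (rg s' 21). ?A q < ?A (rg s' 20)} \<and>
     (\<forall>r<rg s' 20. block_start b r \<le> ar s' 14 r \<and> ar s' 14 r \<le> r \<and> stk ?A b r = insert r (stk' ?A b r (ar s' 14 r)) \<and>
        (\<forall>i. bit (ar s' 15 r) i \<longleftrightarrow> block_start b r + i \<in> stk ?A b r))" for s' :: hst
  \<comment> \<open>A pop shrinks the stack; a push enlarges it by at most one but advances the
    position, which counts twice.\<close>
  define \<Phi> where "\<Phi> s' = 200 * (2 * (M - rg s' 20) + card (stk' ?A b (rg s' 20) (rg s' 21))) + 4" for s' :: hst
  have "runs L (HWhile (Bin Less (Var 20) (Var 3)) mask_body) ?s (500 * (M + 1)) (\<lambda>s'. masks_ok M ?A b (ar s' 15))"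
  proof (rule runs_HWhile[where I = "\<lambda>_::unit. J" and \<Phi> = "\<lambda>_. \<Phi>" and u = "\<lambda>_ _. 190"])
    show "J ?s" by (auto simp: J_def block_start_def stk'_def)
    show "frm mask_body ?s ?s" by (simp add: frm_def)
    show "\<Phi> ?s \<le> 500 * (M + 1)" by (simp add: \<Phi>_def block_start_def stk'_def)
    fix s' assume J: "J s'" and f: "frm mask_body ?s s'"
    have A: "rg s' 3 = M" "rg s' 25 = b" "ar s' 13 = ?A" using f r by (simp_all add: frm_def)
    show "hok L s' (Bin Less (Var 20) (Var 3))" by simp
    {
      assume "hev s' (Bin Less (Var 20) (Var 3)) = 0"
      then have "rg s' 20 = M" using J A by (auto simp: J_def split: if_splits)
      then show "1 + hcost (Bin Less (Var 20) (Var 3)) \<le> \<Phi> s' \<and> masks_ok M ?A b (ar s' 15)"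
        using J by (auto simp: J_def \<Phi>_def masks_ok_def)
    }
    assume h: "hev s' (Bin Less (Var 20) (Var 3)) \<noteq> 0"
    define i p where "i = rg s' 20" and "p = rg s' 21"
    have i: "i < M" using h A by (auto simp: i_def split: if_splits)
    have p: "p \<le> i" "block_start b i \<le> p" and old: "\<And>r. r < i \<Longrightarrow> block_start b r \<le> ar s' 14 r \<and> ar s' 14 r \<le> r \<and>
        stk ?A b r = insert r (stk' ?A b r (ar s' 14 r)) \<and> (\<forall>k. bit (ar s' 15 r) k \<longleftrightarrow> block_start b r + k \<in> stk ?A b r)"
      and inv: "{q. block_start b i \<le> q \<and> q < i \<and> (\<forall>q'. q < q' \<and> q' \<le> i \<longrightarrow> ?A q < ?A q')} = {q \<in> stk' ?A b i p. ?A q < ?A i}"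
      using J unfolding J_def i_def p_def by blast+
    define pop where "pop \<longleftrightarrow> block_start b i < p \<and> ?A i \<le> ?A (p - 1)"
    define mk where "mk = (if block_start b i < p then ar s' 15 (p - 1) else 0)"
    have mb: "i mod b < b" "i - block_start b i = i mod b" "i - i mod b = block_start b i" using b block_start_add_mod[of b i] by (auto simp: block_start_def)
    then have "(2::nat) ^ (i mod b) \<le> 2 ^ b" by (intro power_increasing) auto
    then have sh: "2 ^ (i mod b) < L" using b L by linarith
    have "runs L mask_body s' 190 (\<lambda>s''. if pop then rg s'' 20 = i \<and> rg s'' 21 = ar s' 14 (p - 1) \<and> ar s'' 14 = ar s' 14 \<and> ar s'' 15 = ar s' 15
      else rg s'' 20 = Suc i \<and> rg s'' 21 = Suc i \<and> ar s'' 14 = (ar s' 14)(i := p) \<and>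
        ar s'' 15 = (ar s' 15)(i := semiring_bit_operations_class.or mk (2 ^ (i mod b))))"
      unfolding mask_body_def
    proof (rule runs_wp, goal_cases)
      case 1
      show ?case
      proof (cases "block_start b i < p")
        case True
        then show ?thesis using A i L p sh mb by (auto simp: i_def[symmetric] p_def[symmetric] pop_def mk_def)
      next
        case False
        then show ?thesis using A i L p sh mb by (auto simp: i_def[symmetric] p_def[symmetric] pop_def mk_def)
      qed
    qed simp
    then show "runs L mask_body s' 190 (\<lambda>s''. \<exists>_::unit. J s'' \<and> 1 + hcost (Bin Less (Var 20) (Var 3)) + 190 + \<Phi> s'' \<le> \<Phi> s')"
    proof (rule runs_mono)
      fix s'' :: hst assume e: "if pop then rg s'' 20 = i \<and> rg s'' 21 = ar s' 14 (p - 1) \<and> ar s'' 14 = ar s' 14 \<and> ar s'' 15 = ar s' 15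
      else rg s'' 20 = Suc i \<and> rg s'' 21 = Suc i \<and> ar s'' 14 = (ar s' 14)(i := p) \<and>
        ar s'' 15 = (ar s' 15)(i := semiring_bit_operations_class.or mk (2 ^ (i mod b)))"
      have "J s'' \<and> 194 + \<Phi> s'' \<le> \<Phi> s'"
      proof (cases pop)
        case True
        then have pp: "block_start b i < p" "?A i \<le> ?A (p - 1)" "p - 1 < i" using p by (auto simp: pop_def)
        note o = old[OF pp(3)]
        note P = stk_pop[of ?A b "p - 1" "ar s' 14 (p - 1)" i p, OF conjunct1[OF conjunct2[OF conjunct2[OF o]]] pp(1) refl p(1) b(1) pp(2)]
        have P': "{q \<in> stk' ?A b i p. ?A q < ?A i} = {q \<in> stk' ?A b i (ar s' 14 (p - 1)). ?A q < ?A i}"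
          "card (stk' ?A b i (ar s' 14 (p - 1))) < card (stk' ?A b i p)" "block_start b i \<le> ar s' 14 (p - 1)" using P o by blast+
        have "ar s' 14 (p - 1) \<le> i" using o pp(3) by linarith
        then have "J s''" unfolding J_def using True e i P' inv old pp by auto
        moreover have "194 + \<Phi> s'' \<le> \<Phi> s'" using True e P'(2) by (simp add: \<Phi>_def i_def[symmetric] p_def[symmetric])
        ultimately show ?thesis by simp
      next
        case False
        then have top: "block_start b i < p \<Longrightarrow> ?A (p - 1) < ?A i" by (auto simp: pop_def)
        have P: "stk ?A b i = insert i (stk' ?A b i p)" "i \<notin> stk' ?A b i p"
          using stk_push[OF inv top p(1)] by blast+
        have bit: "bit (semiring_bit_operations_class.or mk (2 ^ (i mod b))) k \<longleftrightarrow> block_start b i + k \<in> stk ?A b i" for k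
        proof -
          have "bit mk k \<longleftrightarrow> block_start b i + k \<in> stk' ?A b i p"
          proof (cases "block_start b i < p")
            case True
            then have "block_start b (p - 1) = block_start b i" using p by (intro block_start_same'[OF b(1)]) auto
            then show ?thesis using True old[of "p - 1"] p by (auto simp: mk_def stk'_def)
          qed (simp add: mk_def stk'_def)
          moreover have "k = i mod b \<longleftrightarrow> block_start b i + k = i" using block_start_add_mod[of b i] by auto
          ultimately show ?thesis unfolding P(1) by (auto simp: bit_or_iff bit_exp_iff)
        qed
        note N = stk_next(1)[OF b(1), where r = i and A = ?A] stk_next(2)[OF b(1), where r = i]
          stk_next(3)[OF b(1), where r = i and A = ?A]
        have "card (stk' ?A b (Suc i) (Suc i)) \<le> card (stk ?A b i)" by (rule card_mono) (use N in auto)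
        also have "card (stk ?A b i) = Suc (card (stk' ?A b i p))" unfolding P(1) using P(2) by simp
        finally have c: "card (stk' ?A b (Suc i) (Suc i)) \<le> Suc (card (stk' ?A b i p))" .
        have E: "rg s'' 20 = Suc i" "rg s'' 21 = Suc i" "ar s'' 14 = (ar s' 14)(i := p)"
          "ar s'' 15 = (ar s' 15)(i := semiring_bit_operations_class.or mk (2 ^ (i mod b)))" using e False by auto
        have "J s''" unfolding J_def E
        proof (intro conjI allI impI)
          fix r assume "r < Suc i"
          then consider "r < i" | "r = i" by linarith
          then have "block_start b r \<le> ((ar s' 14)(i := p)) r \<and> ((ar s' 14)(i := p)) r \<le> r \<and>
            stk ?A b r = insert r (stk' ?A b r (((ar s' 14)(i := p)) r)) \<and>
            (\<forall>k. bit (((ar s' 15)(i := semiring_bit_operations_class.or mk (2 ^ (i mod b)))) r) k \<longleftrightarrow> block_start b r + k \<in> stk ?A b r)"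
            by cases (use old p P bit in auto)
          then show "block_start b r \<le> ((ar s' 14)(i := p)) r" "((ar s' 14)(i := p)) r \<le> r"
            "stk ?A b r = insert r (stk' ?A b r (((ar s' 14)(i := p)) r))"
            "bit (((ar s' 15)(i := semiring_bit_operations_class.or mk (2 ^ (i mod b)))) r) k \<longleftrightarrow> block_start b r + k \<in> stk ?A b r" for k
            by blast+
        qed (use N i in auto)
        moreover have "194 + \<Phi> s'' \<le> \<Phi> s'" using E c i by (simp add: \<Phi>_def i_def[symmetric] p_def[symmetric])
        ultimately show ?thesis by simp
      qed
      then show "\<exists>_::unit. J s'' \<and> 1 + hcost (Bin Less (Var 20) (Var 3)) + 190 + \<Phi> s'' \<le> \<Phi> s'" by simp
    qed simp
  qed
  then show ?thesis unfolding block_masks_def using L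
    by (intro runs_wp_HSeq[where ?t2.0 = "500 * (M + 1)"]) auto
qed

definition block_end :: "nat \<Rightarrow> nat \<Rightarrow> nat \<Rightarrow> nat" where
  "block_end M b k = min (k * b) M"

text \<open>A whole block needs no shift: the lowest bit of the mask at its last position is the
  bottom of the stack and hence the minimum of the block.\<close>

definition block_minima :: hcmd where
  "block_minima = Upd 27 (plus1 (Bin Div (Bin Sub (Var 3) (Cst 1)) (Var 25))) ;;
     For 20 (Var 27) (Upd 21 (Bin Mult (Var 20) (Var 25)) ;; Upd 22 (Bin Add (Var 21) (Var 25)) ;;
       HIf (Bin Less (Var 3) (Var 22)) (Upd 22 (Var 3)) HSkip ;; Upd 22 (Bin Sub (Var 22) (Cst 1)) ;;
       Put 18 (Var 20) (Arr 13 (Bin Add (Var 21) (Arr 16 (Arr 15 (Var 22))))))"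

lemma mod_block_minima [simp]: "modr block_minima = {20,21,22,27}" "moda block_minima = {18}"
  by (auto simp: block_minima_def)

lemma blocks:
  fixes M b nb :: nat
  assumes b: "0 < b" "b \<le> M" and M: "1 \<le> M" and nb: "nb = (M - 1) div b + 1"
  shows "nb * b \<le> 2 * M" "\<And>k. k < nb \<Longrightarrow> k * b < M" "\<And>r. r < M \<Longrightarrow> r div b < nb" "nb \<le> M"
proof -
  have le: "(M - 1) div b * b \<le> M - 1" by (metis div_mult_mod_eq le_add1)
  then show "nb * b \<le> 2 * M" unfolding nb add_mult_distrib using b M by linarith
  show "k * b < M" if "k < nb" for k
  proof -
    have "k * b \<le> (M - 1) div b * b" using that nb by (intro mult_le_mono1) simp
    also note le
    finally show ?thesis using M by simp
  qed
  show "r div b < nb" if "r < M" for r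
  proof -
    have "r \<le> M - 1" using that by simp
    then show ?thesis unfolding nb using div_le_mono[of r "M - 1" b] by simp
  qed
  have "(M - 1) div b \<le> M - 1" by (rule div_le_dividend)
  then show "nb \<le> M" using nb M by linarith
qed

lemma inblock_whole:
  assumes mk: "masks_ok M A b mk" and cz: "ctz_ok (2 ^ b) cz" and b: "0 < b" and k: "k * b < M"
  shows "block_end M b (Suc k) - 1 < M" "k * b \<le> block_end M b (Suc k) - 1" "mk (block_end M b (Suc k) - 1) < 2 ^ b"
    "k * b + cz (mk (block_end M b (Suc k) - 1)) < M"
    "A (k * b + cz (mk (block_end M b (Suc k) - 1))) = rmin A (k * b) (block_end M b (Suc k) - 1)"
proof -
  let ?r = "block_end M b (Suc k) - 1"
  show r: "?r < M" "k * b \<le> ?r" using k b by (auto simp: block_end_def)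
  have "?r div b = k"
  proof (rule div_nat_eqI)
    show "b * k \<le> ?r" using r by (simp add: mult.commute)
    show "?r < b * Suc k" using b k by (auto simp: block_end_def mult.commute min_def)
  qed
  then have "block_start b ?r \<le> k * b" by (simp add: block_start_mult)
  note I = inblock[OF mk cz b r(1) this r(2)]
  show "mk ?r < 2 ^ b" "k * b + cz (mk ?r) < M" "A (k * b + cz (mk ?r)) = rmin A (k * b) ?r"
    using I r by simp_all
qed

lemma runs_block_minima:
  assumes r: "rg s 3 = M" "rg s 25 = b" and b: "0 < b" "b \<le> M" and M: "1 \<le> M" and L: "3 * M + 20 < L" "2 ^ b < L"
    and mk: "masks_ok M (ar s 13) b (ar s 15)" and cz: "ctz_ok (2 ^ b) (ar s 16)" and nb: "nb = (M - 1) div b + 1"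
  shows "runs L block_minima s (100 * (M + 2)) (\<lambda>s'. rg s' 27 = nb \<and>
     (\<forall>k<nb. ar s' 18 k = rmin (ar s 13) (k * b) (block_end M b (Suc k) - 1)))"
  unfolding block_minima_def
proof (rule runs_Upd_HSeq)
  note B = blocks[OF b M nb]
  let ?B = "Upd 21 (Bin Mult (Var 20) (Var 25)) ;; Upd 22 (Bin Add (Var 21) (Var 25)) ;;
       HIf (Bin Less (Var 3) (Var 22)) (Upd 22 (Var 3)) HSkip ;; Upd 22 (Bin Sub (Var 22) (Cst 1)) ;;
       Put 18 (Var 20) (Arr 13 (Bin Add (Var 21) (Arr 16 (Arr 15 (Var 22)))))"
  let ?s = "upd s 27 (hev s (plus1 (Bin Div (Bin Sub (Var 3) (Cst 1)) (Var 25))))"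
  show "runs L (For 20 (Var 27) ?B) ?s (90 * (M + 2)) (\<lambda>s'. rg s' 27 = nb \<and>
     (\<forall>k<nb. ar s' 18 k = rmin (ar s 13) (k * b) (block_end M b (Suc k) - 1)))"
  proof (rule runs_For[where n = nb and c = 80 and I = "\<lambda>i s'. \<forall>k<i. ar s' 18 k = rmin (ar s 13) (k * b) (block_end M b (Suc k) - 1)"])
    fix i s' assume i: "i < nb" "rg s' 20 = i" and I: "\<forall>k<i. ar s' 18 k = rmin (ar s 13) (k * b) (block_end M b (Suc k) - 1)"
      and f: "frm (For 20 (Var 27) ?B) ?s s'"
    have A: "rg s' 3 = M" "rg s' 25 = b" "ar s' 13 = ar s 13" "ar s' 15 = ar s 15" "ar s' 16 = ar s 16"
      using f r by (simp_all add: frm_def)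
    have ib: "i * b < M" using B(2) i by simp
    note W = inblock_whole[OF mk cz b(1) ib]
    have e: "block_end M b (Suc i) = (if M < i * b + b then M else i * b + b)" by (simp add: block_end_def)
    have "runs L ?B s' 80 (\<lambda>s''. ar s'' 18 = (ar s' 18)(i := ar s 13 (i * b + ar s 16 (ar s 15 (block_end M b (Suc i) - 1)))))"
    proof (rule runs_wp)
      have "ar s 15 (block_end M b (Suc i) - 1) < L" using W(3) L by linarith
      then show "wp L ?B (\<lambda>s''. ar s'' 18 = (ar s' 18)(i := ar s 13 (i * b + ar s 16 (ar s 15 (block_end M b (Suc i) - 1))))) s'"
        using A i L W(1,2,4) b M B(4) ib unfolding e by auto
    qed simp
    then show "runs L ?B s' 80 (\<lambda>s''. \<forall>k<Suc i. ar (upd s'' 20 (Suc i)) 18 k = rmin (ar s 13) (k * b) (block_end M b (Suc k) - 1))"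
      by (rule runs_mono) (use I W(5) in \<open>auto simp: less_Suc_eq\<close>)
  next
    show "(nb + 1) * (80 + 7 + hcost (Var 27)) \<le> 90 * (M + 2)"
      using B(4) by simp
  qed (use r nb B(4) L in \<open>auto simp: frm_def\<close>)
  show "hok L s (plus1 (Bin Div (Bin Sub (Var 3) (Cst 1)) (Var 25)))" using r M L B(4) nb by simp
qed simp

text \<open>Row \<open>j\<close> starts at \<open>j * nb\<close>, and a single loop fills all rows:
  entry \<open>nb + i\<close> is the minimum of the entries \<open>i\<close> and
  \<open>i + 2 ^ (i div nb)\<close>, the two halves of its window. Windows running past the last
  block receive values that \<open>sparse_ok\<close> leaves open.\<close>

definition sparse_table :: hcmd where
  "sparse_table = (Upd 28 (Arr 17 (Var 27)) ;; Upd 29 (Bin Mult (Var 28) (Var 27))) ;;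
     For 20 (Var 29) (Upd 21 (Arr 18 (Var 20)) ;;
       Upd 22 (Arr 18 (Bin Add (Var 20) (Bin Shl (Cst 1) (Bin Div (Var 20) (Var 27))))) ;;
       HIf (Bin Less (Var 22) (Var 21)) (Upd 21 (Var 22)) HSkip ;;
       Put 18 (Bin Add (Var 27) (Var 20)) (Var 21))"

lemma mod_sparse_table [simp]: "modr sparse_table = {20,21,22,28,29}" "moda sparse_table = {18}"
  by (auto simp: sparse_table_def)

definition sparse_ok :: "nat \<Rightarrow> (nat \<Rightarrow> nat) \<Rightarrow> nat \<Rightarrow> nat \<Rightarrow> (nat \<Rightarrow> nat) \<Rightarrow> nat \<Rightarrow> bool" where
  "sparse_ok M A b nb sp n \<longleftrightarrow> (\<forall>j k. j * nb + k < n \<and> k < nb \<and> k + 2 ^ j \<le> nb \<longrightarrow>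
     sp (j * nb + k) = rmin A (k * b) (block_end M b (k + 2 ^ j) - 1))"

lemma log_bound:
  assumes "log_ok (2 ^ b) lg" "v \<noteq> 0" "v < 2 ^ b"
  shows "lg v < b" "2 ^ lg v \<le> v" "v < 2 * 2 ^ lg v"
proof -
  show "2 ^ lg v \<le> v" "v < 2 * 2 ^ lg v" using assms by (auto simp: log_ok_def)
  then have "(2::nat) ^ lg v < 2 ^ b" using assms(3) by linarith
  then show "lg v < b" by simp
qed

lemma sparse_step:
  assumes sp: "sparse_ok M A b nb sp (nb + i)" and b: "0 < b" and M: "\<And>k. k < nb \<Longrightarrow> k * b < M"
    and i: "i div nb < lg" "2 ^ lg \<le> nb"
  shows "sparse_ok M A b nb (sp(nb + i := min (sp i) (sp (i + 2 ^ (i div nb))))) (nb + Suc i)"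
  unfolding sparse_ok_def
proof (intro allI impI)
  fix j k assume h: "j * nb + k < nb + Suc i \<and> k < nb \<and> k + 2 ^ j \<le> nb"
  show "(sp(nb + i := min (sp i) (sp (i + 2 ^ (i div nb))))) (j * nb + k) = rmin A (k * b) (block_end M b (k + 2 ^ j) - 1)"
  proof (cases "j * nb + k = nb + i")
    case False
    then show ?thesis using sp h by (auto simp: sparse_ok_def)
  next
    case True
    then obtain j' where j: "j = Suc j'" using h by (cases j) auto
    then have ij: "i = j' * nb + k" using True by simp
    then have d: "i div nb = j'" using h by simp
    have "(2::nat) ^ j' < 2 ^ lg" using i(1) d by simp
    then have lt: "2 ^ j' < nb" using i(2) by linarith
    have k2: "k + 2 ^ j' + 2 ^ j' \<le> nb" using h j by simp
    have 1: "sp i = rmin A (k * b) (block_end M b (k + 2 ^ j') - 1)"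
      using sp h k2 ij lt by (auto simp: sparse_ok_def)
    have pos: "(0::nat) < 2 ^ j'" by simp
    have "j' * nb + (k + 2 ^ j') < nb + i" "k + 2 ^ j' < nb" using ij lt k2 pos by linarith+
    then have 2: "sp (i + 2 ^ j') = rmin A ((k + 2 ^ j') * b) (block_end M b (k + 2 ^ j' + 2 ^ j') - 1)"
      using sp k2 ij by (auto simp: sparse_ok_def add.assoc)
    have kb: "(k + 2 ^ j') * b < M" using M \<open>k + 2 ^ j' < nb\<close> by blast
    then have e1: "block_end M b (k + 2 ^ j') = (k + 2 ^ j') * b" by (simp add: block_end_def)
    have "k * b < (k + 2 ^ j') * b" using b by simp
    then have l1: "k * b \<le> (k + 2 ^ j') * b - 1" "Suc ((k + 2 ^ j') * b - 1) = (k + 2 ^ j') * b" by linarith+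
    have "(k + 2 ^ j') * b < (k + 2 ^ j' + 2 ^ j') * b" using b by simp
    then have l2: "(k + 2 ^ j') * b - 1 < block_end M b (k + 2 ^ j' + 2 ^ j') - 1"
      using kb l1 unfolding block_end_def by linarith
    have "k + 2 ^ j = k + 2 ^ j' + 2 ^ j'" by (simp add: j)
    then show ?thesis using True 1 2 d rmin_split[OF l1(1) l2, of A] l1(2) by (simp only: fun_upd_same e1)
  qed
qed

lemma runs_sparse_table:
  assumes r: "rg s 27 = nb" and b: "0 < b" "b \<le> M" and M: "1 \<le> M" and L: "5 * M + 20 < L" "M < 2 ^ b"
    and nb: "nb = (M - 1) div b + 1" and lg: "log_ok (2 ^ b) (ar s 17)"
    and BM: "\<And>k. k < nb \<Longrightarrow> ar s 18 k = rmin A (k * b) (block_end M b (Suc k) - 1)"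
  shows "runs L sparse_table s (200 * (M + 1)) (\<lambda>s'. \<forall>j k. 2 ^ j \<le> nb \<and> k + 2 ^ j \<le> nb \<longrightarrow>
     ar s' 18 (j * nb + k) = rmin A (k * b) (block_end M b (k + 2 ^ j) - 1))"
proof -
  note B = blocks[OF b M nb]
  let ?lg = "ar s 17 nb"
  let ?n = "?lg * nb"
  have nb1: "nb \<noteq> 0" "nb < 2 ^ b" using nb B(4) L by auto
  note LG = log_bound[OF lg nb1]
  have "?n \<le> b * nb" using LG(1) by (intro mult_le_mono1) simp
  also have "b * nb \<le> 2 * M" using B(1) by (simp only: mult.commute)
  finally have n: "?n \<le> 2 * M" .
  then have n': "nb * ?lg \<le> 2 * M" by (simp only: mult.commute)
  have lgL: "?lg < L" using LG(1) b L by linarith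
  let ?s = "s\<lparr>rg := (rg s)(28 := ?lg, 29 := ?n)\<rparr>"
  let ?B = "Upd 21 (Arr 18 (Var 20)) ;;
       Upd 22 (Arr 18 (Bin Add (Var 20) (Bin Shl (Cst 1) (Bin Div (Var 20) (Var 27))))) ;;
       HIf (Bin Less (Var 22) (Var 21)) (Upd 21 (Var 22)) HSkip ;;
       Put 18 (Bin Add (Var 27) (Var 20)) (Var 21)"
  let ?Q = "\<lambda>s'. \<forall>j k. 2 ^ j \<le> nb \<and> k + 2 ^ j \<le> nb \<longrightarrow> ar s' 18 (j * nb + k) = rmin A (k * b) (block_end M b (k + 2 ^ j) - 1)"
  have "runs L (For 20 (Var 29) ?B) ?s (78 * (2 * M + 1)) ?Q"
  proof (rule runs_For[where n = ?n and c = 70 and I = "\<lambda>i s'. sparse_ok M A b nb (ar s' 18) (nb + i)"])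
    have "sparse_ok M A b nb (ar s 18) nb"
      unfolding sparse_ok_def
    proof (intro allI impI)
      fix j k assume h: "j * nb + k < nb \<and> k < nb \<and> k + 2 ^ j \<le> nb"
      then have "j = 0" by (cases j) auto
      then show "ar s 18 (j * nb + k) = rmin A (k * b) (block_end M b (k + 2 ^ j) - 1)" using BM h by simp
    qed
    then show "sparse_ok M A b nb (ar (upd ?s 20 0) 18) (nb + 0)" by simp
    fix i s' assume i: "i < ?n" "rg s' 20 = i" and I: "sparse_ok M A b nb (ar s' 18) (nb + i)"
      and f: "frm (For 20 (Var 29) ?B) ?s s'"
    have A: "rg s' 27 = nb" using f r by (simp add: frm_def)
    have d: "i div nb < ?lg" using i nb1 by (simp add: div_less_iff_less_mult)
    have "(2::nat) ^ (i div nb) \<le> 2 ^ ?lg" using d by (intro power_increasing) auto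
    then have p: "2 ^ (i div nb) \<le> M" using LG(2) B(4) by linarith
    have "runs L ?B s' 70 (\<lambda>s''. ar s'' 18 = (ar s' 18)(nb + i := min (ar s' 18 i) (ar s' 18 (i + 2 ^ (i div nb)))))"
      by (rule runs_wp) (use A i L n p B(4) in \<open>auto simp: min_def\<close>)
    then show "runs L ?B s' 70 (\<lambda>s''. sparse_ok M A b nb (ar (upd s'' 20 (Suc i)) 18) (nb + Suc i))"
      by (rule runs_mono) (use sparse_step[OF I b(1) B(2) d LG(2)] in auto)
  next
    fix s' :: hst assume I: "sparse_ok M A b nb (ar s' 18) (nb + ?n)"
    show "?Q s'"
    proof (intro allI impI)
      fix j k assume h: "2 ^ j \<le> nb \<and> k + 2 ^ j \<le> nb"
      have "(2::nat) ^ j < 2 ^ Suc ?lg" using h LG(3) by simp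
      then have "j < Suc ?lg" by (rule power_less_imp_less_exp[rotated]) simp
      then have "j * nb \<le> ?n" by (intro mult_le_mono1) simp
      moreover have "k < nb" using h by (metis add_lessD1 le_less_trans less_add_same_cancel1 less_le_trans pos2 zero_less_power)
      ultimately show "ar s' 18 (j * nb + k) = rmin A (k * b) (block_end M b (k + 2 ^ j) - 1)"
        using I h unfolding sparse_ok_def by (metis add_less_le_mono add.commute)
    qed
  qed (use r n n' L in \<open>auto simp: frm_def\<close>)
  then show ?thesis unfolding sparse_table_def using r L B(4) lgL n n'
    by (intro runs_wp_HSeq[where ?t2.0 = "78 * (2 * M + 1)"]) auto
qed

definition rmq_ok :: "nat \<Rightarrow> (nat \<Rightarrow> nat) \<Rightarrow> nat \<Rightarrow> nat \<Rightarrow> hst \<Rightarrow> bool" where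
  "rmq_ok M A b nb s \<longleftrightarrow> rg s 25 = b \<and> rg s 27 = nb \<and> ar s 13 = A \<and> masks_ok M A b (ar s 15) \<and>
     ctz_ok (2 ^ b) (ar s 16) \<and> log_ok (2 ^ b) (ar s 17) \<and>
     (\<forall>j k. 2 ^ j \<le> nb \<and> k + 2 ^ j \<le> nb \<longrightarrow> ar s 18 (j * nb + k) = rmin A (k * b) (block_end M b (k + 2 ^ j) - 1)) \<and>
     nb = (M - 1) div b + 1 \<and> 0 < b \<and> b \<le> M \<and> M < 2 ^ b \<and> 2 ^ b \<le> 2 * M"

definition rmq :: hcmd where
  "rmq = block_size ;; bit_tables ;; block_masks ;; block_minima ;; sparse_table"

lemma mod_rmq [simp]: "modr rmq = {20,21,22,23,24,25,26,27,28,29}" "moda rmq = {14,15,16,17,18}"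
  by (auto simp: rmq_def)

lemma runs_rmq:
  assumes r: "rg s 3 = M" and M: "1 \<le> M" and L: "5 * M + 40 < L"
  shows "runs L rmq s (1500 * (M + 1)) (\<lambda>s'. \<exists>b nb. rmq_ok M (ar s 13) b nb s')"
  unfolding rmq_def
proof (rule runs_HSeq[OF runs_block_size[OF r M]])
  let ?Q = "\<lambda>s'. \<exists>b nb. rmq_ok M (ar s 13) b nb s'"
  fix s1 assume f1: "frm block_size s s1" and 1: "rg s1 26 = 2 ^ rg s1 25 \<and> M < 2 ^ rg s1 25 \<and> 2 ^ rg s1 25 \<le> 2 * M \<and> 1 \<le> rg s1 25 \<and> rg s1 25 \<le> M"
  define b where "b = rg s1 25"
  define nb where "nb = (M - 1) div b + 1"
  have b: "rg s1 25 = b" "rg s1 26 = 2 ^ b" "M < 2 ^ b" "2 ^ b \<le> 2 * M" "0 < b" "b \<le> M" using 1 by (auto simp: b_def)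
  have A1: "rg s1 3 = M" "ar s1 13 = ar s 13" using f1 r by (simp_all add: frm_def)
  show "runs L (bit_tables ;; block_masks ;; block_minima ;; sparse_table) s1 (110 * (2 * M + 1) + (600 * (M + 1) + (100 * (M + 2) + 200 * (M + 1)))) ?Q"
  proof (rule runs_HSeq[OF runs_mono[OF runs_bit_tables[OF b(2)]]])
    show "110 * (2 ^ b + 1) \<le> 110 * (2 * M + 1)" using b by simp
    fix s2 assume f2: "frm bit_tables s1 s2" and 2: "ctz_ok (2 ^ b) (ar s2 16) \<and> log_ok (2 ^ b) (ar s2 17)"
    have A2: "rg s2 3 = M" "ar s2 13 = ar s 13" "rg s2 25 = b" using f2 A1 b by (simp_all add: frm_def)
    show "runs L (block_masks ;; block_minima ;; sparse_table) s2 (600 * (M + 1) + (100 * (M + 2) + 200 * (M + 1))) ?Q"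
    proof (rule runs_HSeq[OF runs_block_masks[OF A2(1,3) b(5,4)]])
      fix s3 assume f3: "frm block_masks s2 s3" and 3: "masks_ok M (ar s2 13) b (ar s3 15)"
      have A3: "rg s3 3 = M" "ar s3 13 = ar s 13" "rg s3 25 = b" "ar s3 16 = ar s2 16" "ar s3 17 = ar s2 17"
        using f3 A2 by (simp_all add: frm_def)
      show "runs L (block_minima ;; sparse_table) s3 (100 * (M + 2) + 200 * (M + 1)) ?Q"
      proof (rule runs_HSeq[OF runs_block_minima[where nb = nb]])
        fix s4 assume f4: "frm block_minima s3 s4" and 4: "rg s4 27 = nb \<and> (\<forall>k<nb. ar s4 18 k = rmin (ar s3 13) (k * b) (block_end M b (Suc k) - 1))"
        have A4: "rg s4 25 = b" "ar s4 13 = ar s 13" "ar s4 15 = ar s3 15" "ar s4 16 = ar s2 16" "ar s4 17 = ar s2 17"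
          using f4 A3 by (simp_all add: frm_def)
        show "runs L sparse_table s4 (200 * (M + 1)) ?Q"
        proof (rule runs_mono[OF runs_sparse_table[where nb = nb and A = "ar s 13" and b = b and M = M]])
          fix s5 assume f5: "frm sparse_table s4 s5" and 5: "\<forall>j k. 2 ^ j \<le> nb \<and> k + 2 ^ j \<le> nb \<longrightarrow>
             ar s5 18 (j * nb + k) = rmin (ar s 13) (k * b) (block_end M b (k + 2 ^ j) - 1)"
          have "rg s5 25 = b" "rg s5 27 = nb" "ar s5 13 = ar s 13" "ar s5 15 = ar s3 15" "ar s5 16 = ar s2 16" "ar s5 17 = ar s2 17"
            using f5 A4 4 by (simp_all add: frm_def)
          then have "rmq_ok M (ar s 13) b nb s5"
            unfolding rmq_ok_def using 5 2 3 A2 b nb_def by simp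
          then show "?Q s5" by blast
        qed (use A4 A3 b M L nb_def 2 4 in auto)
      qed (use A3 A2 b M L nb_def 2 3 in auto)
    qed (use L in auto)
  qed (use b L in auto)
qed (use L in auto)

section \<open>Answering range minimum queries\<close>

definition min_into :: "hexp \<Rightarrow> hcmd" where
  "min_into e = Upd 35 e ;; HIf (Bin Less (Var 35) (Var 32)) (Upd 32 (Var 35)) HSkip"

text \<open>With the conditional expressed by \<open>min\<close>, a query over several candidates is
  verified without a case split for each of them.\<close>

lemma wp_min_into [simp]: "wp L (min_into e) Q s \<longleftrightarrow>
    hok L s e \<and> Q (s\<lparr>rg := (rg s)(35 := hev s e, 32 := min (rg s 32) (hev s e))\<rparr>)"
proof (cases "hev s e < rg s 32")
  case True
  then show ?thesis by (simp add: min_into_def min.absorb4)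
next
  case False
  then have "(rg s)(35 := hev s e, 32 := min (rg s 32) (hev s e)) = (rg s)(35 := hev s e)"
    by (auto simp: fun_eq_iff)
  then show ?thesis using False by (simp add: min_into_def)
qed

lemma min_into_simps [simp]: "tb (min_into e) = hcost e + 8" "modr (min_into e) = {32, 35}" "moda (min_into e) = {}"
  by (auto simp: min_into_def)

text \<open>If the range crosses a block border, it consists of the end of the block of
  \<open>l\<close>, read off the mask at the last position of that block, the beginning of the block
  of \<open>r\<close>, read off the unshifted mask at \<open>r\<close>, and the blocks between them,
  covered by two windows of the sparse table.\<close>

definition query :: hcmd where
  "query = Upd 33 (Bin Div (Var 30) (Var 25)) ;; Upd 34 (Bin Div (Var 31) (Var 25)) ;;
     HIf (Bin Eq (Var 33) (Var 34))
       (Upd 32 (Arr 13 (Bin Add (Var 30) (Arr 16 (Bin Shr (Arr 15 (Var 31)) (Bin Mod (Var 30) (Var 25)))))))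
       (Upd 35 (Bin Sub (Bin Mult (plus1 (Var 33)) (Var 25)) (Cst 1)) ;;
        Upd 32 (Arr 13 (Bin Add (Var 30) (Arr 16 (Bin Shr (Arr 15 (Var 35)) (Bin Mod (Var 30) (Var 25)))))) ;;
        min_into (Arr 13 (Bin Add (Bin Mult (Var 34) (Var 25)) (Arr 16 (Arr 15 (Var 31))))) ;;
        HIf (Bin Less (plus1 (Var 33)) (Var 34))
          (Upd 36 (Arr 17 (Bin Sub (Var 34) (plus1 (Var 33)))) ;;
           min_into (Arr 18 (Bin Add (Bin Mult (Var 36) (Var 27)) (plus1 (Var 33)))) ;;
           min_into (Arr 18 (Bin Add (Bin Mult (Var 36) (Var 27)) (Bin Sub (Var 34) (Bin Shl (Cst 1) (Var 36))))))
          HSkip)"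

lemma mod_query [simp]: "modr query = {32,33,34,35,36}" "moda query = {}"
  by (auto simp: query_def)

lemma runs_query:
  assumes ok: "rmq_ok M A b nb s" and r: "rg s 30 = l" "rg s 31 = r" and lr: "l \<le> r" "r < M" and L: "5 * M + 20 < L"
  shows "runs L query s 300 (\<lambda>s'. rg s' 32 = rmin A l r)"
proof -
  have rg: "rg s 25 = b" "rg s 27 = nb" "ar s 13 = A"
    and mk: "masks_ok M A b (ar s 15)" and cz: "ctz_ok (2 ^ b) (ar s 16)" and lg: "log_ok (2 ^ b) (ar s 17)"
    and sp: "\<And>j k. 2 ^ j \<le> nb \<Longrightarrow> k + 2 ^ j \<le> nb \<Longrightarrow> ar s 18 (j * nb + k) = rmin A (k * b) (block_end M b (k + 2 ^ j) - 1)"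
    and nb: "nb = (M - 1) div b + 1" and b: "0 < b" "b \<le> M" "M < 2 ^ b" "2 ^ b \<le> 2 * M"
    using ok unfolding rmq_ok_def by blast+
  have M: "1 \<le> M" using lr by simp
  note B = blocks[OF b(1,2) M nb]
  let ?bl = "l div b" and ?br = "r div b"
  have br: "?br < nb" using B(3)[OF lr(2)] .
  have ble: "?bl \<le> ?br" using lr by (intro div_le_mono)
  show ?thesis
  proof (cases "?bl = ?br")
    case True
    then have "block_start b r \<le> l" unfolding block_start_mult by (metis block_start_le block_start_mult)
    note I = inblock[OF mk cz b(1) lr(2) this lr(1)]
    show ?thesis unfolding query_def
    proof (rule runs_wp)
      have "ar s 15 r div 2 ^ (l mod b) < L" using I(1) b L by linarith
      moreover have "l + ar s 16 (ar s 15 r div 2 ^ (l mod b)) < L" using I(2) lr L by linarith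
      ultimately show "wp L (Upd 33 (Bin Div (Var 30) (Var 25)) ;; Upd 34 (Bin Div (Var 31) (Var 25)) ;;
     HIf (Bin Eq (Var 33) (Var 34))
       (Upd 32 (Arr 13 (Bin Add (Var 30) (Arr 16 (Bin Shr (Arr 15 (Var 31)) (Bin Mod (Var 30) (Var 25)))))))
       (Upd 35 (Bin Sub (Bin Mult (plus1 (Var 33)) (Var 25)) (Cst 1)) ;;
        Upd 32 (Arr 13 (Bin Add (Var 30) (Arr 16 (Bin Shr (Arr 15 (Var 35)) (Bin Mod (Var 30) (Var 25)))))) ;;
        min_into (Arr 13 (Bin Add (Bin Mult (Var 34) (Var 25)) (Arr 16 (Arr 15 (Var 31))))) ;;
        HIf (Bin Less (plus1 (Var 33)) (Var 34))
          (Upd 36 (Arr 17 (Bin Sub (Var 34) (plus1 (Var 33)))) ;;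
           min_into (Arr 18 (Bin Add (Bin Mult (Var 36) (Var 27)) (plus1 (Var 33)))) ;;
           min_into (Arr 18 (Bin Add (Bin Mult (Var 36) (Var 27)) (Bin Sub (Var 34) (Bin Shl (Cst 1) (Var 36))))))
          HSkip)) (\<lambda>s'. rg s' 32 = rmin A l r) s"
        using True rg r I(3) lr L by simp
    qed simp
  next
    case False
    then have lt: "?bl < ?br" using ble by simp
    define e where "e = (?bl + 1) * b - 1"
    have e1: "e + 1 = (?bl + 1) * b" using b by (simp add: e_def)
    have brb: "?br * b \<le> r" by (metis block_start_le block_start_mult)
    have "(?bl + 1) * b \<le> ?br * b" using lt by (intro mult_le_mono1) simp
    then have eb: "e + 1 \<le> ?br * b" using e1 by simp
    have le: "l \<le> e" "block_start b e \<le> l"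
    proof -
      have "l mod b < b" using b by simp
      then have "l < ?bl * b + b" using div_mult_mod_eq[of l b] by linarith
      then show "l \<le> e" using e1 by simp
      have "e div b = ?bl"
        by (rule div_nat_eqI) (use e1 b in \<open>auto simp: mult.commute\<close>)
      then show "block_start b e \<le> l" unfolding block_start_mult by (metis block_start_le block_start_mult)
    qed
    have eM: "e < M" using eb brb lr by linarith
    note I1 = inblock[OF mk cz b(1) eM le(2,1)]
    have "block_start b r \<le> ?br * b" by (simp add: block_start_mult)
    note I2 = inblock[OF mk cz b(1) lr(2) this brb, simplified]
    let ?v = "ar s 15 e div 2 ^ (l mod b)"
    let ?x1 = "A (l + ar s 16 ?v)" and ?x2 = "A (?br * b + ar s 16 (ar s 15 r))"
    have bl1: "(?bl + 1) * b < L" using e1 eM L by linarith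
    have s1: "?v < L" "l + ar s 16 ?v < L" "ar s 15 r < L" "?br * b + ar s 16 (ar s 15 r) < L" "e < L" "?br * b < L" "?br < L" "?bl + 1 < L" "r < L" "l < L"
      using I1(1,2) I2(1,2) b L eM lr brb br B(4) lt by linarith+
    have R2: "rmin A l r = min (rmin A l e) (rmin A (Suc e) r)" using rmin_split[of l e r A] le eb brb by linarith
    show ?thesis
    proof (cases "?bl + 1 < ?br")
      case False
      then have "?br = ?bl + 1" using lt by simp
      then have "Suc e = ?br * b" using e1 by simp
      then have res: "rmin A l r = min ?x1 ?x2" using R2 I1(3) I2(3) by simp
      show ?thesis unfolding query_def
      proof (rule runs_wp, goal_cases)
        case 1
        show ?case using False lt rg r s1 bl1 L b unfolding res by (simp add: e_def[symmetric, simplified])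
      qed simp
    next
      case True
      let ?q = "?br - (?bl + 1)"
      let ?j = "ar s 17 ?q"
      have q: "?q \<noteq> 0" "?q < 2 ^ b" "?q < nb" using True br B(4) b by linarith+
      note LG = log_bound[OF lg q(1,2)]
      have "?j * nb \<le> b * nb" using LG(1) by (intro mult_le_mono1) simp
      also have "b * nb \<le> 2 * M" using B(1) by (simp only: mult.commute)
      finally have jnb: "?j * nb \<le> 2 * M" .
      have j2: "2 ^ ?j \<le> ?br" "?bl + 1 + 2 ^ ?j \<le> ?br" using LG(2) True by linarith+
      have pos: "(1::nat) \<le> 2 ^ ?j" by simp
      let ?x3 = "ar s 18 (?j * nb + (?bl + 1))" and ?x4 = "ar s 18 (?j * nb + (?br - 2 ^ ?j))"
      let ?m = "(?bl + 1 + 2 ^ ?j) * b"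
      have mle: "?m \<le> ?br * b" using j2 by (intro mult_le_mono1)
      have x3: "?x3 = rmin A ((?bl + 1) * b) (?m - 1)"
      proof -
        have "block_end M b (?bl + 1 + 2 ^ ?j) = ?m" unfolding block_end_def using mle brb lr by linarith
        then show ?thesis using sp[of ?j "?bl + 1"] j2 br by simp
      qed
      have x4: "?x4 = rmin A ((?br - 2 ^ ?j) * b) (?br * b - 1)"
      proof -
        have "block_end M b ?br = ?br * b" unfolding block_end_def using brb lr by linarith
        moreover have "?br - 2 ^ ?j + 2 ^ ?j = ?br" using j2 by simp
        ultimately show ?thesis using sp[of ?j "?br - 2 ^ ?j"] j2 br by simp
      qed
      \<comment> \<open>The window length \<open>2 ^ ?j\<close> is the largest power of two not
        above the number of inner blocks: the windows stay among these blocks, and two of them leave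
        no gap.\<close>
      have o1: "(?br - 2 ^ ?j) * b \<le> ?m" using LG(3) by (intro mult_le_mono1) linarith
      have o2: "(?bl + 1) * b \<le> (?br - 2 ^ ?j) * b" using j2 by (intro mult_le_mono1) linarith
      have o3: "(?bl + 1) * b + b \<le> ?m" using mult_le_mono1[of "?bl + 2" "?bl + 1 + 2 ^ ?j" b] pos by simp
      have o4: "(?br - 2 ^ ?j) * b + b \<le> ?br * b"
      proof -
        have "(?br - 2 ^ ?j + 1) * b \<le> ?br * b" using j2 pos by (intro mult_le_mono1) linarith
        then show ?thesis by simp
      qed
      have "rmin A ((?bl + 1) * b) (?br * b - 1) = min ?x3 ?x4"
        unfolding x3 x4 by (rule rmin_overlap) (use o1 o2 o3 o4 mle b in linarith)+
      moreover have h: "Suc e \<le> ?br * b - 1" "?br * b - 1 < r" "Suc (?br * b - 1) = ?br * b"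
        using e1 o3 mle brb b by linarith+
      moreover have "rmin A (Suc e) r = min (rmin A (Suc e) (?br * b - 1)) (rmin A (?br * b) r)"
        using rmin_split[OF h(1,2), of A] unfolding h(3) .
      moreover have "Suc e = (?bl + 1) * b" using e1 by simp
      ultimately have res: "rmin A l r = min (min (min ?x1 ?x2) ?x3) ?x4"
        using R2 I1(3) I2(3) by (simp only: ac_simps)
      have s2: "?q < L" "?j * nb < L" "?j * nb + (?bl + 1) < L" "?j * nb + (?br - 2 ^ ?j) < L" "?j * nb + ?br - 2 ^ ?j < L" "2 ^ ?j < L" "2 ^ ?j \<le> ?br"
        using q jnb LG B(4) br L lt j2 by linarith+
      show ?thesis unfolding query_def
      proof (rule runs_wp, goal_cases)
        case 1
        have c: "(if ?bl + 1 < ?br then 1 else 0) \<noteq> (0::nat)" using True by simp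
        have "1 < L" "?br \<noteq> ?bl" "?bl + 1 \<le> ?br" "1 \<le> (?bl + 1) * b" using L lt b by auto
        note F = this(1) this(2)[symmetric] this s1 s2 bl1 True e_def[symmetric]
        show ?case unfolding res by (simp add: rg r F F[simplified])
      qed simp
    qed
  qed
qed

subsection \<open>Edit distance and alignments\<close>

text \<open>The costs are those of arbitrary alignments, not of optimal ones, and \<open>sub\<close>
  may replace a letter by itself. Alignments grow at the right end, as furthest reaching points
  do.\<close>

inductive aligned :: "'a list \<Rightarrow> 'a list \<Rightarrow> nat \<Rightarrow> bool" where
  nil: "aligned [] [] 0"
| mat: "aligned A B k \<Longrightarrow> aligned (A @ [a]) (B @ [a]) k"
| sub: "aligned A B k \<Longrightarrow> aligned (A @ [a]) (B @ [b]) (Suc k)"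
| ins: "aligned A B k \<Longrightarrow> aligned A (B @ [b]) (Suc k)"
| del: "aligned A B k \<Longrightarrow> aligned (A @ [a]) B (Suc k)"

lemma aligned_length: "aligned A B k \<Longrightarrow> length A \<le> length B + k \<and> length B \<le> length A + k"
  by (induction rule: aligned.induct) auto

lemma aligned_append: "aligned A2 B2 k2 \<Longrightarrow> aligned A1 B1 k1 \<Longrightarrow> aligned (A1 @ A2) (B1 @ B2) (k1 + k2)"
proof (induction arbitrary: A1 B1 k1 rule: aligned.induct)
  case (mat A B k a)
  then show ?case using aligned.mat[of "A1 @ A" "B1 @ B" "k1 + k" a] by simp
next
  case (sub A B k a b)
  then show ?case using aligned.sub[of "A1 @ A" "B1 @ B" "k1 + k" a b] by simp
next
  case (ins A B k b)
  then show ?case using aligned.ins[of "A1 @ A" "B1 @ B" "k1 + k" b] by simp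
next
  case (del A B k a)
  then show ?case using aligned.del[of "A1 @ A" "B1 @ B" "k1 + k" a] by simp
qed auto

text \<open>Edits act anywhere, whereas alignments grow on the right. Cutting an alignment at a
  point of the second string brings the edited letter to the end of a piece.\<close>

lemma aligned_split:
  "aligned A C k \<Longrightarrow> C = u @ v \<Longrightarrow> \<exists>A1 A2 k1 k2. A = A1 @ A2 \<and> aligned A1 u k1 \<and> aligned A2 v k2 \<and> k = k1 + k2"
proof (induction arbitrary: u v rule: aligned.induct)
  case nil
  then show ?case using aligned.nil by force
next
  case (mat A B k a)
  show ?case
  proof (cases v rule: rev_cases)
    case Nil
    then show ?thesis using mat aligned.mat[OF mat(1)] aligned.nil by force
  next
    case (snoc v' c)
    then have "B = u @ v'" "c = a" using mat by auto
    with mat.IH obtain A1 A2 k1 k2 where "A = A1 @ A2" "aligned A1 u k1" "aligned A2 v' k2" "k = k1 + k2" by blast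
    then show ?thesis using snoc \<open>c = a\<close> aligned.mat[of A2 v' k2 a] by (intro exI[of _ A1] exI[of _ "A2 @ [a]"]) auto
  qed
next
  case (sub A B k a b)
  show ?case
  proof (cases v rule: rev_cases)
    case Nil
    then show ?thesis using sub aligned.sub[OF sub(1)] aligned.nil by force
  next
    case (snoc v' c)
    then have "B = u @ v'" "c = b" using sub by auto
    with sub.IH obtain A1 A2 k1 k2 where "A = A1 @ A2" "aligned A1 u k1" "aligned A2 v' k2" "k = k1 + k2" by blast
    then show ?thesis using snoc \<open>c = b\<close> aligned.sub[of A2 v' k2 a b]
      by (intro exI[of _ A1] exI[of _ "A2 @ [a]"] exI[of _ k1] exI[of _ "Suc k2"]) auto
  qed
next
  case (ins A B k b)
  show ?case
  proof (cases v rule: rev_cases)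
    case Nil
    then show ?thesis using ins aligned.ins[OF ins(1)] aligned.nil by force
  next
    case (snoc v' c)
    then have "B = u @ v'" "c = b" using ins by auto
    with ins.IH obtain A1 A2 k1 k2 where "A = A1 @ A2" "aligned A1 u k1" "aligned A2 v' k2" "k = k1 + k2" by blast
    then show ?thesis using snoc \<open>c = b\<close> aligned.ins[of A2 v' k2 b]
      by (intro exI[of _ A1] exI[of _ A2] exI[of _ k1] exI[of _ "Suc k2"]) auto
  qed
next
  case (del A B k a)
  with del.IH obtain A1 A2 k1 k2 where "A = A1 @ A2" "aligned A1 u k1" "aligned A2 v k2" "k = k1 + k2" by blast
  then show ?case using aligned.del[of A2 v k2 a]
    by (intro exI[of _ A1] exI[of _ "A2 @ [a]"] exI[of _ k1] exI[of _ "Suc k2"]) auto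
qed

text \<open>The last letter of the second string comes from the last step other than
  \<open>del\<close>. That step is replaced, at the price of at most one, and the deletions after it
  are repeated.\<close>

lemma aligned_change_last:
  "aligned A C k \<Longrightarrow> C = u @ [a] \<Longrightarrow> (\<exists>k'\<le>Suc k. aligned A u k') \<and> (\<exists>k'\<le>Suc k. aligned A (u @ [b]) k')"
proof (induction arbitrary: u rule: aligned.induct)
  case (mat A B k a)
  then show ?case using aligned.del[of A u k a] aligned.sub[of A u k a b] by auto
next
  case (sub A B k a' b')
  then show ?case using aligned.del[of A u k a'] aligned.sub[of A u k a' b] by (metis append1_eq_conv le_SucI order_refl)
next
  case (ins A B k b')
  then show ?case using aligned.ins[of A u k b] by (metis append1_eq_conv le_SucI order_refl)
next
  case (del A B k a')
  then obtain k1 k2 where "k1 \<le> Suc k" "aligned A u k1" "k2 \<le> Suc k" "aligned A (u @ [b]) k2" by blast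
  then show ?case using aligned.del[of A u k1 a'] aligned.del[of A "u @ [b]" k2 a'] by (meson Suc_le_mono)
qed auto

lemma aligned_edit:
  assumes "aligned A B k" "edit B C"
  shows "\<exists>k'\<le>Suc k. aligned A C k'"
  using assms(2)
proof cases
  case (insertion u v a)
  then obtain A1 A2 k1 k2 where s: "A = A1 @ A2" "aligned A1 u k1" "aligned A2 v k2" "k = k1 + k2"
    using aligned_split[OF assms(1)] by blast
  have "aligned (A1 @ A2) ((u @ [a]) @ v) (Suc k1 + k2)" by (rule aligned_append[OF s(3) aligned.ins[OF s(2)]])
  then show ?thesis using s insertion by auto
next
  case (deletion u a v)
  then have "B = (u @ [a]) @ v" by simp
  then obtain A1 A2 k1 k2 where s: "A = A1 @ A2" "aligned A1 (u @ [a]) k1" "aligned A2 v k2" "k = k1 + k2"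
    using aligned_split[OF assms(1)] by blast
  obtain k' where k': "k' \<le> Suc k1" "aligned A1 u k'" using aligned_change_last[OF s(2) refl] by blast
  have "aligned (A1 @ A2) (u @ v) (k' + k2)" by (rule aligned_append[OF s(3) k'(2)])
  then show ?thesis using s k' deletion by (intro exI[of _ "k' + k2"]) auto
next
  case (substitution u a v b)
  then have "B = (u @ [a]) @ v" by simp
  then obtain A1 A2 k1 k2 where s: "A = A1 @ A2" "aligned A1 (u @ [a]) k1" "aligned A2 v k2" "k = k1 + k2"
    using aligned_split[OF assms(1)] by blast
  obtain k' where k': "k' \<le> Suc k1" "aligned A1 (u @ [b]) k'" using aligned_change_last[OF s(2) refl] by blast
  have "aligned (A1 @ A2) ((u @ [b]) @ v) (k' + k2)" by (rule aligned_append[OF s(3) k'(2)])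
  then show ?thesis using s k' substitution by (intro exI[of _ "k' + k2"]) auto
qed

lemma aligned_refl: "aligned A A 0"
  by (induction A rule: rev_induct) (auto intro: aligned.intros)

lemma edits_aligned: "(edit ^^ n) A B \<Longrightarrow> \<exists>k\<le>n. aligned A B k"
proof (induction n arbitrary: B)
  case 0
  then show ?case using aligned_refl by auto
next
  case (Suc n)
  then obtain C where "(edit ^^ n) A C" "edit C B" by auto
  then obtain k where "k \<le> n" "aligned A C k" using Suc.IH by blast
  then show ?case using aligned_edit[OF _ \<open>edit C B\<close>] by (meson Suc_le_mono le_trans)
qed

lemma edit_append: "edit A B \<Longrightarrow> edit (A @ w) (B @ w)"
proof (induction rule: edit.induct)
  case (insertion u v a)
  then show ?case using edit.insertion[of u "v @ w" a] by simp
next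
  case (deletion u a v)
  then show ?case using edit.deletion[of u a "v @ w"] by simp
next
  case (substitution u a v b)
  then show ?case using edit.substitution[of u a "v @ w" b] by simp
qed

lemma edits_append: "(edit ^^ n) A B \<Longrightarrow> (edit ^^ n) (A @ w) (B @ w)"
proof (induction n arbitrary: B)
  case (Suc n)
  then obtain C where "(edit ^^ n) A C" "edit C B" by auto
  then show ?case using Suc.IH edit_append by (metis relpowp_Suc_I)
qed auto

lemma aligned_edits: "aligned A B k \<Longrightarrow> (edit ^^ k) A B"
proof (induction rule: aligned.induct)
  case (mat A B k a)
  then show ?case by (intro edits_append)
next
  case (sub A B k a b)
  have "edit (B @ [a]) (B @ [b])" using edit.substitution[of B a "[]" b] by simp
  then show ?case using edits_append[OF sub.IH] by (rule relpowp_Suc_I[rotated])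
next
  case (ins A B k b)
  have "edit B (B @ [b])" using edit.insertion[of B "[]" b] by simp
  then show ?case using ins.IH by (rule relpowp_Suc_I[rotated])
next
  case (del A B k a)
  have "edit (B @ [a]) B" using edit.deletion[of B a "[]"] by simp
  then show ?case using edits_append[OF del.IH] by (rule relpowp_Suc_I[rotated])
qed auto

lemma aligned_Nil: "aligned [] B (length B)" "aligned A [] (length A)"
proof -
  show "aligned [] B (length B)" by (induction B rule: rev_induct) (auto intro: aligned.intros)
  show "aligned A [] (length A)" by (induction A rule: rev_induct) (auto intro: aligned.intros)
qed

text \<open>Inserting all of \<open>B\<close> and deleting all of \<open>A\<close> shows that some
  number of edits works, so the \<open>LEAST\<close> in \<open>ED\<close> is attained. Edit
  sequences become alignments edit by edit, and alignments are themselves edit sequences.\<close>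

lemma ED_le_iff: "ED A B \<le> n \<longleftrightarrow> (\<exists>k\<le>n. aligned A B k)"
proof
  have "aligned ([] @ A) (B @ []) (length B + length A)" by (rule aligned_append) (rule aligned_Nil)+
  then have "(edit ^^ (length B + length A)) A B" using aligned_edits by fastforce
  then have "(edit ^^ ED A B) A B" unfolding ED_def by (rule LeastI)
  then show "ED A B \<le> n \<Longrightarrow> \<exists>k\<le>n. aligned A B k" using edits_aligned le_trans by blast
  show "\<exists>k\<le>n. aligned A B k \<Longrightarrow> ED A B \<le> n" using aligned_edits unfolding ED_def by (meson Least_le le_trans)
qed

lemma aligned_drop_prefix: "aligned A (P @ B) k \<Longrightarrow> \<exists>k'\<le>k + length P. aligned A B k'"
proof (induction P arbitrary: k)
  case (Cons a P)
  have "edit ([] @ [a] @ P @ B) ([] @ P @ B)" by (rule edit.deletion)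
  then obtain k' where "k' \<le> Suc k" "aligned A (P @ B) k'" using aligned_edit[OF Cons.prems] by auto
  then obtain k'' where "k'' \<le> k' + length P" "aligned A B k''" using Cons.IH by blast
  then show ?case using \<open>k' \<le> Suc k\<close> by (intro exI[of _ k'']) simp
qed auto

lemma aligned_equal_length: "length A = length B \<Longrightarrow> aligned A B (length A)"
proof (induction A arbitrary: B rule: rev_induct)
  case (snoc a A)
  then obtain B' b where "B = B' @ [b]" by (cases B rule: rev_cases) auto
  moreover from this have "aligned A B' (length A)" using snoc by simp
  ultimately show ?case using aligned.sub[of A B' "length A" a b] by simp
qed (auto intro: aligned.intros)

subsection \<open>Furthest reaching points with a free row_start\<close>

definition seg :: "(nat \<Rightarrow> 'a) \<Rightarrow> nat \<Rightarrow> nat \<Rightarrow> 'a list" where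
  "seg Z i j = map Z [i..<j]"

lemma seg_Suc: "i \<le> j \<Longrightarrow> seg Z i (Suc j) = seg Z i j @ [Z j]"
  by (simp add: seg_def)

lemma length_seg [simp]: "length (seg Z i j) = j - i"
  by (simp add: seg_def)

lemma seg_append: "i \<le> j \<Longrightarrow> j \<le> k \<Longrightarrow> seg Z i k = seg Z i j @ seg Z j k"
  unfolding seg_def by (metis le_Suc_ex map_append upt_add_eq_append)

definition maximal_slide :: "(nat \<Rightarrow> 'a) \<Rightarrow> nat \<Rightarrow> nat \<Rightarrow> nat \<Rightarrow> nat \<Rightarrow> bool" where
  "maximal_slide Z n b x y \<longleftrightarrow> x \<le> y \<and> y \<le> n \<and> (\<forall>l. x \<le> l \<and> l < y \<longrightarrow> Z l = Z (b + l)) \<and> (y < n \<longrightarrow> Z y \<noteq> Z (b + y))"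

text \<open>A row stores one more than the furthest reaching point of each diagonal; 0 means that
  nothing has been reached yet.\<close>

definition row_start :: "nat \<Rightarrow> (nat \<Rightarrow> nat) \<Rightarrow> nat \<Rightarrow> nat" where
  "row_start n F d = min n (max (max (F d) (F (Suc d))) (if d = 0 then 0 else F (d - 1) - 1))"

text \<open>The entry \<open>W\<close> is a sentinel: \<open>row_start\<close> reads it as the right
  neighbour of the last diagonal \<open>W - 1\<close>.\<close>

definition rowok :: "(nat \<Rightarrow> 'a) \<Rightarrow> nat \<Rightarrow> nat \<Rightarrow> nat \<Rightarrow> (nat \<Rightarrow> nat) \<Rightarrow> (nat \<Rightarrow> nat) \<Rightarrow> bool" where
  "rowok Z n b W F G \<longleftrightarrow> G W = 0 \<and> (\<forall>d<W. \<exists>y. maximal_slide Z n (b + d) (row_start n F d) y \<and> G d = Suc y)"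

text \<open>Row \<open>Suc j\<close> belongs to cost \<open>j\<close>. The zero row
  \<open>F 0\<close> lets every diagonal begin at 0, which is the free start.\<close>

definition rows :: "(nat \<Rightarrow> 'a) \<Rightarrow> nat \<Rightarrow> nat \<Rightarrow> nat \<Rightarrow> (nat \<Rightarrow> nat \<Rightarrow> nat) \<Rightarrow> nat \<Rightarrow> bool" where
  "rows Z n b W F m \<longleftrightarrow> (\<forall>d\<le>W. F 0 d = 0) \<and> (\<forall>j<m. rowok Z n b W (F j) (F (Suc j)))"

lemma rowsD:
  assumes "rows Z n b W F m" "j < m" "d < W"
  shows "\<exists>y. maximal_slide Z n (b + d) (row_start n (F j) d) y \<and> F (Suc j) d = Suc y"
  using assms by (auto simp: rows_def rowok_def)

lemma rows_end: "rows Z n b W F m \<Longrightarrow> j \<le> m \<Longrightarrow> F j W = 0"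
  by (cases j) (auto simp: rows_def rowok_def)

lemma rows_bounds:
  assumes R: "rows Z n b W F m" "j < m" "d < W"
  shows "1 \<le> F (Suc j) d" "F (Suc j) d \<le> Suc n" "F j d \<le> F (Suc j) d \<or> F j d = Suc n \<and> F (Suc j) d = Suc n"
proof -
  obtain y where y: "maximal_slide Z n (b + d) (row_start n (F j) d) y" "F (Suc j) d = Suc y" using rowsD[OF R] by blast
  then show 1: "1 \<le> F (Suc j) d" "F (Suc j) d \<le> Suc n" by (auto simp: maximal_slide_def)
  have "F j d \<le> Suc n"
  proof (cases j)
    case 0
    then show ?thesis using R by (simp add: rows_def)
  next
    case (Suc i)
    then obtain y' where "maximal_slide Z n (b + d) (row_start n (F i) d) y'" "F j d = Suc y'" using rowsD[OF R(1), of i d] R by auto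
    then show ?thesis by (simp add: maximal_slide_def)
  qed
  moreover have "min n (F j d) \<le> y" using y(1) by (auto simp: maximal_slide_def row_start_def)
  ultimately show "F j d \<le> F (Suc j) d \<or> F j d = Suc n \<and> F (Suc j) d = Suc n"
    using y unfolding maximal_slide_def by linarith
qed

lemma aligned_maximal_slide:
  assumes a: "aligned (seg Z 0 x) (seg Z p (b + x)) k" and p: "p \<le> b + x" and s: "maximal_slide Z n b x y"
  shows "aligned (seg Z 0 y) (seg Z p (b + y)) k"
proof -
  have xy: "x \<le> y" and eq: "\<And>l. x \<le> l \<Longrightarrow> l < y \<Longrightarrow> Z l = Z (b + l)" using s by (auto simp: maximal_slide_def)
  have "x + i \<le> y \<Longrightarrow> aligned (seg Z 0 (x + i)) (seg Z p (b + (x + i))) k" for i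
  proof (induction i)
    case (Suc i)
    then have "aligned (seg Z 0 (x + i) @ [Z (x + i)]) (seg Z p (b + (x + i)) @ [Z (x + i)]) k" by (intro aligned.mat) simp
    moreover have "Z (x + i) = Z (b + (x + i))" using eq Suc.prems by simp
    ultimately show ?case using p by (simp add: seg_Suc)
  qed (use a in simp)
  from this[of "y - x"] show ?thesis using xy by simp
qed

text \<open>The candidates in \<open>row_start\<close> are a substitution on the same diagonal, the
  deletion of a letter of the pattern coming from diagonal \<open>Suc d\<close>, and an insertion
  coming from \<open>d - 1\<close>; the slide then adds matches for free. The start \<open>p\<close>
  of the window is whatever diagonal the path began on.\<close>

lemma rows_sound:
  assumes R: "rows Z n b W F m"
  shows "j < m \<Longrightarrow> d < W \<Longrightarrow> F (Suc j) d = Suc y \<Longrightarrow>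
    \<exists>p k. k \<le> j \<and> p \<le> b + d + y \<and> aligned (seg Z 0 y) (seg Z p (b + d + y)) k"
proof (induction j arbitrary: d y)
  case 0
  obtain y' where y': "maximal_slide Z n (b + d) (row_start n (F 0) d) y'" "F (Suc 0) d = Suc y'" using rowsD[OF R, of 0 d] 0 by blast
  have st: "row_start n (F 0) d = 0" using R 0 by (auto simp: row_start_def rows_def)
  have "aligned (seg Z 0 0) (seg Z (b + d) (b + d + 0)) 0" by (simp add: seg_def aligned.nil)
  then have "aligned (seg Z 0 y') (seg Z (b + d) (b + d + y')) 0"
    by (rule aligned_maximal_slide) (use y'(1) st in simp_all)
  then show ?case using y' 0 by (intro exI[of _ "b + d"] exI[of _ 0]) auto
next
  case (Suc j)
  obtain y' where y': "maximal_slide Z n (b + d) (row_start n (F (Suc j)) d) y'" "F (Suc (Suc j)) d = Suc y'"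
    using rowsD[OF R, of "Suc j" d] Suc by blast
  let ?G = "F (Suc j)"
  have j: "j < m" using Suc by simp
  have "\<exists>p k. k \<le> Suc j \<and> p \<le> b + d + row_start n ?G d \<and> aligned (seg Z 0 (row_start n ?G d)) (seg Z p (b + d + row_start n ?G d)) k"
  proof -
    have F1: "1 \<le> ?G d" using rows_bounds(1)[OF R j Suc.prems(2)] .
    let ?c = "max (max (?G d) (?G (Suc d))) (if d = 0 then 0 else ?G (d - 1) - 1)"
    define w where "w = (if d = 0 then 0 else ?G (d - 1) - 1)"
    have c: "?c = max (max (?G d) (?G (Suc d))) w" by (simp only: w_def)
    have mx: "max (max u v) w = u \<or> max (max u v) w = v \<and> u < v \<or> max (max u v) w = w \<and> u < w" for u v :: nat
      by linarith
    have "d \<noteq> 0 \<and> w = ?G (d - 1) - 1" if "?G d < w" using that by (cases "d = 0") (simp_all add: w_def)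
    then consider (diag) "?c = ?G d" | (up) "?c = ?G (Suc d)" "?G d < ?G (Suc d)" | (left) "?c = ?G (d - 1) - 1" "d \<noteq> 0"
      using mx[of "?G d" "?G (Suc d)"] unfolding c by metis
    then show ?thesis
    proof cases
      case diag
      then obtain z where z: "?G d = Suc z" using F1 by (cases "?G d") auto
      obtain p k where pk: "k \<le> j" "p \<le> b + d + z" "aligned (seg Z 0 z) (seg Z p (b + d + z)) k"
        using Suc.IH[OF j Suc.prems(2) z] by blast
      have "z \<le> n" using rows_bounds(2)[OF R j Suc.prems(2)] z by simp
      show ?thesis
      proof (cases "z = n")
        case True
        then have "row_start n ?G d = z" using diag z by (simp add: row_start_def)
        then show ?thesis using pk by (intro exI[of _ p] exI[of _ k]) auto
      next
        case False
        then have "row_start n ?G d = Suc z" using diag z \<open>z \<le> n\<close> by (simp add: row_start_def)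
        moreover have "aligned (seg Z 0 (Suc z)) (seg Z p (b + d + Suc z)) (Suc k)"
          using aligned.sub[OF pk(3), of "Z z" "Z (b + d + z)"] pk(2) by (simp add: seg_Suc)
        ultimately show ?thesis using pk by (intro exI[of _ p] exI[of _ "Suc k"]) auto
      qed
    next
      case up
      have dW: "Suc d < W"
      proof (rule ccontr)
        assume "\<not> ?thesis"
        then have "Suc d = W" using Suc.prems by simp
        then show False using up rows_end[OF R, of "Suc j"] Suc.prems by simp
      qed
      obtain z where z: "?G (Suc d) = Suc z" using up by (cases "?G (Suc d)") auto
      obtain p k where pk: "k \<le> j" "p \<le> b + Suc d + z" "aligned (seg Z 0 z) (seg Z p (b + Suc d + z)) k"
        using Suc.IH[OF j dW z] by blast
      have "z \<le> n" using rows_bounds(2)[OF R j dW] z by simp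
      show ?thesis
      proof (cases "z = n")
        case False
        then have "row_start n ?G d = Suc z" using up z \<open>z \<le> n\<close> by (simp add: row_start_def)
        moreover have "aligned (seg Z 0 (Suc z)) (seg Z p (b + Suc d + z)) (Suc k)"
          using aligned.del[OF pk(3), of "Z z"] by (simp add: seg_Suc)
        ultimately show ?thesis using pk by (intro exI[of _ p] exI[of _ "Suc k"]) auto
      next
        case True
        \<comment> \<open>The pattern is used up on diagonal \<open>Suc d\<close>, so no letter of
          it can be deleted. Passing to diagonal \<open>d\<close> instead drops the last letter of
          the window, which costs at most one, or nothing if the window is empty.\<close>
        then have st: "row_start n ?G d = z" using up z by (simp add: row_start_def)
        show ?thesis
        proof (cases "p \<le> b + d + z")
          case True
          then have "seg Z p (b + Suc d + z) = seg Z p (b + d + z) @ [Z (b + d + z)]" using seg_Suc[of p "b + d + z" Z] by simp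
          then obtain k' where "k' \<le> Suc k" "aligned (seg Z 0 z) (seg Z p (b + d + z)) k'"
            using aligned_change_last[OF pk(3)] by blast
          then show ?thesis using st True pk by (intro exI[of _ p] exI[of _ k']) auto
        next
          case False
          then have "seg Z p (b + Suc d + z) = seg Z (b + d + z) (b + d + z)" by (simp add: seg_def)
          then show ?thesis using st pk by (intro exI[of _ "b + d + z"] exI[of _ k]) auto
        qed
      qed
    next
      case left
      then obtain e where e: "d = Suc e" by (cases d) auto
      then have eW: "e < W" using Suc.prems by auto
      obtain z where z: "?G e = Suc z" using rows_bounds(1)[OF R j eW] by (cases "?G e") auto
      obtain p k where pk: "k \<le> j" "p \<le> b + e + z" "aligned (seg Z 0 z) (seg Z p (b + e + z)) k"
        using Suc.IH[OF j eW z] by blast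
      have "z \<le> n" using rows_bounds(2)[OF R j eW] z by simp
      then have "row_start n ?G d = z" using left z e by (simp add: row_start_def)
      moreover have "aligned (seg Z 0 z) (seg Z p (b + d + z)) (Suc k)"
        using aligned.ins[OF pk(3), of "Z (b + e + z)"] pk(2) e by (simp add: seg_Suc)
      ultimately show ?thesis using pk e by (intro exI[of _ p] exI[of _ "Suc k"]) auto
    qed
  qed
  then obtain p k where pk: "k \<le> Suc j" "p \<le> b + d + row_start n ?G d"
    "aligned (seg Z 0 (row_start n ?G d)) (seg Z p (b + d + row_start n ?G d)) k" by blast
  have "aligned (seg Z 0 y') (seg Z p (b + d + y')) k" by (rule aligned_maximal_slide[OF pk(3,2) y'(1)])
  moreover have "row_start n ?G d \<le> y'" using y'(1) by (simp add: maximal_slide_def)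
  ultimately show ?case using pk y' Suc.prems by (intro exI[of _ p] exI[of _ k]) auto
qed

lemma seg_snocE:
  assumes "seg Z i j = B @ [c]"
  obtains j' where "j = Suc j'" "i \<le> j'" "B = seg Z i j'" "c = Z j'"
proof -
  have "i < j" using assms by (cases "i < j") (auto simp: seg_def)
  then obtain j' where "j = Suc j'" "i \<le> j'" by (cases j) auto
  then show ?thesis using assms that[of j'] by (simp add: seg_Suc)
qed

text \<open>An alignment that begins on \<open>d0\<close> drifts by at most one diagonal per
  insertion or deletion; with cost at most \<open>h\<close> it never leaves the \<open>W\<close>
  diagonals, so every step of it is dominated by the recurrence.\<close>

lemma rows_complete:
  assumes R: "rows Z n b W F m" and d0: "h \<le> d0" "d0 + h < W"
  shows "aligned U V k \<Longrightarrow> U = seg Z 0 x \<Longrightarrow> V = seg Z (b + d0) y \<Longrightarrow> b + d0 \<le> y \<Longrightarrow> x \<le> n \<Longrightarrow> k < m \<Longrightarrow> k \<le> h \<Longrightarrow>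
    \<exists>d. y = b + d + x \<and> d < W \<and> Suc x \<le> F (Suc k) d"
proof (induction arbitrary: x y rule: aligned.induct)
  case nil
  then have "x = 0" "y = b + d0" by (auto simp: seg_def)
  then show ?case using rows_bounds(1)[OF R nil(5), of d0] d0 by auto
next
  case (mat A B k a)
  obtain x' where x: "x = Suc x'" "A = seg Z 0 x'" "a = Z x'" using mat(3) by (metis seg_snocE)
  obtain y' where y: "y = Suc y'" "b + d0 \<le> y'" "B = seg Z (b + d0) y'" "a = Z y'" using mat(4) by (metis seg_snocE)
  obtain d where d: "y' = b + d + x'" "d < W" "Suc x' \<le> F (Suc k) d"
    using mat.IH[OF x(2) y(3,2)] mat.prems x by auto
  obtain z where z: "maximal_slide Z n (b + d) (row_start n (F k) d) z" "F (Suc k) d = Suc z" using rowsD[OF R mat.prems(5) d(2)] by blast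
  have "Z x' = Z (b + d + x')" "x' < n" using x y d mat.prems(4) by simp_all
  \<comment> \<open>A maximal slide cannot stop in front of a match, so the furthest point lies
    beyond \<open>x'\<close>.\<close>
  then have "z \<noteq> x'" using z(1) unfolding maximal_slide_def by auto
  then show ?case using d x y z by (intro exI[of _ d]) auto
next
  case (sub A B k a c)
  obtain x' where x: "x = Suc x'" "A = seg Z 0 x'" "a = Z x'" using sub(3) by (metis seg_snocE)
  obtain y' where y: "y = Suc y'" "b + d0 \<le> y'" "B = seg Z (b + d0) y'" "c = Z y'" using sub(4) by (metis seg_snocE)
  obtain d where d: "y' = b + d + x'" "d < W" "Suc x' \<le> F (Suc k) d"
    using sub.IH[OF x(2) y(3,2)] sub.prems x by auto
  obtain z where z: "maximal_slide Z n (b + d) (row_start n (F (Suc k)) d) z" "F (Suc (Suc k)) d = Suc z"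
    using rowsD[OF R sub.prems(5) d(2)] by blast
  have "Suc x' \<le> row_start n (F (Suc k)) d" using d x sub.prems by (auto simp: row_start_def)
  then show ?case using d x y z by (intro exI[of _ d]) (auto simp: maximal_slide_def)
next
  case (ins A B k c)
  obtain y' where y: "y = Suc y'" "b + d0 \<le> y'" "B = seg Z (b + d0) y'" "c = Z y'" using ins(4) by (metis seg_snocE)
  obtain d where d: "y' = b + d + x" "d < W" "Suc x \<le> F (Suc k) d"
    using ins.IH[OF ins.prems(1) y(3,2)] ins.prems by auto
  \<comment> \<open>The distance between \<open>d\<close> and \<open>d0\<close> is the difference of
    the two lengths and is bounded by the cost so far, which leaves room for one more
    diagonal.\<close>
  have "length B \<le> length A + k" using aligned_length[OF ins.hyps] by simp
  then have "Suc d < W" using y d ins.prems d0 by simp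
  obtain z where z: "maximal_slide Z n (b + Suc d) (row_start n (F (Suc k)) (Suc d)) z" "F (Suc (Suc k)) (Suc d) = Suc z"
    using rowsD[OF R ins.prems(5) \<open>Suc d < W\<close>] by blast
  have "x \<le> row_start n (F (Suc k)) (Suc d)" using d ins.prems by (auto simp: row_start_def)
  then show ?case using d y z \<open>Suc d < W\<close> by (intro exI[of _ "Suc d"]) (auto simp: maximal_slide_def)
next
  case (del A B k a)
  obtain x' where x: "x = Suc x'" "A = seg Z 0 x'" "a = Z x'" using del(3) by (metis seg_snocE)
  obtain d where d: "y = b + d + x'" "d < W" "Suc x' \<le> F (Suc k) d"
    using del.IH[OF x(2) del.prems(2,3)] del.prems x by auto
  have "length A \<le> length B + k" using aligned_length[OF del.hyps] by simp
  then have "0 < d" using x d del.prems d0 by simp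
  then obtain d' where d': "d = Suc d'" by (cases d) auto
  obtain z where z: "maximal_slide Z n (b + d') (row_start n (F (Suc k)) d') z" "F (Suc (Suc k)) d' = Suc z"
    using rowsD[OF R del.prems(5), of d'] d d' by auto
  have "Suc x' \<le> row_start n (F (Suc k)) d'" using d d' x del.prems by (auto simp: row_start_def)
  then show ?case using d d' x z by (intro exI[of _ d']) (auto simp: maximal_slide_def)
qed

text \<open>A reached end stays reached, so \<open>c\<close> is the least cost at which diagonal
  \<open>d\<close> is complete, capped at \<open>h\<close>. Starting on \<open>d\<close> itself is
  one of the free starts, hence \<open>c\<close> is a lower bound. Conversely, comparing lengths
  shows that an alignment of cost \<open>k\<close> has its start \<open>p\<close> within
  \<open>k\<close> of \<open>b + d\<close>, and moving the start there costs at most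
  \<open>k\<close> more. If the cap is attained, \<open>c = h\<close> is \<open>K\<close> or
  \<open>n\<close>, and the capped distance is at most either.\<close>

lemma rows_approx:
  assumes R: "rows Z n b W F h" and d: "h \<le> d" "d + h < W" and hK: "h \<le> K" "h = K \<or> h = n"
  defines "c \<equiv> card {j. j < h \<and> F (Suc j) d \<le> n}"
  shows "c \<le> min (ED (seg Z 0 n) (seg Z (b + d) (b + d + n))) K"
    "min (ED (seg Z 0 n) (seg Z (b + d) (b + d + n))) K \<le> 2 * c"
proof -
  let ?E = "ED (seg Z 0 n) (seg Z (b + d) (b + d + n))"
  have dW: "d < W" using d by simp
  have full: "F (Suc i) d = Suc n" if "F (Suc j) d = Suc n" "j \<le> i" "i < h" for i j
    using that(2,3)
  proof (induction i rule: dec_induct)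
    case (step i)
    then have "F (Suc i) d = Suc n" by simp
    then show ?case using rows_bounds(2,3)[OF R step.prems dW] by auto
  qed (use that in simp)
  have le: "F (Suc j) d \<le> Suc n" if "j < h" for j using rows_bounds(2)[OF R that dW] .
  have ch: "c \<le> h" unfolding c_def by (rule card_less_Collect)
  have cE: "c \<le> ?E"
  proof (cases "?E < h")
    case True
    obtain k where k: "k \<le> ?E" "aligned (seg Z 0 n) (seg Z (b + d) (b + d + n)) k" using ED_le_iff[of _ _ ?E] by auto
    obtain d' where "b + d + n = b + d' + n" "Suc n \<le> F (Suc k) d'"
      using rows_complete[OF R d k(2) refl refl] k(1) True by auto
    then have "F (Suc k) d = Suc n" using le[of k] k(1) True by auto
    then have "{j. j < h \<and> F (Suc j) d \<le> n} \<subseteq> {..<k}" using full[of k] by (force simp: not_less[symmetric])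
    then have "c \<le> card {..<k}" unfolding c_def by (intro card_mono) auto
    then show ?thesis using k by simp
  qed (use ch in simp)
  then show "c \<le> min ?E K" using ch hK by simp
  have "aligned (seg Z 0 n) (seg Z (b + d) (b + d + n)) n"
    using aligned_equal_length[of "seg Z 0 n" "seg Z (b + d) (b + d + n)"] by simp
  then have En: "?E \<le> n" using ED_le_iff by blast
  show "min ?E K \<le> 2 * c"
  proof (cases "c < h")
    case False
    then show ?thesis using ch hK En by auto
  next
    case True
    have "F (Suc c) d = Suc n"
    proof (rule ccontr)
      assume "F (Suc c) d \<noteq> Suc n"
      then have "\<forall>i\<le>c. F (Suc i) d \<le> n" using full[of _ c] le True by (metis le_SucE le_less_trans)
      then have "{..c} \<subseteq> {j. j < h \<and> F (Suc j) d \<le> n}" using True by auto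
      then have "card {..c} \<le> c" unfolding c_def by (intro card_mono) auto
      then show False by simp
    qed
    then obtain p k where pk: "k \<le> c" "p \<le> b + d + n" "aligned (seg Z 0 n) (seg Z p (b + d + n)) k"
      using rows_sound[OF R True dW] by blast
    have len: "n \<le> b + d + n - p + k" "b + d + n - p \<le> n + k" using aligned_length[OF pk(3)] by simp_all
    have "\<exists>k'\<le>2 * k. aligned (seg Z 0 n) (seg Z (b + d) (b + d + n)) k'"
    proof (cases "b + d \<le> p")
      case True
      have "aligned ([] @ seg Z 0 n) (seg Z (b + d) p @ seg Z p (b + d + n)) (length (seg Z (b + d) p) + k)"
        by (rule aligned_append[OF pk(3) aligned_Nil(1)])
      then have "aligned (seg Z 0 n) (seg Z (b + d) (b + d + n)) (p - (b + d) + k)"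
        using seg_append[OF True pk(2), of Z] by simp
      moreover have "p - (b + d) + k \<le> 2 * k" using len pk True by linarith
      ultimately show ?thesis by blast
    next
      case False
      then have "seg Z p (b + d + n) = seg Z p (b + d) @ seg Z (b + d) (b + d + n)" by (intro seg_append) auto
      then obtain k' where "k' \<le> k + length (seg Z p (b + d))" "aligned (seg Z 0 n) (seg Z (b + d) (b + d + n)) k'"
        using aligned_drop_prefix pk(3) by metis
      moreover have "k + length (seg Z p (b + d)) \<le> 2 * k" using len pk False by simp
      ultimately show ?thesis using le_trans by blast
    qed
    then have "?E \<le> 2 * k" using ED_le_iff by blast
    then show ?thesis using pk by simp
  qed
qed

subsection \<open>Longest common extensions\<close>

text \<open>The index is built on the names \<open>T\<close>, which are positive and end in zeros,
  while slides compare the characters \<open>Z\<close>; the two agree on equality inside the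
  text.\<close>

definition lce_ok :: "nat \<Rightarrow> (nat \<Rightarrow> nat) \<Rightarrow> (nat \<Rightarrow> nat) \<Rightarrow> hst \<Rightarrow> bool" where
  "lce_ok M T Z s \<longleftrightarrow> wf_str T M \<and> ranked T M s \<and> (\<forall>i<M. \<forall>j<M. Z i = Z j \<longleftrightarrow> T i = T j) \<and>
     (\<forall>k. 0 < k \<and> k < M \<longrightarrow> ar s 13 k = lcp T (ar s 10 (k - 1)) (ar s 10 k)) \<and>
     (\<exists>c nb. rmq_ok M (ar s 13) c nb s)"

lemma lce_ok_frm:
  assumes "lce_ok M T Z s" "\<And>a. a \<in> {9,10,13,15,16,17,18} \<Longrightarrow> ar s' a = ar s a" "rg s' 25 = rg s 25" "rg s' 27 = rg s 27"
  shows "lce_ok M T Z s'"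
proof -
  have e: "ar s' 9 = ar s 9" "ar s' 10 = ar s 10" "ar s' 13 = ar s 13" "ar s' 15 = ar s 15" "ar s' 16 = ar s 16"
    "ar s' 17 = ar s 17" "ar s' 18 = ar s 18" using assms(2) by simp_all
  show ?thesis using assms(1) unfolding lce_ok_def ranked_def rmq_ok_def lst_def e assms(3,4) .
qed

text \<open>If both positions coincide, the text is compared with itself: the slide runs to the end
  at once, and there is no pair of different ranks to query. This happens for \<open>d = 0\<close>
  when \<open>n - h = 0\<close>.\<close>

definition slide :: hcmd where
  "slide = Upd 45 (Bin Add (Var 4) (Bin Add (Var 41) (Var 44))) ;;
     HIf (Bin Eq (Var 45) (Var 44)) (Upd 44 (Var 0))
       ((Upd 46 (Arr 9 (Var 44)) ;; Upd 47 (Arr 9 (Var 45)) ;;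
         HIf (Bin Less (Var 46) (Var 47))
           (Upd 30 (Var 46) ;; Upd 31 (Bin Sub (Var 47) (Cst 1)))
           (Upd 30 (Var 47) ;; Upd 31 (Bin Sub (Var 46) (Cst 1)))) ;;
        query ;;
        (Upd 44 (Bin Add (Var 44) (Var 32)) ;; HIf (Bin Less (Var 0) (Var 44)) (Upd 44 (Var 0)) HSkip))"

lemma mod_slide [simp]: "modr slide = {30,31,32,33,34,35,36,44,45,46,47}" "moda slide = {}"
  by (auto simp: slide_def)

text \<open>A rank is one more than the place in the suffix array, and entry \<open>k\<close> of
  array 13 belongs to the places \<open>k - 1\<close> and \<open>k\<close>. The relevant range
  therefore begins at the smaller rank and ends one before the larger.\<close>

lemma lcp_ranks:
  assumes ok: "lce_ok M T Z s" and ij: "i < M" "j < M" "ar s 9 i < ar s 9 j"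
  shows "rmin (ar s 13) (ar s 9 i) (ar s 9 j - 1) = lcp T i j" "ar s 9 i \<le> ar s 9 j - 1" "ar s 9 j - 1 < M" "1 \<le> ar s 9 j"
    "ar s 9 i \<le> M" "ar s 9 j \<le> M"
proof -
  have R: "ranked T M s" using ok by (simp add: lce_ok_def)
  note RF = ranked_facts[OF R]
  have r: "1 \<le> ar s 9 i" "ar s 9 i \<le> M" "ar s 10 (ar s 9 i - 1) = i" "1 \<le> ar s 9 j" "ar s 9 j \<le> M" "ar s 10 (ar s 9 j - 1) = j"
    using RF(4)[OF ij(1)] RF(4)[OF ij(2)] by auto
  have lt: "ar s 9 i - 1 < ar s 9 j - 1" "ar s 9 j - 1 < M" "Suc (ar s 9 i - 1) = ar s 9 i" using r ij(3) by linarith+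
  have "lcp T (ar s 10 (ar s 9 i - 1)) (ar s 10 (ar s 9 j - 1)) = rmin (ar s 13) (Suc (ar s 9 i - 1)) (ar s 9 j - 1)"
    by (rule lcp_rmin[where M = M, OF _ _ lt(1,2)]) (use RF(3) ok in \<open>auto simp: lce_ok_def\<close>)
  then show "rmin (ar s 13) (ar s 9 i) (ar s 9 j - 1) = lcp T i j" using r lt(3) by simp
  show "ar s 9 i \<le> ar s 9 j - 1" "ar s 9 j - 1 < M" "1 \<le> ar s 9 j" "ar s 9 i \<le> M" "ar s 9 j \<le> M" using lt r by linarith+
qed

lemma maximal_slide_lcp:
  assumes ok: "lce_ok M T Z s" and x: "x < n" "c + n \<le> M" "c \<noteq> 0"
  shows "maximal_slide Z n c x (min n (x + lcp T x (c + x)))"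
proof -
  have wf: "wf_str T M" and Z: "\<And>i j. i < M \<Longrightarrow> j < M \<Longrightarrow> Z i = Z j \<longleftrightarrow> T i = T j" using ok by (auto simp: lce_ok_def)
  let ?h = "lcp T x (c + x)"
  have "Z l = Z (c + l)" if l: "x \<le> l" "l < min n (x + ?h)" for l
  proof -
    obtain e where e: "l = x + e" using l le_Suc_ex by blast
    then have "T (x + e) = T (c + x + e)" using l lcp_less[of e T x "c + x"] by simp
    then show ?thesis using Z[of l "c + l"] l x e by (simp add: add.assoc)
  qed
  moreover have "Z (x + ?h) \<noteq> Z (c + (x + ?h))" if "x + ?h < n"
    using Z[of "x + ?h" "c + (x + ?h)"] lcp_neq[OF wf, of x "c + x"] x that by (simp add: add.assoc)
  ultimately show ?thesis unfolding maximal_slide_def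
  proof (intro conjI allI impI)
    assume "min n (x + ?h) < n"
    then have "x + ?h < n" "min n (x + ?h) = x + ?h" by auto
    then show "Z (min n (x + ?h)) \<noteq> Z (c + min n (x + ?h))"
      using \<open>x + ?h < n \<Longrightarrow> Z (x + ?h) \<noteq> Z (c + (x + ?h))\<close> by simp
  qed (use x in auto)
qed

lemma runs_slide:
  assumes ok: "lce_ok M T Z s" and r: "rg s 0 = n" "rg s 4 = b" "rg s 41 = d" "rg s 44 = x"
    and x: "x < n" "b + d + n \<le> M" and L: "5 * M + 40 < L"
  shows "runs L slide s 450 (\<lambda>s'. maximal_slide Z n (b + d) x (rg s' 44))"
  unfolding slide_def
proof (rule runs_Upd_HSeq)
  let ?Q = "\<lambda>s'. maximal_slide Z n (b + d) x (rg s' 44)"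
  define j where "j = b + d + x"
  let ?s = "upd s 45 (hev s (Bin Add (Var 4) (Bin Add (Var 41) (Var 44))))"
  have j45: "rg ?s 45 = j" using r by (simp add: j_def)
  let ?P1 = "Upd 46 (Arr 9 (Var 44)) ;; Upd 47 (Arr 9 (Var 45)) ;;
         HIf (Bin Less (Var 46) (Var 47))
           (Upd 30 (Var 46) ;; Upd 31 (Bin Sub (Var 47) (Cst 1)))
           (Upd 30 (Var 47) ;; Upd 31 (Bin Sub (Var 46) (Cst 1)))"
  let ?P3 = "Upd 44 (Bin Add (Var 44) (Var 32)) ;; HIf (Bin Less (Var 0) (Var 44)) (Upd 44 (Var 0)) HSkip"
  show "runs L (HIf (Bin Eq (Var 45) (Var 44)) (Upd 44 (Var 0)) (?P1 ;; query ;; ?P3)) ?s 440 ?Q"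
  proof (rule runs_HIf)
    assume "hev ?s (Bin Eq (Var 45) (Var 44)) \<noteq> 0"
    then have "b + d = 0" using j45 r by (simp add: j_def split: if_splits)
    then have "maximal_slide Z n (b + d) x n" using x by (auto simp: maximal_slide_def)
    then show "runs L (Upd 44 (Var 0)) ?s 435 ?Q" using r by (intro runs_wp) auto
  next
    assume "hev ?s (Bin Eq (Var 45) (Var 44)) = 0"
    then have c: "b + d \<noteq> 0" "j \<noteq> x" using j45 r by (auto simp: j_def split: if_splits)
    have ij: "x < M" "j < M" using x by (auto simp: j_def)
    note S = maximal_slide_lcp[OF ok x c(1)]
    have wf: "wf_str T M" and R: "ranked T M s" using ok by (auto simp: lce_ok_def)
    obtain bb nb where rmq: "rmq_ok M (ar s 13) bb nb s" using ok by (auto simp: lce_ok_def)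
    have lb: "x + lcp T x j \<le> M" using lcp_bound[OF wf ij] c by auto
    define lo hi where "lo = min (ar s 9 x) (ar s 9 j)" and "hi = max (ar s 9 x) (ar s 9 j) - 1"
    have ne: "ar s 9 x < ar s 9 j \<or> ar s 9 j < ar s 9 x"
      using suffix_less_total[OF wf, of x j] ranked_less(1)[OF R ij] ranked_less(1)[OF R ij(2,1)] ij c by auto
    have Q: "rmin (ar s 13) lo hi = lcp T x j" "lo \<le> hi" "hi < M" "1 \<le> ar s 9 x" "1 \<le> ar s 9 j" "ar s 9 x \<le> M" "ar s 9 j \<le> M"
    proof -
      show "1 \<le> ar s 9 x" "1 \<le> ar s 9 j" using ranked_less(2)[OF R] ij by blast+
      show "ar s 9 x \<le> M" "ar s 9 j \<le> M" using ranked_less(3)[OF R] ij by blast+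
      have "rmin (ar s 13) lo hi = lcp T x j \<and> lo \<le> hi \<and> hi < M"
        using ne
      proof
        assume "ar s 9 x < ar s 9 j"
        then show ?thesis using lcp_ranks[OF ok ij] by (simp add: lo_def hi_def min.absorb3 max.absorb4)
      next
        assume "ar s 9 j < ar s 9 x"
        then show ?thesis using lcp_ranks[OF ok ij(2,1)] lcp_sym[of T x j] by (simp add: lo_def hi_def min.absorb4 max.absorb3)
      qed
      then show "rmin (ar s 13) lo hi = lcp T x j" "lo \<le> hi" "hi < M" by auto
    qed
    have "runs L (?P1 ;; query ;; ?P3) s0 435 ?Q"
      if s0: "rg s0 44 = x" "rg s0 45 = j" "rg s0 0 = n" "ar s0 = ar s" "rg s0 25 = rg s 25" "rg s0 27 = rg s 27" for s0 :: hst
    proof (rule runs_wp_HSeq[where ?t2.0 = 330])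
      let ?s1 = "s0\<lparr>rg := (rg s0)(46 := ar s 9 x, 47 := ar s 9 j, 30 := lo, 31 := hi)\<rparr>"
      have w: "wp L ?P1 X s0" if "X ?s1" for X
        using that s0 ij L Q ne by (auto simp: lo_def hi_def min.absorb3 min.absorb4 max.absorb3 max.absorb4)
      have "runs L (query ;; ?P3) ?s1 330 ?Q"
      proof (rule runs_HSeq[OF runs_query[where M = M and A = "ar s 13" and b = bb and nb = nb and l = lo and r = hi]])
        fix s' assume f: "frm query ?s1 s'" and q: "rg s' 32 = rmin (ar s 13) lo hi"
        have A: "rg s' 0 = n" "rg s' 44 = x" using f s0 by (simp_all add: frm_def)
        have "rg s' 32 = lcp T x j" using q Q(1) by simp
        then have "wp L ?P3 (\<lambda>s''. rg s'' 44 = min n (x + lcp T x j)) s'" using A lb L by auto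
        then have "runs L ?P3 s' 30 (\<lambda>s''. rg s'' 44 = min n (x + lcp T x j))" by (rule runs_wp) simp
        then show "runs L ?P3 s' 30 ?Q" by (rule runs_mono) (use S in \<open>auto simp: j_def\<close>)
      next
        have e: "rg ?s1 25 = rg s 25" "rg ?s1 27 = rg s 27" "ar ?s1 = ar s" using s0 by simp_all
        show "rmq_ok M (ar s 13) bb nb ?s1" using rmq unfolding rmq_ok_def e .
      qed (use Q L in auto)
      then show "wp L ?P1 (\<lambda>s'. runs L (query ;; ?P3) s' 330 ?Q) s0" by (rule w)
    qed simp
    from this[of ?s] show "runs L (?P1 ;; query ;; ?P3) ?s 435 ?Q" using r j45 by simp
  qed auto
  show "hok L s (Bin Add (Var 4) (Bin Add (Var 41) (Var 44)))" using r x L by simp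
qed simp

subsection \<open>The main loop\<close>

text \<open>The row is updated in place from left to right. Register 42 carries the old value of the
  left neighbour, which is already overwritten; the right neighbour is still old. Testing register
  42 against \<open>plus1\<close> of register 44 forms the maximum with the predecessor of register
  42 without subtracting from 0.\<close>

definition diagonal_step :: hcmd where
  "diagonal_step = (Upd 43 (Arr 19 (Var 41)) ;; Upd 44 (Var 43) ;; Upd 45 (Arr 19 (plus1 (Var 41))) ;;
      HIf (Bin Less (Var 44) (Var 45)) (Upd 44 (Var 45)) HSkip ;;
      HIf (Bin Less (plus1 (Var 44)) (Var 42)) (Upd 44 (Bin Sub (Var 42) (Cst 1))) HSkip ;;
      HIf (Bin Less (Var 0) (Var 44)) (Upd 44 (Var 0)) HSkip) ;;
     HIf (Bin Less (Var 44) (Var 0)) slide HSkip ;;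
     (Put 19 (Var 41) (plus1 (Var 44)) ;;
      HIf (Bin Less (Var 44) (Var 0)) (Put 20 (Var 41) (plus1 (Arr 20 (Var 41)))) HSkip ;; Upd 42 (Var 43))"

lemma mod_diagonal_step [simp]: "modr diagonal_step = {30,31,32,33,34,35,36,42,43,44,45,46,47}" "moda diagonal_step = {19,20}"
  by (auto simp: diagonal_step_def)

lemma runs_diagonal_step:
  assumes ok: "lce_ok M T Z s" and r: "rg s 0 = n" "rg s 4 = b" "rg s 41 = d"
    and F: "ar s 19 d \<le> n + 1" "ar s 19 (Suc d) \<le> n + 1" "rg s 42 \<le> n + 1"
    and x: "b + d + n \<le> M" and L: "5 * M + 40 < L" "d + 2 < L" "n + 5 < L" "ar s 20 d + 1 < L"
  shows "runs L diagonal_step s 600 (\<lambda>s'. \<exists>y. maximal_slide Z n (b + d) (min n (max (max (ar s 19 d) (ar s 19 (Suc d))) (rg s 42 - 1))) y \<and>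
     ar s' 19 = (ar s 19)(d := Suc y) \<and> ar s' 20 = (ar s 20)(d := (if y < n then ar s 20 d + 1 else ar s 20 d)) \<and>
     rg s' 42 = ar s 19 d)"
  unfolding diagonal_step_def
proof (rule runs_HSeq)
  define x0 where "x0 = min n (max (max (ar s 19 d) (ar s 19 (Suc d))) (rg s 42 - 1))"
  let ?P1 = "Upd 43 (Arr 19 (Var 41)) ;; Upd 44 (Var 43) ;; Upd 45 (Arr 19 (plus1 (Var 41))) ;;
      HIf (Bin Less (Var 44) (Var 45)) (Upd 44 (Var 45)) HSkip ;;
      HIf (Bin Less (plus1 (Var 44)) (Var 42)) (Upd 44 (Bin Sub (Var 42) (Cst 1))) HSkip ;;
      HIf (Bin Less (Var 0) (Var 44)) (Upd 44 (Var 0)) HSkip"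
  let ?P3 = "Put 19 (Var 41) (plus1 (Var 44)) ;;
      HIf (Bin Less (Var 44) (Var 0)) (Put 20 (Var 41) (plus1 (Arr 20 (Var 41)))) HSkip ;; Upd 42 (Var 43)"
  let ?Q = "\<lambda>s'. \<exists>y. maximal_slide Z n (b + d) (min n (max (max (ar s 19 d) (ar s 19 (Suc d))) (rg s 42 - 1))) y \<and>
     ar s' 19 = (ar s 19)(d := Suc y) \<and> ar s' 20 = (ar s 20)(d := (if y < n then ar s 20 d + 1 else ar s 20 d)) \<and>
     rg s' 42 = ar s 19 d"
  show "runs L ?P1 s 80 (\<lambda>s'. rg s' 44 = x0 \<and> rg s' 43 = ar s 19 d)"
  proof (rule runs_wp)
    show "wp L ?P1 (\<lambda>s'. rg s' 44 = x0 \<and> rg s' 43 = ar s 19 d) s"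
      unfolding x0_def using r F L by (auto simp: min_def max_def)
  qed simp
  fix s1 assume f1: "frm ?P1 s s1" and 1: "rg s1 44 = x0 \<and> rg s1 43 = ar s 19 d"
  have A1: "rg s1 0 = n" "rg s1 4 = b" "rg s1 41 = d" "ar s1 = ar s" "rg s1 25 = rg s 25" "rg s1 27 = rg s 27"
    using f1 r by (auto simp: frm_def)
  have ok1: "lce_ok M T Z s1" by (rule lce_ok_frm[OF ok]) (use A1 in auto)
  have x0n: "x0 \<le> n" by (simp add: x0_def)
  show "runs L (HIf (Bin Less (Var 44) (Var 0)) slide HSkip ;; ?P3) s1 (455 + 60) ?Q"
  proof (rule runs_HSeq)
    show "runs L (HIf (Bin Less (Var 44) (Var 0)) slide HSkip) s1 455 (\<lambda>s'. maximal_slide Z n (b + d) x0 (rg s' 44))"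
    proof (rule runs_HIf[where ?t1.0 = 450])
      assume "hev s1 (Bin Less (Var 44) (Var 0)) \<noteq> 0"
      then have "x0 < n" using 1 A1 by (auto split: if_splits)
      then show "runs L slide s1 450 (\<lambda>s'. maximal_slide Z n (b + d) x0 (rg s' 44))"
        using 1 A1 x L by (intro runs_slide[OF ok1]) auto
    next
      assume "hev s1 (Bin Less (Var 44) (Var 0)) = 0"
      then have "x0 = n" using 1 A1 x0n by (auto split: if_splits)
      then show "runs L HSkip s1 450 (\<lambda>s'. maximal_slide Z n (b + d) x0 (rg s' 44))"
        using 1 by (intro runs_wp) (auto simp: maximal_slide_def)
    qed auto
    fix s2 assume f2: "frm (HIf (Bin Less (Var 44) (Var 0)) slide HSkip) s1 s2" and 2: "maximal_slide Z n (b + d) x0 (rg s2 44)"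
    have A2: "rg s2 0 = n" "rg s2 41 = d" "ar s2 = ar s" "rg s2 43 = ar s 19 d" using f2 A1 1 by (auto simp: frm_def)
    have yn: "rg s2 44 \<le> n" using 2 by (simp add: maximal_slide_def)
    have "runs L ?P3 s2 60 (\<lambda>s'. ar s' 19 = (ar s 19)(d := Suc (rg s2 44)) \<and>
       ar s' 20 = (ar s 20)(d := (if rg s2 44 < n then ar s 20 d + 1 else ar s 20 d)) \<and> rg s' 42 = ar s 19 d)"
      by (rule runs_wp) (use A2 yn L in auto)
    then show "runs L ?P3 s2 60 ?Q"
      by (rule runs_mono) (use 2 in \<open>auto simp: x0_def\<close>)
  qed simp
qed simp

definition landau_vishkin :: hcmd where
  "landau_vishkin = For 41 (plus1 (Var 5)) (Put 19 (Var 41) (Cst 0) ;; Put 20 (Var 41) (Cst 0)) ;;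
     For 40 (Var 2) (Upd 42 (Cst 0) ;; For 41 (Var 5) diagonal_step)"

lemma mod_landau_vishkin [simp]: "modr landau_vishkin = {30,31,32,33,34,35,36,40,41,42,43,44,45,46,47}" "moda landau_vishkin = {19,20}"
  by (auto simp: landau_vishkin_def)

lemma runs_lvrow:
  assumes ok: "lce_ok M T Z s" and r: "rg s 0 = n" "rg s 4 = b" "rg s 5 = W"
    and F: "\<And>d. d \<le> W \<Longrightarrow> ar s 19 d \<le> n + 1" "ar s 19 W = 0" and O: "\<And>d. d < W \<Longrightarrow> ar s 20 d + 1 < L"
    and x: "b + W + n \<le> M + 1" and L: "5 * M + 40 < L" "W + 2 < L" "n + 5 < L"
  shows "runs L (Upd 42 (Cst 0) ;; For 41 (Var 5) diagonal_step) s (610 * (W + 1))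
    (\<lambda>s'. rowok Z n b W (ar s 19) (ar s' 19) \<and>
      (\<forall>d<W. ar s' 20 d = ar s 20 d + (if ar s' 19 d \<le> n then 1 else 0)))"
proof (rule runs_Upd_HSeq)
  let ?s = "upd s 42 (hev s (Cst 0))"
  let ?F = "ar s 19"
  let ?I = "\<lambda>i s'. (\<forall>d<i. \<exists>y. maximal_slide Z n (b + d) (row_start n ?F d) y \<and> ar s' 19 d = Suc y) \<and>
     (\<forall>d. i \<le> d \<longrightarrow> ar s' 19 d = ?F d) \<and> rg s' 42 = (if i = 0 then 0 else ?F (i - 1)) \<and>
     (\<forall>d<W. ar s' 20 d = ar s 20 d + (if d < i \<and> ar s' 19 d \<le> n then 1 else 0))"
  show "runs L (For 41 (Var 5) diagonal_step) ?s (608 * (W + 1)) (\<lambda>s'. rowok Z n b W ?F (ar s' 19) \<and>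
      (\<forall>d<W. ar s' 20 d = ar s 20 d + (if ar s' 19 d \<le> n then 1 else 0)))"
  proof (rule runs_For[where n = W and c = 600 and I = ?I])
    fix i s' assume i: "i < W" "rg s' 41 = i" and I: "?I i s'" and f: "frm (For 41 (Var 5) diagonal_step) ?s s'"
    have A: "rg s' 0 = n" "rg s' 4 = b" using f r by (simp_all add: frm_def)
    have ok': "lce_ok M T Z s'" by (rule lce_ok_frm[OF ok]) (use f in \<open>auto simp: frm_def\<close>)
    have e: "ar s' 19 i = ?F i" "ar s' 19 (Suc i) = ?F (Suc i)" "ar s' 20 i = ar s 20 i" using I i by auto
    have st: "min n (max (max (?F i) (?F (Suc i))) (rg s' 42 - 1)) = row_start n ?F i"
      using I e by (auto simp: row_start_def)
    show "runs L diagonal_step s' 600 (\<lambda>s''. ?I (Suc i) (upd s'' 41 (Suc i)))"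
    proof (rule runs_mono[OF runs_diagonal_step[OF ok' A i(2)]])
      fix s'' :: hst assume "\<exists>y. maximal_slide Z n (b + i) (min n (max (max (ar s' 19 i) (ar s' 19 (Suc i))) (rg s' 42 - 1))) y \<and>
         ar s'' 19 = (ar s' 19)(i := Suc y) \<and> ar s'' 20 = (ar s' 20)(i := (if y < n then ar s' 20 i + 1 else ar s' 20 i)) \<and>
         rg s'' 42 = ar s' 19 i"
      then obtain y where y: "maximal_slide Z n (b + i) (row_start n ?F i) y" "ar s'' 19 = (ar s' 19)(i := Suc y)"
        "ar s'' 20 = (ar s' 20)(i := (if y < n then ar s 20 i + 1 else ar s 20 i))" "rg s'' 42 = ?F i"
        unfolding e st by blast
      show "?I (Suc i) (upd s'' 41 (Suc i))"
        using I y by (auto simp: less_Suc_eq)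
    next
      show "rg s' 42 \<le> n + 1" using I F(1)[of "i - 1"] i by auto
    qed (use e F(1)[of i] F(1)[of "Suc i"] i O x L in auto)
  next
    fix s' :: hst assume I: "?I W s'"
    then show "rowok Z n b W ?F (ar s' 19) \<and> (\<forall>d<W. ar s' 20 d = ar s 20 d + (if ar s' 19 d \<le> n then 1 else 0))"
      using F(2) by (auto simp: rowok_def)
  qed (use r L in \<open>auto simp: frm_def\<close>)
qed (use L in auto)

lemma runs_landau_vishkin:
  assumes ok: "lce_ok M T Z s" and r: "rg s 0 = n" "rg s 4 = b" "rg s 5 = W" "rg s 2 = h"
    and x: "b + W + n \<le> M + 1" and L: "5 * M + 40 < L" "W + 5 < L" "n + 5 < L" "h + 5 < L"
  shows "runs L landau_vishkin s (700 * ((W + 2) * (h + 2))) (\<lambda>s'. \<exists>F. rows Z n b W F h \<and>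
    (\<forall>d<W. ar s' 20 d = card {j. j < h \<and> F (Suc j) d \<le> n}))"
  unfolding landau_vishkin_def
proof (rule runs_HSeq)
  let ?P1 = "For 41 (plus1 (Var 5)) (Put 19 (Var 41) (Cst 0) ;; Put 20 (Var 41) (Cst 0))"
  let ?B = "Upd 42 (Cst 0) ;; For 41 (Var 5) diagonal_step"
  show "runs L ?P1 s (30 * (W + 2)) (\<lambda>s'. \<forall>d<W + 1. ar s' 19 d = 0 \<and> ar s' 20 d = 0)"
    by (rule runs_For[where n = "W + 1" and c = 20 and I = "\<lambda>i s'. \<forall>d<i. ar s' 19 d = 0 \<and> ar s' 20 d = 0"])
      (use r L in \<open>auto simp: frm_def less_Suc_eq intro!: runs_wp\<close>)
  fix s1 assume f1: "frm ?P1 s s1" and 1: "\<forall>d<W + 1. ar s1 19 d = 0 \<and> ar s1 20 d = 0"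
  have A1: "rg s1 0 = n" "rg s1 4 = b" "rg s1 5 = W" "rg s1 2 = h" using f1 r by (simp_all add: frm_def)
  have ok1: "lce_ok M T Z s1" by (rule lce_ok_frm[OF ok]) (use f1 in \<open>auto simp: frm_def\<close>)
  let ?I = "\<lambda>i s'. \<exists>F. rows Z n b W F i \<and> ar s' 19 = F i \<and> (\<forall>d<W. ar s' 20 d = card {j. j < i \<and> F (Suc j) d \<le> n})"
  show "runs L (For 40 (Var 2) ?B) s1 (618 * ((W + 1) * (h + 1))) (\<lambda>s'. \<exists>F. rows Z n b W F h \<and>
    (\<forall>d<W. ar s' 20 d = card {j. j < h \<and> F (Suc j) d \<le> n}))"
  proof (rule runs_For[where n = h and c = "610 * (W + 1)" and I = ?I])
    show "?I 0 (upd s1 40 0)" using 1 by (intro exI[of _ "\<lambda>_. ar s1 19"]) (auto simp: rows_def)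
    fix i s' assume i: "i < h" "rg s' 40 = i" and I: "?I i s'" and f: "frm (For 40 (Var 2) ?B) s1 s'"
    obtain F where F: "rows Z n b W F i" "ar s' 19 = F i" "\<forall>d<W. ar s' 20 d = card {j. j < i \<and> F (Suc j) d \<le> n}"
      using I by blast
    have A: "rg s' 0 = n" "rg s' 4 = b" "rg s' 5 = W" using f A1 by (simp_all add: frm_def)
    have ok': "lce_ok M T Z s'" by (rule lce_ok_frm[OF ok1]) (use f in \<open>auto simp: frm_def\<close>)
    have b: "F i d \<le> n + 1" if "d \<le> W" for d
    proof (cases i)
      case 0
      then show ?thesis using F(1) that by (simp add: rows_def)
    next
      case (Suc i')
      then show ?thesis using rows_bounds(2)[OF F(1), of i' d] rows_end[OF F(1), of i] that by (cases "d = W") auto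
    qed
    show "runs L ?B s' (610 * (W + 1)) (\<lambda>s''. ?I (Suc i) (upd s'' 40 (Suc i)))"
    proof (rule runs_mono[OF runs_lvrow[OF ok' A]])
      fix s'' :: hst assume e: "rowok Z n b W (ar s' 19) (ar s'' 19) \<and>
         (\<forall>d<W. ar s'' 20 d = ar s' 20 d + (if ar s'' 19 d \<le> n then 1 else 0))"
      let ?F = "F(Suc i := ar s'' 19)"
      have "rows Z n b W ?F (Suc i)" using F e by (auto simp: rows_def less_Suc_eq)
      moreover have "card {j. j < Suc i \<and> ?F (Suc j) d \<le> n} = card {j. j < i \<and> F (Suc j) d \<le> n} + (if ar s'' 19 d \<le> n then 1 else 0)" for d
      proof -
        have "{j. j < i \<and> ?F (Suc j) d \<le> n} = {j. j < i \<and> F (Suc j) d \<le> n}" by auto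
        then show ?thesis unfolding card_Collect_Suc by simp
      qed
      ultimately show "?I (Suc i) (upd s'' 40 (Suc i))"
        using e F(3) by (intro exI[of _ ?F]) auto
    next
      show "ar s' 20 d + 1 < L" if "d < W" for d
        using F(3) that card_less_Collect[of i "\<lambda>j. F (Suc j) d \<le> n"] i L by simp
    qed (use F(2) b rows_end[OF F(1) order_refl] x L in auto)
  next
    show "(h + 1) * (610 * (W + 1) + 7 + hcost (Var 2)) \<le> 618 * ((W + 1) * (h + 1))"
      by (simp add: algebra_simps)
  qed (use A1 L in \<open>auto simp: frm_def\<close>)
qed (simp add: algebra_simps)

subsection \<open>The program\<close>

text \<open>Diagonal \<open>d\<close> pairs position \<open>x\<close> of the pattern with text
  position \<open>n - h + d + x\<close>. Hence shift \<open>s\<close> is diagonal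
  \<open>K + s + h\<close>, and the last diagonal \<open>2 * (K + h)\<close> ends exactly at the
  padded length \<open>2 * (n + K) + h\<close>.\<close>

definition pad :: hcmd where
  "pad = HIf (Bin Less (Var 1) (Var 0)) (Upd 2 (Var 1)) (Upd 2 (Var 0)) ;;
     (Upd 24 (Bin Mult (Cst 2) (Bin Add (Var 0) (Var 1))) ;;
      Upd 3 (Bin Add (Var 24) (Var 2)) ;; Upd 4 (Bin Sub (Var 0) (Var 2))) ;;
     For 20 (Var 2) (Put 0 (Bin Add (Var 24) (Var 20)) (Cst 0))"

lemma mod_pad [simp]: "modr pad = {2,3,4,20,24}" "moda pad = {0}"
  by (auto simp: pad_def)

lemma runs_pad:
  assumes r: "rg s 0 = n" "rg s 1 = K" and L: "2 * n + 3 * K + 10 < L"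
  shows "runs L pad s (30 * (K + 3)) (\<lambda>s'. rg s' 2 = min K n \<and> rg s' 3 = 2 * (n + K) + min K n \<and> rg s' 4 = n - min K n \<and>
     (\<forall>i<2 * (n + K). ar s' 0 i = ar s 0 i) \<and> (\<forall>i<min K n. ar s' 0 (2 * (n + K) + i) = 0))"
  unfolding pad_def
proof (rule runs_HSeq)
  define h N where "h = min K n" and "N = 2 * (n + K)"
  have h: "h \<le> K" "h \<le> n" by (simp_all add: h_def)
  have NL: "n + K < L" "N + h + 10 < L" "n < L" using L h by (simp_all add: N_def)
  let ?P1 = "HIf (Bin Less (Var 1) (Var 0)) (Upd 2 (Var 1)) (Upd 2 (Var 0))"
  let ?P2 = "Upd 24 (Bin Mult (Cst 2) (Bin Add (Var 0) (Var 1))) ;;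
      Upd 3 (Bin Add (Var 24) (Var 2)) ;; Upd 4 (Bin Sub (Var 0) (Var 2))"
  let ?P3 = "For 20 (Var 2) (Put 0 (Bin Add (Var 24) (Var 20)) (Cst 0))"
  let ?Q = "\<lambda>s'. rg s' 2 = min K n \<and> rg s' 3 = 2 * (n + K) + min K n \<and> rg s' 4 = n - min K n \<and>
     (\<forall>i<2 * (n + K). ar s' 0 i = ar s 0 i) \<and> (\<forall>i<min K n. ar s' 0 (2 * (n + K) + i) = 0)"
  show "runs L ?P1 s 10 (\<lambda>s'. rg s' 2 = h)"
    by (rule runs_wp) (use r in \<open>auto simp: h_def\<close>)
  fix s1 assume f1: "frm ?P1 s s1" and 1: "rg s1 2 = h"
  have A1: "rg s1 0 = n" "rg s1 1 = K" "ar s1 0 = ar s 0" using f1 r by (simp_all add: frm_def)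
  show "runs L (?P2 ;; ?P3) s1 (20 + 30 * (K + 1)) ?Q"
  proof (rule runs_HSeq)
    show "runs L ?P2 s1 20 (\<lambda>s'. rg s' 24 = N \<and> rg s' 3 = N + h \<and> rg s' 4 = n - h)"
      by (rule runs_wp) (use A1 1 NL h in \<open>simp_all add: N_def\<close>)
    fix s2 assume f2: "frm ?P2 s1 s2" and 2: "rg s2 24 = N \<and> rg s2 3 = N + h \<and> rg s2 4 = n - h"
    have A2: "rg s2 2 = h" "ar s2 0 = ar s 0" using f2 A1 1 by (simp_all add: frm_def)
    show "runs L ?P3 s2 (30 * (K + 1)) ?Q"
      unfolding h_def[symmetric] N_def[symmetric]
    proof (rule runs_For[where n = h and c = 20 and I = "\<lambda>k s'. (\<forall>i<N. ar s' 0 i = ar s 0 i) \<and> (\<forall>i<k. ar s' 0 (N + i) = 0)"])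
      show "(h + 1) * (20 + 7 + hcost (Var 2)) \<le> 30 * (K + 1)" using h by simp
    qed (use A2 2 NL in \<open>auto simp: frm_def less_Suc_eq intro!: runs_wp\<close>)
  qed simp
qed simp

definition main :: hcmd where
  "main = pad ;; rename_chars ;; down ;; up ;; kasai ;; rmq ;;
     Upd 5 (plus1 (Bin Mult (Cst 2) (Bin Add (Var 1) (Var 2)))) ;; landau_vishkin"

text \<open>The continuation \<open>P\<close> sees the index only through \<open>lce_ok\<close> and
  the preserved parameters, which separates its construction from its use. The exponent
  \<open>D\<close> enters the time only through the digit passes.\<close>

lemma runs_suffix:
  assumes r: "rg s 3 = M" and M: "1 \<le> M" and L: "9 * M + 40 < L" and D: "\<And>i. i < M \<Longrightarrow> ar s 0 i < (M + 1) ^ D"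
    and rest: "\<And>T s'. lce_ok M T (ar s 0) s' \<Longrightarrow> (\<And>r. r \<in> {0,1,2,4} \<Longrightarrow> rg s' r = rg s r) \<Longrightarrow> runs L P s' t Q"
  shows "runs L (rename_chars ;; down ;; up ;; kasai ;; rmq ;; P) s
    ((D + 2) * (700 * (M + 1)) + (31000 * (M + 2) + (10000 * (M + 1) + (600 * (M + 1) + (1500 * (M + 1) + t))))) Q"
proof (rule runs_HSeq[OF runs_rename[OF r _ D]])
  fix s1 assume f1: "frm rename_chars s s1"
    and 1: "names (ar s 0) M (ar s1 5) \<and> ar s1 5 M = 0 \<and> ar s1 5 (M + 1) = 0 \<and> ar s1 5 (M + 2) = 0"
  let ?A = "\<lambda>s'. rg s' 3 = M \<and> ar s' 0 = ar s 0 \<and> rg s' 0 = rg s 0 \<and> rg s' 1 = rg s 1 \<and> rg s' 2 = rg s 2 \<and> rg s' 4 = rg s 4"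
  have A1: "?A s1" using f1 r by (simp add: frm_def)
  define T where "T i = (if i < M then ar s1 5 i else 0)" for i
  have wf: "wf_str T M" using 1 by (auto simp: wf_str_def T_def names_def)
  have Z: "ar s 0 i = ar s 0 j \<longleftrightarrow> T i = T j" if "i < M" "j < M" for i j
    using names_eq[OF conjunct1[OF 1] that] that by (auto simp: T_def)
  have T5: "ar s1 5 i = T i" if "i < M + 3" for i
  proof -
    have "i < M \<or> i = M \<or> i = M + 1 \<or> i = M + 2" using that by linarith
    then show ?thesis using 1 by (auto simp: T_def)
  qed
  have TM: "T i \<le> M" for i using 1 by (auto simp: T_def names_def)
  show "runs L (down ;; up ;; kasai ;; rmq ;; P) s1 (31000 * (M + 2) + (10000 * (M + 1) + (600 * (M + 1) + (1500 * (M + 1) + t)))) Q"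
  proof (rule runs_HSeq[OF runs_down[where M = M and ?T0.0 = T]])
    fix s2 assume f2: "frm down s1 s2" and 2: "\<exists>Ts Lv. levels M T Ts (ar s2 6) (Suc Lv) \<and> (\<forall>l<Lv. 3 < lvl_length M l) \<and> lvl_length M Lv \<le> 3 \<and>
       (\<forall>l\<le>Lv. ar s2 7 l = lvl_offset M l \<and> ar s2 8 l = lvl_length M l) \<and> rg s2 9 = Lv \<and> rg s2 8 = lvl_offset M Lv \<and> rg s2 7 = lvl_length M Lv"
    have A2: "?A s2" using f2 A1 by (simp add: frm_def)
    obtain Ts Lv where lvls: "levels M T Ts (ar s2 6) (Suc Lv)" "\<forall>l<Lv. 3 < lvl_length M l" "lvl_length M Lv \<le> 3"
       "\<forall>l\<le>Lv. ar s2 7 l = lvl_offset M l \<and> ar s2 8 l = lvl_length M l" "rg s2 9 = Lv" "rg s2 8 = lvl_offset M Lv" "rg s2 7 = lvl_length M Lv" using 2 by blast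
    show "runs L (up ;; kasai ;; rmq ;; P) s2 (10000 * (M + 1) + (600 * (M + 1) + (1500 * (M + 1) + t))) Q"
    proof (rule runs_HSeq[OF runs_up[OF lvls(1) _ lvls(3) _ lvls(5-7) L]])
      fix s3 assume f3: "frm up s2 s3" and 3: "ranked T M s3"
      have A3: "?A s3" using f3 A2 by (simp add: frm_def)
      show "runs L (kasai ;; rmq ;; P) s3 (600 * (M + 1) + (1500 * (M + 1) + t)) Q"
      proof (rule runs_HSeq[OF runs_kasai[where M = M and T = T]])
        fix s4 assume f4: "frm kasai s3 s4" and 4: "\<forall>k. 0 < k \<and> k < M \<longrightarrow> ar s4 13 k = lcp T (ar s3 10 (k - 1)) (ar s3 10 k)"
        have A4: "?A s4" "ar s4 9 = ar s3 9" "ar s4 10 = ar s3 10" using f4 A3 by (simp_all add: frm_def)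
        show "runs L (rmq ;; P) s4 (1500 * (M + 1) + t) Q"
        proof (rule runs_HSeq[OF runs_rmq[where M = M]])
          fix s5 assume f5: "frm rmq s4 s5" and 5: "\<exists>b nb. rmq_ok M (ar s4 13) b nb s5"
          have A5: "?A s5" "ar s5 9 = ar s3 9" "ar s5 10 = ar s3 10" "ar s5 13 = ar s4 13" using f5 A4 by (simp_all add: frm_def)
          have "ranked T M s5" using 3 unfolding ranked_def lst_def A5 .
          then have "lce_ok M T (ar s 0) s5" unfolding lce_ok_def A5 using wf Z 4 5 by blast
          then show "runs L P s5 t Q" using A5 by (intro rest) auto
        qed (use A4 M L in auto)
      qed (use A3 3 wf Z L in auto)
    qed (use lvls in auto)
  qed (use A1 wf T5 TM L in auto)
qed (use L in auto)

lemma runs_main: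
  assumes r: "rg s 0 = n" "rg s 1 = K" and K: "1 \<le> K" and L: "64 * (2 * (n + K)) \<le> L"
    and D: "\<And>i. i < 2 * (n + K) \<Longrightarrow> ar s 0 i < (2 * (n + K)) ^ D"
  shows "runs L main s ((D + 2) * 400000 * (n + K ^ 2)) (\<lambda>s'. rg s' 1 = K \<and> rg s' 2 = min K n \<and>
    (\<forall>i\<le>2 * K. let E = ED (seg (ar s 0) 0 n) (seg (ar s 0) (n + i) (n + i + n)); c = ar s' 20 (i + min K n) in
       c \<le> min E K \<and> min E K \<le> 2 * c))"
proof -
  define h M W where "h = min K n" and "M = 2 * (n + K) + h" and "W = 2 * (K + h) + 1"
  have h: "h \<le> K" "h \<le> n" "h = K \<or> h = n" by (auto simp: h_def)
  have M: "1 \<le> M" "M \<le> 2 * n + 3 * K" using K h by (auto simp: M_def)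
  have LM: "9 * M + 40 < L" using L K h by (auto simp: M_def)
  let ?Q = "\<lambda>s'. rg s' 1 = K \<and> rg s' 2 = h \<and>
    (\<forall>i\<le>2 * K. let E = ED (seg (ar s 0) 0 n) (seg (ar s 0) (n + i) (n + i + n)); c = ar s' 20 (i + h) in
       c \<le> min E K \<and> min E K \<le> 2 * c)"
  let ?t = "(D + 2) * (700 * (M + 1)) + (31000 * (M + 2) + (10000 * (M + 1) + (600 * (M + 1) + (1500 * (M + 1) + (8 + 700 * ((W + 2) * (h + 2)))))))"
  have "runs L main s (30 * (K + 3) + ?t) ?Q"
    unfolding main_def
  proof (rule runs_HSeq[OF runs_pad[OF r]])
    fix s1 assume f1: "frm pad s s1" and 1: "rg s1 2 = min K n \<and> rg s1 3 = 2 * (n + K) + min K n \<and> rg s1 4 = n - min K n \<and>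
     (\<forall>i<2 * (n + K). ar s1 0 i = ar s 0 i) \<and> (\<forall>i<min K n. ar s1 0 (2 * (n + K) + i) = 0)"
    have A1: "rg s1 0 = n" "rg s1 1 = K" "rg s1 2 = h" "rg s1 3 = M" "rg s1 4 = n - h" using f1 r 1 by (simp_all add: frm_def h_def M_def)
    have Z: "ar s1 0 i = (if i < 2 * (n + K) then ar s 0 i else 0)" if "i < M" for i
    proof (cases "i < 2 * (n + K)")
      case False
      then have "i = 2 * (n + K) + (i - (2 * (n + K)))" "i - (2 * (n + K)) < min K n" using that by (auto simp: M_def h_def)
      then show ?thesis using 1 False by metis
    qed (use 1 in simp)
    show "runs L (rename_chars ;; down ;; up ;; kasai ;; rmq ;;
       Upd 5 (plus1 (Bin Mult (Cst 2) (Bin Add (Var 1) (Var 2)))) ;; landau_vishkin) s1 ?t ?Q"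
    proof (rule runs_suffix[OF A1(4) M(1) LM])
      fix i assume i: "i < M"
      show "ar s1 0 i < (M + 1) ^ D"
      proof (cases "i < 2 * (n + K)")
        case True
        then have "ar s1 0 i < (2 * (n + K)) ^ D" using Z[OF i] D by simp
        also have "\<dots> \<le> (M + 1) ^ D" by (rule power_mono) (auto simp: M_def)
        finally show ?thesis .
      qed (use Z[OF i] in simp)
    next
      fix T s2 assume ok: "lce_ok M T (ar s1 0) s2" and A: "\<And>r. r \<in> {0,1,2,4} \<Longrightarrow> rg s2 r = rg s1 r"
      have A2: "rg s2 0 = n" "rg s2 1 = K" "rg s2 2 = h" "rg s2 4 = n - h" using A A1 by auto
      let ?s = "upd s2 5 W"
      have ok': "lce_ok M T (ar s1 0) ?s" by (rule lce_ok_frm[OF ok]) auto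
      have "runs L landau_vishkin ?s (700 * ((W + 2) * (h + 2))) ?Q"
      proof (rule runs_mono[OF runs_landau_vishkin[OF ok', where n = n and b = "n - h" and W = W and h = h]])
        fix s3 assume f3: "frm landau_vishkin ?s s3" and "\<exists>F. rows (ar s1 0) n (n - h) W F h \<and> (\<forall>d<W. ar s3 20 d = card {j. j < h \<and> F (Suc j) d \<le> n})"
        then obtain F where F: "rows (ar s1 0) n (n - h) W F h" "\<forall>d<W. ar s3 20 d = card {j. j < h \<and> F (Suc j) d \<le> n}" by blast
        have A3: "rg s3 1 = K" "rg s3 2 = h" using f3 A2 by (simp_all add: frm_def)
        have "let E = ED (seg (ar s 0) 0 n) (seg (ar s 0) (n + i) (n + i + n)); c = ar s3 20 (i + h) in
            c \<le> min E K \<and> min E K \<le> 2 * c" if i: "i \<le> 2 * K" for i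
        proof -
          have d: "h \<le> i + h" "i + h + h < W" using i by (auto simp: W_def)
          have s: "seg (ar s1 0) x y = seg (ar s 0) x y" if "y \<le> 2 * (n + K)" for x y
            unfolding seg_def using that Z by (auto simp: M_def)
          have p: "n - h + (i + h) = n + i" using h by simp
          have "i + h < W" using d by simp
          then have c: "ar s3 20 (i + h) = card {j. j < h \<and> F (Suc j) (i + h) \<le> n}" using F(2) by blast
          show ?thesis
            using rows_approx[OF F(1) d h(1,3)] s[of n 0] s[of "n + i + n" "n + i"] i unfolding p c by (simp add: Let_def)
        qed
        then show "?Q s3" using A3 by blast
      qed (use A2 h LM in \<open>auto simp: W_def M_def\<close>)
      then show "runs L (Upd 5 (plus1 (Bin Mult (Cst 2) (Bin Add (Var 1) (Var 2)))) ;; landau_vishkin) s2 (8 + 700 * ((W + 2) * (h + 2))) ?Q"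
        by (intro runs_Upd_HSeq) (use A2 LM h in \<open>auto simp: W_def M_def\<close>)
    qed
  qed (use L K in auto)
  moreover have "30 * (K + 3) + ?t \<le> (D + 2) * 400000 * (n + K ^ 2)"
  proof -
    define q where "q = n + K ^ 2"
    have "K \<le> K ^ 2" using K by (simp add: power2_eq_square)
    then have q: "n \<le> q" "n + K \<le> q" "1 \<le> q" "K \<le> q" using K by (simp_all add: q_def)
    have m: "M + 2 \<le> 5 * q" using M K q by linarith
    \<comment> \<open>From \<open>h \<le> K\<close> and \<open>1 \<le> K\<close>:
      \<open>W + 2\<close> is at most \<open>4 * K + 3\<close> and \<open>h + 2\<close> at most
      \<open>K + 2\<close>. Only this phase is quadratic in \<open>K\<close>; all others are linear
      in the text length.\<close>
    have "(W + 2) * (h + 2) \<le> (7 * K) * (3 * K)" by (rule mult_le_mono) (use K h in \<open>auto simp: W_def\<close>)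
    then have w: "(W + 2) * (h + 2) \<le> 21 * q" by (simp add: q_def power2_eq_square)
    have "30 * (K + 3) + ?t \<le> (D + 2) * (3500 * q) + 300000 * q"
    proof -
      have "(D + 2) * (700 * (M + 1)) \<le> (D + 2) * (3500 * q)" using m by (intro mult_le_mono2) simp
      moreover have "30 * k + (a + (31000 * m2 + (10000 * m1 + (600 * m1 + (1500 * m1 + (8 + 700 * u)))))) \<le> A + 300000 * q"
        if "a \<le> A" "m2 \<le> 5 * q" "m1 \<le> 5 * q" "u \<le> 21 * q" "k \<le> 4 * q" for a A m1 m2 u k
        using that q(3) by linarith
      ultimately show ?thesis using m w q by simp
    qed
    also have "\<dots> \<le> (D + 2) * 400000 * q" by (simp add: algebra_simps)
    finally show ?thesis by (simp add: q_def)
  qed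
  ultimately show ?thesis unfolding h_def[symmetric] by (rule runs_mono)
qed

section \<open>Converting between the given memory layout and the arrays\<close>

text \<open>Written directly for the machine, because the arrays do not exist yet. The copy runs
  downwards: the target \<open>32 * i\<close> is never below \<open>i\<close>, so no character is
  overwritten before it has been moved.\<close>

definition scatter :: cmd where
  "scatter = Seq (Assign 20 (Op Add (Op Add (Reg 0) (Reg 0)) (Op Mult (Const 2) (Reg 1))))
     (While (Reg 20) (Seq (Assign 20 (Op Sub (Reg 20) (Const 1))) (Store (Op Mult (Const 32) (Reg 20)) (Mem (Reg 20)))))"

lemma exec_scatter_loop:
  assumes w: "32 * N < 2 ^ w"
  shows "reg \<sigma> 20 = r \<Longrightarrow> r \<le> N \<Longrightarrow> (\<And>i. i < r \<Longrightarrow> mem \<sigma> i = f i) \<Longrightarrow> (\<And>i. r \<le> i \<Longrightarrow> i < N \<Longrightarrow> mem \<sigma> (32 * i) = f i) \<Longrightarrow>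
    \<exists>\<sigma>'. exec w (While (Reg 20) (Seq (Assign 20 (Op Sub (Reg 20) (Const 1))) (Store (Op Mult (Const 32) (Reg 20)) (Mem (Reg 20))))) \<sigma> (12 * r + 2) \<sigma>'
      \<and> (\<forall>i<N. mem \<sigma>' (32 * i) = f i) \<and> reg \<sigma>' 0 = reg \<sigma> 0 \<and> reg \<sigma>' 1 = reg \<sigma> 1"
proof (induction r arbitrary: \<sigma>)
  case 0
  have "exec w (While (Reg 20) (Seq (Assign 20 (Op Sub (Reg 20) (Const 1))) (Store (Op Mult (Const 32) (Reg 20)) (Mem (Reg 20))))) \<sigma> (1 + cost (Reg 20)) \<sigma>"
    by (rule exec.WhileFalse) (use 0 in simp)
  then show ?case using 0 by auto
next
  case (Suc r)
  let ?P = "Assign 20 (Op Sub (Reg 20) (Const 1))" and ?Q = "Store (Op Mult (Const 32) (Reg 20)) (Mem (Reg 20))"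
  have w32: "32 * r < 2 ^ w" "(1::nat) < 2 ^ w" "32 < (2::nat) ^ w" "r < 2 ^ w" using w Suc.prems(2) by linarith+
  have ev: "eval w \<sigma> (Op Sub (Reg 20) (Const 1)) = r"
  proof -
    have "(int (Suc r) - int 1) mod 2 ^ w = int (r mod 2 ^ w)" by (simp add: zmod_int)
    moreover have "(1::nat) mod 2 ^ w = 1" using w32(2) by (rule mod_less)
    ultimately show ?thesis using w32(4) by (simp only: eval.simps word_op.simps Suc.prems(1) nat_int mod_less)
  qed
  have c1: "1 + cost (Op Sub (Reg 20) (Const 1)) = 4" by simp
  let ?s1 = "\<sigma>\<lparr>reg := (reg \<sigma>)(20 := r)\<rparr>"
  let ?s2 = "?s1\<lparr>mem := (mem \<sigma>)(32 * r := mem \<sigma> r)\<rparr>"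
  have ea: "eval w ?s1 (Op Mult (Const 32) (Reg 20)) = 32 * r" and em: "eval w ?s1 (Mem (Reg 20)) = mem \<sigma> r"
    and c2: "1 + cost (Op Mult (Const 32) (Reg 20)) + cost (Mem (Reg 20)) = 6"
    using w32 by simp_all
  have "exec w ?P \<sigma> 4 ?s1"
    using exec.Assign[of w 20 "Op Sub (Reg 20) (Const 1)" \<sigma>] unfolding ev c1 .
  moreover have "exec w ?Q ?s1 6 ?s2"
    using exec.Store[of w "Op Mult (Const 32) (Reg 20)" "Mem (Reg 20)" ?s1] unfolding ea em c2 by simp
  ultimately have b: "exec w (Seq ?P ?Q) \<sigma> (4 + 6) ?s2" by (rule exec.Seq)
  have "\<exists>\<sigma>'. exec w (While (Reg 20) (Seq ?P ?Q)) ?s2 (12 * r + 2) \<sigma>'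
      \<and> (\<forall>i<N. mem \<sigma>' (32 * i) = f i) \<and> reg \<sigma>' 0 = reg ?s2 0 \<and> reg \<sigma>' 1 = reg ?s2 1"
  proof (rule Suc.IH)
    fix i assume "r \<le> i" "i < N"
    then show "mem ?s2 (32 * i) = f i" using Suc.prems(3)[of r] Suc.prems(4)[of i] by (cases "i = r") auto
  qed (use Suc.prems in auto)
  then obtain \<sigma>' where s: "exec w (While (Reg 20) (Seq ?P ?Q)) ?s2 (12 * r + 2) \<sigma>'"
    "\<forall>i<N. mem \<sigma>' (32 * i) = f i" "reg \<sigma>' 0 = reg \<sigma> 0" "reg \<sigma>' 1 = reg \<sigma> 1" by auto
  have "exec w (While (Reg 20) (Seq ?P ?Q)) \<sigma> (1 + cost (Reg 20) + (4 + 6) + (12 * r + 2)) \<sigma>'"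
    by (rule exec.WhileTrue[OF _ b s(1)]) (use Suc.prems in simp)
  moreover have "1 + cost (Reg 20) + (4 + 6) + (12 * r + 2) = 12 * Suc r + 2" by simp
  ultimately show ?case using s by auto
qed

lemma exec_scatter:
  assumes "length Y = length X + 2 * K" "64 * (length X + length Y) < 2 ^ w" "1 \<le> K"
  shows "\<exists>\<sigma>. exec w scatter (input X Y K) (12 * (length X + length Y) + 10) \<sigma> \<and>
    (\<forall>i<length X + length Y. mem \<sigma> (32 * i) = (X @ Y) ! i) \<and> reg \<sigma> 0 = length X \<and> reg \<sigma> 1 = K"
proof -
  let ?N = "length X + length Y"
  let ?e = "Op Add (Op Add (Reg 0) (Reg 0)) (Op Mult (Const 2) (Reg 1))"
  let ?s = "(input X Y K)\<lparr>reg := (reg (input X Y K))(20 := ?N)\<rparr>"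
  have "2 * K < W \<and> length X + length X < W \<and> length X + length X + 2 * K < W \<and> 2 < W" if "64 * ?N < W" for W
    using that assms(1,3) by auto
  from this[OF assms(2)] have l: "2 * K < 2 ^ w" "length X + length X < 2 ^ w" "length X + length X + 2 * K < 2 ^ w" "(2::nat) < 2 ^ w"
    by blast+
  have N: "length X + length X + 2 * K = ?N" using assms by simp
  have ev: "eval w (input X Y K) ?e = ?N" using l N by (simp add: input_def)
  have c: "1 + cost ?e = 8" by simp
  have "exec w (Assign 20 ?e) (input X Y K) 8 ?s"
    using exec.Assign[of w 20 ?e "input X Y K"] unfolding ev c .
  moreover have "\<exists>\<sigma>'. exec w (While (Reg 20) (Seq (Assign 20 (Op Sub (Reg 20) (Const 1))) (Store (Op Mult (Const 32) (Reg 20)) (Mem (Reg 20))))) ?s (12 * ?N + 2) \<sigma>'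
      \<and> (\<forall>i<?N. mem \<sigma>' (32 * i) = (X @ Y) ! i) \<and> reg \<sigma>' 0 = reg ?s 0 \<and> reg \<sigma>' 1 = reg ?s 1"
    by (rule exec_scatter_loop) (use assms in \<open>auto simp: input_def\<close>)
  ultimately obtain \<sigma> where "exec w scatter (input X Y K) (8 + (12 * ?N + 2)) \<sigma>" "\<forall>i<?N. mem \<sigma> (32 * i) = (X @ Y) ! i"
    "reg \<sigma> 0 = reg ?s 0" "reg \<sigma> 1 = reg ?s 1"
    unfolding scatter_def using exec.Seq by blast
  moreover have "8 + (12 * ?N + 2) = 12 * ?N + 10" "reg ?s 0 = length X" "reg ?s 1 = K" by (simp_all add: input_def)
  ultimately have "exec w scatter (input X Y K) (12 * ?N + 10) \<sigma> \<and> (\<forall>i<?N. mem \<sigma> (32 * i) = (X @ Y) ! i) \<and>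
    reg \<sigma> 0 = length X \<and> reg \<sigma> 1 = K" by (simp only:)
  then show ?thesis by (rule exI)
qed

text \<open>Shift \<open>s\<close> belongs to entry \<open>K + s + h\<close> of array 20 and to
  output address \<open>K + s\<close>. The copy runs upwards, since each target lies below all
  sources still to be read.\<close>

definition gather :: cmd where
  "gather = Seq (Assign 20 (Const 0))
     (While (Op Less (Reg 20) (Op Add (Op Mult (Const 2) (Reg 1)) (Const 1)))
       (Seq (Store (Reg 20) (Mem (Op Add (Op Mult (Const 32) (Op Add (Reg 20) (Reg 2))) (Const 20))))
         (Assign 20 (Op Add (Reg 20) (Const 1)))))"

lemma exec_gather_loop:
  assumes w: "32 * (2 * K + 1 + h) + 20 < 2 ^ w"
  shows "i \<le> 2 * K + 1 \<Longrightarrow> reg \<sigma> 20 = i \<Longrightarrow> reg \<sigma> 1 = K \<Longrightarrow> reg \<sigma> 2 = h \<Longrightarrow>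
    (\<And>j. j < i \<Longrightarrow> mem \<sigma> j = f j) \<Longrightarrow> (\<And>j. i \<le> j \<Longrightarrow> j \<le> 2 * K \<Longrightarrow> mem \<sigma> (32 * (j + h) + 20) = f j) \<Longrightarrow>
    \<exists>\<sigma>'. exec w (While (Op Less (Reg 20) (Op Add (Op Mult (Const 2) (Reg 1)) (Const 1)))
       (Seq (Store (Reg 20) (Mem (Op Add (Op Mult (Const 32) (Op Add (Reg 20) (Reg 2))) (Const 20))))
         (Assign 20 (Op Add (Reg 20) (Const 1))))) \<sigma> (22 * (2 * K + 1 - i) + 8) \<sigma>'
      \<and> (\<forall>j<2 * K + 1. mem \<sigma>' j = f j)"
proof (induction "2 * K + 1 - i" arbitrary: i \<sigma>)
  case 0
  let ?c = "Op Less (Reg 20) (Op Add (Op Mult (Const 2) (Reg 1)) (Const 1))"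
  let ?B = "Seq (Store (Reg 20) (Mem (Op Add (Op Mult (Const 32) (Op Add (Reg 20) (Reg 2))) (Const 20))))
         (Assign 20 (Op Add (Reg 20) (Const 1)))"
  have "2 * K + 1 < W \<and> 2 * K < W \<and> 2 < W \<and> 1 < W" if "32 * (2 * K + 1 + h) + 20 < W" for W
    using that by auto
  from this[OF w] have w2: "2 * K + 1 < 2 ^ w" "2 * K < 2 ^ w" "(2::nat) < 2 ^ w" "(1::nat) < 2 ^ w" by blast+
  have i: "i = 2 * K + 1" using 0 by simp
  have "eval w \<sigma> ?c = 0" using 0 i w2 by simp
  then have "exec w (While ?c ?B) \<sigma> (1 + cost ?c) \<sigma>" by (rule exec.WhileFalse)
  moreover have "1 + cost ?c = 22 * (2 * K + 1 - i) + 8" using i by simp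
  ultimately show ?case using 0(6) i by metis
next
  case (Suc m)
  let ?c = "Op Less (Reg 20) (Op Add (Op Mult (Const 2) (Reg 1)) (Const 1))"
  let ?S = "Store (Reg 20) (Mem (Op Add (Op Mult (Const 32) (Op Add (Reg 20) (Reg 2))) (Const 20)))"
  let ?A = "Assign 20 (Op Add (Reg 20) (Const 1))"
  have i: "i < 2 * K + 1" using Suc.hyps(2) by linarith
  have "2 * K + 1 < W \<and> 2 * K < W \<and> 2 < W \<and> 1 < W \<and> 32 < W \<and> 20 < W \<and> 32 * (i + h) + 20 < W \<and> 32 * (i + h) < W \<and>
    i + h < W \<and> i + 1 < W" if "32 * (2 * K + 1 + h) + 20 < W" for W
    using that i by auto
  from this[OF w] have w2: "2 * K + 1 < 2 ^ w" "2 * K < 2 ^ w" "(2::nat) < 2 ^ w" "(1::nat) < 2 ^ w" "(32::nat) < 2 ^ w" "(20::nat) < 2 ^ w"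
    "32 * (i + h) + 20 < 2 ^ w" "32 * (i + h) < 2 ^ w" "i + h < 2 ^ w" "i + 1 < 2 ^ w" by blast+
  have "0 < w" using w2(4) by (cases w) auto
  then have c: "eval w \<sigma> ?c \<noteq> 0" using Suc.prems i w2 by simp
  let ?s1 = "\<sigma>\<lparr>mem := (mem \<sigma>)(i := f i)\<rparr>"
  let ?s2 = "?s1\<lparr>reg := (reg \<sigma>)(20 := i + 1)\<rparr>"
  let ?M = "Mem (Op Add (Op Mult (Const 32) (Op Add (Reg 20) (Reg 2))) (Const 20))"
  have ea: "eval w \<sigma> (Reg 20) = i" and em: "eval w \<sigma> ?M = f i" and c1: "1 + cost (Reg 20) + cost ?M = 10"
    and ev: "eval w ?s1 (Op Add (Reg 20) (Const 1)) = i + 1" and c2: "1 + cost (Op Add (Reg 20) (Const 1)) = 4"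
    using Suc.prems(2-4) Suc.prems(6)[of i] i w2 \<open>0 < w\<close> by simp_all
  have "exec w ?S \<sigma> 10 ?s1"
    using exec.Store[of w "Reg 20" ?M \<sigma>] unfolding ea em c1 .
  moreover have "exec w ?A ?s1 4 ?s2"
    using exec.Assign[of w 20 "Op Add (Reg 20) (Const 1)" ?s1] unfolding ev c2 by simp
  ultimately have b: "exec w (Seq ?S ?A) \<sigma> (10 + 4) ?s2" by (rule exec.Seq)
  have "\<exists>\<sigma>'. exec w (While ?c (Seq ?S ?A)) ?s2 (22 * (2 * K + 1 - (i + 1)) + 8) \<sigma>' \<and> (\<forall>j<2 * K + 1. mem \<sigma>' j = f j)"
  proof (rule Suc.hyps(1))
    show "m = 2 * K + 1 - (i + 1)" using Suc.hyps(2) by linarith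
    fix j assume "i + 1 \<le> j" "j \<le> 2 * K"
    then show "mem ?s2 (32 * (j + h) + 20) = f j" using Suc.prems(6)[of j] by simp
  next
    fix j assume "j < i + 1"
    then show "mem ?s2 j = f j" using Suc.prems(5)[of j] by (cases "j = i") auto
  qed (use Suc.prems i in auto)
  then obtain \<sigma>' where s: "exec w (While ?c (Seq ?S ?A)) ?s2 (22 * (2 * K + 1 - (i + 1)) + 8) \<sigma>'" "\<forall>j<2 * K + 1. mem \<sigma>' j = f j"
    by blast
  have "exec w (While ?c (Seq ?S ?A)) \<sigma> (1 + cost ?c + (10 + 4) + (22 * (2 * K + 1 - (i + 1)) + 8)) \<sigma>'"
    by (rule exec.WhileTrue[OF c b s(1)])
  moreover have "1 + cost ?c + (10 + 4) + (22 * (2 * K + 1 - (i + 1)) + 8) = 22 * (2 * K + 1 - i) + 8" using i by simp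
  ultimately have "exec w (While ?c (Seq ?S ?A)) \<sigma> (22 * (2 * K + 1 - i) + 8) \<sigma>'" by (simp only:)
  with s(2) show ?case by blast
qed

lemma exec_gather:
  assumes w: "32 * (2 * K + 1 + h) + 20 < 2 ^ w" and r: "reg \<sigma> 1 = K" "reg \<sigma> 2 = h"
  shows "\<exists>\<sigma>'. exec w gather \<sigma> (2 + (22 * (2 * K + 1) + 8)) \<sigma>' \<and> (\<forall>j<2 * K + 1. mem \<sigma>' j = mem \<sigma> (32 * (j + h) + 20))"
proof -
  let ?s = "\<sigma>\<lparr>reg := (reg \<sigma>)(20 := 0)\<rparr>"
  have e1: "exec w (Assign 20 (Const 0)) \<sigma> 2 ?s" using exec.Assign[of w 20 "Const 0" \<sigma>] by (simp add: numeral_2_eq_2)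
  obtain \<sigma>' where "exec w (While (Op Less (Reg 20) (Op Add (Op Mult (Const 2) (Reg 1)) (Const 1)))
       (Seq (Store (Reg 20) (Mem (Op Add (Op Mult (Const 32) (Op Add (Reg 20) (Reg 2))) (Const 20))))
         (Assign 20 (Op Add (Reg 20) (Const 1))))) ?s (22 * (2 * K + 1) + 8) \<sigma>'"
      "\<forall>j<2 * K + 1. mem \<sigma>' j = mem \<sigma> (32 * (j + h) + 20)"
    using exec_gather_loop[OF w, of 0 ?s "\<lambda>j. mem \<sigma> (32 * (j + h) + 20)"] r by auto
  then show ?thesis unfolding gather_def using exec.Seq[OF e1] by blast
qed

lemma seg_shift:
  assumes "i + m \<le> length Y"
  shows "seg ((!) (X @ Y)) (length X + i) (length X + i + m) = substr Y i (i + m)"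
proof (rule nth_equalityI)
  show "length (seg ((!) (X @ Y)) (length X + i) (length X + i + m)) = length (substr Y i (i + m))"
    using assms by (simp add: substr_def)
  fix k assume "k < length (seg ((!) (X @ Y)) (length X + i) (length X + i + m))"
  then have k: "k < m" by simp
  have "(X @ Y) ! (length X + (i + k)) = Y ! (i + k)" by (rule nth_append_length_plus)
  then show "seg ((!) (X @ Y)) (length X + i) (length X + i + m) ! k = substr Y i (i + m) ! k"
    using k assms by (simp add: seg_def substr_def add.assoc)
qed

text \<open>Program and word size constant are chosen before the alphabet exponent \<open>d\<close>.
  This is possible because the digit sort detects by itself when to stop; only \<open>C\<close>
  depends on \<open>d\<close>.\<close>

theorem theorem17:
  shows "\<exists>(P :: cmd) (c :: nat). c \<ge> 1 \<and> (\<forall>d :: nat. \<exists>C :: nat.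
    \<forall>(w :: nat) (X :: nat list) (Y :: nat list) (K :: nat).
      K \<ge> 1 \<longrightarrow>
      length Y = length X + 2 * K \<longrightarrow>
      c * (length X + length Y) \<le> 2 ^ w \<longrightarrow>
      (\<forall>a \<in> set X \<union> set Y. a < 2 ^ w \<and> a < (length X + length Y) ^ d) \<longrightarrow>
      (\<exists>t \<sigma>. exec w P (input X Y K) t \<sigma> \<and>
         t \<le> C * (length X + K ^ 2) \<and>
         (\<forall>s \<in> {- int K..int K}.
            two_approx
              (real (capped_ED K X
                 (substr Y (nat (int K + s)) (nat (int (length X) + int K + s)))))
              (real (mem \<sigma> (nat (int K + s)))))))"
proof (rule exI[of _ "Seq scatter (Seq (cc main) gather)"], rule exI[of _ "4096"], intro conjI allI)
  fix d :: nat
  show "\<exists>C :: nat. \<forall>(w :: nat) (X :: nat list) (Y :: nat list) (K :: nat).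
      K \<ge> 1 \<longrightarrow> length Y = length X + 2 * K \<longrightarrow> 4096 * (length X + length Y) \<le> 2 ^ w \<longrightarrow>
      (\<forall>a \<in> set X \<union> set Y. a < 2 ^ w \<and> a < (length X + length Y) ^ d) \<longrightarrow>
      (\<exists>t \<sigma>. exec w (Seq scatter (Seq (cc main) gather)) (input X Y K) t \<sigma> \<and> t \<le> C * (length X + K ^ 2) \<and>
         (\<forall>s \<in> {- int K..int K}.
            two_approx (real (capped_ED K X (substr Y (nat (int K + s)) (nat (int (length X) + int K + s)))))
              (real (mem \<sigma> (nat (int K + s))))))"
  \<comment> \<open>The summand 200 pays for \<open>scatter\<close> and \<open>gather\<close>, the
    rest for the compiled program.\<close>
  proof (rule exI[of _ "(d + 2) * 400000 + 200"], intro allI impI)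
    fix w :: nat and X Y :: "nat list" and K :: nat
    assume K: "K \<ge> 1" and Y: "length Y = length X + 2 * K" and w: "4096 * (length X + length Y) \<le> 2 ^ w"
      and ch: "\<forall>a \<in> set X \<union> set Y. a < 2 ^ w \<and> a < (length X + length Y) ^ d"
    let ?n = "length X" and ?N = "length X + length Y"
    \<comment> \<open>Dividing by the stride 32 of the arrays leaves \<open>L\<close> at least 128
      times the input length, enough for all linear bounds demanded of \<open>L\<close>.\<close>
    define L :: nat where "L = 2 ^ w div 32"
    define h where "h = min K ?n"
    have N: "?N = 2 * (?n + K)" using Y by simp
    have L: "32 * L \<le> 2 ^ w" "64 * (2 * (?n + K)) \<le> L"
    proof -
      show "32 * L \<le> 2 ^ w" by (simp add: L_def)
      have "(4096 * ?N) div 32 \<le> L" unfolding L_def using w by (rule div_le_mono)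
      then show "64 * (2 * (?n + K)) \<le> L" using N by simp
    qed
    have L1: "1 \<le> L" using L K by simp
    obtain \<sigma>1 where s1: "exec w scatter (input X Y K) (12 * ?N + 10) \<sigma>1"
      "\<forall>i<?N. mem \<sigma>1 (32 * i) = (X @ Y) ! i" "reg \<sigma>1 0 = ?n" "reg \<sigma>1 1 = K"
      using exec_scatter[OF Y _ K, of w] w K Y by auto
    have Z: "ar (abst \<sigma>1) 0 i = (X @ Y) ! i" if "i < ?N" for i using s1(2) that by simp
    have chr: "(X @ Y) ! i < (2 * (?n + K)) ^ d" if "i < 2 * (?n + K)" for i
    proof -
      have "(X @ Y) ! i \<in> set (X @ Y)" using that N by (intro nth_mem) simp
      then show ?thesis using ch N by auto
    qed
    have "runs L main (abst \<sigma>1) ((d + 2) * 400000 * (?n + K ^ 2)) (\<lambda>s'. rg s' 1 = K \<and> rg s' 2 = min K ?n \<and>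
      (\<forall>i\<le>2 * K. let E = ED (seg (ar (abst \<sigma>1) 0) 0 ?n) (seg (ar (abst \<sigma>1) 0) (?n + i) (?n + i + ?n));
         c = ar s' 20 (i + min K ?n) in c \<le> min E K \<and> min E K \<le> 2 * c))"
      by (rule runs_main) (use s1 K L chr Z N in auto)
    then obtain t s2 where s2: "hexec L main (abst \<sigma>1) t s2" "t \<le> (d + 2) * 400000 * (?n + K ^ 2)" "rg s2 1 = K" "rg s2 2 = h"
      and E: "\<And>i. i \<le> 2 * K \<Longrightarrow> let E = ED (seg (ar (abst \<sigma>1) 0) 0 ?n) (seg (ar (abst \<sigma>1) 0) (?n + i) (?n + i + ?n));
         c = ar s2 20 (i + h) in c \<le> min E K \<and> min E K \<le> 2 * c"
      unfolding runs_def h_def by blast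
    obtain \<sigma>2 where \<sigma>2: "exec w (cc main) \<sigma>1 t \<sigma>2" "abst \<sigma>2 = s2" using exec_cc[OF L(1) L1 s2(1) refl] by blast
    have r2: "reg \<sigma>2 1 = K" "reg \<sigma>2 2 = h" using s2(3,4) \<sigma>2(2) by (metis rg_abst)+
    have "32 * (2 * K + 1 + h) + 20 < 2 ^ w" using w Y K by (simp add: h_def)
    then obtain \<sigma>3 where \<sigma>3: "exec w gather \<sigma>2 (2 + (22 * (2 * K + 1) + 8)) \<sigma>3"
      "\<forall>j<2 * K + 1. mem \<sigma>3 j = mem \<sigma>2 (32 * (j + h) + 20)" using exec_gather[OF _ r2] by blast
    have run: "exec w (Seq scatter (Seq (cc main) gather)) (input X Y K) (12 * ?N + 10 + (t + (2 + (22 * (2 * K + 1) + 8)))) \<sigma>3"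
      by (rule exec.Seq[OF s1(1) exec.Seq[OF \<sigma>2(1) \<sigma>3(1)]])
    have time: "12 * ?N + 10 + (t + (2 + (22 * (2 * K + 1) + 8))) \<le> ((d + 2) * 400000 + 200) * (?n + K ^ 2)"
    proof -
      have "K \<le> K ^ 2" using K by (simp add: power2_eq_square)
      moreover have "12 * ?N + 10 + (2 + (22 * (2 * K + 1) + 8)) \<le> 200 * (?n + q)" if "K \<le> q" for q using that N K by simp
      ultimately have "12 * ?N + 10 + (2 + (22 * (2 * K + 1) + 8)) \<le> 200 * (?n + K ^ 2)" by blast
      then show ?thesis using s2(2) by (simp add: algebra_simps)
    qed
    have ap: "two_approx (real (capped_ED K X (substr Y i (?n + i)))) (real (mem \<sigma>3 i))" if i: "i \<le> 2 * K" for i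
    proof -
      have sX: "seg (ar (abst \<sigma>1) 0) 0 ?n = X"
        by (rule nth_equalityI) (use Z in \<open>auto simp: seg_def nth_append\<close>)
      have "seg (ar (abst \<sigma>1) 0) (?n + i) (?n + i + ?n) = seg ((!) (X @ Y)) (?n + i) (?n + i + ?n)"
        unfolding seg_def using Z i N by auto
      also have "\<dots> = substr Y i (i + ?n)" by (rule seg_shift) (use i Y in simp)
      finally have sY: "seg (ar (abst \<sigma>1) 0) (?n + i) (?n + i + ?n) = substr Y i (?n + i)" by (simp add: add.commute)
      have m: "mem \<sigma>3 i = ar s2 20 (i + h)" using \<sigma>3(2) i \<sigma>2(2) by (auto simp: abst_def)
      \<comment> \<open>The error is one-sided: the output lies between half the capped distance and
        the capped distance.\<close>
      have "mem \<sigma>3 i \<le> capped_ED K X (substr Y i (?n + i))" "capped_ED K X (substr Y i (?n + i)) \<le> 2 * mem \<sigma>3 i"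
        using E[OF i] unfolding sX sY m by (simp_all add: Let_def capped_ED_def)
      then show ?thesis unfolding two_approx_def by linarith
    qed
    have "\<forall>s \<in> {- int K..int K}. two_approx (real (capped_ED K X (substr Y (nat (int K + s)) (nat (int ?n + int K + s)))))
        (real (mem \<sigma>3 (nat (int K + s))))"
    proof
      fix s assume s: "s \<in> {- int K..int K}"
      have "nat (int ?n + int K + s) = ?n + nat (int K + s)" "nat (int K + s) \<le> 2 * K" using s by auto
      then show "two_approx (real (capped_ED K X (substr Y (nat (int K + s)) (nat (int ?n + int K + s)))))
        (real (mem \<sigma>3 (nat (int K + s))))" using ap by simp
    qed
    then show "\<exists>t \<sigma>. exec w (Seq scatter (Seq (cc main) gather)) (input X Y K) t \<sigma> \<and> t \<le> ((d + 2) * 400000 + 200) * (?n + K ^ 2) \<and>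
         (\<forall>s \<in> {- int K..int K}.
            two_approx (real (capped_ED K X (substr Y (nat (int K + s)) (nat (int ?n + int K + s)))))
              (real (mem \<sigma> (nat (int K + s)))))"
      using run time by blast
  qed
qed simp

end
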